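(* Let $\mathcal A=S_{3c}(G)$, and for each $\hbar\in\mathbb R$ let $\times_\hbar$, ${}^{*_\hbar}$, $\|\cdot\|_\hbar$ be the product, involution and $C^*$-norm on $\mathcal A$ defined in the context. Then $(\mathcal A,\times_\hbar,{}^{*_\hbar},\|\cdot\|_\hbar)_{\hbar\in\mathbb R}$ is a strict deformation quantization of $\mathcal A$ in the direction of $\frac1{2\pi}\{\cdot,\cdot\}_\omega$. In particular, for all $\phi,\psi\in\mathcal A$, $$\lim_{\hbar\to0}\left\|\frac{\phi\times_\hbar\psi-\psi\times_\hbar\phi}{\hbar}-\frac{i}{2\pi}\{\phi,\psi\}_\omega\right\|_\hbar=0.$$
   Context: Fix an integer $n\ge1$ and a nonzero real number $\lambda$. Let $\beta(\cdot,\cdot)$ be the usual inner product on $\mathbb R^n$, $e(t)=e^{2\pi it}$, $\bar e(t)=e^{-2\pi it}$, and $\eta_\lambda(r)=\frac{e^{2\lambda r}-1}{2\lambda}$. $G$ is the Lie group with underlying space $\mathbb R^{2n+1}=\{(p,q,r):p,q\in\mathbb R^n,\ r\in\mathbb R\}$ and multiplication $(p,q,r)(p',q',r')=(e^{\lambda r'}p+p',e^{\lambda r'}q+q',r+r')$. It carries the (Poisson--Lie) Poisson bracket $$\{\phi,\psi\}_\omega(p,q,r)=\eta_\lambda(r)\sum_{i=1}^n\Bigl(\frac{\partial\phi}{\partial p_i}\frac{\partial\psi}{\partial q_i}-\frac{\partial\psi}{\partial p_i}\frac{\partial\phi}{\partial q_i}\Bigr)(p,q,r).$$ $\mathcal A=S_{3c}(G)\subseteq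 C_\infty(G)$ (continuous functions vanishing at infinity) is the space of Schwartz functions on $\mathbb R^{2n+1}$ having compact support in the $r$-variable. For $\phi,\psi\in\mathcal A$ and $\hbar\in\mathbb R$ define $$(\phi\times_\hbar\psi)(p,q,r)=\int\bar e[(p-p')\cdot\tilde x]\,\phi(p',q,r)\,\psi(p,q+\hbar\eta_\lambda(r)\tilde x,r)\,dp'd\tilde x,$$ $$\phi^{*_\hbar}(p,q,r)=\int\overline{\phi(p',q',r)}\,\bar e[(p-p')\cdot x+(q-q')\cdot y]\,\bar e[\hbar\eta_\lambda(r)\beta(x,y)]\,dp'dq'dxdy,$$ and $\|\phi\|_\hbar=\|L^\hbar_\phi\|$, the operator norm of the operator on $L^2(\mathbb R^n\times\mathbb R^n\times\mathbb R)$ given by $$(L^\hbar_\phi\xi)(x,y,r)=\int\phi^\vee(x',y',r)\,\xi(x-x',y-y',r)\,\bar e[\hbar\eta_\lambda(r)\beta(x',y-y')]\,dx'dy',$$ where $\phi^\vee(x,y,r)=\int e(p\cdot x+q\cdot y)\phi(p,q,r)\,dp\,dq$ (Lebesgue measures throughout; the integrals defining $\phi\times_\hbar\psi$, $\phi^{*_\hbar}$, $L^\hbar_\phi\xi$ and $\phi^\vee$ are read as iterated Fourier integrals). Strict deformation quantization (Rieffel): let $\mathcal A$ be a dense ${}^*$-subalgebra of $C_\infty(M)$ on which a Poisson bracket $\{\cdot,\cdot\}$ is defined. A strict deformation quantization of $\mathcal A$ in the direction of $\{\cdot,\cdot\}$ is an open interval $I\ni0$ together with, for each $\hbar\in I$,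 an associative product $\times_\hbar$, an involution ${}^{*_\hbar}$ and a $C^*$-norm $\|\cdot\|_\hbar$ (for these operations) on $\mathcal A$, which for $\hbar=0$ are the pointwise product, complex conjugation and supremum norm, such that (1) the completions $A_\hbar$ of $\mathcal A$ for $\|\cdot\|_\hbar$, with continuity structure given by the elements of $\mathcal A$ as constant fields, form a continuous field of $C^*$-algebras over $I$; (2) for all $\phi,\psi\in\mathcal A$, $\left\|(\phi\times_\hbar\psi-\psi\times_\hbar\phi)/\hbar-i\{\phi,\psi\}\right\|_\hbar\to0$ as $\hbar\to0$. *)

theory Defs
  imports "HOL-Analysis.Analysis"
begin

section \<open>C*-algebras with explicit carriers\<close>

record 'a star_alg =
  carr :: "'a set"
  zer :: 'a
  add :: "'a \<Rightarrow> 'a \<Rightarrow> 'a"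
  scal :: "complex \<Rightarrow> 'a \<Rightarrow> 'a"
  mul :: "'a \<Rightarrow> 'a \<Rightarrow> 'a"
  star :: "'a \<Rightarrow> 'a"
  nrm :: "'a \<Rightarrow> real"

definition diff :: "'a star_alg \<Rightarrow> 'a \<Rightarrow> 'a \<Rightarrow> 'a" where
  "diff S a b = add S a (scal S (-1) b)"

text \<open>A complex *-algebra, not necessarily unital, with a C*-norm; completeness is not required.\<close>

locale pre_cstar_algebra =
  fixes S :: "'a star_alg"
  assumes zer_closed: "zer S \<in> carr S"
    and add_closed: "\<lbrakk>a \<in> carr S; b \<in> carr S\<rbrakk> \<Longrightarrow> add S a b \<in> carr S"
    and scal_closed: "a \<in> carr S \<Longrightarrow> scal S c a \<in> carr S"
    and mul_closed: "\<lbrakk>a \<in> carr S; b \<in> carr S\<rbrakk> \<Longrightarrow> mul S a b \<in> carr S"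
    and star_closed: "a \<in> carr S \<Longrightarrow> star S a \<in> carr S"
    and add_assoc: "\<lbrakk>a \<in> carr S; b \<in> carr S; d \<in> carr S\<rbrakk> \<Longrightarrow>
          add S (add S a b) d = add S a (add S b d)"
    and add_commute: "\<lbrakk>a \<in> carr S; b \<in> carr S\<rbrakk> \<Longrightarrow> add S a b = add S b a"
    and add_zer: "a \<in> carr S \<Longrightarrow> add S a (zer S) = a"
    and diff_self: "a \<in> carr S \<Longrightarrow> diff S a a = zer S"
    and scal_add: "\<lbrakk>a \<in> carr S; b \<in> carr S\<rbrakk> \<Longrightarrow> scal S c (add S a b) = add S (scal S c a) (scal S c b)"
    and add_scal: "a \<in> carr S \<Longrightarrow> scal S (c + c') a = add S (scal S c a) (scal S c' a)"
    and scal_scal: "a \<in> carr S \<Longrightarrow> scal S c (scal S c' a) = scal S (c * c') a"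
    and scal_one: "a \<in> carr S \<Longrightarrow> scal S 1 a = a"
    and mul_assoc: "\<lbrakk>a \<in> carr S; b \<in> carr S; d \<in> carr S\<rbrakk> \<Longrightarrow>
          mul S (mul S a b) d = mul S a (mul S b d)"
    and mul_add_left: "\<lbrakk>a \<in> carr S; b \<in> carr S; d \<in> carr S\<rbrakk> \<Longrightarrow>
          mul S (add S a b) d = add S (mul S a d) (mul S b d)"
    and mul_add_right: "\<lbrakk>a \<in> carr S; b \<in> carr S; d \<in> carr S\<rbrakk> \<Longrightarrow>
          mul S a (add S b d) = add S (mul S a b) (mul S a d)"
    and mul_scal_left: "\<lbrakk>a \<in> carr S; b \<in> carr S\<rbrakk> \<Longrightarrow> mul S (scal S c a) b = scal S c (mul S a b)"
    and mul_scal_right: "\<lbrakk>a \<in> carr S; b \<in> carr S\<rbrakk> \<Longrightarrow> mul S a (scal S c b) = scal S c (mul S a b)"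
    and star_star: "a \<in> carr S \<Longrightarrow> star S (star S a) = a"
    and star_add: "\<lbrakk>a \<in> carr S; b \<in> carr S\<rbrakk> \<Longrightarrow> star S (add S a b) = add S (star S a) (star S b)"
    and star_scal: "a \<in> carr S \<Longrightarrow> star S (scal S c a) = scal S (cnj c) (star S a)"
    and star_mul: "\<lbrakk>a \<in> carr S; b \<in> carr S\<rbrakk> \<Longrightarrow> star S (mul S a b) = mul S (star S b) (star S a)"
    and nrm_nonneg: "a \<in> carr S \<Longrightarrow> 0 \<le> nrm S a"
    and nrm_eq_zero: "a \<in> carr S \<Longrightarrow> nrm S a = 0 \<longleftrightarrow> a = zer S"
    and nrm_triangle: "\<lbrakk>a \<in> carr S; b \<in> carr S\<rbrakk> \<Longrightarrow> nrm S (add S a b) \<le> nrm S a + nrm S b"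
    and nrm_scal: "a \<in> carr S \<Longrightarrow> nrm S (scal S c a) = cmod c * nrm S a"
    and nrm_mul: "\<lbrakk>a \<in> carr S; b \<in> carr S\<rbrakk> \<Longrightarrow> nrm S (mul S a b) \<le> nrm S a * nrm S b"
    and nrm_cstar: "a \<in> carr S \<Longrightarrow> nrm S (mul S (star S a) a) = (nrm S a)\<^sup>2"

definition cauchy_seqs :: "'a star_alg \<Rightarrow> (nat \<Rightarrow> 'a) set" where
  "cauchy_seqs S = {X. (\<forall>n. X n \<in> carr S) \<and>
     (\<forall>\<epsilon>>0. \<exists>N. \<forall>m\<ge>N. \<forall>n\<ge>N. nrm S (diff S (X m) (X n)) < \<epsilon>)}"

locale cstar_algebra = pre_cstar_algebra +
  assumes complete: "X \<in> cauchy_seqs S \<Longrightarrow>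
    \<exists>a\<in>carr S. (\<lambda>n. nrm S (diff S (X n) a)) \<longlonglongrightarrow> 0"

subsection \<open>The completion: Cauchy sequences modulo null sequences\<close>

definition null_rel :: "'a star_alg \<Rightarrow> ((nat \<Rightarrow> 'a) \<times> (nat \<Rightarrow> 'a)) set" where
  "null_rel S = {(X, Y). X \<in> cauchy_seqs S \<and> Y \<in> cauchy_seqs S \<and>
     (\<lambda>n. nrm S (diff S (X n) (Y n))) \<longlonglongrightarrow> 0}"

definition completion :: "'a star_alg \<Rightarrow> (nat \<Rightarrow> 'a) set star_alg" where
  "completion S = \<lparr>
     carr = cauchy_seqs S // null_rel S,
     zer = null_rel S `` {\<lambda>n. zer S},
     add = (\<lambda>P Q. \<Union>X\<in>P. \<Union>Y\<in>Q. null_rel S `` {\<lambda>n. add S (X n) (Y n)}),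
     scal = (\<lambda>c P. \<Union>X\<in>P. null_rel S `` {\<lambda>n. scal S c (X n)}),
     mul = (\<lambda>P Q. \<Union>X\<in>P. \<Union>Y\<in>Q. null_rel S `` {\<lambda>n. mul S (X n) (Y n)}),
     star = (\<lambda>P. \<Union>X\<in>P. null_rel S `` {\<lambda>n. star S (X n)}),
     nrm = (\<lambda>P. the_elem ((\<lambda>X. lim (\<lambda>n. nrm S (X n))) ` P)) \<rparr>"

definition to_completion :: "'a star_alg \<Rightarrow> 'a \<Rightarrow> (nat \<Rightarrow> 'a) set" where
  "to_completion S a = null_rel S `` {\<lambda>n. a}"

subsection \<open>Continuous fields of C*-algebras\<close>

text \<open>Dixmier's definition: \<open>\<Gamma>\<close> is the *-algebra of continuous vector fields of the
  family \<open>B\<close> over \<open>T\<close>. Vector fields are extensional functions on \<open>T\<close>.\<close>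

locale continuous_field =
  fixes T :: "'t::topological_space set"
    and B :: "'t \<Rightarrow> 'b star_alg"
    and \<Gamma> :: "('t \<Rightarrow> 'b) set"
  assumes fibres: "t \<in> T \<Longrightarrow> cstar_algebra (B t)"
    and fields: "\<Gamma> \<subseteq> (\<Pi>\<^sub>E t\<in>T. carr (B t))"
    and zer_field: "(\<lambda>t\<in>T. zer (B t)) \<in> \<Gamma>"
    and add_field: "\<lbrakk>x \<in> \<Gamma>; y \<in> \<Gamma>\<rbrakk> \<Longrightarrow> (\<lambda>t\<in>T. add (B t) (x t) (y t)) \<in> \<Gamma>"
    and scal_field: "x \<in> \<Gamma> \<Longrightarrow> (\<lambda>t\<in>T. scal (B t) c (x t)) \<in> \<Gamma>"
    and mul_field: "\<lbrakk>x \<in> \<Gamma>; y \<in> \<Gamma>\<rbrakk> \<Longrightarrow> (\<lambda>t\<in>T. mul (B t) (x t) (y t)) \<in> \<Gamma>"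
    and star_field: "x \<in> \<Gamma> \<Longrightarrow> (\<lambda>t\<in>T. star (B t) (x t)) \<in> \<Gamma>"
    and dense: "\<lbrakk>t \<in> T; b \<in> carr (B t); \<epsilon> > 0\<rbrakk> \<Longrightarrow> \<exists>x\<in>\<Gamma>. nrm (B t) (diff (B t) (x t) b) < \<epsilon>"
    and continuous_nrm: "x \<in> \<Gamma> \<Longrightarrow> continuous_on T (\<lambda>t. nrm (B t) (x t))"
    and locally_closed: "\<lbrakk>x \<in> (\<Pi>\<^sub>E t\<in>T. carr (B t));
          \<And>t \<epsilon>. \<lbrakk>t \<in> T; \<epsilon> > 0\<rbrakk> \<Longrightarrow> \<exists>y\<in>\<Gamma>. \<exists>U. open U \<and> t \<in> U \<and>
             (\<forall>s\<in>U \<inter> T. nrm (B s) (diff (B s) (x s) (y s)) \<le> \<epsilon>)\<rbrakk> \<Longrightarrow> x \<in> \<Gamma>"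

text \<open>The vector fields that are continuous with respect to a continuity structure \<open>\<Lambda>\<close>
  (Fell): those which are locally uniform limits of members of \<open>\<Lambda>\<close>.\<close>

definition generated_fields ::
    "'t::topological_space set \<Rightarrow> ('t \<Rightarrow> 'b star_alg) \<Rightarrow> ('t \<Rightarrow> 'b) set \<Rightarrow> ('t \<Rightarrow> 'b) set" where
  "generated_fields T B \<Lambda> = {x \<in> (\<Pi>\<^sub>E t\<in>T. carr (B t)).
     \<forall>t\<in>T. \<forall>\<epsilon>>0. \<exists>y\<in>\<Lambda>. \<exists>U. open U \<and> t \<in> U \<and>
       (\<forall>s\<in>U \<inter> T. nrm (B s) (diff (B s) (x s) (y s)) \<le> \<epsilon>)}"

section \<open>Strict deformation quantization\<close>

text \<open>\<open>C\<^sub>\<infinity>(M)\<close>: continuous functions vanishing at infinity.\<close>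

definition C_infinity :: "('m::t2_space \<Rightarrow> complex) set" where
  "C_infinity = {f. continuous_on UNIV f \<and>
     (\<forall>\<epsilon>>0. \<exists>K. compact K \<and> (\<forall>x. x \<notin> K \<longrightarrow> cmod (f x) < \<epsilon>))}"

definition dense_star_subalgebra :: "('m::t2_space \<Rightarrow> complex) set \<Rightarrow> bool" where
  "dense_star_subalgebra A \<longleftrightarrow>
     A \<subseteq> C_infinity \<and>
     (\<lambda>x. 0) \<in> A \<and>
     (\<forall>f\<in>A. \<forall>g\<in>A. (\<lambda>x. f x + g x) \<in> A) \<and>
     (\<forall>c. \<forall>f\<in>A. (\<lambda>x. c * f x) \<in> A) \<and>
     (\<forall>f\<in>A. \<forall>g\<in>A. (\<lambda>x. f x * g x) \<in> A) \<and>
     (\<forall>f\<in>A. (\<lambda>x. cnj (f x)) \<in> A) \<and>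
     (\<forall>f\<in>C_infinity. \<forall>\<epsilon>>0. \<exists>g\<in>A. \<forall>x. cmod (f x - g x) < \<epsilon>)"

text \<open>The last clause of the definition says that the bracket is real, i.e. the complex bilinear
  extension of a Poisson bracket on the real-valued members of \<open>A\<close>.\<close>

definition poisson_bracket_on ::
    "('m \<Rightarrow> complex) set \<Rightarrow> (('m \<Rightarrow> complex) \<Rightarrow> ('m \<Rightarrow> complex) \<Rightarrow> 'm \<Rightarrow> complex) \<Rightarrow> bool" where
  "poisson_bracket_on A pb \<longleftrightarrow>
     (\<forall>f\<in>A. \<forall>g\<in>A. pb f g \<in> A) \<and>
     (\<forall>f\<in>A. \<forall>g\<in>A. \<forall>h\<in>A. pb (\<lambda>x. f x + g x) h = (\<lambda>x. pb f h x + pb g h x)) \<and>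
     (\<forall>c. \<forall>f\<in>A. \<forall>g\<in>A. pb (\<lambda>x. c * f x) g = (\<lambda>x. c * pb f g x)) \<and>
     (\<forall>f\<in>A. \<forall>g\<in>A. pb g f = (\<lambda>x. - pb f g x)) \<and>
     (\<forall>f\<in>A. \<forall>g\<in>A. \<forall>h\<in>A. \<forall>x. pb f (pb g h) x + pb g (pb h f) x + pb h (pb f g) x = 0) \<and>
     (\<forall>f\<in>A. \<forall>g\<in>A. \<forall>h\<in>A. pb f (\<lambda>x. g x * h x) = (\<lambda>x. pb f g x * h x + g x * pb f h x)) \<and>
     (\<forall>f\<in>A. \<forall>g\<in>A. pb (\<lambda>x. cnj (f x)) (\<lambda>x. cnj (g x)) = (\<lambda>x. cnj (pb f g x)))"

definition function_star_alg ::
    "('m \<Rightarrow> complex) set \<Rightarrow> (('m \<Rightarrow> complex) \<Rightarrow> ('m \<Rightarrow> complex) \<Rightarrow> 'm \<Rightarrow> complex) \<Rightarrow>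
     (('m \<Rightarrow> complex) \<Rightarrow> 'm \<Rightarrow> complex) \<Rightarrow> (('m \<Rightarrow> complex) \<Rightarrow> real) \<Rightarrow> ('m \<Rightarrow> complex) star_alg" where
  "function_star_alg A prd invol N = \<lparr>
     carr = A,
     zer = (\<lambda>x. 0),
     add = (\<lambda>f g x. f x + g x),
     scal = (\<lambda>c f x. c * f x),
     mul = prd,
     star = invol,
     nrm = N \<rparr>"

definition constant_fields :: "'t set \<Rightarrow> ('t \<Rightarrow> 'a star_alg) \<Rightarrow> 'a set \<Rightarrow> ('t \<Rightarrow> (nat \<Rightarrow> 'a) set) set" where
  "constant_fields T S A = (\<lambda>a. \<lambda>t\<in>T. to_completion (S t) a) ` A"

definition strict_deformation_quantization ::
    "('m::t2_space \<Rightarrow> complex) set \<Rightarrow>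
     (('m \<Rightarrow> complex) \<Rightarrow> ('m \<Rightarrow> complex) \<Rightarrow> 'm \<Rightarrow> complex) \<Rightarrow>
     real set \<Rightarrow>
     (real \<Rightarrow> ('m \<Rightarrow> complex) \<Rightarrow> ('m \<Rightarrow> complex) \<Rightarrow> 'm \<Rightarrow> complex) \<Rightarrow>
     (real \<Rightarrow> ('m \<Rightarrow> complex) \<Rightarrow> 'm \<Rightarrow> complex) \<Rightarrow>
     (real \<Rightarrow> ('m \<Rightarrow> complex) \<Rightarrow> real) \<Rightarrow> bool" where
  "strict_deformation_quantization A pb I prd invol N \<longleftrightarrow>
     (let S = (\<lambda>h. function_star_alg A (prd h) (invol h) (N h));
          B = (\<lambda>h. completion (S h))
      in
       dense_star_subalgebra A \<and>
       poisson_bracket_on A pb \<and>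
       open I \<and> is_interval I \<and> 0 \<in> I \<and>
       (\<forall>h\<in>I. pre_cstar_algebra (S h)) \<and>
       (\<forall>f\<in>A. \<forall>g\<in>A. prd 0 f g = (\<lambda>x. f x * g x)) \<and>
       (\<forall>f\<in>A. invol 0 f = (\<lambda>x. cnj (f x))) \<and>
       (\<forall>f\<in>A. N 0 f = (SUP x. cmod (f x))) \<and>
       continuous_field I B (generated_fields I B (constant_fields I S A)) \<and>
       (\<forall>f\<in>A. \<forall>g\<in>A.
          ((\<lambda>h. N h (\<lambda>x. (prd h f g x - prd h g f x) / of_real h - \<i> * pb f g x)) \<longlongrightarrow> 0) (at 0)))"

section \<open>Schwartz functions\<close>

definition dderiv :: "'a::real_normed_vector \<Rightarrow> ('a \<Rightarrow> complex) \<Rightarrow> 'a \<Rightarrow> complex" where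
  "dderiv v f x = vector_derivative (\<lambda>t::real. f (x + t *\<^sub>R v)) (at 0)"

text \<open>\<open>foldr dderiv vs f\<close> is the iterated partial derivative of \<open>f\<close> along the
  standard basis vectors listed in \<open>vs\<close>. Differentiability of all of them is smoothness.\<close>

definition schwartz :: "('a::euclidean_space \<Rightarrow> complex) \<Rightarrow> bool" where
  "schwartz f \<longleftrightarrow> (\<forall>vs. set vs \<subseteq> Basis \<longrightarrow>
     (\<forall>x. foldr dderiv vs f differentiable (at x)) \<and>
     (\<forall>k::nat. bounded (range (\<lambda>x. (1 + norm x) ^ k *\<^sub>R foldr dderiv vs f x))))"

section \<open>The group, its Poisson bracket and the deformed operations\<close>

text \<open>The underlying space of \<open>G\<close>, with points \<open>(p, q, r)\<close>; \<open>n = CARD('n)\<close>.\<close>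

type_synonym 'n G = "(real ^ 'n) \<times> (real ^ 'n) \<times> real"

text \<open>The group law of \<open>G\<close> plays no role in the deformation of the algebra of functions.\<close>

definition G_mult :: "real \<Rightarrow> 'n::finite G \<Rightarrow> 'n G \<Rightarrow> 'n G" where
  "G_mult lam = (\<lambda>(p, q, r) (p', q', r').
     (exp (lam * r') *\<^sub>R p + p', exp (lam * r') *\<^sub>R q + q', r + r'))"

definition eta :: "real \<Rightarrow> real \<Rightarrow> real" where
  "eta lam r = (exp (2 * lam * r) - 1) / (2 * lam)"

definition ee :: "real \<Rightarrow> complex" where
  "ee t = exp (2 * of_real pi * \<i> * of_real t)"

definition ee_bar :: "real \<Rightarrow> complex" where
  "ee_bar t = exp (- 2 * of_real pi * \<i> * of_real t)"

definition omega_bracket ::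
    "real \<Rightarrow> ('n::finite G \<Rightarrow> complex) \<Rightarrow> ('n G \<Rightarrow> complex) \<Rightarrow> 'n G \<Rightarrow> complex" where
  "omega_bracket lam \<phi> \<psi> = (\<lambda>(p, q, r). of_real (eta lam r) *
     (\<Sum>i\<in>UNIV. dderiv (axis i 1, 0, 0) \<phi> (p, q, r) * dderiv (0, axis i 1, 0) \<psi> (p, q, r)
              - dderiv (axis i 1, 0, 0) \<psi> (p, q, r) * dderiv (0, axis i 1, 0) \<phi> (p, q, r)))"

definition S3c :: "('n::finite G \<Rightarrow> complex) set" where
  "S3c = {\<phi>. schwartz \<phi> \<and> (\<exists>K. compact K \<and> (\<forall>p q r. r \<notin> K \<longrightarrow> \<phi> (p, q, r) = 0))}"

definition times_h ::
    "real \<Rightarrow> real \<Rightarrow> ('n::finite G \<Rightarrow> complex) \<Rightarrow> ('n G \<Rightarrow> complex) \<Rightarrow> 'n G \<Rightarrow> complex" where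
  "times_h lam h \<phi> \<psi> = (\<lambda>(p, q, r). LINT xt|lborel. (LINT p'|lborel.
     ee_bar ((p - p') \<bullet> xt) * \<phi> (p', q, r) * \<psi> (p, q + (h * eta lam r) *\<^sub>R xt, r)))"

definition star_h :: "real \<Rightarrow> real \<Rightarrow> ('n::finite G \<Rightarrow> complex) \<Rightarrow> 'n G \<Rightarrow> complex" where
  "star_h lam h \<phi> = (\<lambda>(p, q, r). LINT (x, y)|lborel. (LINT (p', q')|lborel.
     cnj (\<phi> (p', q', r)) * ee_bar ((p - p') \<bullet> x + (q - q') \<bullet> y) * ee_bar (h * eta lam r * (x \<bullet> y))))"

definition vee :: "('n::finite G \<Rightarrow> complex) \<Rightarrow> 'n G \<Rightarrow> complex" where
  "vee \<phi> = (\<lambda>(x, y, r). LINT (p, q)|lborel. ee (p \<bullet> x + q \<bullet> y) * \<phi> (p, q, r))"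

definition L_h ::
    "real \<Rightarrow> real \<Rightarrow> ('n::finite G \<Rightarrow> complex) \<Rightarrow> ('n G \<Rightarrow> complex) \<Rightarrow> 'n G \<Rightarrow> complex" where
  "L_h lam h \<phi> \<xi> = (\<lambda>(x, y, r). LINT (x', y')|lborel.
     vee \<phi> (x', y', r) * \<xi> (x - x', y - y', r) * ee_bar (h * eta lam r * (x' \<bullet> (y - y'))))"

text \<open>Operators on \<open>L\<^sup>2\<close> are given on representatives. The bounds of an operator form a
  nonempty set only if it is a bounded operator on \<open>L\<^sup>2\<close>; for an unbounded operator
  the value of \<open>L2_opnorm\<close> is a constant without meaning, the same for all its nonzero multiples,
  so that this case is excluded by the axioms of a norm.\<close>

definition L2_fun :: "('a::euclidean_space \<Rightarrow> complex) set" where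
  "L2_fun = {\<xi> \<in> borel_measurable lborel. integrable lborel (\<lambda>z. (cmod (\<xi> z))\<^sup>2)}"

definition L2_norm :: "('a::euclidean_space \<Rightarrow> complex) \<Rightarrow> real" where
  "L2_norm \<xi> = sqrt (LINT z|lborel. (cmod (\<xi> z))\<^sup>2)"

definition L2_opnorm :: "(('a::euclidean_space \<Rightarrow> complex) \<Rightarrow> 'a \<Rightarrow> complex) \<Rightarrow> real" where
  "L2_opnorm F = Inf {C. 0 \<le> C \<and> (\<forall>\<xi>\<in>L2_fun. F \<xi> \<in> L2_fun \<and> L2_norm (F \<xi>) \<le> C * L2_norm \<xi>)}"

definition norm_h :: "real \<Rightarrow> real \<Rightarrow> ('n::finite G \<Rightarrow> complex) \<Rightarrow> real" where
  "norm_h lam h \<phi> = L2_opnorm (L_h lam h \<phi>)"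

end

theory Submission
  imports Defs "HOL-Probability.Probability"
begin

text \<open>The partial Fourier transform \<open>\<phi> \<mapsto> \<phi>\<^sup>\<or>\<close> in \<open>(p, q)\<close> turns \<open>\<times>\<^sub>h\<close> into a convolution over each \<open>r\<close>, twisted by the phase
  of \<open>L\<^sub>h\<close>, and \<open>L\<^sub>h \<phi>\<close> into twisted convolution by \<open>\<phi>\<^sup>\<or>\<close>. Hence \<open>L\<^sub>h\<close> is a faithful *-representation, and
  \<open>\<parallel>\<phi>\<parallel>\<^sub>h\<close> is at most the supremum over \<open>r\<close> of the \<open>L\<^sup>1\<close>-norm of \<open>\<phi>\<^sup>\<or>(\<cdot>, r)\<close>. This bound, applied to differences and
  Taylor remainders of the phase, shows that product and involution are continuous in \<open>h\<close> and yields the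
  semiclassical limit. The norm itself is continuous because tensoring with a window function exhibits
  multiplication of \<open>\<phi>\<^sup>\<or>\<close> by a coefficient \<open>k\<close> as a contraction from \<open>\<parallel>\<cdot>\<parallel>\<^sub>h\<close> to \<open>\<parallel>\<cdot>\<parallel>\<^sub>t\<close>, where \<open>k\<close> tends to \<open>1\<close> as \<open>t\<close> tends to
  \<open>h\<close>. At \<open>h = 0\<close> the operator is unitarily equivalent to multiplication by \<open>\<phi>\<close>, whence the supremum norm.\<close>

section \<open>Completion of a pre-C*-algebra\<close>

text \<open>The obstacle is continuity of the norm: strong continuity of the operators in h would
  give lower semicontinuity only. The window argument is symmetric in the two parameters and
  quantitative. The phase with coefficient d = h - h' is shared between a modulation and a
  translation, each of size sqrt |d|, so that 1 - k is of order sqrt |d| up to polynomial weights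
  and the norm is locally Hoelder of exponent 1/2. The weights involve eta, which may grow
  exponentially in r; compact support in r lets a Schwartz function absorb it, here and in every
  stability statement for \<open>S3c\<close>. All operators act fibrewise over r, and an L^2
  function is square integrable on almost every fibre, so associativity and adjointness are proved
  on one such fibre and then integrated. From Fourier theory only inversion, for bounded continuous
  integrable functions with integrable transform, and a Bessel inequality enter; together they give
  Plancherel for \<open>S3c\<close>. Faithfulness comes from evaluating a continuous twisted
  convolution at the origin of a fibre, where it is a squared L^2 norm.\<close>

context pre_cstar_algebra
begin

lemma diff_closed: "a \<in> carr S \<Longrightarrow> b \<in> carr S \<Longrightarrow> diff S a b \<in> carr S"
  by (simp add: diff_def add_closed scal_closed)

lemmas closed = zer_closed add_closed scal_closed mul_closed star_closed diff_closed

lemma add_left_commute: "\<lbrakk>a \<in> carr S; b \<in> carr S; c \<in> carr S\<rbrakk> \<Longrightarrow> add S a (add S b c) = add S b (add S a c)"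
  using add_assoc[of a b c] add_assoc[of b a c] add_commute[of a b] by simp

lemmas add_ac = add_assoc add_commute add_left_commute

lemma zer_add: "a \<in> carr S \<Longrightarrow> add S (zer S) a = a"
  using add_commute[of a "zer S"] add_zer zer_closed by simp

lemma nrm_zer: "nrm S (zer S) = 0"
  using nrm_eq_zero zer_closed by blast

lemma scal_zero: "a \<in> carr S \<Longrightarrow> scal S 0 a = zer S"
  using add_scal[of a 1 "-1"] diff_self[of a] by (simp add: scal_one diff_def)

lemma scal_diff: "\<lbrakk>a \<in> carr S; b \<in> carr S\<rbrakk> \<Longrightarrow> scal S c (diff S a b) = diff S (scal S c a) (scal S c b)"
  by (simp add: diff_def scal_add scal_closed scal_scal)

lemma add_diff_add: "\<lbrakk>a \<in> carr S; b \<in> carr S; c \<in> carr S; d \<in> carr S\<rbrakk> \<Longrightarrow>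
   diff S (add S a b) (add S c d) = add S (diff S a c) (diff S b d)"
  by (simp add: diff_def scal_add closed add_ac)

lemma diff_add_diff:
  assumes "a \<in> carr S" "b \<in> carr S" "c \<in> carr S"
  shows "add S (diff S a b) (diff S b c) = diff S a c"
proof -
  have "add S (diff S a b) (diff S b c) = add S (diff S b b) (diff S a c)"
    using assms by (simp add: diff_def closed add_ac)
  then show ?thesis using assms by (simp add: diff_self zer_add closed)
qed

lemma nrm_diff_commute:
  assumes "a \<in> carr S" "b \<in> carr S" shows "nrm S (diff S a b) = nrm S (diff S b a)"
proof -
  have "diff S b a = scal S (-1) (diff S a b)"
    unfolding diff_def using assms add_commute[of b "scal S (-1) a"]
    by (simp add: scal_add scal_scal scal_one closed)
  then show ?thesis using assms nrm_scal[of "diff S a b" "-1"] by (simp only: closed) simp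
qed

lemma nrm_diff_triangle:
  assumes "a \<in> carr S" "b \<in> carr S" "c \<in> carr S"
  shows "nrm S (diff S a c) \<le> nrm S (diff S a b) + nrm S (diff S b c)"
  using diff_add_diff[of a b c] nrm_triangle[of "diff S a b" "diff S b c"] assms by (simp add: closed)

lemma diff_zer: "a \<in> carr S \<Longrightarrow> diff S a (zer S) = a"
  using scal_zero[of "zer S"] scal_scal[of "zer S" "-1" 0]
  by (simp add: diff_def zer_closed add_zer)

lemma nrm_diff_triangle2:
  assumes "a \<in> carr S" "b \<in> carr S"
  shows "\<bar>nrm S a - nrm S b\<bar> \<le> nrm S (diff S a b)"
  using nrm_diff_triangle[of a b "zer S"] nrm_diff_triangle[of b a "zer S"] nrm_diff_commute[of a b] assms
  by (simp add: diff_zer zer_closed)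

lemma mul_diff_mul:
  assumes "a \<in> carr S" "b \<in> carr S" "c \<in> carr S" "d \<in> carr S"
  shows "diff S (mul S a b) (mul S c d) = add S (mul S a (diff S b d)) (mul S (diff S a c) d)"
proof -
  have "add S (mul S a (diff S b d)) (mul S (diff S a c) d) =
     add S (diff S (mul S a b) (mul S a d)) (diff S (mul S a d) (mul S c d))"
    using assms by (simp add: diff_def mul_add_left mul_add_right mul_scal_left mul_scal_right closed)
  then show ?thesis using diff_add_diff assms closed by simp
qed

lemma nrm_diff_mul:
  assumes "a \<in> carr S" "b \<in> carr S" "c \<in> carr S" "d \<in> carr S"
  shows "nrm S (diff S (mul S a b) (mul S c d)) \<le> nrm S a * nrm S (diff S b d) + nrm S (diff S a c) * nrm S d"
  unfolding mul_diff_mul[OF assms]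
  by (intro order_trans[OF nrm_triangle] add_mono nrm_mul closed assms)

lemma nrm_diff_add:
  assumes "a \<in> carr S" "b \<in> carr S" "c \<in> carr S" "d \<in> carr S"
  shows "nrm S (diff S (add S a b) (add S c d)) \<le> nrm S (diff S a c) + nrm S (diff S b d)"
  unfolding add_diff_add[OF assms] using assms by (intro nrm_triangle closed)

lemma nrm_diff_scal:
  assumes "a \<in> carr S" "b \<in> carr S"
  shows "nrm S (diff S (scal S c a) (scal S c b)) = cmod c * nrm S (diff S a b)"
  using scal_diff[OF assms, of c] nrm_scal[OF diff_closed[OF assms], of c] by simp

text \<open>The C*-identity gives |a|^2 = |a* a| <= |a*| |a|, and |a| cancels. Used for a* as well,
  this makes the involution isometric and hence compatible with Cauchy sequences.\<close>

lemma nrm_star_le: assumes "a \<in> carr S" shows "nrm S a \<le> nrm S (star S a)"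
proof (cases "nrm S a = 0")
  case False
  then have pos: "nrm S a > 0" using nrm_nonneg[OF assms] by simp
  have "nrm S a * nrm S a \<le> nrm S (star S a) * nrm S a"
    using nrm_cstar[OF assms] nrm_mul[of "star S a" a] assms by (simp add: closed power2_eq_square)
  then show ?thesis using pos by simp
qed (use nrm_nonneg assms star_closed in auto)

lemma nrm_star: assumes "a \<in> carr S" shows "nrm S (star S a) = nrm S a"
  using nrm_star_le[OF assms] nrm_star_le[of "star S a"] assms by (simp add: closed star_star)

lemma nrm_diff_star:
  assumes "a \<in> carr S" "b \<in> carr S"
  shows "nrm S (diff S (star S a) (star S b)) = nrm S (diff S a b)"
proof -
  have "diff S (star S a) (star S b) = star S (diff S a b)"
    using assms by (simp add: diff_def star_add star_scal closed)
  then show ?thesis using nrm_star[OF diff_closed[OF assms]] by simp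
qed

section \<open>Cauchy sequences and the termwise operations on them\<close>

lemma cauchy_seqsI:
  assumes "\<And>n. X n \<in> carr S" "\<And>m n. nrm S (diff S (X m) (X n)) \<le> E m n"
    "\<And>e. e > 0 \<Longrightarrow> \<exists>N. \<forall>m\<ge>N. \<forall>n\<ge>N. E m n < e"
  shows "X \<in> cauchy_seqs S"
  unfolding cauchy_seqs_def
proof (intro CollectI conjI allI impI assms(1))
  fix e :: real assume "e > 0"
  from assms(3)[OF this] obtain N where "\<forall>m\<ge>N. \<forall>n\<ge>N. E m n < e" by blast
  then show "\<exists>N. \<forall>m\<ge>N. \<forall>n\<ge>N. nrm S (diff S (X m) (X n)) < e"
    using le_less_trans[OF assms(2)] by blast
qed

lemma cauchy_seqs_carr: "X \<in> cauchy_seqs S \<Longrightarrow> X n \<in> carr S"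
  by (simp add: cauchy_seqs_def)

lemma cauchy_seqsD: "X \<in> cauchy_seqs S \<Longrightarrow> e > 0 \<Longrightarrow> \<exists>N. \<forall>m\<ge>N. \<forall>n\<ge>N. nrm S (diff S (X m) (X n)) < e"
  by (simp add: cauchy_seqs_def)

lemma cauchy_const: "a \<in> carr S \<Longrightarrow> (\<lambda>n. a) \<in> cauchy_seqs S"
  by (simp add: cauchy_seqs_def diff_self nrm_zer)

lemma cauchy_nrm_convergent: assumes "X \<in> cauchy_seqs S" shows "convergent (\<lambda>n. nrm S (X n))"
proof -
  have "Cauchy (\<lambda>n. nrm S (X n))"
    unfolding Cauchy_def
  proof (intro allI impI)
    fix e :: real assume "e > 0"
    from cauchy_seqsD[OF assms this] obtain N where N: "\<forall>m\<ge>N. \<forall>n\<ge>N. nrm S (diff S (X m) (X n)) < e" by blast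
    show "\<exists>M. \<forall>m\<ge>M. \<forall>n\<ge>M. dist (nrm S (X m)) (nrm S (X n)) < e"
      using N nrm_diff_triangle2 cauchy_seqs_carr[OF assms] by (auto simp: dist_real_def intro!: exI[of _ N] le_less_trans[OF nrm_diff_triangle2])
  qed
  then show ?thesis by (simp add: Cauchy_convergent_iff)
qed

lemma cauchy_nrm_bounded: assumes "X \<in> cauchy_seqs S" shows "\<exists>B>0. \<forall>n. nrm S (X n) \<le> B"
proof -
  have "Bseq (\<lambda>n. nrm S (X n))" using cauchy_nrm_convergent[OF assms] convergent_imp_Bseq by blast
  then obtain K where "K > 0" "\<And>n. norm (nrm S (X n)) \<le> K" unfolding Bseq_def by blast
  then show ?thesis by (force simp: abs_le_iff)
qed

lemma cauchy_add:
  assumes "X \<in> cauchy_seqs S" "Y \<in> cauchy_seqs S" shows "(\<lambda>n. add S (X n) (Y n)) \<in> cauchy_seqs S"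
proof (rule cauchy_seqsI)
  show "add S (X n) (Y n) \<in> carr S" for n using assms by (simp add: cauchy_seqs_carr closed)
  show "nrm S (diff S (add S (X m) (Y m)) (add S (X n) (Y n))) \<le> nrm S (diff S (X m) (X n)) + nrm S (diff S (Y m) (Y n))" for m n
    using assms by (intro nrm_diff_add cauchy_seqs_carr)
  fix e :: real assume "e > 0"
  then have e2: "e/2 > 0" by simp
  obtain N1 N2 where "\<forall>m\<ge>N1. \<forall>n\<ge>N1. nrm S (diff S (X m) (X n)) < e/2"
    "\<forall>m\<ge>N2. \<forall>n\<ge>N2. nrm S (diff S (Y m) (Y n)) < e/2"
    using cauchy_seqsD[OF assms(1) e2] cauchy_seqsD[OF assms(2) e2] by blast
  then show "\<exists>N. \<forall>m\<ge>N. \<forall>n\<ge>N. nrm S (diff S (X m) (X n)) + nrm S (diff S (Y m) (Y n)) < e"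
    by (intro exI[of _ "max N1 N2"]) (smt (verit) field_sum_of_halves max.bounded_iff)
qed

lemma cauchy_scal:
  assumes "X \<in> cauchy_seqs S" shows "(\<lambda>n. scal S c (X n)) \<in> cauchy_seqs S"
proof (rule cauchy_seqsI)
  show "scal S c (X n) \<in> carr S" for n using assms by (simp add: cauchy_seqs_carr closed)
  show "nrm S (diff S (scal S c (X m)) (scal S c (X n))) \<le> cmod c * nrm S (diff S (X m) (X n))" for m n
    using assms by (simp add: nrm_diff_scal cauchy_seqs_carr)
  fix e :: real assume "e > 0"
  \<comment> \<open>The summand 1 keeps the denominator positive when c = 0.\<close>
  then have e2: "e/(cmod c + 1) > 0" by (simp add: add_nonneg_pos)
  obtain N where N: "\<forall>m\<ge>N. \<forall>n\<ge>N. nrm S (diff S (X m) (X n)) < e/(cmod c + 1)"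
    using cauchy_seqsD[OF assms(1) e2] by blast
  have "cmod c * x < e" if "x < e/(cmod c + 1)" "x \<ge> 0" for x
  proof -
    have "x * (cmod c + 1) < e" using that by (simp add: pos_less_divide_eq add_nonneg_pos)
    then have "(cmod c + 1) * x < e" by (simp add: mult.commute)
    then show ?thesis using that by (simp add: distrib_right)
  qed
  then show "\<exists>N. \<forall>m\<ge>N. \<forall>n\<ge>N. cmod c * nrm S (diff S (X m) (X n)) < e"
    using N nrm_nonneg closed cauchy_seqs_carr[OF assms] by (intro exI[of _ N]) auto
qed

lemma cauchy_star:
  assumes "X \<in> cauchy_seqs S" shows "(\<lambda>n. star S (X n)) \<in> cauchy_seqs S"
  using assms unfolding cauchy_seqs_def by (simp add: nrm_diff_star closed)

lemma cauchy_mul: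
  assumes "X \<in> cauchy_seqs S" "Y \<in> cauchy_seqs S" shows "(\<lambda>n. mul S (X n) (Y n)) \<in> cauchy_seqs S"
proof -
  \<comment> \<open>Multiplication is not uniformly continuous; boundedness of Cauchy sequences
    supplies the missing control of the factors.\<close>
  obtain B C where B: "B > 0" "\<And>n. nrm S (X n) \<le> B" and C: "C > 0" "\<And>n. nrm S (Y n) \<le> C"
    using cauchy_nrm_bounded assms by meson
  show ?thesis
  proof (rule cauchy_seqsI)
    show "mul S (X n) (Y n) \<in> carr S" for n using assms by (simp add: cauchy_seqs_carr closed)
    show "nrm S (diff S (mul S (X m) (Y m)) (mul S (X n) (Y n))) \<le> B * nrm S (diff S (Y m) (Y n)) + nrm S (diff S (X m) (X n)) * C" for m n
      using assms cauchy_seqs_carr B C nrm_nonneg closed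
      by (intro order_trans[OF nrm_diff_mul] add_mono mult_mono) (auto intro: less_imp_le)
    fix e :: real assume e: "e > 0"
    then have e2: "e/(2*B) > 0" "e/(2*C) > 0" using B C by auto
    obtain N1 N2 where N: "\<forall>m\<ge>N1. \<forall>n\<ge>N1. nrm S (diff S (X m) (X n)) < e/(2*C)"
      "\<forall>m\<ge>N2. \<forall>n\<ge>N2. nrm S (diff S (Y m) (Y n)) < e/(2*B)"
      using cauchy_seqsD[OF assms(1) e2(2)] cauchy_seqsD[OF assms(2) e2(1)] by blast
    have "B * y + x * C < e" if "x < e/(2*C)" "y < e/(2*B)" for x y
      using that B C by (simp add: field_simps)
    then show "\<exists>N. \<forall>m\<ge>N. \<forall>n\<ge>N. B * nrm S (diff S (Y m) (Y n)) + nrm S (diff S (X m) (X n)) * C < e"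
      using N by (intro exI[of _ "max N1 N2"]) auto
  qed
qed

section \<open>The quotient by null sequences\<close>

abbreviation cls where "cls X \<equiv> null_rel S `` {X}"

lemma null_rel_iff: "(X, Y) \<in> null_rel S \<longleftrightarrow> X \<in> cauchy_seqs S \<and> Y \<in> cauchy_seqs S \<and> (\<lambda>n. nrm S (diff S (X n) (Y n))) \<longlonglongrightarrow> 0"
  by (simp add: null_rel_def)

lemma null_rel_bound:
  assumes "X \<in> cauchy_seqs S" "Y \<in> cauchy_seqs S" "\<And>n. nrm S (diff S (X n) (Y n)) \<le> E n" "E \<longlonglongrightarrow> 0"
  shows "(X, Y) \<in> null_rel S"
  unfolding null_rel_iff using assms cauchy_seqs_carr
  by (auto intro!: tendsto_sandwich[OF _ _ tendsto_const assms(4)] always_eventually nrm_nonneg closed)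

lemma equiv_null: "equiv (cauchy_seqs S) (null_rel S)"
proof (rule equivI)
  show "null_rel S \<subseteq> cauchy_seqs S \<times> cauchy_seqs S" by (auto simp: null_rel_def)
  show "refl_on (cauchy_seqs S) (null_rel S)"
    by (auto simp: refl_on_def null_rel_def cauchy_seqs_carr diff_self nrm_zer)
  show "sym (null_rel S)"
    by (rule symI) (simp add: null_rel_iff cauchy_seqs_carr nrm_diff_commute)
  show "trans (null_rel S)"
  proof (rule transI)
    fix X Y Z assume *: "(X, Y) \<in> null_rel S" "(Y, Z) \<in> null_rel S"
    then have "(\<lambda>n. nrm S (diff S (X n) (Y n)) + nrm S (diff S (Y n) (Z n))) \<longlonglongrightarrow> 0 + 0"
      by (intro tendsto_add) (auto simp: null_rel_iff)
    with * show "(X, Z) \<in> null_rel S"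
      by (intro null_rel_bound[where E="\<lambda>n. nrm S (diff S (X n) (Y n)) + nrm S (diff S (Y n) (Z n))"])
        (auto simp: null_rel_iff intro!: nrm_diff_triangle cauchy_seqs_carr)
  qed
qed

lemma cls_eq: "(X, Y) \<in> null_rel S \<Longrightarrow> cls X = cls Y"
  using equiv_null equiv_class_eq by metis

lemma cls_eq_iff: "X \<in> cauchy_seqs S \<Longrightarrow> Y \<in> cauchy_seqs S \<Longrightarrow> cls X = cls Y \<longleftrightarrow> (\<lambda>n. nrm S (diff S (X n) (Y n))) \<longlonglongrightarrow> 0"
  using eq_equiv_class_iff[OF equiv_null] null_rel_iff by simp

lemma carr_completion: "carr (completion S) = cls ` cauchy_seqs S"
  by (auto simp: completion_def quotient_def)

lemma cls_carr: "X \<in> cauchy_seqs S \<Longrightarrow> cls X \<in> carr (completion S)"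
  by (simp add: carr_completion)

lemma completionE:
  assumes "a \<in> carr (completion S)" obtains X where "X \<in> cauchy_seqs S" "a = cls X"
  using assms by (auto simp: carr_completion)

lemma zer_completion: "zer (completion S) = cls (\<lambda>n. zer S)"
  by (simp add: completion_def)

text \<open>The operations of \<open>completion\<close> are unions over representatives. Each union
  collapses to the class obtained from a single representative because its body is constant on
  classes; the same pattern serves for the other operations.\<close>

lemma scal_completion: "X \<in> cauchy_seqs S \<Longrightarrow> scal (completion S) c (cls X) = cls (\<lambda>n. scal S c (X n))"
  unfolding completion_def star_alg.simps
proof (rule UN_equiv_class[OF equiv_null])
  show "(\<lambda>X. cls (\<lambda>n. scal S c (X n))) respects null_rel S"
  proof (rule congruentI, rule cls_eq)
    fix X Y assume "(X, Y) \<in> null_rel S"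
    then show "((\<lambda>n. scal S c (X n)), (\<lambda>n. scal S c (Y n))) \<in> null_rel S"
      by (auto simp: null_rel_iff cauchy_scal nrm_diff_scal cauchy_seqs_carr intro!: tendsto_mult_right_zero)
  qed
qed

lemma star_completion: "X \<in> cauchy_seqs S \<Longrightarrow> star (completion S) (cls X) = cls (\<lambda>n. star S (X n))"
  unfolding completion_def star_alg.simps
proof (rule UN_equiv_class[OF equiv_null])
  show "(\<lambda>X. cls (\<lambda>n. star S (X n))) respects null_rel S"
  proof (rule congruentI, rule cls_eq)
    fix X Y assume "(X, Y) \<in> null_rel S"
    then show "((\<lambda>n. star S (X n)), (\<lambda>n. star S (Y n))) \<in> null_rel S"
      by (auto simp: null_rel_iff cauchy_star nrm_diff_star cauchy_seqs_carr)
  qed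
qed

lemma add_completion: "X \<in> cauchy_seqs S \<Longrightarrow> Y \<in> cauchy_seqs S \<Longrightarrow>
  add (completion S) (cls X) (cls Y) = cls (\<lambda>n. add S (X n) (Y n))"
  unfolding completion_def star_alg.simps
proof (rule UN_equiv_class2[OF equiv_null equiv_null])
  show "congruent2 (null_rel S) (null_rel S) (\<lambda>X Y. cls (\<lambda>n. add S (X n) (Y n)))"
  proof (rule congruent2I', rule cls_eq)
    fix X X' Y Y' assume *: "(X, X') \<in> null_rel S" "(Y, Y') \<in> null_rel S"
    then have "(\<lambda>n. nrm S (diff S (X n) (X' n)) + nrm S (diff S (Y n) (Y' n))) \<longlonglongrightarrow> 0 + 0"
      by (intro tendsto_add) (auto simp: null_rel_iff)
    with * show "((\<lambda>n. add S (X n) (Y n)), (\<lambda>n. add S (X' n) (Y' n))) \<in> null_rel S"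
      by (intro null_rel_bound[where E="\<lambda>n. nrm S (diff S (X n) (X' n)) + nrm S (diff S (Y n) (Y' n))"])
        (auto simp: null_rel_iff intro!: nrm_diff_add cauchy_seqs_carr cauchy_add)
  qed
qed

lemma mul_completion: "X \<in> cauchy_seqs S \<Longrightarrow> Y \<in> cauchy_seqs S \<Longrightarrow>
  mul (completion S) (cls X) (cls Y) = cls (\<lambda>n. mul S (X n) (Y n))"
  unfolding completion_def star_alg.simps
proof (rule UN_equiv_class2[OF equiv_null equiv_null])
  show "congruent2 (null_rel S) (null_rel S) (\<lambda>X Y. cls (\<lambda>n. mul S (X n) (Y n)))"
  proof (rule congruent2I', rule cls_eq)
    fix X X' Y Y' assume *: "(X, X') \<in> null_rel S" "(Y, Y') \<in> null_rel S"
    then have X: "X \<in> cauchy_seqs S" "X' \<in> cauchy_seqs S" "Y \<in> cauchy_seqs S" "Y' \<in> cauchy_seqs S"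
      by (auto simp: null_rel_iff)
    obtain B C where B: "B > 0" "\<And>n. nrm S (X n) \<le> B" and C: "C > 0" "\<And>n. nrm S (Y' n) \<le> C"
      using cauchy_nrm_bounded X by meson
    have "(\<lambda>n. B * nrm S (diff S (Y n) (Y' n)) + nrm S (diff S (X n) (X' n)) * C) \<longlonglongrightarrow> B * 0 + 0 * C"
      using * by (intro tendsto_add tendsto_mult tendsto_const) (auto simp: null_rel_iff)
    moreover have "nrm S (diff S (mul S (X n) (Y n)) (mul S (X' n) (Y' n))) \<le> B * nrm S (diff S (Y n) (Y' n)) + nrm S (diff S (X n) (X' n)) * C" for n
      using X cauchy_seqs_carr B C nrm_nonneg closed
      by (intro order_trans[OF nrm_diff_mul] add_mono mult_mono) (auto intro: less_imp_le)
    ultimately show "((\<lambda>n. mul S (X n) (Y n)), (\<lambda>n. mul S (X' n) (Y' n))) \<in> null_rel S"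
      using X by (intro null_rel_bound[where E="\<lambda>n. B * nrm S (diff S (Y n) (Y' n)) + nrm S (diff S (X n) (X' n)) * C"])
        (auto intro!: cauchy_mul)
  qed
qed

text \<open>Equivalent sequences have the same limit of norms, so the set to which
  \<open>the_elem\<close> is applied in \<open>completion\<close> is a singleton.\<close>

lemma nrm_completion:
  assumes "X \<in> cauchy_seqs S" shows "nrm (completion S) (cls X) = lim (\<lambda>n. nrm S (X n))"
proof -
  have "lim (\<lambda>n. nrm S (Y n)) = lim (\<lambda>n. nrm S (X n))" if "Y \<in> cls X" for Y
  proof -
    from that have *: "(X, Y) \<in> null_rel S" by simp
    have "(\<lambda>n. nrm S (X n) - nrm S (Y n)) \<longlonglongrightarrow> 0"
    proof (rule Lim_null_comparison)
      show "\<forall>\<^sub>F n in sequentially. norm (nrm S (X n) - nrm S (Y n)) \<le> nrm S (diff S (X n) (Y n))"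
        using * by (auto simp: null_rel_iff intro!: always_eventually nrm_diff_triangle2 cauchy_seqs_carr)
    qed (use * in \<open>auto simp: null_rel_iff\<close>)
    moreover have "convergent (\<lambda>n. nrm S (X n))" "convergent (\<lambda>n. nrm S (Y n))"
      using * cauchy_nrm_convergent by (auto simp: null_rel_iff)
    then have "(\<lambda>n. nrm S (X n) - nrm S (Y n)) \<longlonglongrightarrow> lim (\<lambda>n. nrm S (X n)) - lim (\<lambda>n. nrm S (Y n))"
      by (intro tendsto_diff) (auto simp: convergent_LIMSEQ_iff)
    ultimately show ?thesis using LIMSEQ_unique by fastforce
  qed
  moreover have "X \<in> cls X" using equiv_class_self[OF equiv_null assms] .
  ultimately have "(\<lambda>X. lim (\<lambda>n. nrm S (X n))) ` cls X = {lim (\<lambda>n. nrm S (X n))}"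
    unfolding set_eq_iff image_iff singleton_iff by metis
  then show ?thesis by (simp add: completion_def)
qed

lemma nrm_completion_tendsto:
  assumes "X \<in> cauchy_seqs S" shows "(\<lambda>n. nrm S (X n)) \<longlonglongrightarrow> nrm (completion S) (cls X)"
  using cauchy_nrm_convergent[OF assms] nrm_completion[OF assms] by (simp add: convergent_LIMSEQ_iff)

lemma cauchy_diff: "X \<in> cauchy_seqs S \<Longrightarrow> Y \<in> cauchy_seqs S \<Longrightarrow> (\<lambda>n. diff S (X n) (Y n)) \<in> cauchy_seqs S"
  unfolding diff_def by (intro cauchy_add cauchy_scal)

lemma diff_completion: "X \<in> cauchy_seqs S \<Longrightarrow> Y \<in> cauchy_seqs S \<Longrightarrow>
  diff (completion S) (cls X) (cls Y) = cls (\<lambda>n. diff S (X n) (Y n))"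
  by (simp add: diff_def scal_completion add_completion cauchy_scal)

lemmas completion_ops = zer_completion add_completion scal_completion mul_completion star_completion diff_completion
lemmas cauchy_ops = cauchy_const[OF zer_closed] cauchy_add cauchy_scal cauchy_mul cauchy_star cauchy_diff

text \<open>Algebraic identities hold term by term for representatives, and norm inequalities pass
  to the limit of the norms. For definiteness, the norms of a sequence tend to 0 exactly if the
  sequence is equivalent to the zero sequence.\<close>

lemma pre_completion: "pre_cstar_algebra (completion S)"
proof (unfold_locales, goal_cases)
  case 1 then show ?case by (simp add: cls_carr completion_ops cauchy_ops)
next case 2 then show ?case by (elim completionE) (simp add: cls_carr completion_ops cauchy_ops)
next case 3 then show ?case by (elim completionE) (simp add: cls_carr completion_ops cauchy_ops)
next case 4 then show ?case by (elim completionE) (simp add: cls_carr completion_ops cauchy_ops)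
next case 5 then show ?case by (elim completionE) (simp add: cls_carr completion_ops cauchy_ops)
next case 6 then show ?case by (elim completionE) (simp add: cls_carr completion_ops cauchy_ops add_assoc cauchy_seqs_carr)
next case 7 then show ?case by (elim completionE) (simp add: cls_carr completion_ops cauchy_ops, simp add: add_commute cauchy_seqs_carr)
next case 8 then show ?case by (elim completionE) (simp add: cls_carr completion_ops cauchy_ops add_zer cauchy_seqs_carr)
next case 9 then show ?case by (elim completionE) (simp add: cls_carr completion_ops cauchy_ops diff_self cauchy_seqs_carr)
next case 10 then show ?case by (elim completionE) (simp add: cls_carr completion_ops cauchy_ops scal_add cauchy_seqs_carr)
next case 11 then show ?case by (elim completionE) (simp add: cls_carr completion_ops cauchy_ops add_scal cauchy_seqs_carr)
next case 12 then show ?case by (elim completionE) (simp add: cls_carr completion_ops cauchy_ops scal_scal cauchy_seqs_carr)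
next case 13 then show ?case by (elim completionE) (simp add: cls_carr completion_ops cauchy_ops scal_one cauchy_seqs_carr)
next case 14 then show ?case by (elim completionE) (simp add: cls_carr completion_ops cauchy_ops mul_assoc cauchy_seqs_carr)
next case 15 then show ?case by (elim completionE) (simp add: cls_carr completion_ops cauchy_ops mul_add_left cauchy_seqs_carr)
next case 16 then show ?case by (elim completionE) (simp add: cls_carr completion_ops cauchy_ops mul_add_right cauchy_seqs_carr)
next case 17 then show ?case by (elim completionE) (simp add: cls_carr completion_ops cauchy_ops mul_scal_left cauchy_seqs_carr)
next case 18 then show ?case by (elim completionE) (simp add: cls_carr completion_ops cauchy_ops mul_scal_right cauchy_seqs_carr)
next case 19 then show ?case by (elim completionE) (simp add: cls_carr completion_ops cauchy_ops star_star cauchy_seqs_carr)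
next case 20 then show ?case by (elim completionE) (simp add: cls_carr completion_ops cauchy_ops star_add cauchy_seqs_carr)
next case 21 then show ?case by (elim completionE) (simp add: cls_carr completion_ops cauchy_ops star_scal cauchy_seqs_carr)
next case 22 then show ?case by (elim completionE) (simp add: cls_carr completion_ops cauchy_ops star_mul cauchy_seqs_carr)
next case (23 a)
  then obtain X where X: "X \<in> cauchy_seqs S" "a = cls X" by (elim completionE)
  show ?case unfolding X(2)
    by (rule LIMSEQ_le_const[OF nrm_completion_tendsto[OF X(1)]]) (use X cauchy_seqs_carr nrm_nonneg in auto)
next case (24 a)
  then obtain X where X: "X \<in> cauchy_seqs S" "a = cls X" by (elim completionE)
  have "(\<lambda>n. nrm S (diff S (X n) (zer S))) = (\<lambda>n. nrm S (X n))"
    using X by (simp add: diff_zer cauchy_seqs_carr)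
  then have "a = zer (completion S) \<longleftrightarrow> (\<lambda>n. nrm S (X n)) \<longlonglongrightarrow> 0"
    using X cls_eq_iff[OF X(1) cauchy_const[OF zer_closed]] by (simp add: zer_completion)
  then show ?case using nrm_completion_tendsto[OF X(1)] X LIMSEQ_unique by auto
next case (25 a b)
  then obtain X Y where X: "X \<in> cauchy_seqs S" "a = cls X" "Y \<in> cauchy_seqs S" "b = cls Y" by (elim completionE)
  show ?case unfolding X(2,4) add_completion[OF X(1,3)]
    by (rule LIMSEQ_le[OF nrm_completion_tendsto[OF cauchy_add[OF X(1,3)]] tendsto_add[OF nrm_completion_tendsto[OF X(1)] nrm_completion_tendsto[OF X(3)]]])
      (use X cauchy_seqs_carr nrm_triangle in auto)
next case (26 a c)
  then obtain X where X: "X \<in> cauchy_seqs S" "a = cls X" by (elim completionE)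
  have "(\<lambda>n. cmod c * nrm S (X n)) \<longlonglongrightarrow> nrm (completion S) (cls (\<lambda>n. scal S c (X n)))"
    using nrm_completion_tendsto[OF cauchy_scal[OF X(1)], of c] X by (simp add: nrm_scal cauchy_seqs_carr)
  then show ?case using tendsto_mult_left[OF nrm_completion_tendsto[OF X(1)], of "cmod c"] X
    by (auto simp: scal_completion dest: LIMSEQ_unique)
next case (27 a b)
  then obtain X Y where X: "X \<in> cauchy_seqs S" "a = cls X" "Y \<in> cauchy_seqs S" "b = cls Y" by (elim completionE)
  show ?case unfolding X(2,4) mul_completion[OF X(1,3)]
    by (rule LIMSEQ_le[OF nrm_completion_tendsto[OF cauchy_mul[OF X(1,3)]] tendsto_mult[OF nrm_completion_tendsto[OF X(1)] nrm_completion_tendsto[OF X(3)]]])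
      (use X cauchy_seqs_carr nrm_mul in auto)
next case (28 a)
  then obtain X where X: "X \<in> cauchy_seqs S" "a = cls X" by (elim completionE)
  have "(\<lambda>n. (nrm S (X n))^2) \<longlonglongrightarrow> nrm (completion S) (cls (\<lambda>n. mul S (star S (X n)) (X n)))"
    using nrm_completion_tendsto[OF cauchy_mul[OF cauchy_star[OF X(1)] X(1)]] X by (simp add: nrm_cstar cauchy_seqs_carr)
  then show ?case using tendsto_power[OF nrm_completion_tendsto[OF X(1)], of 2] X
    by (auto simp: star_completion mul_completion cauchy_star dest: LIMSEQ_unique)
qed

section \<open>The dense embedding and completeness\<close>

lemma to_completion_closed: "a \<in> carr S \<Longrightarrow> to_completion S a \<in> carr (completion S)"
  by (simp add: to_completion_def carr_completion cauchy_const)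

lemma nrm_to_completion: "a \<in> carr S \<Longrightarrow> nrm (completion S) (to_completion S a) = nrm S a"
  by (simp add: to_completion_def nrm_completion[OF cauchy_const] limI)

lemma to_completion_ops:
  assumes "a \<in> carr S" "b \<in> carr S"
  shows "to_completion S (zer S) = zer (completion S)"
    "to_completion S (add S a b) = add (completion S) (to_completion S a) (to_completion S b)"
    "to_completion S (mul S a b) = mul (completion S) (to_completion S a) (to_completion S b)"
    "to_completion S (diff S a b) = diff (completion S) (to_completion S a) (to_completion S b)"
    "to_completion S (scal S c a) = scal (completion S) c (to_completion S a)"
    "to_completion S (star S a) = star (completion S) (to_completion S a)"
  using assms by (simp_all add: to_completion_def completion_ops cauchy_const)

text \<open>A late term X N of a representative is within e/2 of all later terms, hence of the class
  itself.\<close>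

lemma to_completion_dense:
  assumes "b \<in> carr (completion S)" "e > 0"
  shows "\<exists>a\<in>carr S. nrm (completion S) (diff (completion S) (to_completion S a) b) < e"
proof -
  obtain X where X: "X \<in> cauchy_seqs S" "b = cls X" using assms by (auto simp: carr_completion)
  obtain N where N: "\<And>m n. m \<ge> N \<Longrightarrow> n \<ge> N \<Longrightarrow> nrm S (diff S (X m) (X n)) < e/2"
    using cauchy_seqsD[OF X(1), of "e/2"] assms by auto
  have c: "(\<lambda>n. X N) \<in> cauchy_seqs S" using X by (simp add: cauchy_const cauchy_seqs_carr)
  have "nrm (completion S) (cls (\<lambda>n. diff S (X N) (X n))) \<le> e/2"
    by (rule LIMSEQ_le_const2[OF nrm_completion_tendsto[OF cauchy_diff[OF c X(1)]]])
      (use N in \<open>auto intro!: exI[of _ N] less_imp_le\<close>)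
  then have "nrm (completion S) (diff (completion S) (to_completion S (X N)) b) < e"
    using X c assms(2) by (simp add: to_completion_def diff_completion)
  then show ?thesis using X cauchy_seqs_carr by blast
qed

text \<open>Each P k lies within 1/(k+1) of the image of some a k. The sequence a is then Cauchy in
  \<open>S\<close>, and its own class is the limit of P: the images of a k converge to it, and P k
  stays close to them.\<close>

lemma cstar_completion: "cstar_algebra (completion S)"
proof -
  interpret C: pre_cstar_algebra "completion S" by (rule pre_completion)
  let ?C = "completion S" and ?i = "to_completion S"
  show ?thesis
  proof
    fix P assume P: "P \<in> cauchy_seqs ?C"
    have "\<exists>a\<in>carr S. nrm ?C (diff ?C (?i a) (P k)) < inverse (real (Suc k))" for k
      using to_completion_dense C.cauchy_seqs_carr[OF P] by simp
    then obtain a where a: "\<And>k. a k \<in> carr S" "\<And>k. nrm ?C (diff ?C (?i (a k)) (P k)) < inverse (real (Suc k))"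
      by metis
    have E0: "(\<lambda>k. inverse (real (Suc k))) \<longlonglongrightarrow> 0" by (rule LIMSEQ_inverse_real_of_nat)
    have aC: "a \<in> cauchy_seqs S"
    proof (rule cauchy_seqsI[OF a(1)])
      fix m n
      have "nrm S (diff S (a m) (a n)) = nrm ?C (diff ?C (?i (a m)) (?i (a n)))"
        using a nrm_to_completion to_completion_ops closed by metis
      also have "\<dots> \<le> nrm ?C (diff ?C (?i (a m)) (P m)) + (nrm ?C (diff ?C (P m) (P n)) + nrm ?C (diff ?C (P n) (?i (a n))))"
        using a to_completion_closed C.cauchy_seqs_carr[OF P]
        by (intro order_trans[OF C.nrm_diff_triangle[of _ "P m"]] add_mono order_refl C.nrm_diff_triangle) auto
      also have "\<dots> \<le> inverse (real (Suc m)) + (nrm ?C (diff ?C (P m) (P n)) + inverse (real (Suc n)))"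
        using a(2)[of m] a(2)[of n] C.nrm_diff_commute[of "P n" "?i (a n)"] to_completion_closed[OF a(1)] C.cauchy_seqs_carr[OF P]
        by (auto intro!: add_mono less_imp_le)
      finally show "nrm S (diff S (a m) (a n)) \<le> inverse (real (Suc m)) + (nrm ?C (diff ?C (P m) (P n)) + inverse (real (Suc n)))" .
    next
      fix e :: real assume "e > 0"
      then have e3: "e/3 > 0" by simp
      obtain N1 where N1: "\<And>k. k \<ge> N1 \<Longrightarrow> inverse (real (Suc k)) < e/3"
        using order_tendstoD(2)[OF E0 e3] by (auto simp: eventually_sequentially)
      obtain N2 where N2: "\<And>m n. m \<ge> N2 \<Longrightarrow> n \<ge> N2 \<Longrightarrow> nrm ?C (diff ?C (P m) (P n)) < e/3"
        using C.cauchy_seqsD[OF P e3] by blast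
      show "\<exists>N. \<forall>m\<ge>N. \<forall>n\<ge>N. inverse (real (Suc m)) + (nrm ?C (diff ?C (P m) (P n)) + inverse (real (Suc n))) < e"
      proof (intro exI[of _ "max N1 N2"] allI impI)
        fix m n assume "m \<ge> max N1 N2" "n \<ge> max N1 N2"
        then show "inverse (real (Suc m)) + (nrm ?C (diff ?C (P m) (P n)) + inverse (real (Suc n))) < e"
          using N1[of m] N1[of n] N2[of m n] by simp
      qed
    qed
    let ?L = "cls a"
    have L: "?L \<in> carr ?C" using aC by (simp add: carr_completion)
    have lim1: "(\<lambda>k. nrm ?C (diff ?C (?i (a k)) ?L)) \<longlonglongrightarrow> 0"
    proof (rule LIMSEQ_I)
      fix e :: real assume "e > 0"
      then obtain N where N: "\<And>m n. m \<ge> N \<Longrightarrow> n \<ge> N \<Longrightarrow> nrm S (diff S (a m) (a n)) < e/2"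
        using cauchy_seqsD[OF aC, of "e/2"] by auto
      have "nrm ?C (diff ?C (?i (a k)) ?L) \<le> e/2" if "k \<ge> N" for k
      proof -
        have c: "(\<lambda>n. a k) \<in> cauchy_seqs S" using a by (simp add: cauchy_const)
        show ?thesis unfolding to_completion_def diff_completion[OF c aC]
          by (rule LIMSEQ_le_const2[OF nrm_completion_tendsto[OF cauchy_diff[OF c aC]]])
            (use N that in \<open>auto intro!: exI[of _ N] less_imp_le\<close>)
      qed
      moreover have "0 \<le> nrm ?C (diff ?C (?i (a k)) ?L)" for k
        using a L to_completion_closed by (intro C.nrm_nonneg C.closed) auto
      ultimately show "\<exists>N. \<forall>k\<ge>N. norm (nrm ?C (diff ?C (?i (a k)) ?L) - 0) < e"
        using \<open>e > 0\<close> by (intro exI[of _ N]) fastforce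
    qed
    have "(\<lambda>k. nrm ?C (diff ?C (P k) ?L)) \<longlonglongrightarrow> 0"
    proof (rule Lim_null_comparison)
      show "\<forall>\<^sub>F k in sequentially. norm (nrm ?C (diff ?C (P k) ?L)) \<le> inverse (real (Suc k)) + nrm ?C (diff ?C (?i (a k)) ?L)"
      proof (rule always_eventually, rule allI)
        fix k
        have "nrm ?C (diff ?C (P k) ?L) \<le> nrm ?C (diff ?C (P k) (?i (a k))) + nrm ?C (diff ?C (?i (a k)) ?L)"
          using a L C.cauchy_seqs_carr[OF P] to_completion_closed by (intro C.nrm_diff_triangle) auto
        moreover have "nrm ?C (diff ?C (P k) (?i (a k))) < inverse (real (Suc k))"
          using a(2)[of k] C.nrm_diff_commute[of "P k" "?i (a k)"] to_completion_closed[OF a(1)] C.cauchy_seqs_carr[OF P] by simp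
        moreover have "0 \<le> nrm ?C (diff ?C (P k) ?L)"
          using L C.cauchy_seqs_carr[OF P] by (intro C.nrm_nonneg C.closed) auto
        ultimately show "norm (nrm ?C (diff ?C (P k) ?L)) \<le> inverse (real (Suc k)) + nrm ?C (diff ?C (?i (a k)) ?L)" by simp
      qed
      show "(\<lambda>k. inverse (real (Suc k)) + nrm ?C (diff ?C (?i (a k)) ?L)) \<longlonglongrightarrow> 0"
        using tendsto_add[OF E0 lim1] by simp
    qed
    then show "\<exists>a\<in>carr ?C. (\<lambda>n. nrm ?C (diff ?C (P n) a)) \<longlonglongrightarrow> 0" using L by blast
  qed
qed

end

section \<open>Continuous fields generated by constant fields\<close>

text \<open>In contrast to \<open>at t within T\<close> this filter sees the point t itself. It
  expresses the neighbourhoods occurring in \<open>generated_fields\<close>, so that several of them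
  can be intersected by \<open>eventually_elim\<close>.\<close>

lemma eventually_nhds_within_iff:
  "eventually P (inf (nhds t) (principal T)) \<longleftrightarrow> (\<exists>U. open U \<and> t \<in> U \<and> (\<forall>s\<in>U \<inter> T. P s))"
  by (auto simp: eventually_inf_principal eventually_nhds)

lemma tendsto_nhds_within:
  assumes "(f \<longlongrightarrow> f t) (at t within T)"
  shows "(f \<longlongrightarrow> f t) (inf (nhds t) (principal T))"
  unfolding tendsto_def
proof (intro allI impI)
  fix V assume V: "open V" "f t \<in> V"
  then have "eventually (\<lambda>x. f x \<in> V) (at t within T)" using assms by (simp add: tendsto_def)
  then obtain U where U: "open U" "t \<in> U" "\<And>x. x \<in> U \<Longrightarrow> x \<noteq> t \<Longrightarrow> x \<in> T \<Longrightarrow> f x \<in> V"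
    unfolding eventually_at_topological by auto
  then show "\<forall>\<^sub>F x in inf (nhds t) (principal T). f x \<in> V"
    unfolding eventually_nhds_within_iff using V by (intro exI[of _ U]) auto
qed

text \<open>The linear structure is common to all fibres, while products and involutions vary, so
  the constant fields are not closed under the latter. By \<open>mul_cont\<close> and
  \<open>star_cont\<close> the field of products of a and b is close, near t, to the constant field
  of their product at t, and likewise for the involution. Every axiom for general fields then
  follows by local approximation with constant ones.\<close>

lemma continuous_field_generated:
  fixes S :: "'t::topological_space \<Rightarrow> 'a star_alg" and T :: "'t set" and A :: "'a set"
  assumes pre: "\<And>t. t \<in> T \<Longrightarrow> pre_cstar_algebra (S t)"
    and carr: "\<And>t. t \<in> T \<Longrightarrow> carr (S t) = A"
    and zer: "\<And>t. t \<in> T \<Longrightarrow> zer (S t) = z"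
    and add: "\<And>t. t \<in> T \<Longrightarrow> add (S t) = ad"
    and scal: "\<And>t. t \<in> T \<Longrightarrow> scal (S t) = sc"
    and nrm_cont: "\<And>a. a \<in> A \<Longrightarrow> continuous_on T (\<lambda>t. nrm (S t) a)"
    and mul_cont: "\<And>a b t. a \<in> A \<Longrightarrow> b \<in> A \<Longrightarrow> t \<in> T \<Longrightarrow>
       ((\<lambda>s. nrm (S s) (diff (S s) (mul (S s) a b) (mul (S t) a b))) \<longlongrightarrow> 0) (at t within T)"
    and star_cont: "\<And>a t. a \<in> A \<Longrightarrow> t \<in> T \<Longrightarrow>
       ((\<lambda>s. nrm (S s) (diff (S s) (star (S s) a) (star (S t) a))) \<longlongrightarrow> 0) (at t within T)"
  shows "continuous_field T (\<lambda>t. completion (S t))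
    (generated_fields T (\<lambda>t. completion (S t)) (constant_fields T S A))"
proof -
  define C where "C t = completion (S t)" for t
  define i where "i t = to_completion (S t)" for t
  define nb where "nb t = inf (nhds t) (principal T)" for t
  define G where "G = generated_fields T C (constant_fields T S A)"
  have Tnb: "\<forall>\<^sub>F s in nb t. s \<in> T" for t by (auto simp: nb_def eventually_inf_principal)
  have nbD: "P t" if "eventually P (nb t)" "t \<in> T" for P t
    using that by (auto simp: nb_def eventually_nhds_within_iff)
  have at_nb: "eventually P (at t within T)" if "eventually P (nb t)" for P t
    using that by (auto simp: nb_def eventually_nhds_within_iff eventually_at_topological)
  note pC = pre_cstar_algebra.pre_completion[OF pre, folded C_def]
  note cC = pre_cstar_algebra.cstar_completion[OF pre, folded C_def]
  have ic: "i t a \<in> carr (C t)" if "t \<in> T" "a \<in> A" for t a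
    using pre_cstar_algebra.to_completion_closed[OF pre] carr that by (simp add: i_def C_def)
  have ni: "nrm (C t) (i t a) = nrm (S t) a" if "t \<in> T" "a \<in> A" for t a
    using pre_cstar_algebra.nrm_to_completion[OF pre] carr that by (simp add: i_def C_def)
  have A_ne: "z \<in> A" "\<And>a b. a \<in> A \<Longrightarrow> b \<in> A \<Longrightarrow> ad a b \<in> A" "\<And>a c. a \<in> A \<Longrightarrow> sc c a \<in> A"
     "\<And>a b. a \<in> A \<Longrightarrow> b \<in> A \<Longrightarrow> mul (S t) a b \<in> A" "\<And>a. a \<in> A \<Longrightarrow> star (S t) a \<in> A"
     if "t \<in> T" for t
    using pre_cstar_algebra.closed[OF pre[OF that]] carr[OF that] zer[OF that] add[OF that] scal[OF that] by auto
  have iz: "i t z = zer (C t)" and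
    iadd: "\<And>a b. a \<in> A \<Longrightarrow> b \<in> A \<Longrightarrow> i t (ad a b) = add (C t) (i t a) (i t b)" and
    imul: "\<And>a b. a \<in> A \<Longrightarrow> b \<in> A \<Longrightarrow> i t (mul (S t) a b) = mul (C t) (i t a) (i t b)" and
    idiff: "\<And>a b. a \<in> A \<Longrightarrow> b \<in> A \<Longrightarrow> i t (diff (S t) a b) = diff (C t) (i t a) (i t b)" and
    iscal: "\<And>a c. a \<in> A \<Longrightarrow> i t (sc c a) = scal (C t) c (i t a)" and
    istar: "\<And>a. a \<in> A \<Longrightarrow> i t (star (S t) a) = star (C t) (i t a)"
    if "t \<in> T" for t
    using pre_cstar_algebra.to_completion_ops[OF pre[OF that], folded C_def i_def] carr[OF that] zer[OF that]
       add[OF that] scal[OF that] A_ne(1)[OF that] by auto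
  have Gc: "x s \<in> carr (C s)" if xG: "x \<in> G" "s \<in> T" for x s
    using that by (auto simp: G_def generated_fields_def PiE_iff)
  have Gapp: "\<exists>a\<in>A. \<forall>\<^sub>F s in nb t. nrm (C s) (diff (C s) (x s) (i s a)) \<le> e" if xG: "x \<in> G" "t \<in> T" "e > 0" for x t e
  proof -
    have "\<exists>y\<in>constant_fields T S A. \<exists>U. open U \<and> t \<in> U \<and> (\<forall>s\<in>U \<inter> T. nrm (C s) (diff (C s) (x s) (y s)) \<le> e)"
      using that unfolding G_def generated_fields_def by simp
    then obtain a U where "a \<in> A" "open U" "t \<in> U"
       "\<And>s. s \<in> U \<inter> T \<Longrightarrow> nrm (C s) (diff (C s) (x s) ((\<lambda>t\<in>T. to_completion (S t) a) s)) \<le> e"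
      unfolding constant_fields_def bex_simps by blast
    then show ?thesis by (intro bexI[of _ a]) (auto simp: nb_def eventually_nhds_within_iff i_def intro!: exI[of _ U])
  qed
  have GI: "x \<in> G" if x: "x \<in> (\<Pi>\<^sub>E t\<in>T. carr (C t))" and
     e: "\<And>t e. t \<in> T \<Longrightarrow> e > 0 \<Longrightarrow> \<exists>a\<in>A. \<forall>\<^sub>F s in nb t. s \<in> T \<longrightarrow> nrm (C s) (diff (C s) (x s) (i s a)) \<le> e" for x
    unfolding G_def generated_fields_def
  proof (intro CollectI conjI ballI allI impI x)
    fix t and e :: real assume "t \<in> T" "e > 0"
    from e[OF this] obtain a U where a: "a \<in> A" and U: "open U" "t \<in> U"
      "\<And>s. s \<in> U \<Longrightarrow> s \<in> T \<Longrightarrow> nrm (C s) (diff (C s) (x s) (i s a)) \<le> e"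
      unfolding nb_def eventually_nhds_within_iff by auto
    show "\<exists>y\<in>constant_fields T S A. \<exists>U. open U \<and> t \<in> U \<and> (\<forall>s\<in>U \<inter> T. nrm (C s) (diff (C s) (x s) (y s)) \<le> e)"
      using a U by (intro bexI[of _ "\<lambda>t\<in>T. to_completion (S t) a"] exI[of _ U]) (auto simp: constant_fields_def i_def)
  qed
  have ncont: "\<forall>\<^sub>F s in nb t. \<bar>nrm (S s) a - nrm (S t) a\<bar> < e" if "a \<in> A" "t \<in> T" "e > 0" for a t e
  proof -
    have "((\<lambda>t. nrm (S t) a) \<longlongrightarrow> nrm (S t) a) (nb t)"
      unfolding nb_def using nrm_cont[OF that(1)] that(2) by (intro tendsto_nhds_within) (auto simp: continuous_on_def)
    then show ?thesis using that(3) by (auto simp: tendsto_iff dist_real_def)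
  qed
  \<comment> \<open>The hypotheses on products and involutions are limits over s different from t;
    since the value at t is 0, the point t can be included.\<close>
  have null0: "\<forall>\<^sub>F s in nb t. f s \<le> e" if f: "(f \<longlongrightarrow> 0) (at t within T)" and "f t = 0" "e > 0" for f :: "'t \<Rightarrow> real" and t e
  proof -
    have "(f \<longlongrightarrow> f t) (nb t)" unfolding nb_def using that by (intro tendsto_nhds_within) simp
    then have "\<forall>\<^sub>F s in nb t. f s < e" using that by (intro order_tendstoD) auto
    then show ?thesis by (rule eventually_mono) simp
  qed
  have zero_diff: "nrm (S t) (diff (S t) a a) = 0" if "t \<in> T" "a \<in> A" for t a
    using pre_cstar_algebra.diff_self[OF pre] pre_cstar_algebra.nrm_zer[OF pre] that carr by simp
  have "continuous_field T C G"
  proof (rule continuous_field.intro)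
    show "cstar_algebra (C t)" if "t \<in> T" for t using cC that by simp
    show "G \<subseteq> (\<Pi>\<^sub>E t\<in>T. carr (C t))" by (auto simp: G_def generated_fields_def)
    have const: "(\<lambda>t\<in>T. i t a) \<in> G" if "a \<in> A" for a
    proof (rule GI)
      show "(\<lambda>t\<in>T. i t a) \<in> (\<Pi>\<^sub>E t\<in>T. carr (C t))" using ic that by auto
      fix t e assume "t \<in> T" "(e::real) > 0"
      show "\<exists>b\<in>A. \<forall>\<^sub>F s in nb t. s \<in> T \<longrightarrow> nrm (C s) (diff (C s) ((\<lambda>t\<in>T. i t a) s) (i s b)) \<le> e"
      proof (intro bexI[of _ a] that always_eventually allI impI)
        fix s assume s: "s \<in> T"
        interpret pre_cstar_algebra "C s" by (rule pC[OF s])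
        show "nrm (C s) (diff (C s) ((\<lambda>t\<in>T. i t a) s) (i s a)) \<le> e"
          using s \<open>e > 0\<close> ic[OF s that] by (simp add: diff_self nrm_zer)
      qed
    qed
    show "(\<lambda>t\<in>T. zer (C t)) \<in> G"
    \<comment> \<open>Membership of \<open>z\<close> in \<open>A\<close> is read off from a fibre;
      over the empty set there is none, and the claim is vacuous.\<close>
    proof (cases "T = {}")
      case False
      then have "z \<in> A" using A_ne by blast
      then show ?thesis using const[of z] iz by (simp cong: restrict_cong)
    next
      case True
      then show ?thesis by (intro GI) auto
    qed
    show "\<exists>x\<in>G. nrm (C t) (diff (C t) (x t) b) < e" if "t \<in> T" "b \<in> carr (C t)" "e > 0" for t b e
    proof -
      have "\<exists>a\<in>carr (S t). nrm (C t) (diff (C t) (i t a) b) < e"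
        using pre_cstar_algebra.to_completion_dense[OF pre, folded C_def i_def] that by blast
      then obtain a where "a \<in> A" "nrm (C t) (diff (C t) (i t a) b) < e"
        using carr[OF \<open>t \<in> T\<close>] by blast
      then show ?thesis using const that by (intro bexI[of _ "\<lambda>t\<in>T. i t a"]) auto
    qed
    show "(\<lambda>t\<in>T. add (C t) (x t) (y t)) \<in> G" if xG: "x \<in> G" "y \<in> G" for x y
    proof (rule GI)
      show "(\<lambda>t\<in>T. add (C t) (x t) (y t)) \<in> (\<Pi>\<^sub>E t\<in>T. carr (C t))"
        using Gc that pre_cstar_algebra.add_closed[OF pC] by auto
      fix t and e :: real assume t: "t \<in> T" "e > 0"
      then have e: "e/2 > 0" by simp
      obtain a b where ab: "a \<in> A" "b \<in> A" "\<forall>\<^sub>F s in nb t. nrm (C s) (diff (C s) (x s) (i s a)) \<le> e/2"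
         "\<forall>\<^sub>F s in nb t. nrm (C s) (diff (C s) (y s) (i s b)) \<le> e/2"
        using Gapp[OF xG(1) t(1) e] Gapp[OF xG(2) t(1) e] by blast
      show "\<exists>a\<in>A. \<forall>\<^sub>F s in nb t. s \<in> T \<longrightarrow> nrm (C s) (diff (C s) ((\<lambda>t\<in>T. add (C t) (x t) (y t)) s) (i s a)) \<le> e"
      proof (intro bexI[of _ "ad a b"])
        show "ad a b \<in> A" using A_ne(2)[OF t(1)] ab by simp
        show "\<forall>\<^sub>F s in nb t. s \<in> T \<longrightarrow> nrm (C s) (diff (C s) ((\<lambda>t\<in>T. add (C t) (x t) (y t)) s) (i s (ad a b))) \<le> e"
          using ab(3,4)
        proof (eventually_elim, intro impI)
          fix s assume s: "nrm (C s) (diff (C s) (x s) (i s a)) \<le> e/2" "nrm (C s) (diff (C s) (y s) (i s b)) \<le> e/2" "s \<in> T"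
          interpret pre_cstar_algebra "C s" by (rule pC[OF s(3)])
          have "nrm (C s) (diff (C s) (add (C s) (x s) (y s)) (add (C s) (i s a) (i s b))) \<le> e/2 + e/2"
            using Gc that ic ab s by (intro order_trans[OF nrm_diff_add] add_mono) auto
          then show "nrm (C s) (diff (C s) ((\<lambda>t\<in>T. add (C t) (x t) (y t)) s) (i s (ad a b))) \<le> e"
            using s ab iadd by simp
        qed
      qed
    qed
    show "(\<lambda>t\<in>T. scal (C t) c (x t)) \<in> G" if xG: "x \<in> G" for x c
    proof (rule GI)
      show "(\<lambda>t\<in>T. scal (C t) c (x t)) \<in> (\<Pi>\<^sub>E t\<in>T. carr (C t))"
        using Gc that pre_cstar_algebra.scal_closed[OF pC] by auto
      fix t and e :: real assume t: "t \<in> T" "e > 0"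
      then have e: "e/(cmod c + 1) > 0" by (simp add: add_nonneg_pos)
      obtain a where ab: "a \<in> A" "\<forall>\<^sub>F s in nb t. nrm (C s) (diff (C s) (x s) (i s a)) \<le> e/(cmod c + 1)"
        using Gapp[OF xG(1) t(1) e] by blast
      show "\<exists>a\<in>A. \<forall>\<^sub>F s in nb t. s \<in> T \<longrightarrow> nrm (C s) (diff (C s) ((\<lambda>t\<in>T. scal (C t) c (x t)) s) (i s a)) \<le> e"
      proof (intro bexI[of _ "sc c a"])
        show "sc c a \<in> A" using A_ne(3)[OF t(1)] ab by simp
        show "\<forall>\<^sub>F s in nb t. s \<in> T \<longrightarrow> nrm (C s) (diff (C s) ((\<lambda>t\<in>T. scal (C t) c (x t)) s) (i s (sc c a))) \<le> e"
          using ab(2)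
        proof (eventually_elim, intro impI)
          fix s assume s: "nrm (C s) (diff (C s) (x s) (i s a)) \<le> e/(cmod c + 1)" "s \<in> T"
          interpret pre_cstar_algebra "C s" by (rule pC[OF s(2)])
          have "nrm (C s) (diff (C s) (scal (C s) c (x s)) (scal (C s) c (i s a))) = cmod c * nrm (C s) (diff (C s) (x s) (i s a))"
            using Gc that ic ab s by (intro nrm_diff_scal) auto
          also have "\<dots> \<le> (cmod c + 1) * (e/(cmod c + 1))"
            using s t nrm_nonneg[OF diff_closed[OF Gc[OF xG s(2)] ic[OF s(2) ab(1)]]] by (intro mult_mono) auto
          also have "\<dots> = e" by (metis add_nonneg_pos less_numeral_extra(1,3) nonzero_mult_div_cancel_left norm_ge_zero times_divide_eq_right)
          finally show "nrm (C s) (diff (C s) ((\<lambda>t\<in>T. scal (C t) c (x t)) s) (i s (sc c a))) \<le> e"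
            using s ab iscal by simp
        qed
      qed
    qed
    show "(\<lambda>t\<in>T. star (C t) (x t)) \<in> G" if xG: "x \<in> G" for x
    proof (rule GI)
      show "(\<lambda>t\<in>T. star (C t) (x t)) \<in> (\<Pi>\<^sub>E t\<in>T. carr (C t))"
        using Gc that pre_cstar_algebra.star_closed[OF pC] by auto
      fix t and e :: real assume t: "t \<in> T" "e > 0"
      then have e: "e/2 > 0" by simp
      obtain a where ab: "a \<in> A" "\<forall>\<^sub>F s in nb t. nrm (C s) (diff (C s) (x s) (i s a)) \<le> e/2"
        using Gapp[OF xG(1) t(1) e] by blast
      have sc: "\<forall>\<^sub>F s in nb t. nrm (S s) (diff (S s) (star (S s) a) (star (S t) a)) \<le> e/2"
        using zero_diff A_ne(5) ab t by (intro null0 star_cont) auto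
      show "\<exists>a\<in>A. \<forall>\<^sub>F s in nb t. s \<in> T \<longrightarrow> nrm (C s) (diff (C s) ((\<lambda>t\<in>T. star (C t) (x t)) s) (i s a)) \<le> e"
      proof (intro bexI[of _ "star (S t) a"])
        show sA: "star (S t) a \<in> A" using A_ne(5)[OF t(1)] ab by simp
        show "\<forall>\<^sub>F s in nb t. s \<in> T \<longrightarrow> nrm (C s) (diff (C s) ((\<lambda>t\<in>T. star (C t) (x t)) s) (i s (star (S t) a))) \<le> e"
          using ab(2) sc
        proof (eventually_elim, intro impI)
          fix s assume s: "nrm (C s) (diff (C s) (x s) (i s a)) \<le> e/2"
            "nrm (S s) (diff (S s) (star (S s) a) (star (S t) a)) \<le> e/2" "s \<in> T"
          interpret pre_cstar_algebra "C s" by (rule pC[OF s(3)])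
          have sA': "star (S s) a \<in> A" using A_ne(5)[OF s(3)] ab by simp
          have dA: "diff (S s) (star (S s) a) (star (S t) a) \<in> A"
            using pre_cstar_algebra.diff_closed[OF pre[OF s(3)]] carr[OF s(3)] sA sA' by simp
          have "nrm (C s) (diff (C s) (star (C s) (x s)) (i s (star (S t) a))) \<le>
             nrm (C s) (diff (C s) (star (C s) (x s)) (i s (star (S s) a))) + nrm (C s) (diff (C s) (i s (star (S s) a)) (i s (star (S t) a)))"
            using Gc that ic sA sA' s by (intro nrm_diff_triangle closed) auto
          also have "nrm (C s) (diff (C s) (i s (star (S s) a)) (i s (star (S t) a))) = nrm (S s) (diff (S s) (star (S s) a) (star (S t) a))"
            using idiff[OF s(3) sA' sA] ni[OF s(3) dA] by simp
          also have "nrm (C s) (diff (C s) (star (C s) (x s)) (i s (star (S s) a))) = nrm (C s) (diff (C s) (x s) (i s a))"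
            using Gc that ic ab s istar by (simp add: nrm_diff_star)
          finally show "nrm (C s) (diff (C s) ((\<lambda>t\<in>T. star (C t) (x t)) s) (i s (star (S t) a))) \<le> e"
            using s by simp
        qed
      qed
    qed
    show "(\<lambda>t\<in>T. mul (C t) (x t) (y t)) \<in> G" if xG: "x \<in> G" "y \<in> G" for x y
    proof (rule GI)
      show "(\<lambda>t\<in>T. mul (C t) (x t) (y t)) \<in> (\<Pi>\<^sub>E t\<in>T. carr (C t))"
        using Gc that pre_cstar_algebra.mul_closed[OF pC] by auto
      fix t and e :: real assume t: "t \<in> T" "e > 0"
      \<comment> \<open>In x y - a b = x (y - b) + (x - a) b the bound \<open>Bx\<close> for x near
        t has to be known before b is chosen, and the bound \<open>Bb\<close> for b before a is
        chosen; hence the preliminary approximant a0. The 2 in \<open>Bx\<close> is 1 for the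
        distance from x to a0 and 1 for the variation of the norm of a0 near t.\<close>
      obtain a0 where a0: "a0 \<in> A" "\<forall>\<^sub>F s in nb t. nrm (C s) (diff (C s) (x s) (i s a0)) \<le> 1"
        using Gapp[OF xG(1) t(1), of 1] by auto
      define Bx where "Bx = nrm (S t) a0 + 2"
      have "Bx > 0" unfolding Bx_def
        using pre_cstar_algebra.nrm_nonneg[OF pre[OF t(1)]] carr[OF t(1)] a0(1) by (simp add: add_nonneg_pos)
      then have e: "e/(3*Bx) > 0" using t by simp
      obtain b where b: "b \<in> A" "\<forall>\<^sub>F s in nb t. nrm (C s) (diff (C s) (y s) (i s b)) \<le> e/(3*Bx)"
        using Gapp[OF xG(2) t(1) e] by blast
      define Bb where "Bb = nrm (S t) b + 1"
      have "Bb > 0" unfolding Bb_def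
        using pre_cstar_algebra.nrm_nonneg[OF pre[OF t(1)]] carr[OF t(1)] b(1) by (simp add: add_nonneg_pos)
      then have e: "e/(3*Bb) > 0" using t by simp
      obtain a where a: "a \<in> A" "\<forall>\<^sub>F s in nb t. nrm (C s) (diff (C s) (x s) (i s a)) \<le> e/(3*Bb)"
        using Gapp[OF xG(1) t(1) e] by blast
      have mA: "mul (S t) a b \<in> A" using A_ne(4)[OF t(1)] a b by simp
      have sc: "\<forall>\<^sub>F s in nb t. nrm (S s) (diff (S s) (mul (S s) a b) (mul (S t) a b)) \<le> e/3"
        using zero_diff mA a b t by (intro null0 mul_cont) auto
      show "\<exists>a\<in>A. \<forall>\<^sub>F s in nb t. s \<in> T \<longrightarrow> nrm (C s) (diff (C s) ((\<lambda>t\<in>T. mul (C t) (x t) (y t)) s) (i s a)) \<le> e"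
      proof (intro bexI[of _ "mul (S t) a b"] mA)
        show "\<forall>\<^sub>F s in nb t. s \<in> T \<longrightarrow> nrm (C s) (diff (C s) ((\<lambda>t\<in>T. mul (C t) (x t) (y t)) s) (i s (mul (S t) a b))) \<le> e"
          using a0(2) a(2) b(2) sc ncont[OF a0(1) t(1) zero_less_one] ncont[OF b(1) t(1) zero_less_one]
        proof (eventually_elim, intro impI)
          fix s assume s: "nrm (C s) (diff (C s) (x s) (i s a0)) \<le> 1"
            "nrm (C s) (diff (C s) (x s) (i s a)) \<le> e/(3*Bb)"
            "nrm (C s) (diff (C s) (y s) (i s b)) \<le> e/(3*Bx)"
            "nrm (S s) (diff (S s) (mul (S s) a b) (mul (S t) a b)) \<le> e/3"
            "\<bar>nrm (S s) a0 - nrm (S t) a0\<bar> < 1" "\<bar>nrm (S s) b - nrm (S t) b\<bar> < 1" "s \<in> T"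
          interpret pre_cstar_algebra "C s" by (rule pC[OF s(7)])
          note c = Gc[OF that(1) s(7)] Gc[OF that(2) s(7)] ic[OF s(7) a(1)] ic[OF s(7) b(1)] ic[OF s(7) a0(1)]
          have nx: "nrm (C s) (x s) \<le> Bx"
            using nrm_diff_triangle2[OF c(1) c(5)] s(1,5) ni[OF s(7) a0(1)] unfolding Bx_def by linarith
          have nb: "nrm (C s) (i s b) \<le> Bb"
            using s(6) ni[OF s(7) b(1)] unfolding Bb_def by linarith
          have mA': "mul (S s) a b \<in> A" using A_ne(4)[OF s(7)] a b by simp
          have dA: "diff (S s) (mul (S s) a b) (mul (S t) a b) \<in> A"
            using pre_cstar_algebra.diff_closed[OF pre[OF s(7)]] carr[OF s(7)] mA mA' by simp
          have "nrm (C s) (diff (C s) (mul (C s) (x s) (y s)) (i s (mul (S t) a b))) \<le>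
             nrm (C s) (diff (C s) (mul (C s) (x s) (y s)) (i s (mul (S s) a b))) + nrm (C s) (diff (C s) (i s (mul (S s) a b)) (i s (mul (S t) a b)))"
            using c ic mA mA' s by (intro nrm_diff_triangle closed) auto
          also have "nrm (C s) (diff (C s) (i s (mul (S s) a b)) (i s (mul (S t) a b))) = nrm (S s) (diff (S s) (mul (S s) a b) (mul (S t) a b))"
            using idiff[OF s(7) mA' mA] ni[OF s(7) dA] by simp
          also have "nrm (C s) (diff (C s) (mul (C s) (x s) (y s)) (i s (mul (S s) a b))) \<le>
              nrm (C s) (x s) * nrm (C s) (diff (C s) (y s) (i s b)) + nrm (C s) (diff (C s) (x s) (i s a)) * nrm (C s) (i s b)"
            using c imul[OF s(7) a(1) b(1)] by (simp add: nrm_diff_mul)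
          also have "\<dots> \<le> Bx * (e/(3*Bx)) + (e/(3*Bb)) * Bb"
            using nx nb s(2,3) \<open>Bx > 0\<close> \<open>Bb > 0\<close> t by (intro add_mono mult_mono) (auto intro!: nrm_nonneg closed c)
          also have "\<dots> = e/3 + e/3" using \<open>Bx > 0\<close> \<open>Bb > 0\<close> by simp
          finally show "nrm (C s) (diff (C s) ((\<lambda>t\<in>T. mul (C t) (x t) (y t)) s) (i s (mul (S t) a b))) \<le> e"
            using s by simp
        qed
      qed
    qed
    show "continuous_on T (\<lambda>t. nrm (C t) (x t))" if xG: "x \<in> G" for x
      unfolding continuous_on_def tendsto_iff dist_real_def
    proof (intro ballI allI impI)
      fix t and e :: real assume t: "t \<in> T" "e > 0"
      then have e: "e/4 > 0" by simp
      obtain a where a: "a \<in> A" "\<forall>\<^sub>F s in nb t. nrm (C s) (diff (C s) (x s) (i s a)) \<le> e/4"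
        using Gapp[OF xG t(1) e] by blast
      have d: "\<bar>nrm (C s) (x s) - nrm (S s) a\<bar> \<le> e/4"
        if "s \<in> T" "nrm (C s) (diff (C s) (x s) (i s a)) \<le> e/4" for s
      proof -
        interpret pre_cstar_algebra "C s" by (rule pC[OF that(1)])
        show ?thesis using nrm_diff_triangle2[of "x s" "i s a"] Gc[OF \<open>x \<in> G\<close>] ic[OF that(1) a(1)] ni[OF that(1) a(1)] that by force
      qed
      have dt: "\<bar>nrm (C t) (x t) - nrm (S t) a\<bar> \<le> e/4" using d[OF t(1)] nbD[OF a(2) t(1)] by simp
      have "\<forall>\<^sub>F s in nb t. \<bar>nrm (C s) (x s) - nrm (C t) (x t)\<bar> < e"
        using a(2) ncont[OF a(1) t(1) e] Tnb
      proof eventually_elim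
        case (elim s)
        show ?case using d[OF elim(3,1)] dt elim(2) t(2) by linarith
      qed
      then show "\<forall>\<^sub>F s in at t within T. \<bar>nrm (C s) (x s) - nrm (C t) (x t)\<bar> < e" by (rule at_nb)
    qed
    show "x \<in> G" if x: "x \<in> (\<Pi>\<^sub>E t\<in>T. carr (C t))" and
      app: "\<And>t e. \<lbrakk>t \<in> T; e > 0\<rbrakk> \<Longrightarrow> \<exists>y\<in>G. \<exists>U. open U \<and> t \<in> U \<and> (\<forall>s\<in>U \<inter> T. nrm (C s) (diff (C s) (x s) (y s)) \<le> e)" for x
    proof (rule GI[OF x])
      fix t and e :: real assume t: "t \<in> T" "e > 0"
      then have e: "e/2 > 0" by simp
      obtain y where y: "y \<in> G" "\<forall>\<^sub>F s in nb t. nrm (C s) (diff (C s) (x s) (y s)) \<le> e/2"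
        using app[OF t(1) e] unfolding nb_def eventually_nhds_within_iff by blast
      obtain a where a: "a \<in> A" "\<forall>\<^sub>F s in nb t. nrm (C s) (diff (C s) (y s) (i s a)) \<le> e/2"
        using Gapp[OF y(1) t(1) e] by blast
      show "\<exists>a\<in>A. \<forall>\<^sub>F s in nb t. s \<in> T \<longrightarrow> nrm (C s) (diff (C s) (x s) (i s a)) \<le> e"
      proof (intro bexI[OF _ a(1)])
        show "\<forall>\<^sub>F s in nb t. s \<in> T \<longrightarrow> nrm (C s) (diff (C s) (x s) (i s a)) \<le> e"
          using a(2) y(2)
        proof (eventually_elim, intro impI)
          fix s assume s: "nrm (C s) (diff (C s) (y s) (i s a)) \<le> e/2" "nrm (C s) (diff (C s) (x s) (y s)) \<le> e/2" "s \<in> T"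
          interpret pre_cstar_algebra "C s" by (rule pC[OF s(3)])
          have "x s \<in> carr (C s)" using x s(3) by auto
          then show "nrm (C s) (diff (C s) (x s) (i s a)) \<le> e"
            using nrm_diff_triangle[of "x s" "y s" "i s a"] Gc[OF y(1) s(3)] ic[OF s(3) a(1)] s by linarith
        qed
      qed
    qed
  qed
  then show ?thesis by (simp add: C_def[abs_def] G_def)
qed

section \<open>Fourier analysis on Euclidean spaces\<close>

lemma ee_bar_eq: "ee_bar t = ee (- t)"
  by (simp add: ee_def ee_bar_def)

lemma ee_cis: "ee t = cis (2 * pi * t)"
  by (simp add: ee_def cis_conv_exp mult_ac)

lemma norm_ee [simp]: "cmod (ee t) = 1"
  by (simp add: ee_cis)

lemma ee_0 [simp]: "ee 0 = 1"
  by (simp add: ee_def)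

lemma ee_add: "ee (s + t) = ee s * ee t"
  by (simp add: ee_cis cis_mult distrib_left)

lemma cnj_ee [simp]: "cnj (ee t) = ee (- t)"
  by (simp add: ee_cis cis_cnj)

lemma ee_minus_mult [simp]: "ee (- t) * ee t = 1" "ee t * ee (- t) = 1"
  by (simp_all flip: ee_add)

lemma ee_has_vector_derivative [derivative_intros]:
  "(ee has_vector_derivative (2 * of_real pi * \<i> * ee t)) (at t within S)"
  unfolding ee_def[abs_def]
  by (rule has_vector_derivative_eq_rhs, rule has_vector_derivative_real_field)
     (auto intro!: derivative_eq_intros)

lemma continuous_on_ee: "continuous_on S ee"
  unfolding ee_def[abs_def] by (intro continuous_intros)

lemma measurable_ee [measurable]: "ee \<in> borel_measurable borel"
  by (intro borel_measurable_continuous_onI continuous_on_ee)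

lemma ee_iexp: "ee t = exp (\<i> * of_real (2 * pi * t))"
  by (simp add: ee_def mult_ac)

lemma ee_diff_le: "cmod (ee s - ee t) \<le> 2 * pi * \<bar>s - t\<bar>"
proof -
  have "ee s - ee t = ee t * (ee (s - t) - 1)" by (simp add: right_diff_distrib flip: ee_add)
  moreover have "cmod (ee (s - t) - 1) \<le> 2 * pi * \<bar>s - t\<bar>"
    using iexp_approx1[of "2 * pi * (s - t)" 0] by (simp add: ee_iexp abs_mult)
  ultimately show ?thesis by (simp add: norm_mult)
qed

lemma ee_taylor_le: "cmod (ee t - 1 - 2 * of_real pi * \<i> * of_real t) \<le> (2 * pi * t)\<^sup>2 / 2"
  using iexp_approx1[of "2 * pi * t" 1] by (simp add: ee_iexp field_simps power2_eq_square numeral_2_eq_2)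

section \<open>Lebesgue integration: measurability in parameters, Fubini, affine
  substitutions\<close>

lemma measurable_fst_borel [measurable]:
  "(fst :: 'a::second_countable_topology \<times> 'b::second_countable_topology \<Rightarrow> 'a) \<in> borel \<rightarrow>\<^sub>M borel"
  by (intro borel_measurable_continuous_onI continuous_intros)

lemma measurable_snd_borel [measurable]:
  "(snd :: 'a::second_countable_topology \<times> 'b::second_countable_topology \<Rightarrow> 'b) \<in> borel \<rightarrow>\<^sub>M borel"
  by (intro borel_measurable_continuous_onI continuous_intros)

lemma measurable_lborel_integral:
  fixes f :: "'a::euclidean_space \<Rightarrow> 'b::euclidean_space \<Rightarrow> 'c::{banach,second_countable_topology}"
  assumes "(\<lambda>z. f (fst z) (snd z)) \<in> borel_measurable borel"
  shows "(\<lambda>x. LINT y|lborel. f x y) \<in> borel_measurable borel"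
proof -
  have "(\<lambda>(x, y). f x y) \<in> borel_measurable (lborel \<Otimes>\<^sub>M lborel)"
    using assms by (simp add: lborel_prod case_prod_beta')
  from lborel.borel_measurable_lebesgue_integral[OF this] show ?thesis by simp
qed

lemma measurable_lborel_nn_integral:
  fixes f :: "'a::euclidean_space \<Rightarrow> 'b::euclidean_space \<Rightarrow> ennreal"
  assumes "(\<lambda>z. f (fst z) (snd z)) \<in> borel_measurable borel"
  shows "(\<lambda>x. \<integral>\<^sup>+y. f x y \<partial>lborel) \<in> borel_measurable borel"
proof -
  have "(\<lambda>(x, y). f x y) \<in> borel_measurable (lborel \<Otimes>\<^sub>M lborel)"
    using assms by (simp add: lborel_prod case_prod_beta')
  from lborel.borel_measurable_nn_integral[OF this] show ?thesis by simp
qed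

lemma nn_integral_lborel_pair:
  fixes f :: "'a::euclidean_space \<times> 'b::euclidean_space \<Rightarrow> ennreal"
  assumes "f \<in> borel_measurable borel"
  shows "(\<integral>\<^sup>+z. f z \<partial>lborel) = (\<integral>\<^sup>+x. \<integral>\<^sup>+y. f (x, y) \<partial>lborel \<partial>lborel)"
    "(\<integral>\<^sup>+z. f z \<partial>lborel) = (\<integral>\<^sup>+y. \<integral>\<^sup>+x. f (x, y) \<partial>lborel \<partial>lborel)"
proof -
  have m: "f \<in> borel_measurable (lborel \<Otimes>\<^sub>M lborel)" using assms by (simp add: lborel_prod)
  show "(\<integral>\<^sup>+z. f z \<partial>lborel) = (\<integral>\<^sup>+x. \<integral>\<^sup>+y. f (x, y) \<partial>lborel \<partial>lborel)"
    using lborel.nn_integral_fst[OF m] by (simp add: lborel_prod)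
  show "(\<integral>\<^sup>+z. f z \<partial>lborel) = (\<integral>\<^sup>+y. \<integral>\<^sup>+x. f (x, y) \<partial>lborel \<partial>lborel)"
    using lborel_pair.nn_integral_snd[OF m] by (simp add: lborel_prod)
qed

lemma integrable_lborel_pairI:
  fixes f :: "'a::euclidean_space \<times> 'b::euclidean_space \<Rightarrow> 'c::{banach,second_countable_topology}"
  assumes "f \<in> borel_measurable borel" "(\<integral>\<^sup>+x. \<integral>\<^sup>+y. ennreal (norm (f (x, y))) \<partial>lborel \<partial>lborel) < \<infinity>"
  shows "integrable lborel f"
proof (rule integrableI_bounded)
  note [measurable] = assms(1)
  show "f \<in> borel_measurable lborel" by simp
  show "(\<integral>\<^sup>+z. ennreal (norm (f z)) \<partial>lborel) < \<infinity>"
    using assms(2) by (subst nn_integral_lborel_pair(1)) auto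
qed

lemma integral_lborel_pair:
  fixes f :: "'a::euclidean_space \<times> 'b::euclidean_space \<Rightarrow> 'c::{banach,second_countable_topology}"
  assumes "integrable lborel f"
  shows "(LINT z|lborel. f z) = (LINT x|lborel. LINT y|lborel. f (x, y))"
    "(LINT z|lborel. f z) = (LINT y|lborel. LINT x|lborel. f (x, y))"
proof -
  have i: "integrable (lborel \<Otimes>\<^sub>M lborel) (\<lambda>(x, y). f (x, y))" using assms by (simp add: lborel_prod)
  show "(LINT z|lborel. f z) = (LINT x|lborel. LINT y|lborel. f (x, y))"
    using lborel_pair.integral_fst[OF i] by (simp add: lborel_prod)
  show "(LINT z|lborel. f z) = (LINT y|lborel. LINT x|lborel. f (x, y))"
    using lborel_pair.integral_snd[OF i] by (simp add: lborel_prod)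
qed

lemma integral_lborel_swap:
  fixes f :: "'a::euclidean_space \<Rightarrow> 'b::euclidean_space \<Rightarrow> 'c::{banach,second_countable_topology}"
  assumes "integrable lborel (\<lambda>z. f (fst z) (snd z))"
  shows "(LINT x|lborel. LINT y|lborel. f x y) = (LINT y|lborel. LINT x|lborel. f x y)"
  using integral_lborel_pair[OF assms] by simp

lemma integrable_lborel_prod:
  fixes f :: "'a::euclidean_space \<Rightarrow> 'c::{real_normed_field,banach,second_countable_topology}" and g :: "'b::euclidean_space \<Rightarrow> 'c"
  assumes f: "integrable lborel f" and g: "integrable lborel g"
  shows "integrable lborel (\<lambda>z. f (fst z) * g (snd z))"
proof (rule integrable_lborel_pairI)
  have [measurable]: "f \<in> borel_measurable borel" "g \<in> borel_measurable borel"
    using borel_measurable_integrable[OF f] borel_measurable_integrable[OF g] by simp_all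
  show "(\<lambda>z. f (fst z) * g (snd z)) \<in> borel_measurable borel" by measurable
  have "(\<integral>\<^sup>+x. \<integral>\<^sup>+y. ennreal (norm (f x * g y)) \<partial>lborel \<partial>lborel) =
     (\<integral>\<^sup>+x. ennreal (norm (f x)) \<partial>lborel) * (\<integral>\<^sup>+x. ennreal (norm (g x)) \<partial>lborel)"
    by (simp add: norm_mult ennreal_mult nn_integral_cmult nn_integral_multc)
  also have "\<dots> < \<infinity>" using f g by (auto simp: integrable_iff_bounded ennreal_mult_less_top)
  finally show "(\<integral>\<^sup>+x. \<integral>\<^sup>+y. ennreal (norm (f (fst (x, y)) * g (snd (x, y)))) \<partial>lborel \<partial>lborel) < \<infinity>" by simp
qed

lemma
  fixes c :: real and t :: "'a::euclidean_space" and f :: "'a \<Rightarrow> ennreal" and g :: "'a \<Rightarrow> 'c::{banach,second_countable_topology}"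
  assumes c: "c \<noteq> 0"
  shows nn_integral_lborel_affine: "f \<in> borel_measurable borel \<Longrightarrow>
      (\<integral>\<^sup>+x. f x \<partial>lborel) = ennreal (\<bar>c\<bar> ^ DIM('a)) * (\<integral>\<^sup>+x. f (t + c *\<^sub>R x) \<partial>lborel)" (is "_ \<Longrightarrow> ?A")
    and integrable_lborel_affine: "g \<in> borel_measurable borel \<Longrightarrow>
      integrable lborel (\<lambda>x. g (t + c *\<^sub>R x)) \<longleftrightarrow> integrable lborel g" (is "_ \<Longrightarrow> ?B")
    and integral_lborel_affine: "g \<in> borel_measurable borel \<Longrightarrow>
      (LINT x|lborel. g x) = (\<bar>c\<bar> ^ DIM('a)) *\<^sub>R (LINT x|lborel. g (t + c *\<^sub>R x))" (is "_ \<Longrightarrow> ?C")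
proof -
  have T[measurable]: "(\<lambda>x. t + c *\<^sub>R x) \<in> borel \<rightarrow>\<^sub>M borel" by measurable
  note L = lborel_affine[OF c, of t]
  show ?A if [measurable]: "f \<in> borel_measurable borel"
    by (subst L) (simp add: nn_integral_density nn_integral_distr nn_integral_cmult)
  show ?B if [measurable]: "g \<in> borel_measurable borel"
  proof -
    have "integrable lborel g \<longleftrightarrow> integrable (distr lborel borel (\<lambda>x. t + c *\<^sub>R x)) (\<lambda>x. \<bar>c\<bar> ^ DIM('a) *\<^sub>R g x)"
      by (subst L) (simp add: integrable_density)
    also have "\<dots> \<longleftrightarrow> integrable lborel (\<lambda>x. \<bar>c\<bar> ^ DIM('a) *\<^sub>R g (t + c *\<^sub>R x))"
      by (subst integrable_distr_eq) auto
    also have "\<dots> \<longleftrightarrow> integrable lborel (\<lambda>x. g (t + c *\<^sub>R x))"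
      using c integrable_scaleR_right[of "inverse (\<bar>c\<bar> ^ DIM('a))" lborel "\<lambda>x. \<bar>c\<bar> ^ DIM('a) *\<^sub>R g (t + c *\<^sub>R x)"]
      by auto
    finally show ?thesis by simp
  qed
  show ?C if [measurable]: "g \<in> borel_measurable borel"
    by (subst L) (simp add: integral_density integral_distr)
qed

lemma
  fixes t :: "'a::euclidean_space" and f :: "'a \<Rightarrow> ennreal" and g :: "'a \<Rightarrow> 'c::{banach,second_countable_topology}"
  shows nn_integral_lborel_translate: "f \<in> borel_measurable borel \<Longrightarrow> (\<integral>\<^sup>+x. f (x + t) \<partial>lborel) = (\<integral>\<^sup>+x. f x \<partial>lborel)"
    and integrable_lborel_translate: "g \<in> borel_measurable borel \<Longrightarrow>
      integrable lborel (\<lambda>x. g (x + t)) \<longleftrightarrow> integrable lborel g"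
    and integral_lborel_translate: "g \<in> borel_measurable borel \<Longrightarrow> (LINT x|lborel. g (x + t)) = (LINT x|lborel. g x)"
  using nn_integral_lborel_affine[of 1 f t] integrable_lborel_affine[of 1 g t] integral_lborel_affine[of 1 g t]
  by (simp_all add: add.commute)

lemma
  fixes t :: "'a::euclidean_space" and f :: "'a \<Rightarrow> ennreal" and g :: "'a \<Rightarrow> 'c::{banach,second_countable_topology}"
  shows nn_integral_lborel_reflect: "f \<in> borel_measurable borel \<Longrightarrow> (\<integral>\<^sup>+x. f (t - x) \<partial>lborel) = (\<integral>\<^sup>+x. f x \<partial>lborel)"
    and integrable_lborel_reflect: "g \<in> borel_measurable borel \<Longrightarrow>
      integrable lborel (\<lambda>x. g (t - x)) \<longleftrightarrow> integrable lborel g"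
    and integral_lborel_reflect: "g \<in> borel_measurable borel \<Longrightarrow> (LINT x|lborel. g (t - x)) = (LINT x|lborel. g x)"
  using nn_integral_lborel_affine[of "-1" f t] integrable_lborel_affine[of "-1" g t] integral_lborel_affine[of "-1" g t]
  by simp_all

text \<open>Lebesgue measure is the image of the product of one-dimensional Lebesgue measures under
  the coordinate map, so functions of product form integrate factor by factor. This reduces the
  Gaussian and the weight \<open>wt\<close> to the line.\<close>

lemma
  fixes f :: "'a::euclidean_space \<Rightarrow> real \<Rightarrow> complex"
  assumes f: "\<And>b. b \<in> Basis \<Longrightarrow> integrable lborel (f b)"
  shows integrable_lborel_Basis_prod: "integrable lborel (\<lambda>x. \<Prod>b\<in>Basis. f b (x \<bullet> b))"
    and integral_lborel_Basis_prod: "(LINT x|lborel. (\<Prod>b\<in>Basis. f b (x \<bullet> b))) = (\<Prod>b\<in>Basis. LINT x|lborel. f b x)"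
proof -
  interpret P: product_sigma_finite "\<lambda>b::'a. lborel :: real measure" ..
  have m[measurable]: "f b \<in> borel_measurable borel" if "b \<in> Basis" for b
    using borel_measurable_integrable[OF f[OF that]] by simp
  have T: "(\<lambda>g. \<Sum>b\<in>Basis. g b *\<^sub>R b) \<in> (\<Pi>\<^sub>M b\<in>Basis. lborel) \<rightarrow>\<^sub>M (borel :: 'a measure)" by measurable
  have M: "(\<lambda>x. \<Prod>b\<in>Basis. f b (x \<bullet> b)) \<in> borel_measurable (borel :: 'a measure)" by measurable
  have eq: "(\<Prod>b\<in>Basis. f b ((\<Sum>c\<in>Basis. g c *\<^sub>R c) \<bullet> b)) = (\<Prod>b\<in>Basis. f b (g b))" for g
    by (intro prod.cong refl) simp
  show "integrable lborel (\<lambda>x. \<Prod>b\<in>Basis. f b (x \<bullet> b))"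
    using P.product_integrable_prod[OF finite_Basis f]
    by (subst lborel_eq, subst integrable_distr_eq[OF T M]) (simp only: eq)
  show "(LINT x|lborel. (\<Prod>b\<in>Basis. f b (x \<bullet> b))) = (\<Prod>b\<in>Basis. LINT x|lborel. f b x)"
    using P.product_integral_prod[OF finite_Basis f]
    by (subst lborel_eq, subst integral_distr[OF T M]) (simp only: eq)
qed

subsection \<open>Gaussians\<close>

text \<open>The constant pi makes this function a probability density that is fixed by the Fourier
  transform with kernel \<open>ee\<close>.\<close>

definition gauss :: "'a::euclidean_space \<Rightarrow> real" where
  "gauss x = exp (- pi * (norm x)\<^sup>2)"

lemma gauss_nonneg: "gauss x \<ge> 0" by (simp add: gauss_def)
lemma gauss_0 [simp]: "gauss 0 = 1" by (simp add: gauss_def)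
lemma gauss_le_1: "gauss x \<le> 1" by (simp add: gauss_def)
lemma gauss_measurable [measurable]: "gauss \<in> borel_measurable borel"
  unfolding gauss_def[abs_def] by measurable

text \<open>With s = sqrt (2 pi) the substitution x = s y turns the characteristic function exp (-
  u^2 / 2) of the standard normal law, taken at u = s t, into the transform of exp (- pi
  y^2).\<close>

lemma
  fixes t :: real
  shows integrable_gauss_real: "integrable lborel (\<lambda>x. ee (x * t) * of_real (exp (- pi * x\<^sup>2)))"
    and integral_gauss_real: "(LINT x|lborel. ee (x * t) * of_real (exp (- pi * x\<^sup>2))) = of_real (exp (- pi * t\<^sup>2))"
proof -
  define s where "s = sqrt (2 * pi)"
  have s: "s > 0" "s * s = 2 * pi" by (simp_all add: s_def)
  have "(LINT x|std_normal_distribution. iexp (s * t * x)) = of_real (exp (- (s * t)\<^sup>2 / 2))"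
    using fun_cong[OF char_std_normal_distribution, of "s * t"] by (simp add: char_def)
  also have "(LINT x|std_normal_distribution. iexp (s * t * x)) = (LINT x|lborel. std_normal_density x *\<^sub>R iexp (s * t * x))"
    by (subst integral_density) (auto simp: normal_density_nonneg)
  also have "\<dots> = s *\<^sub>R (LINT x|lborel. std_normal_density (s * x) *\<^sub>R iexp (s * t * (s * x)))"
    using integral_lborel_affine[of s "\<lambda>x. std_normal_density x *\<^sub>R iexp (s * t * x)" 0] s by simp
  also have "\<dots> = (LINT x|lborel. s *\<^sub>R (std_normal_density (s * x) *\<^sub>R iexp (s * t * (s * x))))"
    by (rule integral_scaleR_right[symmetric])
  also have "(\<lambda>x. s *\<^sub>R (std_normal_density (s * x) *\<^sub>R iexp (s * t * (s * x)))) = (\<lambda>x. ee (x * t) * of_real (exp (- pi * x\<^sup>2)))"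
  proof
    fix x
    have "s * std_normal_density (s * x) = exp (- pi * x\<^sup>2)"
      using s by (simp add: std_normal_density_def s_def[symmetric] power_mult_distrib power2_eq_square)
    moreover have "iexp (s * t * (s * x)) = ee (x * t)"
    proof -
      have "s * t * (s * x) = 2 * pi * (x * t)" using s(2) by (simp add: algebra_simps)
      then show ?thesis by (simp only: ee_iexp)
    qed
    ultimately show "s *\<^sub>R (std_normal_density (s * x) *\<^sub>R iexp (s * t * (s * x))) = ee (x * t) * of_real (exp (- pi * x\<^sup>2))"
      by (simp only: scaleR_scaleR) (simp add: scaleR_conv_of_real)
  qed
  finally show "(LINT x|lborel. ee (x * t) * of_real (exp (- pi * x\<^sup>2))) = of_real (exp (- pi * t\<^sup>2))"
    using s by (simp add: power_mult_distrib power2_eq_square)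
  have "integrable lborel (\<lambda>x. of_real (exp (- pi * x\<^sup>2)) :: complex)"
  proof (rule ccontr)
    assume "\<not> ?thesis"
    moreover have "integrable lborel std_normal_density" using integrable_normal_density[of 1 0] by simp
    then have "integrable lborel (\<lambda>x. std_normal_density (0 + s *\<^sub>R x))"
      using integrable_lborel_affine[of s std_normal_density 0] s by simp
    then have "integrable lborel (\<lambda>x. of_real (s * std_normal_density (0 + s *\<^sub>R x)) :: complex)"
      by (intro integrable_of_real integrable_mult_right)
    moreover have "s * std_normal_density (0 + s *\<^sub>R x) = exp (- pi * x\<^sup>2)" for x
      using s by (simp add: std_normal_density_def s_def[symmetric] power_mult_distrib power2_eq_square)
    then have "(\<lambda>x. complex_of_real (s * std_normal_density (0 + s *\<^sub>R x))) = (\<lambda>x. of_real (exp (- pi * x\<^sup>2)))"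
      by (simp only: )
    ultimately show False by metis
  qed
  then show "integrable lborel (\<lambda>x. ee (x * t) * of_real (exp (- pi * x\<^sup>2)))"
    by (rule Bochner_Integration.integrable_bound) (auto simp: norm_mult)
qed

lemma ee_sum: "finite A \<Longrightarrow> ee (sum f A) = (\<Prod>x\<in>A. ee (f x))"
  by (induction A rule: finite_induct) (auto simp: ee_add)

lemma gauss_prod: "gauss x = (\<Prod>b\<in>Basis. exp (- pi * (x \<bullet> b)\<^sup>2))"
  unfolding gauss_def exp_sum[OF finite_Basis, symmetric]
  by (subst power2_norm_eq_inner, subst euclidean_inner) (simp add: sum_distrib_left power2_eq_square)

lemma ee_gauss_prod: "ee (x \<bullet> t) * of_real (gauss x) = (\<Prod>b\<in>Basis. ee ((x \<bullet> b) * (t \<bullet> b)) * of_real (exp (- pi * (x \<bullet> b)\<^sup>2)))"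
  by (subst euclidean_inner) (simp add: ee_sum gauss_prod prod.distrib)

lemma
  fixes t :: "'a::euclidean_space"
  shows integrable_ee_gauss: "integrable lborel (\<lambda>x. ee (x \<bullet> t) * of_real (gauss x))"
    and integral_ee_gauss: "(LINT x|lborel. ee (x \<bullet> t) * of_real (gauss x)) = of_real (gauss t)"
  unfolding ee_gauss_prod
  using integrable_lborel_Basis_prod[of "\<lambda>b x. ee (x * (t \<bullet> b)) * of_real (exp (- pi * x\<^sup>2))"]
    integral_lborel_Basis_prod[of "\<lambda>b x. ee (x * (t \<bullet> b)) * of_real (exp (- pi * x\<^sup>2))"]
    integrable_gauss_real integral_gauss_real
  by (simp_all add: gauss_prod)

lemma integrable_gauss: "integrable lborel (gauss :: 'a::euclidean_space \<Rightarrow> real)"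
  using integrable_Re[OF integrable_ee_gauss[of "0::'a"]] by simp

lemma integral_gauss: "(LINT x|lborel. gauss (x::'a::euclidean_space)) = 1"
proof -
  have "complex_of_real (LINT x|lborel. gauss (x::'a)) = 1"
    using integral_ee_gauss[of "0::'a"] by simp
  then show ?thesis using of_real_eq_1_iff by blast
qed

lemma nn_integral_gauss: "(\<integral>\<^sup>+x. ennreal (gauss (x::'a::euclidean_space)) \<partial>lborel) = 1"
  using nn_integral_eq_integral[OF integrable_gauss AE_I2[OF gauss_nonneg]] by (simp add: integral_gauss)

lemma
  fixes v :: "'a::euclidean_space"
  assumes e: "e > 0"
  shows integrable_ee_gauss_scale: "integrable lborel (\<lambda>x. ee (x \<bullet> v) * of_real (gauss (e *\<^sub>R x)))"
    and integral_ee_gauss_scale: "e ^ DIM('a) *\<^sub>R (LINT x|lborel. ee (x \<bullet> v) * of_real (gauss (e *\<^sub>R x))) = of_real (gauss (v /\<^sub>R e))"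
proof -
  define g where "g x = ee (x \<bullet> (v /\<^sub>R e)) * of_real (gauss x)" for x :: 'a
  have m: "g \<in> borel_measurable borel" unfolding g_def[abs_def] by measurable
  have eq: "g (0 + e *\<^sub>R x) = ee (x \<bullet> v) * of_real (gauss (e *\<^sub>R x))" for x
  proof -
    have "(e *\<^sub>R x) \<bullet> (v /\<^sub>R e) = x \<bullet> v" using e by simp
    then show ?thesis by (simp only: g_def add_0)
  qed
  have gi: "integrable lborel g" unfolding g_def[abs_def] by (rule integrable_ee_gauss)
  show "integrable lborel (\<lambda>x. ee (x \<bullet> v) * of_real (gauss (e *\<^sub>R x)))"
    using integrable_lborel_affine[of e g 0, OF _ m] e gi unfolding eq by simp
  show "e ^ DIM('a) *\<^sub>R (LINT x|lborel. ee (x \<bullet> v) * of_real (gauss (e *\<^sub>R x))) = of_real (gauss (v /\<^sub>R e))"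
    using integral_lborel_affine[of e g 0, OF _ m] e integral_ee_gauss[of "v /\<^sub>R e", folded g_def] unfolding eq by simp
qed

subsection \<open>The Fourier transform: inversion and the Bessel inequality\<close>

text \<open>The sign of the exponent is that of \<open>vee\<close>, which is thereby
  \<open>FT\<close> on every slice of constant r.\<close>

definition FT :: "('a::euclidean_space \<Rightarrow> complex) \<Rightarrow> 'a \<Rightarrow> complex" where
  "FT f t = (LINT x|lborel. ee (x \<bullet> t) * f x)"

lemma integrable_ee_mult:
  fixes f :: "'a::euclidean_space \<Rightarrow> complex" and g :: "'a \<Rightarrow> real"
  assumes "integrable lborel f" and [measurable]: "g \<in> borel_measurable borel"
  shows "integrable lborel (\<lambda>x. ee (g x) * f x)"
proof -
  have [measurable]: "f \<in> borel_measurable borel" using borel_measurable_integrable[OF assms(1)] by simp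
  show ?thesis by (rule Bochner_Integration.integrable_bound[OF assms(1)]) (auto simp: norm_mult)
qed

lemma FT_measurable [measurable]:
  assumes [measurable]: "f \<in> borel_measurable borel" shows "FT f \<in> borel_measurable borel"
  unfolding FT_def[abs_def] by (rule measurable_lborel_integral) measurable

lemma norm_FT_le:
  assumes "integrable lborel f" shows "cmod (FT f t) \<le> (LINT x|lborel. cmod (f x))"
proof -
  have "cmod (FT f t) \<le> (LINT x|lborel. cmod (ee (x \<bullet> t) * f x))"
    unfolding FT_def by (rule integral_norm_bound)
  then show ?thesis by (simp add: norm_mult)
qed

text \<open>A function that is not integrable has integral 0 by convention, so the bound holds in
  that case too.\<close>

lemma norm_integral_le_nn: "ennreal (norm (LINT x|M. f x)) \<le> (\<integral>\<^sup>+x. ennreal (norm (f x)) \<partial>M)"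
  for f :: "_ \<Rightarrow> 'c::{banach,second_countable_topology}"
  by (cases "integrable M f") (auto simp: integral_norm_bound_ennreal not_integrable_integral_eq)

text \<open>Without the Gaussian factor the double integral need not converge absolutely. With it
  Fubini applies, the t-integral is a Gaussian of width e centred at x, and the damped inversion
  integral becomes an average of f near x.\<close>

lemma LINT_gauss_kernel:
  fixes f :: "'a::euclidean_space \<Rightarrow> complex"
  assumes f: "integrable lborel f" and e: "e > 0"
  shows "(LINT t|lborel. of_real (gauss (e *\<^sub>R t)) * (ee (- (x \<bullet> t)) * FT f t)) = (LINT u|lborel. of_real (gauss u) * f (x + e *\<^sub>R u))"
proof -
  have [measurable]: "f \<in> borel_measurable borel" using borel_measurable_integrable[OF f] by simp
  have gi: "integrable lborel (\<lambda>t::'a. complex_of_real (gauss (e *\<^sub>R t)))"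
    using integrable_ee_gauss_scale[OF e, of "0::'a"] by simp
  have "integrable lborel (\<lambda>z::'a\<times>'a. ee ((snd z - x) \<bullet> fst z) * (of_real (gauss (e *\<^sub>R fst z)) * f (snd z)))"
    by (intro integrable_ee_mult integrable_lborel_prod gi f) measurable
  then have sw: "(LINT t|lborel. LINT p|lborel. ee ((p - x) \<bullet> t) * (of_real (gauss (e *\<^sub>R t)) * f p)) =
      (LINT p|lborel. LINT t|lborel. ee ((p - x) \<bullet> t) * (of_real (gauss (e *\<^sub>R t)) * f p))"
    by (rule integral_lborel_swap)
  have ph: "ee ((p - x) \<bullet> t) = ee (p \<bullet> t) * ee (- (x \<bullet> t))" for p t
    by (simp add: inner_diff_left flip: ee_add)
  have "(LINT t|lborel. of_real (gauss (e *\<^sub>R t)) * (ee (- (x \<bullet> t)) * FT f t)) =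
     (LINT t|lborel. LINT p|lborel. ee ((p - x) \<bullet> t) * (of_real (gauss (e *\<^sub>R t)) * f p))"
    unfolding FT_def integral_mult_right_zero[symmetric]
    by (intro Bochner_Integration.integral_cong refl) (simp add: ph mult_ac)
  also have "\<dots> = (LINT p|lborel. f p * (LINT t|lborel. ee (t \<bullet> (p - x)) * of_real (gauss (e *\<^sub>R t))))"
    unfolding sw integral_mult_right_zero[symmetric]
    by (intro Bochner_Integration.integral_cong refl) (simp add: inner_commute mult_ac)
  also have "\<dots> = e ^ DIM('a) *\<^sub>R (LINT u|lborel. f (x + e *\<^sub>R u) * (LINT t|lborel. ee (t \<bullet> (e *\<^sub>R u)) * of_real (gauss (e *\<^sub>R t))))"
    using e by (subst integral_lborel_affine[of e _ x]) (auto intro!: borel_measurable_times measurable_lborel_integral)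
  also have "\<dots> = (LINT u|lborel. f (x + e *\<^sub>R u) * (e ^ DIM('a) *\<^sub>R (LINT t|lborel. ee (t \<bullet> (e *\<^sub>R u)) * of_real (gauss (e *\<^sub>R t)))))"
    by simp
  also have "\<dots> = (LINT u|lborel. of_real (gauss u) * f (x + e *\<^sub>R u))"
    using e by (subst integral_ee_gauss_scale[OF e]) (simp add: mult.commute)
  finally show ?thesis .
qed

text \<open>Let e tend to 0 in \<open>LINT_gauss_kernel\<close>. The damped side is dominated by
  \<open>FT f\<close>; the averaged side is dominated by B times the Gaussian and converges by
  continuity of f.\<close>

theorem FT_inversion:
  fixes f :: "'a::euclidean_space \<Rightarrow> complex"
  assumes f: "integrable lborel f" "continuous_on UNIV f" "\<And>x. cmod (f x) \<le> B" and F: "integrable lborel (FT f)"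
  shows "(LINT t|lborel. ee (- (x \<bullet> t)) * FT f t) = f x"
proof -
  have [measurable]: "f \<in> borel_measurable borel" using borel_measurable_integrable[OF f(1)] by simp
  define e where "e n = inverse (real (Suc n))" for n
  have e: "e n > 0" "e \<longlonglongrightarrow> 0" for n unfolding e_def using LIMSEQ_inverse_real_of_nat by auto
  have l1: "(\<lambda>n. LINT t|lborel. of_real (gauss (e n *\<^sub>R t)) * (ee (- (x \<bullet> t)) * FT f t)) \<longlonglongrightarrow> (LINT t|lborel. ee (- (x \<bullet> t)) * FT f t)"
  proof (rule integral_dominated_convergence[where w="\<lambda>t. cmod (FT f t)"])
    show "AE t in lborel. (\<lambda>n. of_real (gauss (e n *\<^sub>R t)) * (ee (- (x \<bullet> t)) * FT f t)) \<longlonglongrightarrow> ee (- (x \<bullet> t)) * FT f t"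
    proof (intro always_eventually allI)
      fix t :: 'a
      have "(\<lambda>n. complex_of_real (gauss (e n *\<^sub>R t)) * (ee (- (x \<bullet> t)) * FT f t)) \<longlonglongrightarrow> of_real (exp (- pi * (norm (0 *\<^sub>R t))\<^sup>2)) * (ee (- (x \<bullet> t)) * FT f t)"
        unfolding gauss_def by (intro tendsto_intros e)
      then show "(\<lambda>n. of_real (gauss (e n *\<^sub>R t)) * (ee (- (x \<bullet> t)) * FT f t)) \<longlonglongrightarrow> ee (- (x \<bullet> t)) * FT f t" by simp
    qed
    show "AE t in lborel. cmod (of_real (gauss (e n *\<^sub>R t)) * (ee (- (x \<bullet> t)) * FT f t)) \<le> cmod (FT f t)" for n
      by (intro always_eventually allI) (simp add: norm_mult gauss_nonneg gauss_le_1 mult_left_le_one_le)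
  qed (use F in auto)
  have l2: "(\<lambda>n. LINT u|lborel. of_real (gauss u) * f (x + e n *\<^sub>R u)) \<longlonglongrightarrow> (LINT u::'a|lborel. of_real (gauss u) * f x)"
  proof (rule integral_dominated_convergence[where w="\<lambda>u::'a. gauss u * B"])
    show "AE u in lborel. (\<lambda>n. of_real (gauss u) * f (x + e n *\<^sub>R u)) \<longlonglongrightarrow> of_real (gauss u) * f x"
    proof (intro always_eventually allI)
      fix u :: 'a
      have "(\<lambda>n. x + e n *\<^sub>R u) \<longlonglongrightarrow> x + 0 *\<^sub>R u" by (intro tendsto_intros e)
      then have "(\<lambda>n. f (x + e n *\<^sub>R u)) \<longlonglongrightarrow> f x"
        using continuous_on_tendsto_compose[OF f(2), of "\<lambda>n. x + e n *\<^sub>R u" x sequentially] by simp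
      then show "(\<lambda>n. of_real (gauss u) * f (x + e n *\<^sub>R u)) \<longlonglongrightarrow> of_real (gauss u) * f x" by (intro tendsto_intros)
    qed
    show "AE u in lborel. cmod (of_real (gauss u) * f (x + e n *\<^sub>R u)) \<le> gauss u * B" for n
      using f(3) by (intro always_eventually allI) (simp add: norm_mult gauss_nonneg mult_left_mono)
    show "integrable lborel (\<lambda>u::'a. gauss u * B)" using integrable_gauss by (intro integrable_mult_left)
  qed auto
  have l3: "(LINT u::'a|lborel. of_real (gauss u) * f x) = f x"
    by (simp add: integral_gauss)
  show ?thesis using LIMSEQ_unique[OF l1[unfolded LINT_gauss_kernel[OF f(1) e(1)]] l2] l3 by simp
qed

text \<open>The Gaussian-damped square integral of \<open>FT f\<close> equals the pairing of f with
  a Gaussian average of f, hence is at most the square integral of f. Fatou removes the damping.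
  Values in \<open>ennreal\<close> allow the right-hand side to be infinite.\<close>

theorem FT_Bessel:
  fixes f :: "'a::euclidean_space \<Rightarrow> complex"
  assumes f: "integrable lborel f"
  shows "(\<integral>\<^sup>+t. ennreal ((cmod (FT f t))\<^sup>2) \<partial>lborel) \<le> (\<integral>\<^sup>+x. ennreal ((cmod (f x))\<^sup>2) \<partial>lborel)"
proof -
  have [measurable]: "f \<in> borel_measurable borel" using borel_measurable_integrable[OF f] by simp
  let ?I = "\<integral>\<^sup>+x. ennreal ((cmod (f x))\<^sup>2) \<partial>lborel"
  have bound: "(\<integral>\<^sup>+t. ennreal (gauss (e *\<^sub>R t) * (cmod (FT f t))\<^sup>2) \<partial>lborel) \<le> ?I" if e: "e > 0" for e
  proof -
    define h where "h x = cnj (f x)" for x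
    have gi: "integrable lborel (\<lambda>t::'a. complex_of_real (gauss (e *\<^sub>R t)))"
      using integrable_ee_gauss_scale[OF e, of "0::'a"] by simp
    have inner: "(LINT t|lborel. of_real (gauss (e *\<^sub>R t)) * (ee (- (x \<bullet> t)) * FT f t)) = (LINT u|lborel. of_real (gauss u) * f (x + e *\<^sub>R u))" for x
      by (rule LINT_gauss_kernel[OF f e])
    have FTb: "cmod (FT f t) \<le> (LINT x|lborel. cmod (f x))" for t by (rule norm_FT_le[OF f])
    have B0: "0 \<le> (LINT x|lborel. cmod (f x))" by simp
    have gb1: "cmod (of_real (gauss (e *\<^sub>R t)) * FT f t) \<le> cmod (of_real (LINT x|lborel. cmod (f x)) * complex_of_real (gauss (e *\<^sub>R t)))" for t
      using mult_left_mono[OF FTb[of t] gauss_nonneg[of "e *\<^sub>R t"]] B0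
      by (simp add: norm_mult gauss_nonneg mult.commute)
    have gb2: "cmod (complex_of_real (gauss (e *\<^sub>R t) * (cmod (FT f t))\<^sup>2)) \<le> cmod (of_real (LINT x|lborel. cmod (f x)) * (of_real (gauss (e *\<^sub>R t)) * FT f t))" for t
      using mult_right_mono[OF gb1[of t] norm_ge_zero[of "FT f t"]]
      by (simp add: norm_mult gauss_nonneg power2_eq_square mult.assoc)
    have gF: "integrable lborel (\<lambda>t. of_real (gauss (e *\<^sub>R t)) * FT f t)"
      by (rule Bochner_Integration.integrable_bound[OF integrable_mult_right[OF gi, of "of_real (LINT x|lborel. cmod (f x))"]])
        (auto intro!: AE_I2 gb1)
    have hi: "integrable lborel h" unfolding h_def using f by simp
    have "complex_of_real (gauss (e *\<^sub>R t) * (cmod (FT f t))\<^sup>2) = (LINT x|lborel. ee (- (x \<bullet> t)) * (h x * (of_real (gauss (e *\<^sub>R t)) * FT f t)))" for t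
    proof -
      have "cnj (FT f t) = (LINT x|lborel. ee (- (x \<bullet> t)) * h x)"
        unfolding FT_def h_def by (subst Bochner_Integration.integral_cnj[symmetric]) simp
      then show ?thesis
        by (simp only: of_real_mult complex_norm_square) (simp add: mult_ac flip: integral_mult_right_zero)
    qed
    then have "complex_of_real (LINT t|lborel. gauss (e *\<^sub>R t) * (cmod (FT f t))\<^sup>2) =
      (LINT t|lborel. LINT x|lborel. ee (- (x \<bullet> t)) * (h x * (of_real (gauss (e *\<^sub>R t)) * FT f t)))"
      by (simp add: flip: integral_complex_of_real)
    also have "\<dots> = (LINT x|lborel. LINT t|lborel. ee (- (x \<bullet> t)) * (h x * (of_real (gauss (e *\<^sub>R t)) * FT f t)))"
    proof (rule integral_lborel_swap)
      have "integrable lborel (\<lambda>z::'a\<times>'a. ee (- (snd z \<bullet> fst z)) * ((of_real (gauss (e *\<^sub>R fst z)) * FT f (fst z)) * h (snd z)))"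
        by (intro integrable_ee_mult integrable_lborel_prod gF hi) measurable
      then show "integrable lborel (\<lambda>z::'a\<times>'a. ee (- (snd z \<bullet> fst z)) * (h (snd z) * (of_real (gauss (e *\<^sub>R fst z)) * FT f (fst z))))"
        by (simp add: mult_ac)
    qed
    also have "\<dots> = (LINT x|lborel. h x * (LINT t|lborel. of_real (gauss (e *\<^sub>R t)) * (ee (- (x \<bullet> t)) * FT f t)))"
      by (simp add: mult_ac flip: integral_mult_right_zero)
    also have "\<dots> = (LINT x|lborel. h x * (LINT u|lborel. of_real (gauss u) * f (x + e *\<^sub>R u)))"
      unfolding inner ..
    finally have eq: "complex_of_real (LINT t|lborel. gauss (e *\<^sub>R t) * (cmod (FT f t))\<^sup>2) = \<dots>" .
    have "integrable lborel (\<lambda>t. complex_of_real (gauss (e *\<^sub>R t) * (cmod (FT f t))\<^sup>2))"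
    proof (rule Bochner_Integration.integrable_bound[OF integrable_mult_right[OF gF, of "of_real (LINT x|lborel. cmod (f x))"]])
      show "AE t in lborel. cmod (complex_of_real (gauss (e *\<^sub>R t) * (cmod (FT f t))\<^sup>2)) \<le> cmod (of_real (LINT x|lborel. cmod (f x)) * (of_real (gauss (e *\<^sub>R t)) * FT f t))"
        by (rule AE_I2) (rule gb2)
    qed measurable
    from integrable_Re[OF this] have int: "integrable lborel (\<lambda>t. gauss (e *\<^sub>R t) * (cmod (FT f t))\<^sup>2)"
      by (simp only: Re_complex_of_real)
    have "(\<integral>\<^sup>+t. ennreal (gauss (e *\<^sub>R t) * (cmod (FT f t))\<^sup>2) \<partial>lborel) = ennreal (LINT t|lborel. gauss (e *\<^sub>R t) * (cmod (FT f t))\<^sup>2)"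
      by (intro nn_integral_eq_integral int) (auto simp: gauss_nonneg)
    also have "\<dots> \<le> ennreal (cmod (complex_of_real (LINT t|lborel. gauss (e *\<^sub>R t) * (cmod (FT f t))\<^sup>2)))"
      by (intro ennreal_leI) simp
    also have "\<dots> \<le> (\<integral>\<^sup>+x. ennreal (cmod (h x * (LINT u|lborel. of_real (gauss u) * f (x + e *\<^sub>R u)))) \<partial>lborel)"
      unfolding eq by (rule norm_integral_le_nn)
    also have "\<dots> \<le> (\<integral>\<^sup>+x. \<integral>\<^sup>+u. ennreal (gauss u * (((cmod (f x))\<^sup>2 + (cmod (f (x + e *\<^sub>R u)))\<^sup>2) / 2)) \<partial>lborel \<partial>lborel)"
    proof (rule nn_integral_mono)
      fix x
      have "ennreal (cmod (h x * (LINT u|lborel. of_real (gauss u) * f (x + e *\<^sub>R u)))) =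
        ennreal (cmod (LINT u|lborel. h x * (of_real (gauss u) * f (x + e *\<^sub>R u))))" by simp
      also have "\<dots> \<le> (\<integral>\<^sup>+u. ennreal (cmod (h x * (of_real (gauss u) * f (x + e *\<^sub>R u)))) \<partial>lborel)"
        by (rule norm_integral_le_nn)
      also have "\<dots> \<le> (\<integral>\<^sup>+u. ennreal (gauss u * (((cmod (f x))\<^sup>2 + (cmod (f (x + e *\<^sub>R u)))\<^sup>2) / 2)) \<partial>lborel)"
      proof (intro nn_integral_mono ennreal_leI)
        fix u
        \<comment> \<open>The arithmetic-geometric mean inequality separates f from its translate;
          both squares have the same integral, and the Gaussian has mass 1.\<close>
        have "cmod (f x) * cmod (f (x + e *\<^sub>R u)) \<le> ((cmod (f x))\<^sup>2 + (cmod (f (x + e *\<^sub>R u)))\<^sup>2) / 2"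
          using sum_squares_bound[of "cmod (f x)" "cmod (f (x + e *\<^sub>R u))"] by simp
        then have "gauss u * (cmod (f x) * cmod (f (x + e *\<^sub>R u))) \<le> gauss u * (((cmod (f x))\<^sup>2 + (cmod (f (x + e *\<^sub>R u)))\<^sup>2) / 2)"
          by (rule mult_left_mono) (rule gauss_nonneg)
        then show "cmod (h x * (of_real (gauss u) * f (x + e *\<^sub>R u))) \<le> gauss u * (((cmod (f x))\<^sup>2 + (cmod (f (x + e *\<^sub>R u)))\<^sup>2) / 2)"
          by (simp add: norm_mult h_def gauss_nonneg mult_ac)
      qed
      finally show "ennreal (cmod (h x * (LINT u|lborel. of_real (gauss u) * f (x + e *\<^sub>R u)))) \<le> (\<integral>\<^sup>+u. ennreal (gauss u * (((cmod (f x))\<^sup>2 + (cmod (f (x + e *\<^sub>R u)))\<^sup>2) / 2)) \<partial>lborel)" .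
    qed
    also have "\<dots> = (\<integral>\<^sup>+u. \<integral>\<^sup>+x. ennreal (gauss u * (((cmod (f x))\<^sup>2 + (cmod (f (x + e *\<^sub>R u)))\<^sup>2) / 2)) \<partial>lborel \<partial>lborel)"
      using nn_integral_lborel_pair[of "\<lambda>z::'a\<times>'a. ennreal (gauss (snd z) * (((cmod (f (fst z)))\<^sup>2 + (cmod (f (fst z + e *\<^sub>R snd z)))\<^sup>2) / 2))"] by simp
    also have "\<dots> = (\<integral>\<^sup>+u. ennreal (gauss (u::'a)) * ?I \<partial>lborel)"
    proof (rule nn_integral_cong)
      fix u :: 'a
      have "(\<integral>\<^sup>+x. ennreal (gauss u * (((cmod (f x))\<^sup>2 + (cmod (f (x + e *\<^sub>R u)))\<^sup>2) / 2)) \<partial>lborel) =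
        (\<integral>\<^sup>+x. ennreal (gauss u / 2) * (ennreal ((cmod (f x))\<^sup>2) + ennreal ((cmod (f (x + e *\<^sub>R u)))\<^sup>2)) \<partial>lborel)"
        by (intro nn_integral_cong) (simp add: gauss_nonneg flip: ennreal_plus ennreal_mult)
      also have "\<dots> = ennreal (gauss u / 2) * (?I + ?I)"
        by (simp add: nn_integral_cmult nn_integral_add nn_integral_lborel_translate[where f="\<lambda>x. ennreal ((cmod (f x))\<^sup>2)"])
      also have "\<dots> = (ennreal (gauss u / 2) * 2) * ?I" by (simp add: mult_2[symmetric] mult_ac)
      also have "ennreal (gauss u / 2) * 2 = ennreal (gauss u)"
        by (metis ennreal_mult ennreal_numeral gauss_nonneg divide_nonneg_nonneg zero_le_numeral nonzero_eq_divide_eq zero_neq_numeral)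
      finally show "(\<integral>\<^sup>+x. ennreal (gauss u * (((cmod (f x))\<^sup>2 + (cmod (f (x + e *\<^sub>R u)))\<^sup>2) / 2)) \<partial>lborel) = ennreal (gauss u) * ?I" .
    qed
    also have "\<dots> = ?I" by (simp add: nn_integral_multc nn_integral_gauss)
    finally show ?thesis .
  qed
  define e where "e n = inverse (real (Suc n))" for n
  have e: "e n > 0" "e \<longlonglongrightarrow> 0" for n unfolding e_def using LIMSEQ_inverse_real_of_nat by auto
  have "(\<integral>\<^sup>+t. ennreal ((cmod (FT f t))\<^sup>2) \<partial>lborel) = (\<integral>\<^sup>+t. liminf (\<lambda>n. ennreal (gauss (e n *\<^sub>R t) * (cmod (FT f t))\<^sup>2)) \<partial>lborel)"
  proof (rule nn_integral_cong)
    fix t :: 'a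
    have "(\<lambda>n. ennreal (gauss (e n *\<^sub>R t) * (cmod (FT f t))\<^sup>2)) \<longlonglongrightarrow> ennreal (exp (- pi * (norm (0 *\<^sub>R t))\<^sup>2) * (cmod (FT f t))\<^sup>2)"
      unfolding gauss_def by (intro tendsto_ennrealI tendsto_intros e)
    then show "ennreal ((cmod (FT f t))\<^sup>2) = liminf (\<lambda>n. ennreal (gauss (e n *\<^sub>R t) * (cmod (FT f t))\<^sup>2))"
      by (intro lim_imp_Liminf[symmetric]) auto
  qed
  also have "\<dots> \<le> liminf (\<lambda>n. \<integral>\<^sup>+t. ennreal (gauss (e n *\<^sub>R t) * (cmod (FT f t))\<^sup>2) \<partial>lborel)"
    by (rule nn_integral_liminf) measurable
  also have "\<dots> \<le> limsup (\<lambda>n. \<integral>\<^sup>+t. ennreal (gauss (e n *\<^sub>R t) * (cmod (FT f t))\<^sup>2) \<partial>lborel)"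
    by (rule Liminf_le_Limsup) simp
  also have "\<dots> \<le> ?I" by (intro Limsup_bounded always_eventually allI bound e)
  finally show ?thesis .
qed

section \<open>Calculus of Schwartz functions\<close>

lemma dderiv_eq:
  assumes "(f has_derivative D) (at x)" shows "dderiv v f x = D v"
proof -
  interpret D: bounded_linear D using assms by (rule has_derivative_bounded_linear)
  have "((\<lambda>t::real. x + t *\<^sub>R v) has_derivative (\<lambda>t. t *\<^sub>R v)) (at 0)"
    by (auto intro!: derivative_eq_intros)
  then have "(f \<circ> (\<lambda>t::real. x + t *\<^sub>R v) has_derivative D \<circ> (\<lambda>t. t *\<^sub>R v)) (at 0)"
    using assms by (intro diff_chain_at) auto
  then have "((\<lambda>t::real. f (x + t *\<^sub>R v)) has_vector_derivative D v) (at 0)"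
    by (simp add: has_vector_derivative_def o_def D.scaleR)
  then show ?thesis unfolding dderiv_def by (rule vector_derivative_at)
qed

lemma has_derivative_dderiv:
  assumes "f differentiable (at x)" shows "(f has_derivative (\<lambda>v. dderiv v f x)) (at x)"
proof -
  obtain D where D: "(f has_derivative D) (at x)" using assms by (auto simp: differentiable_def)
  then have "(\<lambda>v. dderiv v f x) = D" using dderiv_eq by blast
  then show ?thesis using D by simp
qed

lemma dderiv_sum_Basis:
  assumes "f differentiable (at x)"
  shows "dderiv v f x = (\<Sum>b\<in>Basis. (v \<bullet> b) *\<^sub>R dderiv b f x)"
proof -
  interpret D: bounded_linear "\<lambda>v. dderiv v f x"
    using has_derivative_dderiv[OF assms] by (rule has_derivative_bounded_linear)
  show ?thesis by (subst (1) euclidean_representation[of v, symmetric]) (simp only: D.sum D.scaleR)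
qed

definition rapid :: "('a::real_normed_vector \<Rightarrow> complex) \<Rightarrow> bool" where
  "rapid f \<longleftrightarrow> (\<forall>k::nat. \<exists>C. \<forall>x. (1 + norm x) ^ k * cmod (f x) \<le> C)"

lemma rapidE:
  fixes f :: "'a::real_normed_vector \<Rightarrow> complex"
  assumes "rapid f" obtains C where "C \<ge> 0" "\<And>x. (1 + norm x) ^ k * cmod (f x) \<le> C"
proof -
  obtain C where C: "\<And>x. (1 + norm x) ^ k * cmod (f x) \<le> C" using assms unfolding rapid_def by blast
  have "0 \<le> (1 + norm (0::'a)) ^ k * cmod (f 0)" by simp
  also have "\<dots> \<le> C" by (rule C)
  finally show ?thesis using C that by blast
qed

lemma rapid_bounded_range: "rapid f \<longleftrightarrow> (\<forall>k::nat. bounded (range (\<lambda>x. (1 + norm x) ^ k *\<^sub>R f x)))"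
  unfolding rapid_def bounded_iff by (auto simp: abs_of_nonneg add_nonneg_nonneg)

lemma schwartz_alt: "schwartz f \<longleftrightarrow> (\<forall>vs. set vs \<subseteq> Basis \<longrightarrow> (\<forall>x. foldr dderiv vs f differentiable (at x)) \<and> rapid (foldr dderiv vs f))"
  unfolding schwartz_def rapid_bounded_range by blast

lemma schwartz_differentiable: "schwartz f \<Longrightarrow> f differentiable (at x)"
  unfolding schwartz_alt by (auto dest: spec[of _ "[]"])

lemma schwartz_rapid: "schwartz f \<Longrightarrow> rapid f"
  unfolding schwartz_alt by (auto dest: spec[of _ "[]"])

lemma schwartz_dderiv:
  assumes "schwartz f" "b \<in> Basis" shows "schwartz (dderiv b f)"
  unfolding schwartz_alt
proof (intro allI impI)
  fix vs :: "'a list" assume "set vs \<subseteq> Basis"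
  then have "set (vs @ [b]) \<subseteq> Basis" using assms by simp
  then show "(\<forall>x. foldr dderiv vs (dderiv b f) differentiable (at x)) \<and> rapid (foldr dderiv vs (dderiv b f))"
    using assms(1)[unfolded schwartz_alt, rule_format, of "vs @ [b]"] by simp
qed

text \<open>Iterated derivatives never have to be computed: it suffices to exhibit a set of
  differentiable rapid functions that contains f and is stable under derivatives along basis
  vectors.\<close>

lemma schwartz_coinduct:
  assumes "f \<in> X" "\<And>f x. f \<in> X \<Longrightarrow> f differentiable (at x)" "\<And>f. f \<in> X \<Longrightarrow> rapid f"
    "\<And>f b. f \<in> X \<Longrightarrow> b \<in> Basis \<Longrightarrow> dderiv b f \<in> X"
  shows "schwartz f"
proof -
  have "foldr dderiv vs f \<in> X" if "set vs \<subseteq> Basis" for vs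
    using that by (induction vs) (use assms in auto)
  then show ?thesis unfolding schwartz_alt using assms by blast
qed

text \<open>Nonempty finite sums. The derivative of a product, or of a twisted convolution, is a sum
  of expressions of the same kind; admitting sums in the coinduction set means that only the
  generating expressions have to be examined.\<close>

inductive_set fin_sums :: "('a \<Rightarrow> complex) set \<Rightarrow> ('a \<Rightarrow> complex) set" for S where
  base: "f \<in> S \<Longrightarrow> f \<in> fin_sums S"
| add: "f \<in> fin_sums S \<Longrightarrow> g \<in> fin_sums S \<Longrightarrow> (\<lambda>x. f x + g x) \<in> fin_sums S"

lemma fin_sums_sum: "finite A \<Longrightarrow> A \<noteq> {} \<Longrightarrow> (\<And>a. a \<in> A \<Longrightarrow> f a \<in> fin_sums S) \<Longrightarrow> (\<lambda>x. \<Sum>a\<in>A. f a x) \<in> fin_sums S"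
  by (induction A rule: finite_ne_induct) (auto intro: fin_sums.add)

lemma rapid_add:
  assumes "rapid f" "rapid g" shows "rapid (\<lambda>x. f x + g x)"
  unfolding rapid_def
proof
  fix k
  obtain C where C: "\<And>x. (1 + norm x) ^ k * cmod (f x) \<le> C" using assms(1)[unfolded rapid_def, rule_format, of k] by blast
  obtain D where D: "\<And>x. (1 + norm x) ^ k * cmod (g x) \<le> D" using assms(2)[unfolded rapid_def, rule_format, of k] by blast
  have "(1 + norm x) ^ k * cmod (f x + g x) \<le> C + D" for x
  proof -
    have "(1 + norm x) ^ k * cmod (f x + g x) \<le> (1 + norm x) ^ k * (cmod (f x) + cmod (g x))"
      by (intro mult_left_mono norm_triangle_ineq) auto
    then show ?thesis using C[of x] D[of x] by (simp add: distrib_left)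
  qed
  then show "\<exists>C. \<forall>x. (1 + norm x) ^ k * cmod (f x + g x) \<le> C" by blast
qed

lemma dderiv_add:
  assumes "f differentiable (at x)" "g differentiable (at x)"
  shows "dderiv v (\<lambda>x. f x + g x) x = dderiv v f x + dderiv v g x"
  by (rule dderiv_eq) (intro derivative_intros has_derivative_dderiv assms)

lemma dderiv_mult:
  assumes "f differentiable (at x)" "g differentiable (at x)"
  shows "dderiv v (\<lambda>x. f x * g x) x = dderiv v f x * g x + f x * dderiv v g x"
  by (rule dderiv_eq[THEN trans], rule has_derivative_mult)
    (use assms has_derivative_dderiv in \<open>auto simp: add.commute\<close>)

lemma dderiv_cmult:
  assumes "f differentiable (at x)"
  shows "dderiv v (\<lambda>x. c * f x) x = c * dderiv v f x"
  using dderiv_mult[of "\<lambda>_. c" x f v] assms dderiv_eq[of "\<lambda>_. c" "\<lambda>_. 0" x v] by simp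

lemma dderiv_cnj:
  assumes "f differentiable (at x)"
  shows "dderiv v (\<lambda>x. cnj (f x)) x = cnj (dderiv v f x)"
  by (rule dderiv_eq) (intro derivative_intros has_derivative_dderiv assms)

lemma schwartz_fin_sums_coinduct:
  assumes f: "f \<in> fin_sums S" and D: "\<And>f x. f \<in> S \<Longrightarrow> f differentiable (at x)" and R: "\<And>f. f \<in> S \<Longrightarrow> rapid f"
    and d: "\<And>f b. f \<in> S \<Longrightarrow> b \<in> Basis \<Longrightarrow> dderiv b f \<in> fin_sums S"
  shows "schwartz f"
proof (rule schwartz_coinduct[OF f])
  show D': "f differentiable (at x)" if "f \<in> fin_sums S" for f x
    using that by (induction) (auto intro: D differentiable_add)
  show "rapid f" if "f \<in> fin_sums S" for f
    using that by (induction) (auto intro: R rapid_add)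
  show "dderiv b f \<in> fin_sums S" if "f \<in> fin_sums S" "b \<in> Basis" for f b
    using that
  proof induction
    case (add f g)
    have "dderiv b (\<lambda>x. f x + g x) = (\<lambda>x. dderiv b f x + dderiv b g x)"
      using D' add by (intro ext dderiv_add) auto
    then show ?case using add by (auto intro: fin_sums.add)
  qed (use d in auto)
qed

lemma rapid_mult:
  assumes "rapid f" "rapid g" shows "rapid (\<lambda>x. f x * g x)"
  unfolding rapid_def
proof
  fix k
  obtain C where C: "C \<ge> 0" "\<And>x. (1 + norm x) ^ k * cmod (f x) \<le> C" using rapidE[OF assms(1)] by metis
  obtain D where D: "\<And>x. (1 + norm x) ^ 0 * cmod (g x) \<le> D" using rapidE[OF assms(2)] by metis
  have "(1 + norm x) ^ k * cmod (f x * g x) \<le> C * D" for x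
    using mult_mono[OF C(2)[of x] D[of x] C(1)] by (simp add: norm_mult mult_ac)
  then show "\<exists>C. \<forall>x. (1 + norm x) ^ k * cmod (f x * g x) \<le> C" by blast
qed

lemma schwartz_add:
  assumes "schwartz f" "schwartz g" shows "schwartz (\<lambda>x. f x + g x)"
proof (rule schwartz_fin_sums_coinduct)
  show "(\<lambda>x. f x + g x) \<in> fin_sums (Collect schwartz)"
    using assms by (intro fin_sums.add fin_sums.base) auto
qed (auto intro: fin_sums.base schwartz_differentiable schwartz_rapid schwartz_dderiv)

lemma schwartz_mult:
  assumes "schwartz f" "schwartz g" shows "schwartz (\<lambda>x. f x * g x)"
proof (rule schwartz_fin_sums_coinduct)
  let ?S = "{\<lambda>x. f x * g x | f g :: 'a \<Rightarrow> complex. schwartz f \<and> schwartz g}"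
  show "(\<lambda>x. f x * g x) \<in> fin_sums ?S" using assms by (auto intro: fin_sums.base)
  show "h differentiable (at x)" if "h \<in> ?S" for h x
    using that by clarify (rule differentiable_mult[OF schwartz_differentiable schwartz_differentiable])
  show "rapid h" if "h \<in> ?S" for h using that by clarify (rule rapid_mult[OF schwartz_rapid schwartz_rapid])
  fix h b assume "h \<in> ?S" and b: "(b::'a) \<in> Basis"
  then obtain f g where h: "h = (\<lambda>x. f x * g x)" "schwartz f" "schwartz g" by auto
  have "dderiv b h = (\<lambda>x. dderiv b f x * g x + f x * dderiv b g x)"
    unfolding h(1) using h by (intro ext dderiv_mult schwartz_differentiable)
  moreover have "(\<lambda>x. dderiv b f x * g x) \<in> ?S" "(\<lambda>x. f x * dderiv b g x) \<in> ?S"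
    using h b schwartz_dderiv by blast+
  ultimately show "dderiv b h \<in> fin_sums ?S" by (simp only:) (intro fin_sums.add fin_sums.base)
qed

lemma schwartz_cnj:
  assumes "schwartz f" shows "schwartz (\<lambda>x. cnj (f x))"
proof (rule schwartz_coinduct)
  let ?S = "{\<lambda>x. cnj (f x) | f :: 'a \<Rightarrow> complex. schwartz f}"
  show "(\<lambda>x. cnj (f x)) \<in> ?S" using assms by auto
  show "h differentiable (at x)" if "h \<in> ?S" for h x
    using that by clarify (rule differentiableI[OF has_derivative_cnj[OF has_derivative_dderiv[OF schwartz_differentiable]]])
  show "rapid h" if "h \<in> ?S" for h using that by clarify (drule schwartz_rapid, simp add: rapid_def)
  fix h b assume "h \<in> ?S" and b: "(b::'a) \<in> Basis"
  then obtain f where h: "h = (\<lambda>x. cnj (f x))" "schwartz f" by auto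
  have "dderiv b h = (\<lambda>x. cnj (dderiv b f x))"
    unfolding h(1) using h by (intro ext dderiv_cnj schwartz_differentiable)
  then show "dderiv b h \<in> ?S" using h b schwartz_dderiv by blast
qed

subsection \<open>The coordinates of the group\<close>

type_synonym 'n V = "(real ^ 'n) \<times> (real ^ 'n)"

text \<open>All operations act fibrewise over r, so a point is regrouped into its horizontal vector
  in \<open>'n V\<close>, the pair of the first two components, and the coordinate r.\<close>

definition emb :: "'n::finite V \<Rightarrow> real \<Rightarrow> 'n G" where
  "emb w r = (fst w, snd w, r)"

definition hpart :: "'n::finite G \<Rightarrow> 'n V" where
  "hpart z = (fst z, fst (snd z))"

definition rpart :: "'n::finite G \<Rightarrow> real" where
  "rpart z = snd (snd z)"

lemma hpart_emb [simp]: "hpart (emb w r) = w" and rpart_emb [simp]: "rpart (emb w r) = r" and emb_parts [simp]: "emb (hpart z) (rpart z) = z"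
  by (simp_all add: hpart_def rpart_def emb_def)

lemma hpart_triple [simp]: "hpart (p, q, r) = (p, q)" and rpart_triple [simp]: "rpart (p, q, r) = r"
  by (simp_all add: hpart_def rpart_def emb_def)

lemma linear_hpart: "bounded_linear hpart" and linear_rpart: "bounded_linear rpart"
  unfolding hpart_def[abs_def] rpart_def[abs_def]
  by (intro bounded_linear_Pair bounded_linear_fst bounded_linear_compose[OF bounded_linear_fst bounded_linear_snd] bounded_linear_compose[OF bounded_linear_snd bounded_linear_snd])+

lemma hpart_simps [simp]: "hpart (x + y) = hpart x + hpart y" "hpart (x - y) = hpart x - hpart y" "hpart (c *\<^sub>R x) = c *\<^sub>R hpart x" "hpart 0 = 0"
   "rpart (x + y) = rpart x + rpart y" "rpart (x - y) = rpart x - rpart y" "rpart (c *\<^sub>R x) = c * rpart x" "rpart 0 = 0"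
  by (simp_all add: hpart_def rpart_def zero_prod_def)

lemma norm_hpart_le: "norm (hpart z) \<le> norm z" and norm_rpart_le: "\<bar>rpart z\<bar> \<le> norm z" and norm_parts_le: "norm z \<le> norm (hpart z) + \<bar>rpart z\<bar>"
proof -
  obtain p q r where z: "z = (p, q, r)" by (cases z) auto
  have n: "norm z = sqrt ((norm (hpart z))\<^sup>2 + (rpart z)\<^sup>2)"
    by (simp add: z norm_Pair)
  show "norm (hpart z) \<le> norm z" "\<bar>rpart z\<bar> \<le> norm z" unfolding n by (auto intro!: real_le_rsqrt)
  show "norm z \<le> norm (hpart z) + \<bar>rpart z\<bar>" unfolding n using sqrt_sum_squares_le_sum_abs[of "norm (hpart z)" "rpart z"] by simp
qed

lemma norm_le_emb: "norm w \<le> norm (emb w r)" using norm_hpart_le[of "emb w r"] by simp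

lemma emb_measurable [measurable]:
  assumes [measurable]: "f \<in> M \<rightarrow>\<^sub>M borel" "g \<in> M \<rightarrow>\<^sub>M borel" shows "(\<lambda>x. emb (f x) (g x)) \<in> M \<rightarrow>\<^sub>M borel"
  unfolding emb_def by measurable

lemma hpart_measurable [measurable]: "hpart \<in> borel \<rightarrow>\<^sub>M borel" and rpart_measurable [measurable]: "rpart \<in> borel_measurable borel"
  unfolding hpart_def[abs_def] rpart_def[abs_def] by measurable

lemma continuous_on_emb [continuous_intros]:
  "continuous_on S f \<Longrightarrow> continuous_on S g \<Longrightarrow> continuous_on S (\<lambda>x. emb (f x) (g x))"
  unfolding emb_def by (intro continuous_intros)

lemma emb_Basis: "e \<in> Basis \<Longrightarrow> emb e 0 \<in> Basis" "emb 0 1 \<in> Basis"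
  by (force simp: emb_def Basis_prod_def zero_prod_def image_iff)+

lemma S3c_iff: "\<phi> \<in> S3c \<longleftrightarrow> schwartz \<phi> \<and> (\<exists>R. \<forall>z. \<bar>rpart z\<bar> > R \<longrightarrow> \<phi> z = 0)"
proof
  assume "\<phi> \<in> S3c"
  then obtain K where K: "schwartz \<phi>" "compact K" "\<And>p q r. r \<notin> K \<Longrightarrow> \<phi> (p, q, r) = 0" by (auto simp: S3c_def)
  obtain R where "\<And>r. r \<in> K \<Longrightarrow> \<bar>r\<bar> \<le> R" using compact_imp_bounded[OF K(2)] by (auto simp: bounded_iff)
  then have "\<forall>z. \<bar>rpart z\<bar> > R \<longrightarrow> \<phi> z = 0" using K(3) by (auto simp: rpart_def) (meson linorder_not_le)
  then show "schwartz \<phi> \<and> (\<exists>R. \<forall>z. \<bar>rpart z\<bar> > R \<longrightarrow> \<phi> z = 0)" using K by blast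
next
  assume "schwartz \<phi> \<and> (\<exists>R. \<forall>z. \<bar>rpart z\<bar> > R \<longrightarrow> \<phi> z = 0)"
  then obtain R where R: "schwartz \<phi>" "\<And>z. \<bar>rpart z\<bar> > R \<Longrightarrow> \<phi> z = 0" by blast
  show "\<phi> \<in> S3c" unfolding S3c_def using R by (auto intro!: exI[of _ "{-R..R}"] simp: abs_if split: if_splits)
qed

lemma S3cI: "schwartz f \<Longrightarrow> (\<And>z. \<bar>rpart z\<bar> > R \<Longrightarrow> f z = 0) \<Longrightarrow> f \<in> S3c"
  unfolding S3c_iff by blast

lemma S3cE:
  assumes "\<phi> \<in> S3c" obtains R where "R \<ge> 0" "\<And>z. \<bar>rpart z\<bar> > R \<Longrightarrow> \<phi> z = 0"
proof -
  obtain R where "\<And>z. \<bar>rpart z\<bar> > R \<Longrightarrow> \<phi> z = 0" using assms unfolding S3c_iff by blast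
  then show ?thesis using that[of "max R 0"] by auto
qed

lemma S3c_schwartz: "\<phi> \<in> S3c \<Longrightarrow> schwartz \<phi>" by (simp add: S3c_iff)
lemmas S3c_differentiable = schwartz_differentiable[OF S3c_schwartz]
lemmas S3c_rapid = schwartz_rapid[OF S3c_schwartz]
lemmas S3c_has_derivative = has_derivative_dderiv[OF S3c_differentiable]

lemma S3c_continuous_on: "\<phi> \<in> S3c \<Longrightarrow> continuous_on S \<phi>"
  by (intro continuous_at_imp_continuous_on ballI differentiable_imp_continuous_within S3c_differentiable)

lemma S3c_measurable: "\<phi> \<in> S3c \<Longrightarrow> \<phi> \<in> borel_measurable borel"
  by (intro borel_measurable_continuous_onI S3c_continuous_on)

lemma S3c_add: "f \<in> S3c \<Longrightarrow> g \<in> S3c \<Longrightarrow> (\<lambda>z. f z + g z) \<in> S3c"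
proof -
  assume *: "f \<in> S3c" "g \<in> S3c"
  obtain R R' where "\<And>z. \<bar>rpart z\<bar> > R \<Longrightarrow> f z = 0" "\<And>z. \<bar>rpart z\<bar> > R' \<Longrightarrow> g z = 0" using * S3cE by metis
  then show ?thesis using * schwartz_add by (auto simp: S3c_iff intro!: exI[of _ "max R R'"])
qed

lemma S3c_mult: "f \<in> S3c \<Longrightarrow> g \<in> S3c \<Longrightarrow> (\<lambda>z. f z * g z) \<in> S3c"
  using schwartz_mult unfolding S3c_iff by fastforce

lemma S3c_cnj: "f \<in> S3c \<Longrightarrow> (\<lambda>z. cnj (f z)) \<in> S3c"
  using schwartz_cnj unfolding S3c_iff by fastforce

lemma dderiv_rsupport:
  assumes "\<And>z. \<bar>rpart z\<bar> > R \<Longrightarrow> f z = 0" "\<bar>rpart z\<bar> > R"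
  shows "dderiv b f z = 0"
proof (rule dderiv_eq[where D="\<lambda>_. 0"])
  have o: "open {z. \<bar>rpart z\<bar> > R}"
    using linear_rpart by (intro open_Collect_less continuous_intros linear_continuous_on)
  show "(f has_derivative (\<lambda>_. 0)) (at z)"
    by (rule has_derivative_transform_within_open[OF has_derivative_const o]) (use assms in auto)
qed

lemma S3c_dderiv: "f \<in> S3c \<Longrightarrow> b \<in> Basis \<Longrightarrow> dderiv b f \<in> S3c"
proof -
  assume *: "f \<in> S3c" "b \<in> Basis"
  then obtain R where "\<And>z. \<bar>rpart z\<bar> > R \<Longrightarrow> f z = 0" unfolding S3c_iff by blast
  then have "\<And>z. \<bar>rpart z\<bar> > R \<Longrightarrow> dderiv b f z = 0" by (rule dderiv_rsupport)
  then show ?thesis using schwartz_dderiv[OF S3c_schwartz] * unfolding S3c_iff by blast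
qed

subsection \<open>Multipliers\<close>

text \<open>Multipliers of \<open>S3c\<close>: the algebra generated by the coordinates, the
  exponential contained in eta, and the phases occurring in the involution. It is closed under
  differentiation, and on each slab |r| <= R its members grow at most polynomially, because the
  exponential is bounded there.\<close>

inductive_set mods :: "real \<Rightarrow> ('n::finite G \<Rightarrow> complex) set" for lam where
  const: "(\<lambda>_. c) \<in> mods lam"
| coord: "(\<lambda>z. of_real (z \<bullet> a)) \<in> mods lam"
| expo: "(\<lambda>z. of_real (exp (2 * lam * rpart z))) \<in> mods lam"
| phase: "(\<lambda>z. ee (c * eta lam (rpart z) * (fst z \<bullet> fst (snd z)))) \<in> mods lam"
| add: "f \<in> mods lam \<Longrightarrow> g \<in> mods lam \<Longrightarrow> (\<lambda>z. f z + g z) \<in> mods lam"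
| mult: "f \<in> mods lam \<Longrightarrow> g \<in> mods lam \<Longrightarrow> (\<lambda>z. f z * g z) \<in> mods lam"

lemma mods_sum: "finite A \<Longrightarrow> (\<And>a. a \<in> A \<Longrightarrow> f a \<in> mods lam) \<Longrightarrow> (\<lambda>x. \<Sum>a\<in>A. f a x) \<in> mods lam"
  by (induction A rule: finite_induct) (auto intro: mods.intros)

lemma inner_emb: "z \<bullet> emb v r = hpart z \<bullet> v + rpart z * r"
  by (cases z) (simp add: emb_def inner_prod_def)

lemma mods_hpart_inner: "(\<lambda>z. of_real (hpart z \<bullet> v)) \<in> mods lam"
  using mods.coord[of "emb v 0"] by (simp add: inner_emb)

lemma mods_fst_inner: "(\<lambda>z. of_real (fst z \<bullet> v)) \<in> mods lam" and mods_snd_inner: "(\<lambda>z. of_real (fst (snd z) \<bullet> v)) \<in> mods lam"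
  using mods_hpart_inner[of "(v, 0)"] mods_hpart_inner[of "(0, v)"] by (simp_all add: hpart_def)

lemma mods_pq: "(\<lambda>z. of_real (fst z \<bullet> fst (snd z))) \<in> mods lam"
proof -
  have "(\<lambda>z::'a G. \<Sum>b\<in>Basis. complex_of_real (fst z \<bullet> b) * of_real (fst (snd z) \<bullet> b)) \<in> mods lam"
    by (intro mods_sum mods.mult mods_fst_inner mods_snd_inner) auto
  moreover have "(\<Sum>b\<in>Basis. complex_of_real (fst z \<bullet> b) * of_real (fst (snd z) \<bullet> b)) = of_real (fst z \<bullet> fst (snd z))" for z :: "'a G"
    by (subst euclidean_inner[of "fst z"]) simp
  ultimately show ?thesis by simp
qed

lemma mods_eta: "(\<lambda>z. of_real (eta lam (rpart z))) \<in> mods lam"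
proof -
  have "(\<lambda>z::'a G. complex_of_real (1 / (2 * lam)) * of_real (exp (2 * lam * rpart z)) + of_real (- (1 / (2 * lam)))) \<in> mods lam"
    by (intro mods.intros)
  moreover have "complex_of_real (1 / (2 * lam)) * of_real (exp (2 * lam * rpart z)) + of_real (- (1 / (2 * lam))) = of_real (eta lam (rpart z))" for z :: "'a G"
    by (simp add: eta_def diff_divide_distrib)
  ultimately show ?thesis by simp
qed

text \<open>The factor \<open>2 * lam / (2 * lam)\<close> covers \<open>lam = 0\<close>, where \<open>eta lam\<close> is \<open>0\<close> because \<open>x / 0 = 0\<close>.\<close>

lemma eta_has_derivative:
  "((\<lambda>z. eta lam (rpart z)) has_derivative (\<lambda>v. (2 * lam / (2 * lam)) * exp (2 * lam * rpart z) * rpart v)) (at z)"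
proof -
  have r: "(rpart has_derivative rpart) (at z)" by (rule bounded_linear_imp_has_derivative[OF linear_rpart])
  define c where "c = inverse (2 * lam)"
  have "((\<lambda>z. (exp (2 * lam * rpart z) - 1) * c) has_derivative (\<lambda>v. (2 * lam * c) * exp (2 * lam * rpart z) * rpart v)) (at z)"
    by (rule derivative_eq_intros r refl)+ (simp add: fun_eq_iff)
  moreover have "(exp (2 * lam * s) - 1) * c = eta lam s" "2 * lam * c = 2 * lam / (2 * lam)" for s
    by (simp_all only: eta_def c_def divide_inverse)
  ultimately show ?thesis by (simp only:)
qed

lemma ee_has_derivative:
  assumes "(f has_derivative D) (at z)"
  shows "((\<lambda>z. ee (f z)) has_derivative (\<lambda>v. 2 * of_real pi * \<i> * of_real (D v) * ee (f z))) (at z)"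
proof -
  have "(ee has_derivative (\<lambda>h. h *\<^sub>R (2 * of_real pi * \<i> * ee (f z)))) (at (f z))"
    using ee_has_vector_derivative[of "f z" UNIV] by (simp add: has_vector_derivative_def)
  from diff_chain_at[OF assms this] show ?thesis by (simp add: o_def scaleR_conv_of_real mult_ac)
qed

lemma mods_derivative:
  assumes "m \<in> mods lam"
  shows "\<exists>D. (\<forall>z. (m has_derivative D z) (at z)) \<and> (\<forall>v. (\<lambda>z. D z v) \<in> mods lam)"
  using assms
proof induction
  case (const c) then show ?case by (intro exI[of _ "\<lambda>_ _. 0"]) (auto intro: mods.intros)
next
  case (coord a)
  have "((\<lambda>z. complex_of_real (z \<bullet> a)) has_derivative (\<lambda>v. of_real (v \<bullet> a))) (at z)" for z :: "'a G"
    by (auto intro!: derivative_eq_intros)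
  then show ?case by (intro exI[of _ "\<lambda>z v. of_real (v \<bullet> a)"]) (auto intro: mods.intros)
next
  case expo
  have r: "(rpart has_derivative rpart) (at z)" for z :: "'a G" by (rule bounded_linear_imp_has_derivative[OF linear_rpart])
  have "((\<lambda>z. complex_of_real (exp (2 * lam * rpart z))) has_derivative (\<lambda>v. of_real (2 * lam * rpart v) * of_real (exp (2 * lam * rpart z)))) (at z)" for z :: "'a G"
    by (rule derivative_eq_intros r refl)+ (simp add: mult_ac)
  then show ?case by (intro exI[of _ "\<lambda>z v. of_real (2 * lam * rpart v) * of_real (exp (2 * lam * rpart z))"]) (auto intro!: mods.intros simp del: of_real_mult)
next
  case (phase c)
  \<comment> \<open>The derivative of the exponent of the phase, by the product rule for eta and the
    inner product. It is a polynomial in the generators, which keeps the derivative of the phase in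
    \<open>mods\<close>.\<close>
  let ?E = "\<lambda>z v::'a G. c * ((2 * lam / (2 * lam)) * exp (2 * lam * rpart z) * rpart v * (fst z \<bullet> fst (snd z)) + eta lam (rpart z) * (fst v \<bullet> fst (snd z) + fst (snd v) \<bullet> fst z))"
  have d: "((\<lambda>z. c * eta lam (rpart z) * (fst z \<bullet> fst (snd z))) has_derivative ?E z) (at z)" for z :: "'a G"
    by (rule derivative_eq_intros eta_has_derivative refl)+ (simp add: fun_eq_iff algebra_simps inner_commute)
  have "(\<lambda>z. complex_of_real (?E z v)) \<in> mods lam" for v
  proof -
    have "(\<lambda>z. of_real c * (of_real (2 * lam / (2 * lam)) * of_real (exp (2 * lam * rpart z)) * of_real (rpart v) * of_real (fst z \<bullet> fst (snd z)) + of_real (eta lam (rpart z)) * (of_real (fst (snd z) \<bullet> fst v) + of_real (fst z \<bullet> fst (snd v))))) \<in> mods lam"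
      by (intro mods.mult mods.add mods_eta mods_pq mods_fst_inner mods_snd_inner mods.expo mods.const)
    then show ?thesis by (simp add: inner_commute)
  qed
  then show ?case
    by (intro exI[of _ "\<lambda>z v. 2 * of_real pi * \<i> * of_real (?E z v) * ee (c * eta lam (rpart z) * (fst z \<bullet> fst (snd z)))"] conjI allI ee_has_derivative d mods.mult mods.const mods.phase)
next
  case (add f g)
  then obtain D E where "\<And>z. (f has_derivative D z) (at z)" "\<And>v. (\<lambda>z. D z v) \<in> mods lam" "\<And>z. (g has_derivative E z) (at z)" "\<And>v. (\<lambda>z. E z v) \<in> mods lam" by blast
  then show ?case by (intro exI[of _ "\<lambda>z v. D z v + E z v"]) (auto intro!: mods.intros derivative_intros)
next
  case (mult f g)
  then obtain D E where "\<And>z. (f has_derivative D z) (at z)" "\<And>v. (\<lambda>z. D z v) \<in> mods lam" "\<And>z. (g has_derivative E z) (at z)" "\<And>v. (\<lambda>z. E z v) \<in> mods lam" by blast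
  with mult show ?case by (intro exI[of _ "\<lambda>z v. f z * E z v + D z v * g z"]) (auto intro!: mods.intros has_derivative_mult)
qed

lemma mods_differentiable: "m \<in> mods lam \<Longrightarrow> m differentiable (at z)"
  using mods_derivative[of m lam] unfolding differentiable_def by blast

lemma mods_dderiv: assumes "m \<in> mods lam" shows "dderiv v m \<in> mods lam"
proof -
  obtain D where D: "\<And>z. (m has_derivative D z) (at z)" "\<And>v. (\<lambda>z. D z v) \<in> mods lam" using mods_derivative[OF assms] by blast
  have "dderiv v m = (\<lambda>z. D z v)" using D(1) dderiv_eq by blast
  then show ?thesis using D by simp
qed

lemma mods_growth:
  assumes "m \<in> mods lam"
  shows "\<exists>k C. \<forall>z. \<bar>rpart z\<bar> \<le> R \<longrightarrow> cmod (m z) \<le> C * (1 + norm z) ^ k"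
  using assms
proof induction
  case (const c) show ?case by (rule exI[of _ 0], rule exI[of _ "cmod c"]) simp
next
  case (coord a)
  have "cmod (of_real (z \<bullet> a)) \<le> norm a * (1 + norm z) ^ 1" for z
    using Cauchy_Schwarz_ineq2[of z a] by (simp add: algebra_simps add_increasing)
  then show ?case by blast
next
  case expo
  have "cmod (of_real (exp (2 * lam * rpart z))) \<le> exp (2 * \<bar>lam\<bar> * R) * (1 + norm z) ^ 0" if "\<bar>rpart z\<bar> \<le> R" for z :: "'a G"
  proof -
    have "2 * lam * rpart z \<le> 2 * \<bar>lam\<bar> * \<bar>rpart z\<bar>" by (metis abs_ge_self abs_mult abs_numeral)
    also have "\<dots> \<le> 2 * \<bar>lam\<bar> * R" using that by (intro mult_left_mono) auto
    finally show ?thesis by simp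
  qed
  then show ?case by blast
next
  case (phase c) show ?case by (rule exI[of _ 0], rule exI[of _ 1]) simp
next
  case (add f g)
  then obtain k C l D where *: "\<And>z. \<bar>rpart z\<bar> \<le> R \<Longrightarrow> cmod (f z) \<le> C * (1 + norm z) ^ k" "\<And>z. \<bar>rpart z\<bar> \<le> R \<Longrightarrow> cmod (g z) \<le> D * (1 + norm z) ^ l" by metis
  have "cmod (f z + g z) \<le> (\<bar>C\<bar> + \<bar>D\<bar>) * (1 + norm z) ^ (k + l)" if "\<bar>rpart z\<bar> \<le> R" for z
  proof -
    have "cmod (f z + g z) \<le> C * (1 + norm z) ^ k + D * (1 + norm z) ^ l" using *[OF that] norm_triangle_ineq[of "f z" "g z"] by linarith
    also have "\<dots> \<le> \<bar>C\<bar> * (1 + norm z) ^ (k + l) + \<bar>D\<bar> * (1 + norm z) ^ (k + l)"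
      by (intro add_mono mult_mono power_increasing) auto
    finally show ?thesis by (simp add: distrib_right)
  qed
  then show ?case by blast
next
  case (mult f g)
  then obtain k C l D where *: "\<And>z. \<bar>rpart z\<bar> \<le> R \<Longrightarrow> cmod (f z) \<le> C * (1 + norm z) ^ k" "\<And>z. \<bar>rpart z\<bar> \<le> R \<Longrightarrow> cmod (g z) \<le> D * (1 + norm z) ^ l" by metis
  have "cmod (f z * g z) \<le> (C * D) * (1 + norm z) ^ (k + l)" if "\<bar>rpart z\<bar> \<le> R" for z
    using mult_mono[OF *[OF that]] order_trans[OF norm_ge_zero *(1)[OF that]] by (simp add: norm_mult power_add mult_ac)
  then show ?case by blast
qed

lemma rapid_mods_mult:
  assumes m: "m \<in> mods lam" and f: "f \<in> S3c" shows "rapid (\<lambda>z. m z * f z)"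
  unfolding rapid_def
proof
  fix k
  obtain R where R: "\<And>z. \<bar>rpart z\<bar> > R \<Longrightarrow> f z = 0" using S3cE[OF f] by metis
  obtain l C where C: "\<And>z. \<bar>rpart z\<bar> \<le> R \<Longrightarrow> cmod (m z) \<le> C * (1 + norm z) ^ l" using mods_growth[OF m] by metis
  obtain D where D: "D \<ge> 0" "\<And>z. (1 + norm z) ^ (k + l) * cmod (f z) \<le> D" using rapidE[OF S3c_rapid[OF f]] by metis
  have "(1 + norm z) ^ k * cmod (m z * f z) \<le> \<bar>C\<bar> * D" for z
  proof (cases "\<bar>rpart z\<bar> \<le> R")
    case True
    have "(1 + norm z) ^ k * cmod (m z * f z) \<le> (1 + norm z) ^ k * ((\<bar>C\<bar> * (1 + norm z) ^ l) * cmod (f z))"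
      unfolding norm_mult by (intro mult_left_mono mult_right_mono order_trans[OF C[OF True]]) auto
    also have "\<dots> = \<bar>C\<bar> * ((1 + norm z) ^ (k + l) * cmod (f z))" by (simp add: power_add mult_ac)
    also have "\<dots> \<le> \<bar>C\<bar> * D" using D by (intro mult_left_mono) auto
    finally show ?thesis .
  qed (use R D in auto)
  then show "\<exists>C. \<forall>z. (1 + norm z) ^ k * cmod (m z * f z) \<le> C" by blast
qed

text \<open>By the product rule, sums of products m f with m in \<open>mods\<close> and f in
  \<open>S3c\<close> are closed under derivatives. Each product is rapid: f vanishes off a slab |r|
  <= R, and on the slab it decays faster than m grows.\<close>

lemma S3c_mods_mult:
  assumes m: "m \<in> mods lam" and f: "f \<in> S3c" shows "(\<lambda>z. m z * f z) \<in> S3c"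
proof -
  let ?S = "{\<lambda>z. m z * f z | m f :: 'a G \<Rightarrow> complex. m \<in> mods lam \<and> f \<in> S3c}"
  have "schwartz (\<lambda>z. m z * f z)"
  proof (rule schwartz_fin_sums_coinduct)
    show "(\<lambda>z. m z * f z) \<in> fin_sums ?S" using assms by (auto intro: fin_sums.base)
    show "h differentiable (at x)" if "h \<in> ?S" for h x
      using that by clarify (rule differentiable_mult[OF mods_differentiable S3c_differentiable])
    show "rapid h" if "h \<in> ?S" for h using that by clarify (rule rapid_mods_mult)
    fix h b assume "h \<in> ?S" and b: "(b::'a G) \<in> Basis"
    then obtain m f where h: "h = (\<lambda>x. m x * f x)" "m \<in> mods lam" "f \<in> S3c" by auto
    have "dderiv b h = (\<lambda>x. dderiv b m x * f x + m x * dderiv b f x)"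
      unfolding h(1) using h by (intro ext dderiv_mult S3c_differentiable mods_differentiable)
    moreover have "(\<lambda>x. dderiv b m x * f x) \<in> ?S" "(\<lambda>x. m x * dderiv b f x) \<in> ?S"
      using h b S3c_dderiv mods_dderiv by blast+
    ultimately show "dderiv b h \<in> fin_sums ?S" by (simp only:) (intro fin_sums.add fin_sums.base)
  qed
  moreover obtain R where "\<And>z. \<bar>rpart z\<bar> > R \<Longrightarrow> f z = 0" using S3cE[OF f] by metis
  ultimately show ?thesis by (intro S3cI[where R=R]) simp_all
qed

lemma S3c_cmult: "f \<in> S3c \<Longrightarrow> (\<lambda>z. c * f z) \<in> S3c"
  by (rule S3c_mods_mult[OF mods.const[where lam=1]])

lemma S3c_zero: "(\<lambda>z. 0) \<in> S3c"
proof (rule S3cI)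
  show "schwartz (\<lambda>z::'a G. 0)"
    by (rule schwartz_coinduct[of _ "{\<lambda>z. 0}"]) (auto simp: rapid_def intro!: dderiv_eq)
qed simp

lemma S3c_sum: "finite A \<Longrightarrow> (\<And>a. a \<in> A \<Longrightarrow> f a \<in> S3c) \<Longrightarrow> (\<lambda>x. \<Sum>a\<in>A. f a x) \<in> S3c"
  by (induction A rule: finite_induct) (simp_all add: S3c_zero S3c_add)

lemma S3c_uminus: "f \<in> S3c \<Longrightarrow> (\<lambda>z. - f z) \<in> S3c"
  using S3c_cmult[of f "-1"] by simp

lemma S3c_diff: "f \<in> S3c \<Longrightarrow> g \<in> S3c \<Longrightarrow> (\<lambda>z. f z - g z) \<in> S3c"
proof -
  assume f: "f \<in> S3c" and g: "g \<in> S3c"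
  have "(\<lambda>z. f z + (- g z)) \<in> S3c" by (rule S3c_add[OF f S3c_uminus[OF g]])
  then show "(\<lambda>z. f z - g z) \<in> S3c" by (simp only: diff_conv_add_uminus)
qed

lemma dderiv_emb_0:
  assumes "f \<in> S3c"
  shows "dderiv (emb v 0) f \<in> S3c"
proof -
  have "dderiv (emb v 0) f = (\<lambda>z. \<Sum>b\<in>Basis. of_real (emb v 0 \<bullet> b) * dderiv b f z)"
    by (intro ext) (simp only: dderiv_sum_Basis[OF S3c_differentiable[OF assms], of "emb v 0"] scaleR_conv_of_real)
  also have "\<dots> \<in> S3c" using assms by (intro S3c_sum S3c_cmult S3c_dderiv) auto
  finally show ?thesis .
qed

lemma S3c_hreflect:
  assumes f: "f \<in> S3c" shows "(\<lambda>z. f (emb (- hpart z) (rpart z))) \<in> S3c"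
proof -
  let ?T = "\<lambda>z::'a G. emb (- hpart z) (rpart z)"
  have T: "(?T has_derivative ?T) (at z)" for z
    unfolding emb_def using linear_hpart linear_rpart
    by (intro derivative_intros has_derivative_fst has_derivative_snd bounded_linear_imp_has_derivative) auto
  have nT: "norm (?T z) = norm z" for z by (cases z) (simp add: emb_def norm_Pair)
  let ?S = "{\<lambda>z. f (?T z) | f. f \<in> S3c}"
  have "schwartz (\<lambda>z. f (?T z))"
  proof (rule schwartz_coinduct)
    show "(\<lambda>z. f (?T z)) \<in> ?S" using f by blast
    have D: "((\<lambda>z. f (?T z)) has_derivative (\<lambda>v. dderiv (?T v) f (?T z))) (at z)" if "f \<in> S3c" for f z
      using diff_chain_at[OF T S3c_has_derivative[OF that]] by (simp add: o_def)
    show "h differentiable (at x)" if "h \<in> ?S" for h x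
      using that D unfolding differentiable_def by blast
    show "rapid h" if h: "h \<in> ?S" for h
    proof -
      obtain f where f: "h = (\<lambda>z. f (?T z))" "f \<in> S3c" using h by blast
      show ?thesis unfolding rapid_def
      proof
        fix k
        obtain C where C: "\<And>z. (1 + norm z) ^ k * cmod (f z) \<le> C" using rapidE[OF S3c_rapid[OF f(2)]] by metis
        have "(1 + norm z) ^ k * cmod (h z) \<le> C" for z using C[of "?T z"] unfolding nT f by simp
        then show "\<exists>C. \<forall>z. (1 + norm z) ^ k * cmod (h z) \<le> C" by blast
      qed
    qed
    fix h b assume "h \<in> ?S" and b: "(b::'a G) \<in> Basis"
    then obtain f where h: "h = (\<lambda>z. f (?T z))" "f \<in> S3c" by blast
    have "dderiv (?T b) f = (\<lambda>z. \<Sum>a\<in>Basis. of_real (?T b \<bullet> a) * dderiv a f z)"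
      by (intro ext) (simp only: dderiv_sum_Basis[OF S3c_differentiable[OF h(2)], of "?T b"] scaleR_conv_of_real)
    also have "\<dots> \<in> S3c" using h(2) by (intro S3c_sum S3c_cmult S3c_dderiv) auto
    finally have "dderiv (?T b) f \<in> S3c" .
    moreover have "dderiv b h = (\<lambda>z. dderiv (?T b) f (?T z))"
      unfolding h(1) using dderiv_eq[OF D[OF h(2)]] by (intro ext)
    ultimately show "dderiv b h \<in> ?S" by blast
  qed
  moreover obtain R where "\<And>z. \<bar>rpart z\<bar> > R \<Longrightarrow> f z = 0" using S3cE[OF f] by metis
  ultimately show ?thesis by (intro S3cI[where R=R]) simp_all
qed

subsection \<open>Integrals with parameters\<close>

text \<open>An integrable majorant of product form, so that its integrability reduces to that of 1 /
  (1 + t^2) on the line. Its reciprocal is at most (1 + |w|) to the power twice the dimension, so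
  rapid functions are dominated by multiples of it.\<close>

definition wt :: "'a::euclidean_space \<Rightarrow> real" where
  "wt w = (\<Prod>b\<in>Basis. inverse (1 + (w \<bullet> b)\<^sup>2))"

lemma wt_nonneg: "0 \<le> wt w" unfolding wt_def by (intro prod_nonneg) (simp add: add_nonneg_nonneg)

lemma wt_measurable [measurable]: "wt \<in> borel_measurable borel" unfolding wt_def[abs_def] by measurable

lemma integrable_wt: "integrable lborel (wt :: 'a::euclidean_space \<Rightarrow> real)"
proof -
  have "integrable lborel (\<lambda>x::real. inverse (1 + x\<^sup>2))"
    using integrable_inverse_1_plus_square by (simp add: set_integrable_def)
  then have "integrable lborel (\<lambda>x::real. complex_of_real (inverse (1 + x\<^sup>2)))" by (rule integrable_of_real)
  then have "integrable lborel (\<lambda>w::'a. \<Prod>b\<in>Basis. complex_of_real (inverse (1 + (w \<bullet> b)\<^sup>2)))"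
    by (intro integrable_lborel_Basis_prod)
  then have "integrable lborel (\<lambda>w::'a. complex_of_real (wt w))" by (simp add: wt_def)
  from integrable_Re[OF this] show ?thesis by simp
qed

lemma wt_ge: "1 \<le> (1 + norm w) ^ (2 * DIM('a)) * wt (w::'a::euclidean_space)"
proof -
  have "1 / (1 + norm w) ^ (2 * DIM('a)) = (\<Prod>b\<in>(Basis::'a set). inverse ((1 + norm w)\<^sup>2))"
    by (simp add: power_mult divide_inverse power_inverse)
  also have "\<dots> \<le> wt w"
    unfolding wt_def
  proof (intro prod_mono conjI)
    fix b :: 'a assume "b \<in> Basis"
    then have "(w \<bullet> b)\<^sup>2 \<le> (norm w)\<^sup>2" using Basis_le_norm[of b w] by (metis abs_ge_zero power2_abs power_mono)
    then have "1 + (w \<bullet> b)\<^sup>2 \<le> (1 + norm w)\<^sup>2" by (simp add: power2_sum add_increasing2)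
    then show "inverse ((1 + norm w)\<^sup>2) \<le> inverse (1 + (w \<bullet> b)\<^sup>2)" by (intro le_imp_inverse_le) (auto simp: add_pos_nonneg)
  qed auto
  finally show ?thesis by (simp add: divide_le_eq add_pos_nonneg mult.commute)
qed

text \<open>Decay is spent in two portions: twice the dimension many powers produce the integrable
  weight, and k further powers remain to absorb polynomial factors. The constant is uniform in
  r.\<close>

lemma S3c_wt:
  fixes f :: "'n::finite G \<Rightarrow> complex"
  assumes "f \<in> S3c"
  obtains C where "C \<ge> 0" "\<And>w r. (1 + norm (emb w r)) ^ k * cmod (f (emb w r)) \<le> C * wt w"
proof -
  let ?d = "2 * DIM('n V)"
  obtain C where C: "C \<ge> 0" "\<And>x. (1 + norm x) ^ (k + ?d) * cmod (f x) \<le> C" using rapidE[OF S3c_rapid[OF assms]] by metis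
  have "(1 + norm (emb w r)) ^ k * cmod (f (emb w r)) \<le> C * wt w" for w r
  proof -
    have "(1 + norm (emb w r)) ^ k * cmod (f (emb w r)) \<le> (1 + norm (emb w r)) ^ k * cmod (f (emb w r)) * ((1 + norm w) ^ ?d * wt w)"
      using mult_left_mono[OF wt_ge[of w], of "(1 + norm (emb w r)) ^ k * cmod (f (emb w r))"] by simp
    also have "\<dots> \<le> (1 + norm (emb w r)) ^ k * cmod (f (emb w r)) * ((1 + norm (emb w r)) ^ ?d * wt w)"
      by (intro mult_left_mono mult_right_mono power_mono add_left_mono norm_le_emb) (auto simp: wt_nonneg)
    also have "\<dots> = (1 + norm (emb w r)) ^ (k + ?d) * cmod (f (emb w r)) * wt w" by (simp add: power_add mult_ac)
    also have "\<dots> \<le> C * wt w" by (intro mult_right_mono C wt_nonneg)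
    finally show ?thesis .
  qed
  then show ?thesis using that C by blast
qed

lemma S3c_wt0:
  fixes f :: "'n::finite G \<Rightarrow> complex"
  assumes "f \<in> S3c"
  obtains C where "C \<ge> 0" "\<And>w r. cmod (f (emb w r)) \<le> C * wt w"
  using S3c_wt[OF assms, of 0] by auto

lemma S3c_slice_measurable: "f \<in> S3c \<Longrightarrow> (\<lambda>w. f (emb w r)) \<in> borel_measurable borel"
  using S3c_measurable[measurable] by measurable

lemma integrable_wtI:
  fixes h :: "'a::euclidean_space \<Rightarrow> complex"
  assumes "h \<in> borel_measurable borel" "\<And>w. cmod (h w) \<le> C * wt w" shows "integrable lborel h"
proof (rule Bochner_Integration.integrable_bound[of _ "\<lambda>w. C * wt w"])
  show "integrable lborel (\<lambda>w::'a. C * wt w)" by (intro integrable_mult_right integrable_wt)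
  show "AE w in lborel. cmod (h w) \<le> norm (C * wt w)" using assms(2) by (intro AE_I2) (simp add: order_trans[OF _ abs_ge_self])
qed (use assms in simp)

lemma S3c_slice_integrable: "f \<in> S3c \<Longrightarrow> integrable lborel (\<lambda>w. f (emb w r))"
  by (rule S3c_wt0, assumption, rule integrable_wtI) (auto intro: S3c_slice_measurable)

text \<open>The mean value inequality on the convex ball turns the bound on the derivative into a
  Lipschitz bound with constant g w. Difference quotients are then dominated by an integrable
  function, and dominated convergence applies along sequences.\<close>

lemma has_derivative_param_integral:
  fixes K :: "'w::euclidean_space \<Rightarrow> 'z::euclidean_space \<Rightarrow> complex"
  assumes int: "\<And>z. z \<in> ball z0 1 \<Longrightarrow> integrable lborel (\<lambda>w. K w z)"
    and D: "\<And>w z. z \<in> ball z0 1 \<Longrightarrow> (K w has_derivative D w z) (at z)"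
    and meas: "\<And>v. (\<lambda>w. D w z0 v) \<in> borel_measurable borel"
    and bd: "\<And>w z v. z \<in> ball z0 1 \<Longrightarrow> cmod (D w z v) \<le> g w * norm v" and g: "integrable lborel g"
  shows "((\<lambda>z. LINT w|lborel. K w z) has_derivative (\<lambda>v. LINT w|lborel. D w z0 v)) (at z0)"
proof -
  have z0: "z0 \<in> ball z0 1" by simp
  have bl: "bounded_linear (D w z)" if "z \<in> ball z0 1" for w z using D[OF that] by (rule has_derivative_bounded_linear)
  have Dint: "integrable lborel (\<lambda>w. D w z0 v)" for v
    by (rule Bochner_Integration.integrable_bound[OF integrable_mult_left[OF g, of "norm v"]])
      (use meas bd[OF z0] in \<open>auto intro!: AE_I2 order_trans[OF bd[OF z0] abs_ge_self]\<close>)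
  have lip: "cmod (K w y - K w z0) \<le> g w * norm (y - z0)" if "y \<in> ball z0 1" for w y
  proof (rule differentiable_bound[of "ball z0 1" "K w" "D w"])
    show "(K w has_derivative D w x) (at x within ball z0 1)" if "x \<in> ball z0 1" for x
      using D[OF that] by (rule has_derivative_at_withinI)
    \<comment> \<open>Inserting a basis vector into \<open>bd\<close> shows that g w is nonnegative,
      as the bound on the operator norm requires.\<close>
    show "onorm (D w x) \<le> g w" if "x \<in> ball z0 1" for x using bd[OF that] by (rule onorm_bound[rotated])
       (use bd[OF that, of w] order_trans[OF norm_ge_zero bd[OF that, of w "SOME b. b \<in> Basis"]] in \<open>auto simp: SOME_Basis\<close>)
  qed (use that in auto)
  let ?I = "\<lambda>z. LINT w|lborel. K w z" and ?D = "\<lambda>v. LINT w|lborel. D w z0 v"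
  have "((\<lambda>y. norm ((?I y - ?I z0) - ?D (y - z0)) / norm (y - z0)) \<longlongrightarrow> 0) (at z0 within ball z0 1)"
    unfolding tendsto_at_iff_sequentially
  proof (intro allI impI)
    fix X :: "nat \<Rightarrow> 'z" assume X: "\<forall>i. X i \<in> ball z0 1 - {z0}" "X \<longlonglongrightarrow> z0"
    \<comment> \<open>The normalised remainder is dominated by 2 g: one g from the Lipschitz bound,
      one from the bound on the derivative.\<close>
    let ?q = "\<lambda>i w. ((K w (X i) - K w z0) - D w z0 (X i - z0)) /\<^sub>R norm (X i - z0)"
    have q1: "(\<lambda>i. LINT w|lborel. ?q i w) \<longlonglongrightarrow> (LINT w::'w|lborel. 0)"
    proof (rule integral_dominated_convergence[where w="\<lambda>w. 2 * g w"])
      show "AE w in lborel. (\<lambda>i. ?q i w) \<longlonglongrightarrow> 0"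
      proof (rule AE_I2)
        fix w
        have "((\<lambda>y. norm ((K w y - K w z0) - D w z0 (y - z0)) / norm (y - z0)) \<longlongrightarrow> 0) (at z0)"
          using D[OF z0, of w] unfolding has_derivative_iff_norm by blast
        then have "((\<lambda>y. norm ((K w y - K w z0) - D w z0 (y - z0)) / norm (y - z0)) \<longlongrightarrow> 0) (at z0 within ball z0 1)"
          by (rule tendsto_within_subset) simp
        then have "(\<lambda>i. norm (?q i w)) \<longlonglongrightarrow> 0"
          using X unfolding tendsto_at_iff_sequentially by (auto simp: o_def divide_inverse mult.commute)
        then show "(\<lambda>i. ?q i w) \<longlonglongrightarrow> 0" by (rule tendsto_norm_zero_cancel)
      qed
      show "AE w in lborel. cmod (?q i w) \<le> 2 * g w" for i
      proof (rule AE_I2)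
        fix w
        have Xi: "X i \<in> ball z0 1" "norm (X i - z0) > 0" using X by auto
        have "cmod ((K w (X i) - K w z0) - D w z0 (X i - z0)) \<le> g w * norm (X i - z0) + g w * norm (X i - z0)"
          by (rule order_trans[OF norm_triangle_ineq4]) (intro add_mono lip Xi bd z0)
        also have "\<dots> = 2 * g w * norm (X i - z0)" by simp
        finally show "cmod (?q i w) \<le> 2 * g w" using Xi(2) by (simp add: divide_le_eq flip: divide_inverse_commute)
      qed
      have m: "(\<lambda>w. K w z) \<in> borel_measurable borel" if "z \<in> ball z0 1" for z
        using borel_measurable_integrable[OF int[OF that]] by simp
      show "?q i \<in> borel_measurable lborel" for i using m[of "X i"] m[of z0] meas X by (auto intro!: borel_measurable_scaleR borel_measurable_diff)
    qed (use g in auto)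
    have q2: "(LINT w|lborel. ?q i w) = ((?I (X i) - ?I z0) - ?D (X i - z0)) /\<^sub>R norm (X i - z0)" for i
    proof -
      have "X i \<in> ball z0 1" using X by auto
      then show ?thesis using int[of "X i"] int[OF z0] Dint by simp
    qed
    have "(\<lambda>i. ((?I (X i) - ?I z0) - ?D (X i - z0)) /\<^sub>R norm (X i - z0)) \<longlonglongrightarrow> 0" using q1 unfolding q2 by simp
    from tendsto_norm[OF this] show "((\<lambda>y. norm ((?I y - ?I z0) - ?D (y - z0)) / norm (y - z0)) \<circ> X) \<longlonglongrightarrow> 0"
      by (simp add: o_def divide_inverse mult.commute)
  qed
  then have lim: "((\<lambda>y. norm ((?I y - ?I z0) - ?D (y - z0)) / norm (y - z0)) \<longlongrightarrow> 0) (at z0)"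
    by (simp add: at_within_open[OF z0])
  have "bounded_linear ?D"
  proof (rule bounded_linear_intro[where K="LINT w|lborel. g w"])
    fix x y :: 'z and r :: real
    note b = bounded_linear.linear[OF bl[OF z0]]
    show "?D (x + y) = ?D x + ?D y" using Dint by (simp add: linear_add[OF b])
    show "?D (r *\<^sub>R x) = r *\<^sub>R ?D x" by (simp add: linear_scale[OF b])
    have "cmod (?D x) \<le> (LINT w|lborel. g w * norm x)"
      by (rule Bochner_Integration.integral_norm_bound_integral) (use Dint g bd[OF z0] in auto)
    also have "\<dots> = norm x * (LINT w|lborel. g w)" by simp
    finally show "cmod (?D x) \<le> norm x * (LINT w|lborel. g w)" .
  qed
  then show ?thesis using lim unfolding has_derivative_iff_norm by simp
qed

section \<open>The deformed operations in Fourier space\<close>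

subsection \<open>The partial Fourier transform\<close>

lemma vee_emb: "vee \<phi> (emb x r) = FT (\<lambda>w. \<phi> (emb w r)) x"
  unfolding vee_def FT_def emb_def
  by (auto simp: case_prod_beta' inner_prod_def intro!: Bochner_Integration.integral_cong)

lemma vee_eq: "vee \<phi> z = FT (\<lambda>w. \<phi> (emb w (rpart z))) (hpart z)"
  using vee_emb[of \<phi> "hpart z" "rpart z"] by simp

lemma dderiv_scaleR:
  assumes "f differentiable (at x)" shows "dderiv (c *\<^sub>R v) f x = c *\<^sub>R dderiv v f x"
proof -
  interpret D: bounded_linear "\<lambda>v. dderiv v f x"
    using has_derivative_dderiv[OF assms] by (rule has_derivative_bounded_linear)
  show ?thesis by (rule D.scaleR)
qed

lemma one_add_le_mult: "a \<le> b + c \<Longrightarrow> 0 \<le> b \<Longrightarrow> 0 \<le> c \<Longrightarrow> 1 + a \<le> (1 + b) * (1 + (c::real))"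
  by (rule order_trans[of _ "1 + (b + c)"]) (auto simp: algebra_simps)

lemma norm_fst_le2: "norm (fst x) \<le> norm x" and norm_snd_le2: "norm (snd x) \<le> norm x"
  by (cases x; simp add: norm_fst_le norm_snd_le)+

text \<open>The vector v may live in any Euclidean space, so the same decay serves for integrals
  over one horizontal component only and for integrals over all of the group.\<close>

lemma S3c_wt_gen:
  fixes f :: "'n::finite G \<Rightarrow> complex"
  assumes "f \<in> S3c"
  obtains C where "C \<ge> 0" "\<And>z (v::'b::euclidean_space). norm v \<le> norm z \<Longrightarrow> cmod (f z) \<le> C * wt v"
proof -
  let ?d = "2 * DIM('b)"
  obtain C where C: "C \<ge> 0" "\<And>x. (1 + norm x) ^ ?d * cmod (f x) \<le> C" using rapidE[OF S3c_rapid[OF assms]] by metis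
  have "cmod (f z) \<le> C * wt v" if "norm v \<le> norm z" for z and v :: 'b
  proof -
    have "cmod (f z) \<le> cmod (f z) * ((1 + norm v) ^ ?d * wt v)"
      using mult_left_mono[OF wt_ge[of v], of "cmod (f z)"] by simp
    also have "\<dots> \<le> cmod (f z) * ((1 + norm z) ^ ?d * wt v)"
      by (intro mult_left_mono mult_right_mono power_mono add_left_mono that) (auto simp: wt_nonneg)
    also have "\<dots> = (1 + norm z) ^ ?d * cmod (f z) * wt v" by (simp add: mult_ac)
    also have "\<dots> \<le> C * wt v" by (intro mult_right_mono C wt_nonneg)
    finally show ?thesis .
  qed
  then show ?thesis using that C by blast
qed

lemma S3c_bounded:
  assumes "f \<in> S3c" obtains C where "C \<ge> 0" "\<And>z. cmod (f z) \<le> C"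
  using rapidE[OF S3c_rapid[OF assms], of 0] by auto

lemma integrable_FT_integrand: "f \<in> S3c \<Longrightarrow> integrable lborel (\<lambda>w. ee (w \<bullet> x) * f (emb w r))"
  by (intro integrable_ee_mult S3c_slice_integrable) auto

lemma vee_add: "f \<in> S3c \<Longrightarrow> g \<in> S3c \<Longrightarrow> vee (\<lambda>z. f z + g z) z = vee f z + vee g z"
  by (simp add: vee_eq FT_def distrib_left integrable_FT_integrand)

lemma vee_cmult: "vee (\<lambda>z. c * f z) z = c * vee f z"
  by (simp add: vee_eq FT_def mult.left_commute)

lemma vee_diff: "f \<in> S3c \<Longrightarrow> g \<in> S3c \<Longrightarrow> vee (\<lambda>z. f z - g z) z = vee f z - vee g z"
  by (simp add: vee_eq FT_def right_diff_distrib integrable_FT_integrand)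

lemma vee_zero: "vee (\<lambda>z. 0) = (\<lambda>z. 0)"
  by (simp add: vee_eq FT_def fun_eq_iff)

lemma vee_sum: "finite A \<Longrightarrow> (\<And>a. a \<in> A \<Longrightarrow> f a \<in> S3c) \<Longrightarrow> vee (\<lambda>z. \<Sum>a\<in>A. f a z) z = (\<Sum>a\<in>A. vee (f a) z)"
  by (induction A rule: finite_induct) (simp_all add: vee_add S3c_sum vee_zero)

lemma vee_rmult: "vee (\<lambda>z. m (rpart z) * f z) z = m (rpart z) * vee f z"
  by (simp add: vee_eq FT_def mult.left_commute)

lemma norm_vee_le:
  assumes "f \<in> S3c" obtains C where "C \<ge> 0" "\<And>z. cmod (vee f z) \<le> C"
proof -
  obtain C where C: "C \<ge> 0" "\<And>w r. cmod (f (emb w r)) \<le> C * wt w" using S3c_wt0[OF assms] by metis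
  have "cmod (vee f z) \<le> (LINT w|lborel. C * wt (w::'a V))" for z
    unfolding vee_eq
    by (rule order_trans[OF norm_FT_le[OF S3c_slice_integrable[OF assms]]], rule integral_mono)
      (auto intro!: integrable_norm S3c_slice_integrable[OF assms] integrable_wt C)
  then show ?thesis using that[of "\<bar>LINT w|lborel. C * wt (w::'a V)\<bar>"] by (meson abs_ge_self abs_ge_zero order_trans)
qed

lemma has_derivative_emb_rpart:
  fixes f :: "'n::finite G \<Rightarrow> complex"
  assumes f: "f \<in> S3c"
  shows "((\<lambda>z::'n G. f (emb w (rpart z))) has_derivative (\<lambda>u. rpart u *\<^sub>R dderiv (emb 0 1) f (emb w (rpart z)))) (at z)"
proof -
  have "((\<lambda>z::'n G. emb w (rpart z) :: 'n G) has_derivative (\<lambda>u. emb 0 (rpart u))) (at z)"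
    unfolding emb_def by (auto intro!: derivative_eq_intros bounded_linear_imp_has_derivative linear_rpart simp: zero_prod_def)
  from diff_chain_at[OF this S3c_has_derivative[OF f]]
  have h: "((\<lambda>z::'n G. f (emb w (rpart z))) has_derivative (\<lambda>u. dderiv (emb 0 (rpart u)) f (emb w (rpart z)))) (at z)"
    by (simp add: o_def)
  have "dderiv (emb 0 (rpart u)) f x = rpart u *\<^sub>R dderiv (emb 0 1) f x" for u :: "'n G" and x
  proof -
    have "emb 0 (rpart u) = rpart u *\<^sub>R (emb 0 1 :: 'n G)" by (simp add: emb_def)
    then show ?thesis using dderiv_scaleR[OF S3c_differentiable[OF f], of "rpart u" "emb 0 1" x] by simp
  qed
  then show ?thesis by (intro has_derivative_eq_rhs[OF h] ext)
qed

lemma has_derivative_hpart_inner: "((\<lambda>z. w \<bullet> hpart z) has_derivative (\<lambda>u. w \<bullet> hpart u)) (at z)"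
  by (intro bounded_linear_imp_has_derivative bounded_linear_compose[OF bounded_linear_inner_right linear_hpart])

lemma S3c_hpart_mult: "f \<in> S3c \<Longrightarrow> (\<lambda>z. of_real (hpart z \<bullet> v) * f z) \<in> S3c"
  by (rule S3c_mods_mult[OF mods_hpart_inner[where lam=1]])

lemma vee_derivative_S3c:
  "f \<in> S3c \<Longrightarrow> (\<lambda>z. 2 * of_real pi * \<i> * (of_real (hpart z \<bullet> v) * f z) + of_real s * dderiv (emb 0 1) f z) \<in> S3c"
  by (intro S3c_add S3c_cmult S3c_hpart_mult S3c_dderiv emb_Basis)

text \<open>A horizontal derivative of the transform brings down a factor 2 pi i times a coordinate,
  and the derivative in r falls on f. Either way the result is \<open>vee\<close> of a member of
  \<open>S3c\<close>, so the image of \<open>S3c\<close> is closed under derivatives.\<close>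

lemma has_derivative_vee:
  assumes f: "f \<in> S3c"
  shows "(vee f has_derivative (\<lambda>u. vee (\<lambda>z. 2 * of_real pi * \<i> * (of_real (hpart z \<bullet> hpart u) * f z) + of_real (rpart u) * dderiv (emb 0 1) f z) z0)) (at z0)"
proof -
  let ?f' = "dderiv (emb 0 1) f"
  have f': "?f' \<in> S3c" using f by (intro S3c_dderiv emb_Basis)
  define D where "D w z u = ee (w \<bullet> hpart z) * (2 * of_real pi * \<i> * (of_real (w \<bullet> hpart u) * f (emb w (rpart z))) + of_real (rpart u) * ?f' (emb w (rpart z)))" for w z u
  obtain C1 where C1: "C1 \<ge> 0" "\<And>w r. (1 + norm (emb w r)) ^ 1 * cmod (f (emb w r)) \<le> C1 * wt w" using S3c_wt[OF f] by metis
  obtain C2 where C2: "C2 \<ge> 0" "\<And>w r. cmod (?f' (emb w r)) \<le> C2 * wt w" using S3c_wt0[OF f'] by metis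
  have "((\<lambda>z. LINT w|lborel. ee (w \<bullet> hpart z) * f (emb w (rpart z))) has_derivative (\<lambda>u. LINT w|lborel. D w z0 u)) (at z0)"
  proof (rule has_derivative_param_integral[where g="\<lambda>w. (2 * pi * C1 + C2) * wt w"])
    show "integrable lborel (\<lambda>w. ee (w \<bullet> hpart z) * f (emb w (rpart z)))" for z
      by (rule integrable_FT_integrand[OF f])
    show "((\<lambda>z. ee (w \<bullet> hpart z) * f (emb w (rpart z))) has_derivative D w z) (at z)" for w z
      by (rule has_derivative_eq_rhs[OF has_derivative_mult[OF ee_has_derivative[OF has_derivative_hpart_inner] has_derivative_emb_rpart[OF f]]])
        (simp add: D_def fun_eq_iff algebra_simps scaleR_conv_of_real)
    show "(\<lambda>w. D w z0 v) \<in> borel_measurable borel" for v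
      unfolding D_def using S3c_slice_measurable[OF f, measurable] S3c_slice_measurable[OF f', measurable] by measurable
    show "cmod (D w z u) \<le> (2 * pi * C1 + C2) * wt w * norm u" for w z u
    proof -
      have "cmod (D w z u) \<le> 2 * pi * (\<bar>w \<bullet> hpart u\<bar> * cmod (f (emb w (rpart z)))) + \<bar>rpart u\<bar> * cmod (?f' (emb w (rpart z)))"
        unfolding D_def norm_mult norm_ee mult_1 by (rule order_trans[OF norm_triangle_ineq]) (simp add: norm_mult)
      also have "\<dots> \<le> 2 * pi * (norm u * (C1 * wt w)) + norm u * (C2 * wt w)"
      proof (intro add_mono mult_left_mono)
        have "\<bar>w \<bullet> hpart u\<bar> * cmod (f (emb w (rpart z))) \<le> (norm w * norm u) * cmod (f (emb w (rpart z)))"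
          by (intro mult_right_mono order_trans[OF Cauchy_Schwarz_ineq2] mult_left_mono norm_hpart_le) auto
        also have "\<dots> = norm u * (norm w * cmod (f (emb w (rpart z))))" by simp
        also have "\<dots> \<le> norm u * (C1 * wt w)"
        proof (intro mult_left_mono)
          have "norm w * cmod (f (emb w (rpart z))) \<le> (1 + norm (emb w (rpart z))) ^ 1 * cmod (f (emb w (rpart z)))"
            using norm_le_emb[of w "rpart z"] by (intro mult_right_mono) auto
          then show "norm w * cmod (f (emb w (rpart z))) \<le> C1 * wt w" using C1(2)[of w "rpart z"] by linarith
        qed auto
        finally show "\<bar>w \<bullet> hpart u\<bar> * cmod (f (emb w (rpart z))) \<le> norm u * (C1 * wt w)" .
        show "\<bar>rpart u\<bar> * cmod (?f' (emb w (rpart z))) \<le> norm u * (C2 * wt w)"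
          by (intro mult_mono norm_rpart_le C2) auto
      qed auto
      finally show ?thesis by (simp add: algebra_simps)
    qed
    show "integrable lborel (\<lambda>w::'a V. (2 * pi * C1 + C2) * wt w)" by (intro integrable_mult_right integrable_wt)
  qed
  then show ?thesis unfolding vee_eq[abs_def] FT_def D_def by simp
qed

text \<open>In place of integration by parts: the integral of the transform integrand translated by
  t v does not depend on t. Differentiating under the integral sign at t = 0 gives a vanishing sum
  of two terms, one from the exponential and one from f.\<close>

lemma vee_hderiv:
  assumes f: "f \<in> S3c"
  shows "vee (dderiv (emb v 0) f) z = - (2 * of_real pi * \<i> * of_real (hpart z \<bullet> v)) * vee f z"
proof -
  let ?f' = "dderiv (emb v 0) f" and ?x = "hpart z" and ?r = "rpart z"
  have f': "?f' \<in> S3c" using f by (intro dderiv_emb_0)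
  let ?d = "2 * DIM('a V)"
  define K where "K w t = ee ((w + t *\<^sub>R v) \<bullet> ?x) * f (emb (w + t *\<^sub>R v) ?r)" for w t
  define H where "H w = ee (w \<bullet> ?x) * (2 * of_real pi * \<i> * (of_real (v \<bullet> ?x) * f (emb w ?r)) + ?f' (emb w ?r))" for w
  define D where "D w t (s::real) = of_real s * H (w + t *\<^sub>R v)" for w t s
  have Hm: "H \<in> borel_measurable borel"
    unfolding H_def using S3c_slice_measurable[OF f, measurable] S3c_slice_measurable[OF f', measurable] by measurable
  obtain C1 where C1: "C1 \<ge> 0" "\<And>z. (1 + norm z) ^ ?d * cmod (f z) \<le> C1" using rapidE[OF S3c_rapid[OF f]] by metis
  obtain C2 where C2: "C2 \<ge> 0" "\<And>z. (1 + norm z) ^ ?d * cmod (?f' z) \<le> C2" using rapidE[OF S3c_rapid[OF f']] by metis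
  define B where "B = 2 * pi * (\<bar>v \<bullet> ?x\<bar> * C1) + C2"
  have Hb: "(1 + norm w) ^ ?d * cmod (H w) \<le> B" for w
  proof -
    have "cmod (H w) \<le> 2 * pi * (\<bar>v \<bullet> ?x\<bar> * cmod (f (emb w ?r))) + cmod (?f' (emb w ?r))"
      unfolding H_def norm_mult norm_ee mult_1 by (rule order_trans[OF norm_triangle_ineq]) (simp add: norm_mult)
    then have "(1 + norm w) ^ ?d * cmod (H w) \<le> (1 + norm (emb w ?r)) ^ ?d * (2 * pi * (\<bar>v \<bullet> ?x\<bar> * cmod (f (emb w ?r))) + cmod (?f' (emb w ?r)))"
      by (intro mult_mono power_mono add_left_mono norm_le_emb) auto
    also have "\<dots> = 2 * pi * (\<bar>v \<bullet> ?x\<bar> * ((1 + norm (emb w ?r)) ^ ?d * cmod (f (emb w ?r)))) + (1 + norm (emb w ?r)) ^ ?d * cmod (?f' (emb w ?r))"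
      by (simp add: algebra_simps)
    also have "\<dots> \<le> B" unfolding B_def by (intro add_mono mult_left_mono C1 C2) auto
    finally show ?thesis .
  qed
  have B0: "B \<ge> 0" unfolding B_def using C1 C2 by simp
  have "((\<lambda>t. LINT w|lborel. K w t) has_derivative (\<lambda>s. LINT w|lborel. D w 0 s)) (at 0)"
  proof (rule has_derivative_param_integral[where g="\<lambda>w. ((1 + norm v) ^ ?d * B) * wt w"])
    show "integrable lborel (\<lambda>w. K w t)" for t
      unfolding K_def using integrable_FT_integrand[OF f, of ?x ?r] borel_measurable_integrable[OF integrable_FT_integrand[OF f, of ?x ?r]]
      by (subst integrable_lborel_translate[where g="\<lambda>w. ee (w \<bullet> ?x) * f (emb w ?r)"]) auto
    show "(K w has_derivative D w t) (at t)" for w t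
    proof -
      have "((\<lambda>t. emb (w + t *\<^sub>R v) ?r) has_derivative (\<lambda>s. s *\<^sub>R emb v 0)) (at t)"
        unfolding emb_def by (auto intro!: derivative_eq_intros)
      from diff_chain_at[OF this S3c_has_derivative[OF f]]
      have 1: "((\<lambda>t. f (emb (w + t *\<^sub>R v) ?r)) has_derivative (\<lambda>s. s *\<^sub>R ?f' (emb (w + t *\<^sub>R v) ?r))) (at t)"
        by (simp add: o_def dderiv_scaleR[OF S3c_differentiable[OF f]])
      have 2: "((\<lambda>t. (w + t *\<^sub>R v) \<bullet> ?x) has_derivative (\<lambda>s. s * (v \<bullet> ?x))) (at t)"
        by (auto intro!: derivative_eq_intros)
      show ?thesis unfolding K_def
        by (rule has_derivative_eq_rhs[OF has_derivative_mult[OF ee_has_derivative[OF 2] 1]])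
          (simp add: D_def H_def fun_eq_iff algebra_simps scaleR_conv_of_real)
    qed
    show "(\<lambda>w. D w 0 s) \<in> borel_measurable borel" for s unfolding D_def using Hm by simp
    show "cmod (D w t s) \<le> (1 + norm v) ^ ?d * B * wt w * norm s" if "t \<in> ball 0 1" for w t s
    proof -
      \<comment> \<open>For |t| < 1 the translation by t v changes norms by at most |v|, so a weight
        centred at w dominates all translates at the cost of a power of 1 + |v|.\<close>
      have nw: "norm w \<le> norm (w + t *\<^sub>R v) + norm v"
      proof -
        have "norm w \<le> norm (w + t *\<^sub>R v) + norm (t *\<^sub>R v)" using norm_triangle_ineq4[of "w + t *\<^sub>R v" "t *\<^sub>R v"] by simp
        moreover have "norm (t *\<^sub>R v) \<le> norm v" using that by (simp add: mult_left_le_one_le)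
        ultimately show ?thesis by linarith
      qed
      have n2: "1 + norm w \<le> (1 + norm v) * (1 + norm (w + t *\<^sub>R v))"
        by (rule one_add_le_mult) (use nw in \<open>auto simp: add.commute\<close>)
      have "cmod (H (w + t *\<^sub>R v)) \<le> cmod (H (w + t *\<^sub>R v)) * ((1 + norm w) ^ ?d * wt w)"
        using mult_left_mono[OF wt_ge[of w], of "cmod (H (w + t *\<^sub>R v))"] by simp
      also have "\<dots> \<le> cmod (H (w + t *\<^sub>R v)) * (((1 + norm v) * (1 + norm (w + t *\<^sub>R v))) ^ ?d * wt w)"
        by (intro mult_left_mono mult_right_mono power_mono n2) (auto simp: wt_nonneg)
      also have "\<dots> = (1 + norm v) ^ ?d * ((1 + norm (w + t *\<^sub>R v)) ^ ?d * cmod (H (w + t *\<^sub>R v))) * wt w"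
        by (simp add: power_mult_distrib mult_ac)
      also have "\<dots> \<le> (1 + norm v) ^ ?d * B * wt w"
        by (intro mult_right_mono mult_left_mono Hb) (auto simp: wt_nonneg)
      finally have "cmod (H (w + t *\<^sub>R v)) * norm s \<le> (1 + norm v) ^ ?d * B * wt w * norm s" by (rule mult_right_mono) simp
      then show ?thesis by (simp add: D_def norm_mult mult.commute)
    qed
    show "integrable lborel (\<lambda>w::'a V. (1 + norm v) ^ ?d * B * wt w)" by (intro integrable_mult_right integrable_wt)
  qed
  moreover have "(LINT w|lborel. K w t) = vee f z" for t
    unfolding K_def vee_eq FT_def using borel_measurable_integrable[OF integrable_FT_integrand[OF f, of ?x ?r]]
    by (subst integral_lborel_translate[where g="\<lambda>w. ee (w \<bullet> ?x) * f (emb w ?r)"]) auto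
  ultimately have "((\<lambda>t::real. vee f z) has_derivative (\<lambda>s. LINT w|lborel. D w 0 s)) (at 0)" by simp
  moreover have "((\<lambda>t::real. vee f z) has_derivative (\<lambda>s. 0)) (at 0)" by simp
  ultimately have "(\<lambda>s. LINT w|lborel. D w 0 s) = (\<lambda>s. 0)" by (rule has_derivative_unique)
  from fun_cong[OF this, of 1] have "(LINT w|lborel. H w) = 0" by (simp add: D_def)
  moreover have "(LINT w|lborel. H w) = 2 * of_real pi * \<i> * of_real (v \<bullet> ?x) * vee f z + vee ?f' z"
  proof -
    have "H = (\<lambda>w. 2 * of_real pi * \<i> * of_real (v \<bullet> ?x) * (ee (w \<bullet> ?x) * f (emb w ?r)) + ee (w \<bullet> ?x) * ?f' (emb w ?r))"
      by (simp add: H_def fun_eq_iff algebra_simps)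
    then show ?thesis
      using integrable_FT_integrand[OF f, of ?x ?r] integrable_FT_integrand[OF f', of ?x ?r] by (simp add: vee_eq FT_def)
  qed
  ultimately show ?thesis by (simp add: eq_neg_iff_add_eq_0 add.commute inner_commute)
qed

text \<open>Smoothness comes from \<open>has_derivative_vee\<close>. For decay, k derivatives in the
  form of the operator \<open>T\<close> below become the factor (1 + |x|^2)^k on the transform,
  while transforms of \<open>S3c\<close> are bounded.\<close>

lemma vee_S3c:
  assumes f: "f \<in> S3c" shows "vee f \<in> S3c"
proof -
  have "schwartz (vee f)"
  proof (rule schwartz_coinduct[where X="vee ` S3c"])
    show "vee f \<in> vee ` S3c" using f by simp
    show "h differentiable (at x)" if "h \<in> vee ` S3c" for h x
      using that has_derivative_vee unfolding differentiable_def by blast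
    show "dderiv b h \<in> vee ` S3c" if hX: "h \<in> vee ` S3c" for h b
    proof -
      obtain f where f: "h = vee f" "f \<in> S3c" using hX by blast
      have "dderiv b h = vee (\<lambda>z. 2 * of_real pi * \<i> * (of_real (hpart z \<bullet> hpart b) * f z) + of_real (rpart b) * dderiv (emb 0 1) f z)"
        unfolding f(1) by (intro ext dderiv_eq[OF has_derivative_vee[OF f(2)]])
      then show ?thesis using vee_derivative_S3c[OF f(2)] by simp
    qed
    show "rapid h" if h: "h \<in> vee ` S3c" for h :: "'a G \<Rightarrow> complex"
    proof -
      obtain f where f: "h = vee f" "f \<in> S3c" using h by blast
      obtain R where R: "R \<ge> 0" "\<And>z. \<bar>rpart z\<bar> > R \<Longrightarrow> f z = 0" using S3cE[OF f(2)] by metis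
      \<comment> \<open>The constant makes \<open>T\<close> the identity minus the horizontal
        Laplacian divided by 4 pi^2, which \<open>vee\<close> turns into multiplication by 1 +
        |x|^2.\<close>
      define a :: complex where "a = - 1 / (4 * of_real pi ^ 2)"
      define T where "T g = (\<lambda>z. g z + a * (\<Sum>e\<in>Basis. dderiv (emb e 0) (dderiv (emb e 0) g) z))" for g :: "'a G \<Rightarrow> complex"
      have TS: "T g \<in> S3c" if "g \<in> S3c" for g
        unfolding T_def using that by (intro S3c_add S3c_cmult S3c_sum dderiv_emb_0) auto
      have veeT: "vee (T g) z = of_real (1 + (norm (hpart z))\<^sup>2) * vee g z" if "g \<in> S3c" for g z
      proof -
        have s: "vee (\<lambda>z. \<Sum>e\<in>Basis. dderiv (emb e 0) (dderiv (emb e 0) g) z) z = (\<Sum>e\<in>Basis. vee (dderiv (emb e 0) (dderiv (emb e 0) g)) z)"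
          using that by (intro vee_sum) (auto intro!: dderiv_emb_0)
        have "vee (T g) z = vee g z + a * (\<Sum>e\<in>Basis. vee (dderiv (emb e 0) (dderiv (emb e 0) g)) z)"
          unfolding T_def using that by (subst vee_add) (auto intro!: S3c_cmult S3c_sum dderiv_emb_0 simp: vee_cmult s)
        also have "(\<Sum>e\<in>Basis. vee (dderiv (emb e 0) (dderiv (emb e 0) g)) z) = (\<Sum>e\<in>Basis. - (4 * of_real pi ^ 2) * (of_real ((hpart z \<bullet> e)\<^sup>2) * vee g z))"
          using that by (intro sum.cong refl) (simp add: vee_hderiv dderiv_emb_0 power2_eq_square algebra_simps)
        also have "\<dots> = - (4 * of_real pi ^ 2) * (of_real ((norm (hpart z))\<^sup>2) * vee g z)"
        proof -
          have n: "complex_of_real ((norm (hpart z))\<^sup>2) = (\<Sum>e\<in>Basis. of_real ((hpart z \<bullet> e)\<^sup>2))"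
            unfolding power2_norm_eq_inner by (subst euclidean_inner) (simp add: power2_eq_square)
          show ?thesis by (simp only: n sum_distrib_left sum_distrib_right)
        qed
        also have "vee g z + a * \<dots> = of_real (1 + (norm (hpart z))\<^sup>2) * vee g z"
          by (simp add: a_def field_simps)
        finally show ?thesis .
      qed
      have Tk: "(T ^^ k) f \<in> S3c \<and> vee ((T ^^ k) f) z = of_real ((1 + (norm (hpart z))\<^sup>2) ^ k) * vee f z" for k z
        by (induction k) (use f TS veeT in \<open>auto simp: mult_ac\<close>)
      show ?thesis unfolding rapid_def
      proof
        fix k
        obtain C where C: "C \<ge> 0" "\<And>z. cmod (vee ((T ^^ k) f) z) \<le> C" using norm_vee_le Tk by metis
        have "(1 + norm z) ^ k * cmod (h z) \<le> (2 + R) ^ k * C" for z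
        proof (cases "\<bar>rpart z\<bar> \<le> R")
          case True
          have "norm (hpart z) \<le> 1 + (norm (hpart z))\<^sup>2"
          proof -
            have "2 * norm (hpart z) \<le> 1 + (norm (hpart z))\<^sup>2" using sum_squares_bound[of 1 "norm (hpart z)"] by simp
            then show ?thesis using norm_ge_zero[of "hpart z"] by linarith
          qed
          \<comment> \<open>On the slab |r| <= R one power of 1 + |z| is paid for by one application
            of \<open>T\<close>; off the slab the transform vanishes.\<close>
          then have "1 + norm z \<le> (1 + R) + (1 + (norm (hpart z))\<^sup>2)" using norm_parts_le[of z] True by linarith
          also have "\<dots> \<le> (2 + R) * (1 + (norm (hpart z))\<^sup>2)" using R(1) by (simp add: algebra_simps add_increasing)
          finally have "(1 + norm z) ^ k \<le> ((2 + R) * (1 + (norm (hpart z))\<^sup>2)) ^ k" by (rule power_mono) simp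
          then have "(1 + norm z) ^ k * cmod (h z) \<le> ((2 + R) * (1 + (norm (hpart z))\<^sup>2)) ^ k * cmod (h z)" by (rule mult_right_mono) simp
          also have "\<dots> = (2 + R) ^ k * cmod (vee ((T ^^ k) f) z)"
            using Tk[of k z] by (simp add: f power_mult_distrib norm_mult norm_power flip: of_real_power of_real_add)
          also have "\<dots> \<le> (2 + R) ^ k * C" using R C by (intro mult_left_mono) auto
          finally show ?thesis .
        next
          case False
          then have "h z = 0" using R by (simp add: f vee_eq FT_def)
          then show ?thesis using R C by simp
        qed
        then show "\<exists>C. \<forall>z. (1 + norm z) ^ k * cmod (h z) \<le> C" by blast
      qed
    qed
  qed
  moreover obtain R where "R \<ge> 0" "\<And>z. \<bar>rpart z\<bar> > R \<Longrightarrow> f z = 0" using S3cE[OF f] by metis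
  ultimately show ?thesis by (intro S3cI[where R=R]) (simp_all add: vee_eq FT_def)
qed

text \<open>Applying \<open>vee\<close> twice gives this reflection, so \<open>hrefl (vee f)\<close>
  is the inverse partial Fourier transform of f.\<close>

definition hrefl :: "('n::finite G \<Rightarrow> complex) \<Rightarrow> 'n G \<Rightarrow> complex" where
  "hrefl f z = f (emb (- hpart z) (rpart z))"

lemma hrefl_emb [simp]: "hrefl f (emb w r) = f (emb (- w) r)"
  by (simp add: hrefl_def)

lemma hrefl_S3c: "f \<in> S3c \<Longrightarrow> hrefl f \<in> S3c"
  unfolding hrefl_def[abs_def] by (rule S3c_hreflect)

lemma vee_hrefl:
  assumes "f \<in> S3c" shows "vee (hrefl f) = hrefl (vee f)"
proof
  fix z
  have "vee (hrefl f) z = (LINT w|lborel. ee ((0 - w) \<bullet> (- hpart z)) * f (emb (0 - w) (rpart z)))"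
    by (simp add: vee_eq FT_def)
  also have "\<dots> = (LINT w|lborel. ee (w \<bullet> (- hpart z)) * f (emb w (rpart z)))"
    using borel_measurable_integrable[OF integrable_FT_integrand[OF assms, of "- hpart z" "rpart z"]]
    by (intro integral_lborel_reflect[where g="\<lambda>w. ee (w \<bullet> (- hpart z)) * f (emb w (rpart z))"]) simp
  also have "\<dots> = hrefl (vee f) z" by (simp add: hrefl_def vee_eq FT_def)
  finally show "vee (hrefl f) z = hrefl (vee f) z" .
qed

lemma vee_inversion:
  assumes f: "f \<in> S3c" shows "hrefl (vee (vee f)) = f"
proof
  fix z
  obtain C where C: "\<And>z. cmod (f z) \<le> C" using S3c_bounded[OF f] by metis
  have "(LINT t|lborel. ee (- (hpart z \<bullet> t)) * FT (\<lambda>w. f (emb w (rpart z))) t) = f (emb (hpart z) (rpart z))"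
  proof (rule FT_inversion[where B=C])
    show "continuous_on UNIV (\<lambda>w. f (emb w (rpart z)))"
      by (rule continuous_on_compose2[OF S3c_continuous_on[OF f, of UNIV]]) (auto intro!: continuous_intros)
    have "FT (\<lambda>w. f (emb w (rpart z))) = (\<lambda>w. vee f (emb w (rpart z)))" by (simp add: vee_emb)
    then show "integrable lborel (FT (\<lambda>w. f (emb w (rpart z))))"
      using S3c_slice_integrable[OF vee_S3c[OF f]] by simp
  qed (use C S3c_slice_integrable[OF f] in auto)
  then show "hrefl (vee (vee f)) z = f z"
    by (simp add: hrefl_def vee_eq FT_def inner_commute)
qed

lemma vee_vee: "f \<in> S3c \<Longrightarrow> vee (hrefl (vee f)) = f"
  using vee_inversion[of f] by (simp add: vee_hrefl vee_S3c)

lemma vee_inj: "f \<in> S3c \<Longrightarrow> g \<in> S3c \<Longrightarrow> vee f = vee g \<Longrightarrow> f = g"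
  using vee_inversion by metis

subsection \<open>The twisted convolution\<close>

text \<open>Convolution over each r, twisted by a bicharacter of strength c times eta. The operators
  and products of parameter h correspond to c = - h, because their phase is
  \<open>ee_bar\<close>.\<close>

definition twc :: "real \<Rightarrow> real \<Rightarrow> ('n::finite G \<Rightarrow> complex) \<Rightarrow> ('n G \<Rightarrow> complex) \<Rightarrow> 'n G \<Rightarrow> complex" where
  "twc lam c F G z = (LINT w|lborel. F (emb w (rpart z)) * G (emb (hpart z - w) (rpart z)) *
     ee (c * eta lam (rpart z) * (fst w \<bullet> snd (hpart z - w))))"

lemma L_h_twc: "L_h lam h \<phi> \<xi> z = twc lam (- h) (vee \<phi>) \<xi> z"
  by (cases z) (simp add: L_h_def twc_def emb_def case_prod_beta' ee_bar_eq)

lemma twc_measurable_integrand [measurable]: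
  assumes [measurable]: "F \<in> borel_measurable borel" "G \<in> borel_measurable borel"
  shows "(\<lambda>w. F (emb w r) * G (emb (x - w) r) * ee (c * (fst w \<bullet> snd (x - w)))) \<in> borel_measurable borel"
  by measurable

lemma twc_integrable:
  assumes F: "F \<in> S3c" and G: "G \<in> S3c"
  shows "integrable lborel (\<lambda>w. F (emb w r) * G (emb (x - w) r) * ee (c * (fst w \<bullet> snd (x - w))))"
proof -
  obtain C where C: "C \<ge> 0" "\<And>w r. cmod (F (emb w r)) \<le> C * wt w" using S3c_wt0[OF F] by metis
  obtain D where D: "D \<ge> 0" "\<And>z. cmod (G z) \<le> D" using S3c_bounded[OF G] by metis
  show ?thesis
  proof (rule integrable_wtI[where C="C * D"])
    show "(\<lambda>w. F (emb w r) * G (emb (x - w) r) * ee (c * (fst w \<bullet> snd (x - w)))) \<in> borel_measurable borel"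
      using S3c_measurable[OF F] S3c_measurable[OF G] by (rule twc_measurable_integrand)
    show "cmod (F (emb w r) * G (emb (x - w) r) * ee (c * (fst w \<bullet> snd (x - w)))) \<le> C * D * wt w" for w
      using mult_mono[OF C(2)[of w r] D(2)[of "emb (x - w) r"]] C D wt_nonneg[of w] by (simp add: norm_mult mult_ac)
  qed
qed

lemma dderiv_bound:
  assumes "G \<in> S3c" obtains D where "D \<ge> 0" "\<And>u z. cmod (dderiv u G z) \<le> D * norm u"
proof -
  have "\<exists>C\<ge>0. \<forall>z. cmod (dderiv b G z) \<le> C" if "b \<in> Basis" for b
    using S3c_bounded[OF S3c_dderiv[OF assms that]] by metis
  then obtain C where C: "\<And>b. b \<in> Basis \<Longrightarrow> C b \<ge> 0" "\<And>b z. b \<in> Basis \<Longrightarrow> cmod (dderiv b G z) \<le> C b" by metis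
  have "cmod (dderiv u G z) \<le> (\<Sum>b\<in>Basis. C b) * norm u" for u z
  proof -
    have "cmod (dderiv u G z) \<le> (\<Sum>b\<in>Basis. norm u * C b)"
      unfolding dderiv_sum_Basis[OF S3c_differentiable[OF assms], of u z]
      by (intro sum_norm_le) (auto intro!: mult_mono Basis_le_norm C)
    then show ?thesis by (simp add: sum_distrib_left mult.commute)
  qed
  then show ?thesis using that C(1) sum_nonneg by metis
qed

lemma S3c_exp_mult: "f \<in> S3c \<Longrightarrow> (\<lambda>z. of_real (exp (2 * lam * rpart z)) * f z) \<in> S3c"
  by (rule S3c_mods_mult[OF mods.expo])

lemma S3c_eta_mult: "f \<in> S3c \<Longrightarrow> (\<lambda>z. of_real (eta lam (rpart z)) * f z) \<in> S3c"
  by (rule S3c_mods_mult[OF mods_eta])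

text \<open>The variable z enters F through r only, G through all components, and the phase through
  eta and the second horizontal component. Expanding the inner product in the phase over a basis
  writes each resulting term as a twisted convolution of members of \<open>S3c\<close>, so sums of
  twisted convolutions are closed under derivatives.\<close>

lemma has_derivative_twc:
  assumes F: "F \<in> S3c" and G: "G \<in> S3c"
  shows "(twc lam c F G has_derivative (\<lambda>u.
     of_real (rpart u) * twc lam c (dderiv (emb 0 1) F) G z0 + twc lam c F (dderiv u G) z0 +
     2 * of_real pi * \<i> * of_real c * (of_real (2 * lam / (2 * lam) * rpart u) *
        (\<Sum>e\<in>Basis. twc lam c (\<lambda>z. of_real (fst z \<bullet> e) * (of_real (exp (2 * lam * rpart z)) * F z)) (\<lambda>z. of_real (fst (snd z) \<bullet> e) * G z) z0)
      + twc lam c (\<lambda>z. of_real (fst z \<bullet> snd (hpart u)) * (of_real (eta lam (rpart z)) * F z)) G z0))) (at z0)"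
    (is "(_ has_derivative ?D) _")
proof -
  let ?F' = "dderiv (emb 0 1) F" and ?k = "2 * lam / (2 * lam)"
  have F': "?F' \<in> S3c" using F by (intro S3c_dderiv emb_Basis)
  define P where "P z w = ee (c * eta lam (rpart z) * (fst w \<bullet> snd (hpart z - w)))" for z :: "'a G" and w
  define Q where "Q z w u = ?k * exp (2 * lam * rpart z) * rpart u * (fst w \<bullet> snd (hpart z - w)) + eta lam (rpart z) * (fst w \<bullet> snd (hpart u))" for z u :: "'a G" and w
  define D where "D w z u = of_real (rpart u) * (?F' (emb w (rpart z)) * G (emb (hpart z - w) (rpart z)) * P z w)
     + F (emb w (rpart z)) * dderiv u G (emb (hpart z - w) (rpart z)) * P z w
     + 2 * of_real pi * \<i> * of_real c * (of_real (Q z w u) * (F (emb w (rpart z)) * G (emb (hpart z - w) (rpart z)) * P z w))" for w z u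
  let ?Fe = "\<lambda>z. of_real (exp (2 * lam * rpart z)) * F z" and ?Fn = "\<lambda>z. of_real (eta lam (rpart z)) * F z"
  have Fe: "?Fe \<in> S3c" and Fn: "?Fn \<in> S3c" using F by (auto intro: S3c_exp_mult S3c_eta_mult)
  obtain A0 where A0: "A0 \<ge> 0" "\<And>w r. cmod (F (emb w r)) \<le> A0 * wt w" using S3c_wt0[OF F] by metis
  obtain A1 where A1: "A1 \<ge> 0" "\<And>w r. cmod (?F' (emb w r)) \<le> A1 * wt w" using S3c_wt0[OF F'] by metis
  obtain A2 where A2: "A2 \<ge> 0" "\<And>w r. (1 + norm (emb w r)) ^ 1 * cmod (?Fe (emb w r)) \<le> A2 * wt w" using S3c_wt[OF Fe, of 1] by metis
  obtain A3 where A3: "A3 \<ge> 0" "\<And>w r. (1 + norm (emb w r)) ^ 1 * cmod (?Fn (emb w r)) \<le> A3 * wt w" using S3c_wt[OF Fn, of 1] by metis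
  obtain B0 where B0: "B0 \<ge> 0" "\<And>z. cmod (G z) \<le> B0" using S3c_bounded[OF G] by metis
  obtain B1 where B1: "B1 \<ge> 0" "\<And>u z. cmod (dderiv u G z) \<le> B1 * norm u" using dderiv_bound[OF G] by metis
  obtain B2 where B2: "B2 \<ge> 0" "\<And>z. (1 + norm z) ^ 1 * cmod (G z) \<le> B2" using rapidE[OF S3c_rapid[OF G], of 1] by metis
  have nP: "cmod (P z w) = 1" for z w by (simp add: P_def)
  have "((\<lambda>z. LINT w|lborel. F (emb w (rpart z)) * G (emb (hpart z - w) (rpart z)) * P z w) has_derivative (\<lambda>u. LINT w|lborel. D w z0 u)) (at z0)"
  proof (rule has_derivative_param_integral[where g="\<lambda>w. (A1 * B0 + A0 * B1 + 2 * pi * \<bar>c\<bar> * (A2 * B2 + A3 * B0)) * wt w"])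
    show "integrable lborel (\<lambda>w. F (emb w (rpart z)) * G (emb (hpart z - w) (rpart z)) * P z w)" for z
      unfolding P_def by (rule twc_integrable[OF F G])
    show "((\<lambda>z. F (emb w (rpart z)) * G (emb (hpart z - w) (rpart z)) * P z w) has_derivative D w z) (at z)" for w z
    proof -
      have e: "((\<lambda>z. emb (hpart z - w) (rpart z)) has_derivative (\<lambda>u. u)) (at z)"
      proof -
        have "((\<lambda>z. z - emb w 0) has_derivative (\<lambda>u. u)) (at z)" by (auto intro!: derivative_eq_intros)
        moreover have "z - emb w 0 = emb (hpart z - w) (rpart z)" for z by (cases z) (simp add: emb_def)
        ultimately show ?thesis by simp
      qed
      have 2: "((\<lambda>z. G (emb (hpart z - w) (rpart z))) has_derivative (\<lambda>u. dderiv u G (emb (hpart z - w) (rpart z)))) (at z)"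
        using diff_chain_at[OF e S3c_has_derivative[OF G]] by (simp add: o_def)
      have "((\<lambda>z. fst w \<bullet> snd (hpart z - w)) has_derivative (\<lambda>u. fst w \<bullet> snd (hpart u))) (at z)"
        using linear_hpart by (auto intro!: derivative_eq_intros bounded_linear_imp_has_derivative)
      then have "((\<lambda>z. c * (eta lam (rpart z) * (fst w \<bullet> snd (hpart z - w)))) has_derivative (\<lambda>u. c * Q z w u)) (at z)"
        by (rule has_derivative_eq_rhs[OF has_derivative_mult_right[OF has_derivative_mult[OF eta_has_derivative]]])
          (simp add: Q_def fun_eq_iff algebra_simps)
      from ee_has_derivative[OF this]
      have 3: "((\<lambda>z. P z w) has_derivative (\<lambda>u. 2 * of_real pi * \<i> * of_real (c * Q z w u) * P z w)) (at z)"
        by (simp add: P_def mult.assoc)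
      show ?thesis
        by (rule has_derivative_eq_rhs[OF has_derivative_mult[OF has_derivative_mult[OF has_derivative_emb_rpart[OF F] 2] 3]])
          (simp add: D_def fun_eq_iff algebra_simps scaleR_conv_of_real)
    qed
    have dG: "dderiv v G \<in> borel_measurable borel" for v
    proof -
      have "dderiv v G = (\<lambda>z. \<Sum>b\<in>Basis. of_real (v \<bullet> b) * dderiv b G z)"
        by (intro ext) (simp only: dderiv_sum_Basis[OF S3c_differentiable[OF G], of v] scaleR_conv_of_real)
      moreover have "(\<lambda>z. \<Sum>b\<in>Basis. of_real (v \<bullet> b) * dderiv b G z) \<in> borel_measurable borel"
        by (intro borel_measurable_sum borel_measurable_times borel_measurable_const S3c_measurable S3c_dderiv G)
      ultimately show ?thesis by simp
    qed
    show "(\<lambda>w. D w z0 v) \<in> borel_measurable borel" for v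
      unfolding D_def P_def Q_def
      using S3c_measurable[OF F, measurable] S3c_measurable[OF F', measurable] S3c_measurable[OF G, measurable] dG[of v, measurable] by measurable
    show "cmod (D w z u) \<le> (A1 * B0 + A0 * B1 + 2 * pi * \<bar>c\<bar> * (A2 * B2 + A3 * B0)) * wt w * norm u" for w z u
    proof -
      let ?r = "rpart z" and ?v = "hpart z - w"
      have nw: "norm w \<le> (1 + norm (emb w ?r)) ^ 1" using norm_le_emb[of w ?r] by simp
      have nv: "norm ?v \<le> (1 + norm (emb ?v ?r)) ^ 1" using norm_le_emb[of ?v ?r] by simp
      have f1: "\<bar>fst w \<bullet> snd ?v\<bar> \<le> norm w * norm ?v"
        by (intro order_trans[OF Cauchy_Schwarz_ineq2] mult_mono norm_fst_le2 norm_snd_le2) auto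
      have f2: "\<bar>fst w \<bullet> snd (hpart u)\<bar> \<le> norm w * norm u"
        by (intro order_trans[OF Cauchy_Schwarz_ineq2] mult_mono norm_fst_le2 order_trans[OF norm_snd_le2 norm_hpart_le]) auto
      have t1: "cmod (of_real (rpart u) * (?F' (emb w ?r) * G (emb ?v ?r) * P z w)) \<le> norm u * ((A1 * wt w) * B0)"
        unfolding norm_mult nP mult_1_right norm_of_real by (intro mult_mono norm_rpart_le A1 B0) (auto simp: wt_nonneg A1 B0)
      have t2: "cmod (F (emb w ?r) * dderiv u G (emb ?v ?r) * P z w) \<le> (A0 * wt w) * (B1 * norm u)"
        unfolding norm_mult nP mult_1_right by (intro mult_mono A0 B1) (auto simp: wt_nonneg A0 B1)
      have k: "\<bar>?k\<bar> \<le> 1" by (cases "lam = 0") auto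
      have t3: "cmod (of_real (Q z w u) * (F (emb w ?r) * G (emb ?v ?r) * P z w)) \<le> norm u * ((A2 * wt w) * B2) + norm u * ((A3 * wt w) * B0)"
      proof -
        have Q: "\<bar>Q z w u\<bar> \<le> exp (2 * lam * ?r) * norm u * (norm w * norm ?v) + \<bar>eta lam ?r\<bar> * (norm w * norm u)"
        proof -
          have "\<bar>?k * exp (2 * lam * ?r) * rpart u * (fst w \<bullet> snd ?v)\<bar> \<le> 1 * exp (2 * lam * ?r) * norm u * (norm w * norm ?v)"
            unfolding abs_mult abs_exp_cancel by (intro mult_mono k f1 norm_rpart_le) auto
          moreover have "\<bar>eta lam ?r * (fst w \<bullet> snd (hpart u))\<bar> \<le> \<bar>eta lam ?r\<bar> * (norm w * norm u)"
            unfolding abs_mult by (intro mult_left_mono f2) auto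
          ultimately show ?thesis unfolding Q_def by linarith
        qed
        have "cmod (of_real (Q z w u) * (F (emb w ?r) * G (emb ?v ?r) * P z w)) = \<bar>Q z w u\<bar> * (cmod (F (emb w ?r)) * cmod (G (emb ?v ?r)))"
          by (simp add: norm_mult nP)
        also have "\<dots> \<le> (exp (2 * lam * ?r) * norm u * (norm w * norm ?v) + \<bar>eta lam ?r\<bar> * (norm w * norm u)) * (cmod (F (emb w ?r)) * cmod (G (emb ?v ?r)))"
          by (intro mult_right_mono Q) auto
        also have "\<dots> = norm u * ((norm w * cmod (?Fe (emb w ?r))) * (norm ?v * cmod (G (emb ?v ?r)))) + norm u * ((norm w * cmod (?Fn (emb w ?r))) * cmod (G (emb ?v ?r)))"
          by (simp add: norm_mult algebra_simps)
        also have "\<dots> \<le> norm u * ((A2 * wt w) * B2) + norm u * ((A3 * wt w) * B0)"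
          by (intro add_mono mult_left_mono mult_mono B0 order_trans[OF mult_right_mono[OF nw norm_ge_zero] A2(2)] order_trans[OF mult_right_mono[OF nv norm_ge_zero] B2(2)]
               order_trans[OF mult_right_mono[OF nw norm_ge_zero] A3(2)]) (auto simp: wt_nonneg A2 A3)
        finally show ?thesis .
      qed
      have "cmod (D w z u) \<le> norm u * ((A1 * wt w) * B0) + (A0 * wt w) * (B1 * norm u) + 2 * pi * \<bar>c\<bar> * (norm u * ((A2 * wt w) * B2) + norm u * ((A3 * wt w) * B0))"
        unfolding D_def
        by (rule order_trans[OF norm_triangle_ineq add_mono[OF order_trans[OF norm_triangle_ineq add_mono[OF t1 t2]]]])
          (use mult_left_mono[OF t3, of "2 * pi * \<bar>c\<bar>"] in \<open>simp add: norm_mult\<close>)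
      then show ?thesis by (simp add: algebra_simps)
    qed
    show "integrable lborel (\<lambda>w::'a V. (A1 * B0 + A0 * B1 + 2 * pi * \<bar>c\<bar> * (A2 * B2 + A3 * B0)) * wt w)"
      by (intro integrable_mult_right integrable_wt)
  qed
  then have *: "(twc lam c F G has_derivative (\<lambda>u. LINT w|lborel. D w z0 u)) (at z0)"
    unfolding twc_def[abs_def] P_def by simp
  have "(LINT w|lborel. D w z0 u) = ?D u" for u
  proof -
    let ?r = "rpart z0" and ?v = "\<lambda>w. hpart z0 - w"
    have dG: "dderiv u G \<in> S3c"
    proof -
      have "dderiv u G = (\<lambda>z. \<Sum>b\<in>Basis. of_real (u \<bullet> b) * dderiv b G z)"
        by (intro ext) (simp only: dderiv_sum_Basis[OF S3c_differentiable[OF G], of u] scaleR_conv_of_real)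
      also have "\<dots> \<in> S3c" using G by (intro S3c_sum S3c_cmult S3c_dderiv) auto
      finally show ?thesis .
    qed
    have c1: "(\<lambda>z. of_real (fst z \<bullet> e) * f z) \<in> S3c" "(\<lambda>z. of_real (fst (snd z) \<bullet> e) * f z) \<in> S3c" if "f \<in> S3c" for e and f :: "'a G \<Rightarrow> complex"
      using S3c_mods_mult[OF mods_fst_inner[where lam=1] that] S3c_mods_mult[OF mods_snd_inner[where lam=1] that] by auto
    define I where "I F G w = F (emb w ?r) * G (emb (?v w) ?r) * ee ((c * eta lam ?r) * (fst w \<bullet> snd (?v w)))" for F G :: "'a G \<Rightarrow> complex" and w
    have Ii: "integrable lborel (I F G)" if "F \<in> S3c" "G \<in> S3c" for F G
      unfolding I_def by (rule twc_integrable[OF that])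
    have It: "integral\<^sup>L lborel (I F G) = twc lam c F G z0" for F G
      unfolding I_def twc_def ..
    have "D w z0 u = of_real (rpart u) * I ?F' G w + I F (dderiv u G) w + 2 * of_real pi * \<i> * of_real c * (of_real (?k * rpart u) *
        (\<Sum>e\<in>Basis. I (\<lambda>z. of_real (fst z \<bullet> e) * ?Fe z) (\<lambda>z. of_real (fst (snd z) \<bullet> e) * G z) w)
        + I (\<lambda>z. of_real (fst z \<bullet> snd (hpart u)) * ?Fn z) G w)" for w
    proof -
      have "(\<Sum>e\<in>Basis. I (\<lambda>z. of_real (fst z \<bullet> e) * ?Fe z) (\<lambda>z. of_real (fst (snd z) \<bullet> e) * G z) w) =
        (\<Sum>e\<in>Basis. of_real ((fst w \<bullet> e) * (snd (?v w) \<bullet> e)) * (?Fe (emb w ?r) * G (emb (?v w) ?r) * P z0 w))"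
        by (intro sum.cong refl) (simp add: I_def P_def emb_def mult_ac)
      also have "\<dots> = of_real (fst w \<bullet> snd (?v w)) * (?Fe (emb w ?r) * G (emb (?v w) ?r) * P z0 w)"
        by (simp only: euclidean_inner[of "fst w" "snd (?v w)"] of_real_sum sum_distrib_right)
      finally have S: "(\<Sum>e\<in>Basis. I (\<lambda>z. of_real (fst z \<bullet> e) * ?Fe z) (\<lambda>z. of_real (fst (snd z) \<bullet> e) * G z) w) = \<dots>" .
      show ?thesis
        unfolding D_def Q_def S by (simp add: I_def P_def emb_def algebra_simps)
    qed
    then have "(LINT w|lborel. D w z0 u) = (LINT w|lborel. of_real (rpart u) * I ?F' G w + I F (dderiv u G) w + 2 * of_real pi * \<i> * of_real c * (of_real (?k * rpart u) *
        (\<Sum>e\<in>Basis. I (\<lambda>z. of_real (fst z \<bullet> e) * ?Fe z) (\<lambda>z. of_real (fst (snd z) \<bullet> e) * G z) w)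
        + I (\<lambda>z. of_real (fst z \<bullet> snd (hpart u)) * ?Fn z) G w))"
      by simp
    also have "\<dots> = of_real (rpart u) * integral\<^sup>L lborel (I ?F' G) + integral\<^sup>L lborel (I F (dderiv u G)) + 2 * of_real pi * \<i> * of_real c * (of_real (?k * rpart u) *
        (\<Sum>e\<in>Basis. integral\<^sup>L lborel (I (\<lambda>z. of_real (fst z \<bullet> e) * ?Fe z) (\<lambda>z. of_real (fst (snd z) \<bullet> e) * G z)))
        + integral\<^sup>L lborel (I (\<lambda>z. of_real (fst z \<bullet> snd (hpart u)) * ?Fn z) G))"
      using Ii[OF F' G] Ii[OF F dG] Ii[OF c1(1)[OF Fe] c1(2)[OF G]] Ii[OF c1(1)[OF Fn] G]
      by (simp add: Bochner_Integration.integral_add Bochner_Integration.integral_sum Bochner_Integration.integrable_sum Bochner_Integration.integrable_add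
          integral_mult_right_zero integrable_mult_right del: of_real_mult of_real_divide)
    finally show ?thesis unfolding It .
  qed
  then show ?thesis using * by simp
qed

text \<open>Since z is the sum of (w, r) and (x - w, 0), the weight 1 + |z| is at most the product
  of the weights at (w, r) and (x - w, r), so the decay of F and that of G combine.\<close>

lemma rapid_twc:
  assumes F: "F \<in> S3c" and G: "G \<in> S3c" shows "rapid (twc lam c F G)"
  unfolding rapid_def
proof
  fix k
  obtain A where A: "A \<ge> 0" "\<And>w r. (1 + norm (emb w r)) ^ k * cmod (F (emb w r)) \<le> A * wt w" using S3c_wt[OF F] by metis
  obtain B where B: "B \<ge> 0" "\<And>z. (1 + norm z) ^ k * cmod (G z) \<le> B" using rapidE[OF S3c_rapid[OF G]] by metis
  have "(1 + norm z) ^ k * cmod (twc lam c F G z) \<le> (LINT w|lborel. (A * B) * wt (w::'a V))" for z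
  proof -
    let ?r = "rpart z" and ?v = "\<lambda>w. hpart z - w"
    let ?I = "\<lambda>w. F (emb w ?r) * G (emb (?v w) ?r) * ee (c * eta lam ?r * (fst w \<bullet> snd (?v w)))"
    have "(1 + norm z) ^ k * cmod (twc lam c F G z) = cmod (LINT w|lborel. of_real ((1 + norm z) ^ k) * ?I w)"
      unfolding twc_def by (simp add: norm_mult norm_power flip: of_real_add of_real_power)
    also have "\<dots> \<le> (LINT w|lborel. (A * B) * wt (w::'a V))"
    proof (rule Bochner_Integration.integral_norm_bound_integral)
      show "integrable lborel (\<lambda>w. of_real ((1 + norm z) ^ k) * ?I w)" by (intro integrable_mult_right twc_integrable F G)
      show "integrable lborel (\<lambda>w::'a V. (A * B) * wt w)" by (intro integrable_mult_right integrable_wt)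
      fix w :: "'a V"
      have "z = emb w ?r + emb (?v w) 0" by (cases z) (simp add: emb_def)
      then have "norm z \<le> norm (emb w ?r) + norm (emb (?v w) 0)" using norm_triangle_ineq by metis
      moreover have "norm (emb (?v w) 0) \<le> norm (emb (?v w) ?r)" using norm_parts_le[of "emb (?v w) 0"] norm_le_emb[of "?v w" ?r] by simp
      ultimately have "1 + norm z \<le> (1 + norm (emb w ?r)) * (1 + norm (emb (?v w) ?r))" by (intro one_add_le_mult) auto
      then have "(1 + norm z) ^ k \<le> (1 + norm (emb w ?r)) ^ k * (1 + norm (emb (?v w) ?r)) ^ k"
        by (metis power_mono power_mult_distrib norm_ge_zero add_nonneg_nonneg zero_le_one)
      then have "(1 + norm z) ^ k * (cmod (F (emb w ?r)) * cmod (G (emb (?v w) ?r))) \<le> (1 + norm (emb w ?r)) ^ k * (1 + norm (emb (?v w) ?r)) ^ k * (cmod (F (emb w ?r)) * cmod (G (emb (?v w) ?r)))"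
        by (rule mult_right_mono) simp
      also have "\<dots> = ((1 + norm (emb w ?r)) ^ k * cmod (F (emb w ?r))) * ((1 + norm (emb (?v w) ?r)) ^ k * cmod (G (emb (?v w) ?r)))" by simp
      also have "\<dots> \<le> (A * wt w) * B" by (intro mult_mono A B) (auto simp: wt_nonneg A)
      finally show "cmod (of_real ((1 + norm z) ^ k) * ?I w) \<le> A * B * wt w"
        by (simp add: norm_mult norm_power mult_ac flip: of_real_add of_real_power)
    qed
    finally show ?thesis .
  qed
  then show "\<exists>C. \<forall>z. (1 + norm z) ^ k * cmod (twc lam c F G z) \<le> C" by blast
qed

lemma twc_cmult: "twc lam c (\<lambda>z. a * F z) G z = a * twc lam c F G z"
  unfolding twc_def by (simp add: mult.assoc)

lemma twc_S3c:
  assumes F: "F \<in> S3c" and G: "G \<in> S3c" shows "twc lam c F G \<in> S3c"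
proof -
  let ?S = "{twc lam c F G | F G :: 'a G \<Rightarrow> complex. F \<in> S3c \<and> G \<in> S3c}"
  have base: "twc lam c F G \<in> fin_sums ?S" if "F \<in> S3c" "G \<in> S3c" for F G :: "'a G \<Rightarrow> complex"
    using that by (intro fin_sums.base) blast
  have "schwartz (twc lam c F G)"
  proof (rule schwartz_fin_sums_coinduct)
    show "twc lam c F G \<in> fin_sums ?S" using F G by (rule base)
    show "h differentiable (at x)" if "h \<in> ?S" for h x
      using that by clarify (rule differentiableI[OF has_derivative_twc])
    show "rapid h" if "h \<in> ?S" for h using that by clarify (rule rapid_twc)
    fix h b assume "h \<in> ?S" and b: "(b::'a G) \<in> Basis"
    then obtain F G where h: "h = twc lam c F G" "F \<in> S3c" "G \<in> S3c" by blast
    let ?k = "2 * of_real pi * \<i> * of_real c :: complex" and ?l = "of_real (2 * lam / (2 * lam) * rpart b) :: complex"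
    have "dderiv b h = (\<lambda>z. twc lam c (\<lambda>z. of_real (rpart b) * dderiv (emb 0 1) F z) G z + twc lam c F (dderiv b G) z +
       ((\<Sum>e\<in>Basis. twc lam c (\<lambda>z. (?k * ?l) * (of_real (fst z \<bullet> e) * (of_real (exp (2 * lam * rpart z)) * F z))) (\<lambda>z. of_real (fst (snd z) \<bullet> e) * G z) z)
        + twc lam c (\<lambda>z. ?k * (of_real (fst z \<bullet> snd (hpart b)) * (of_real (eta lam (rpart z)) * F z))) G z))"
      unfolding h(1) by (intro ext, subst dderiv_eq[OF has_derivative_twc[OF h(2,3)]])
        (simp add: twc_cmult distrib_left sum_distrib_left mult.assoc del: of_real_mult of_real_divide)
    also have "\<dots> \<in> fin_sums ?S"
      using h b
      by (intro fin_sums.add fin_sums_sum base S3c_cmult S3c_dderiv emb_Basis S3c_mods_mult[OF mods_fst_inner[where lam=lam]]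
          S3c_mods_mult[OF mods_snd_inner[where lam=lam]] S3c_exp_mult S3c_eta_mult) auto
    finally show "dderiv b h \<in> fin_sums ?S" .
  qed
  moreover obtain R where "\<And>z. \<bar>rpart z\<bar> > R \<Longrightarrow> F z = 0" using S3cE[OF F] by metis
  ultimately show ?thesis by (intro S3cI[where R=R]) (simp_all add: twc_def)
qed

subsection \<open>The deformed product and involution\<close>

lemma continuous_param_integral:
  fixes K :: "'w::euclidean_space \<Rightarrow> 'z::euclidean_space \<Rightarrow> complex"
  assumes meas: "\<And>z. (\<lambda>w. K w z) \<in> borel_measurable borel" and cont: "\<And>w. continuous_on UNIV (K w)"
    and bd: "\<And>w z. cmod (K w z) \<le> g w" and g: "integrable lborel g"
  shows "continuous_on UNIV (\<lambda>z. LINT w|lborel. K w z)"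
  unfolding continuous_on_sequentially
proof (intro allI ballI impI, elim conjE)
  fix X :: "nat \<Rightarrow> 'z" and a assume X: "X \<longlonglongrightarrow> a"
  show "((\<lambda>z. LINT w|lborel. K w z) \<circ> X) \<longlonglongrightarrow> (LINT w|lborel. K w a)"
    unfolding o_def
  proof (rule integral_dominated_convergence[where w=g])
    show "AE w in lborel. (\<lambda>i. K w (X i)) \<longlonglongrightarrow> K w a"
      using cont X by (intro AE_I2) (auto intro: continuous_on_tendsto_compose[of UNIV])
    show "AE w in lborel. cmod (K w (X i)) \<le> g w" for i using bd by (intro AE_I2)
  qed (use meas g in auto)
qed

lemma ee_bar_inner_diff: "ee_bar ((p - p') \<bullet> a) = ee (- (p \<bullet> a)) * ee (p' \<bullet> a)"
  by (simp add: ee_bar_eq inner_diff_left flip: ee_add)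

text \<open>The product formula transforms \<phi> in p only, whereas \<open>vee\<close> transforms p
  and q. Undoing the transform in q is one application of \<open>FT_inversion\<close> to the
  function \<open>K\<close> of q, whose integrability comes from Fubini.\<close>

lemma partial_inversion:
  fixes \<phi> :: "'n::finite G \<Rightarrow> complex"
  assumes f: "\<phi> \<in> S3c"
  shows "(LINT b|lborel. ee (- (q \<bullet> b)) * vee \<phi> (a, b, r)) = (LINT p|lborel. ee (p \<bullet> a) * \<phi> (p, q, r))"
    and "integrable lborel (\<lambda>p. ee (p \<bullet> a) * \<phi> (p, q, r))"
proof -
  note [measurable] = S3c_measurable[OF f]
  define K where "K q = (LINT p|lborel. ee (p \<bullet> a) * \<phi> (p, q, r))" for q
  have n1: "norm p \<le> norm (p, q, r)" for p q :: "real^'n" by (simp add: norm_Pair real_le_rsqrt)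
  have n2: "norm b \<le> norm (p, b, r)" for p b :: "real^'n"
    using norm_le_emb[of "(p, b)" r] norm_snd_le[of b p] unfolding emb_def by simp
  obtain C where C: "C \<ge> 0" "\<And>z (v::real^'n). norm v \<le> norm z \<Longrightarrow> cmod (\<phi> z) \<le> C * wt v" using S3c_wt_gen[OF f] by metis
  have Cp: "cmod (ee (p \<bullet> a) * \<phi> (p, q, r)) \<le> C * wt p" for p q using C(2)[OF n1] by (simp add: norm_mult)
  show i: "integrable lborel (\<lambda>p. ee (p \<bullet> a) * \<phi> (p, q, r))" for q
    by (rule integrable_wtI[OF _ Cp]) measurable
  have Kc: "continuous_on UNIV K"
    unfolding K_def
  proof (rule continuous_param_integral[where g="\<lambda>p. C * wt p"])
    show "continuous_on UNIV (\<lambda>q. ee (p \<bullet> a) * \<phi> (p, q, r))" for p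
      by (intro continuous_intros continuous_on_compose2[OF S3c_continuous_on[OF f, of UNIV]]) auto
  qed (use Cp integrable_wt in auto)
  have Kb: "cmod (K q) \<le> (LINT p|lborel. C * wt (p::real^'n))" for q
    unfolding K_def by (rule Bochner_Integration.integral_norm_bound_integral[OF i _ Cp]) (intro integrable_mult_right integrable_wt)
  have sl: "integrable lborel (\<lambda>w. ee (fst w \<bullet> a) * \<phi> (emb w r))"
    by (intro integrable_ee_mult S3c_slice_integrable f) measurable
  have Ki: "integrable lborel K"
  proof -
    have "integrable (lborel \<Otimes>\<^sub>M lborel) (\<lambda>(p, q). ee (p \<bullet> a) * \<phi> (p, q, r))"
      using sl by (simp add: lborel_prod case_prod_beta' emb_def)
    from lborel_pair.integrable_snd[OF this] show ?thesis unfolding K_def[abs_def] .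
  qed
  have FK: "FT K b = vee \<phi> (a, b, r)" for b
  proof -
    have i2: "integrable lborel (\<lambda>w. ee (w \<bullet> (a, b)) * \<phi> (emb w r))" by (rule integrable_FT_integrand[OF f])
    have "vee \<phi> (a, b, r) = (LINT w|lborel. ee (w \<bullet> (a, b)) * \<phi> (emb w r))"
      using vee_emb[of \<phi> "(a, b)" r] by (simp add: emb_def FT_def)
    also have "\<dots> = (LINT q|lborel. LINT p|lborel. ee ((p, q) \<bullet> (a, b)) * \<phi> (emb (p, q) r))"
      by (rule integral_lborel_pair(2)[OF i2])
    also have "\<dots> = FT K b"
      unfolding FT_def K_def by (simp add: inner_prod_def ee_add emb_def mult_ac flip: integral_mult_right_zero)
    finally show ?thesis ..
  qed
  obtain D where D: "D \<ge> 0" "\<And>z (v::real^'n). norm v \<le> norm z \<Longrightarrow> cmod (vee \<phi> z) \<le> D * wt v" using S3c_wt_gen[OF vee_S3c[OF f]] by metis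
  note [measurable] = S3c_measurable[OF vee_S3c[OF f]]
  have "integrable lborel (FT K)" unfolding FK
    by (rule integrable_wtI[OF _ D(2)[OF n2]]) measurable
  from FT_inversion[OF Ki Kc Kb this, of q]
  show "(LINT b|lborel. ee (- (q \<bullet> b)) * vee \<phi> (a, b, r)) = (LINT p|lborel. ee (p \<bullet> a) * \<phi> (p, q, r))"
    unfolding FK by (simp add: K_def)
qed

text \<open>In the product \<psi> is evaluated at a point whose q-component is shifted in proportion
  to the Fourier variable of \<phi>. Writing \<psi> by Fourier inversion turns this shift into the
  bilinear phase of the twisted convolution.\<close>

lemma times_h_twc:
  fixes \<phi> \<psi> :: "'n::finite G \<Rightarrow> complex"
  assumes f: "\<phi> \<in> S3c" and g: "\<psi> \<in> S3c"
  shows "times_h lam h \<phi> \<psi> = hrefl (vee (twc lam (- h) (vee \<phi>) (vee \<psi>)))"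
proof
  fix z :: "'n G"
  obtain p q r where z: "z = (p, q, r)" by (cases z) auto
  define t where "t = h * eta lam r"
  let ?F = "\<lambda>w. vee \<phi> (emb w r)" and ?G = "\<lambda>w. vee \<psi> (emb w r)"
  note Fi = S3c_slice_integrable[OF vee_S3c[OF f], of r] and Gi = S3c_slice_integrable[OF vee_S3c[OF g], of r]
  note [measurable] = S3c_slice_measurable[OF vee_S3c[OF f], of r] S3c_slice_measurable[OF vee_S3c[OF g], of r]
  have inv: "(LINT v|lborel. ee (- (x \<bullet> v)) * ?G v) = \<psi> (emb x r)" for x
    using fun_cong[OF vee_inversion[OF g], of "emb x r"] by (simp add: vee_emb FT_def inner_commute)
  have int2: "integrable lborel (\<lambda>s::'n V \<times> 'n V. ee (- ((p, q) \<bullet> (fst s + snd s)) + - t * (fst (fst s) \<bullet> snd (snd s))) * (?F (fst s) * ?G (snd s)))"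
    by (intro integrable_ee_mult integrable_lborel_prod Fi Gi) measurable
  \<comment> \<open>Absolute integrability before the order of integration is exchanged: up to the
    translation x = w + v the integrand is a product of two integrable functions times a
    phase.\<close>
  have int1: "integrable lborel (\<lambda>s::'n V \<times> 'n V. ee (- ((p, q) \<bullet> fst s) + - t * (fst (snd s) \<bullet> snd (fst s - snd s))) * (?F (snd s) * ?G (fst s - snd s)))"
  proof (rule integrable_lborel_pairI)
    let ?A = "\<integral>\<^sup>+w. ennreal (cmod (?F w)) \<partial>lborel" and ?B = "\<integral>\<^sup>+w. ennreal (cmod (?G w)) \<partial>lborel"
    have "(\<integral>\<^sup>+x. \<integral>\<^sup>+w. ennreal (cmod (?F w * ?G (x - w))) \<partial>lborel \<partial>lborel) = (\<integral>\<^sup>+w. \<integral>\<^sup>+x. ennreal (cmod (?F w * ?G (x - w))) \<partial>lborel \<partial>lborel)"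
      using nn_integral_lborel_pair[of "\<lambda>s. ennreal (cmod (?F (snd s) * ?G (fst s - snd s)))"] by simp
    also have "\<dots> = (\<integral>\<^sup>+w. ennreal (cmod (?F w)) * ?B \<partial>lborel)"
    proof (rule nn_integral_cong)
      fix w :: "'n V"
      have "(\<integral>\<^sup>+x. ennreal (cmod (?F w * ?G (x - w))) \<partial>lborel) = ennreal (cmod (?F w)) * (\<integral>\<^sup>+x. ennreal (cmod (?G (x + - w))) \<partial>lborel)"
        by (simp add: norm_mult ennreal_mult nn_integral_cmult)
      then show "(\<integral>\<^sup>+x. ennreal (cmod (?F w * ?G (x - w))) \<partial>lborel) = ennreal (cmod (?F w)) * ?B"
        by (subst (asm) nn_integral_lborel_translate[where f="\<lambda>x. ennreal (cmod (?G x))"]) auto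
    qed
    also have "\<dots> = ?A * ?B" by (simp add: nn_integral_multc)
    also have "\<dots> < \<infinity>" using Fi Gi by (auto simp: integrable_iff_bounded ennreal_mult_less_top)
    finally show "(\<integral>\<^sup>+x. \<integral>\<^sup>+w. ennreal (cmod (ee (- ((p, q) \<bullet> fst (x, w)) + - t * (fst (snd (x, w)) \<bullet> snd (fst (x, w) - snd (x, w)))) * (?F (snd (x, w)) * ?G (fst (x, w) - snd (x, w))))) \<partial>lborel \<partial>lborel) < \<infinity>"
      by (simp add: norm_mult)
  qed measurable
  have ph: "ee (- ((p, q) \<bullet> x) + - t * s) = ee (x \<bullet> - (p, q)) * ee (- h * eta lam r * s)" for x s
    unfolding ee_add by (simp add: t_def inner_commute del: uminus_Pair)
  have "hrefl (vee (twc lam (- h) (vee \<phi>) (vee \<psi>))) z = (LINT x|lborel. LINT w|lborel. ee (- ((p, q) \<bullet> x) + - t * (fst w \<bullet> snd (x - w))) * (?F w * ?G (x - w)))"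
    unfolding hrefl_def vee_emb[of "twc lam (- h) (vee \<phi>) (vee \<psi>)"] FT_def twc_def z hpart_triple rpart_triple hpart_emb rpart_emb integral_mult_right_zero[symmetric]
    by (intro Bochner_Integration.integral_cong refl) (simp only: ph mult_ac)
  also have "\<dots> = (LINT w|lborel. LINT x|lborel. ee (- ((p, q) \<bullet> x) + - t * (fst w \<bullet> snd (x - w))) * (?F w * ?G (x - w)))"
    by (rule integral_lborel_swap[OF int1])
  also have "\<dots> = (LINT w|lborel. LINT v|lborel. ee (- ((p, q) \<bullet> (w + v)) + - t * (fst w \<bullet> snd v)) * (?F w * ?G v))"
  proof (rule Bochner_Integration.integral_cong[OF refl])
    fix w :: "'n V"
    show "(LINT x|lborel. ee (- ((p, q) \<bullet> x) + - t * (fst w \<bullet> snd (x - w))) * (?F w * ?G (x - w))) = (LINT v|lborel. ee (- ((p, q) \<bullet> (w + v)) + - t * (fst w \<bullet> snd v)) * (?F w * ?G v))"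
      by (subst integral_lborel_translate[of _ w, symmetric]) (measurable, simp add: add.commute)
  qed
  \<comment> \<open>The v-integral is Fourier inversion for \<psi> at the shifted point with
    q-component q + t fst w.\<close>
  also have "\<dots> = (LINT w|lborel. ee (- ((p, q) \<bullet> w)) * (?F w * \<psi> (p, q + t *\<^sub>R fst w, r)))"
  proof (rule Bochner_Integration.integral_cong[OF refl])
    fix w :: "'n V"
    have "ee (- ((p, q) \<bullet> (w + v)) + - t * (fst w \<bullet> snd v)) * (?F w * ?G v) = (ee (- ((p, q) \<bullet> w)) * ?F w) * (ee (- ((p, q + t *\<^sub>R fst w) \<bullet> v)) * ?G v)" for v
    proof -
      have "- ((p, q) \<bullet> (w + v)) + - t * (fst w \<bullet> snd v) = - ((p, q) \<bullet> w) + - ((p, q + t *\<^sub>R fst w) \<bullet> v)"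
        by (simp add: inner_prod_def inner_add_right inner_add_left)
      then show ?thesis by (simp only: ee_add mult_ac)
    qed
    then have "(LINT v|lborel. ee (- ((p, q) \<bullet> (w + v)) + - t * (fst w \<bullet> snd v)) * (?F w * ?G v)) = (ee (- ((p, q) \<bullet> w)) * ?F w) * \<psi> (emb (p, q + t *\<^sub>R fst w) r)"
      by (simp only: integral_mult_right_zero inv)
    then show "(LINT v|lborel. ee (- ((p, q) \<bullet> (w + v)) + - t * (fst w \<bullet> snd v)) * (?F w * ?G v)) = ee (- ((p, q) \<bullet> w)) * (?F w * \<psi> (p, q + t *\<^sub>R fst w, r))"
      by (simp add: emb_def mult.assoc)
  qed
  also have "\<dots> = (LINT a|lborel. LINT b|lborel. ee (- ((p, q) \<bullet> (a, b))) * (?F (a, b) * \<psi> (p, q + t *\<^sub>R a, r)))"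
  proof (subst integral_lborel_pair(1))
    obtain C where C: "C \<ge> 0" "\<And>z. cmod (\<psi> z) \<le> C" using S3c_bounded[OF g] by metis
    note [measurable] = S3c_measurable[OF g]
    have "integrable lborel (\<lambda>w. ?F w * \<psi> (p, q + t *\<^sub>R fst w, r))"
      by (rule Bochner_Integration.integrable_bound[OF integrable_mult_right[OF Fi, of "of_real C"]])
        (use C in \<open>auto intro!: AE_I2 mult_mono simp: norm_mult mult.commute[of C]\<close>)
    then show "integrable lborel (\<lambda>w. ee (- ((p, q) \<bullet> w)) * (?F w * \<psi> (p, q + t *\<^sub>R fst w, r)))"
      by (rule integrable_ee_mult) measurable
  qed simp
  also have "\<dots> = (LINT a|lborel. (ee (- (p \<bullet> a)) * \<psi> (p, q + t *\<^sub>R a, r)) * (LINT b|lborel. ee (- (q \<bullet> b)) * vee \<phi> (a, b, r)))"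
    unfolding integral_mult_right_zero[symmetric]
    by (intro Bochner_Integration.integral_cong refl) (simp add: inner_prod_def emb_def mult_ac flip: ee_add)
  \<comment> \<open>The integral over the second half b of w is undone by
    \<open>partial_inversion\<close>, which leaves the transform of \<phi> in p alone.\<close>
  also have "\<dots> = (LINT a|lborel. LINT p'|lborel. ee_bar ((p - p') \<bullet> a) * \<phi> (p', q, r) * \<psi> (p, q + t *\<^sub>R a, r))"
    unfolding partial_inversion(1)[OF f] integral_mult_right_zero[symmetric]
    by (intro Bochner_Integration.integral_cong refl) (simp only: ee_bar_inner_diff mult_ac)
  also have "\<dots> = times_h lam h \<phi> \<psi> z"
    by (simp add: z times_h_def t_def)
  finally show "times_h lam h \<phi> \<psi> z = hrefl (vee (twc lam (- h) (vee \<phi>) (vee \<psi>))) z" ..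
qed

lemma times_h_S3c: "\<phi> \<in> S3c \<Longrightarrow> \<psi> \<in> S3c \<Longrightarrow> times_h lam h \<phi> \<psi> \<in> S3c"
  by (simp add: times_h_twc hrefl_S3c vee_S3c twc_S3c)

lemma vee_times_h: "\<phi> \<in> S3c \<Longrightarrow> \<psi> \<in> S3c \<Longrightarrow> vee (times_h lam h \<phi> \<psi>) = twc lam (- h) (vee \<phi>) (vee \<psi>)"
  by (simp add: times_h_twc vee_vee vee_S3c twc_S3c)

text \<open>At h = 0 the factor \<psi> leaves the integral at the fixed point, and the rest is
  Fourier inversion in p. The partial transform \<open>H\<close> is integrable because it is an
  integral over b of a slice of \<open>vee\<close>.\<close>

lemma times_h_0:
  fixes \<phi> \<psi> :: "'n::finite G \<Rightarrow> complex"
  assumes f: "\<phi> \<in> S3c"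
  shows "times_h lam 0 \<phi> \<psi> = (\<lambda>z. \<phi> z * \<psi> z)"
proof
  fix z :: "'n G"
  obtain p q r where z: "z = (p, q, r)" by (cases z) auto
  note [measurable] = S3c_measurable[OF f] S3c_measurable[OF vee_S3c[OF f]]
  define H where "H a = (LINT p|lborel. ee (p \<bullet> a) * \<phi> (p, q, r))" for a
  have H: "H = FT (\<lambda>p. \<phi> (p, q, r))" by (simp add: H_def FT_def fun_eq_iff)
  obtain C where C: "\<And>z. cmod (\<phi> z) \<le> C" using S3c_bounded[OF f] by metis
  have "integrable lborel (\<lambda>w. ee (- (q \<bullet> snd w)) * vee \<phi> (emb w r))"
    by (intro integrable_ee_mult S3c_slice_integrable vee_S3c f) measurable
  then have "integrable (lborel \<Otimes>\<^sub>M lborel) (\<lambda>(a, b). ee (- (q \<bullet> b)) * vee \<phi> (a, b, r))"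
    by (simp add: lborel_prod case_prod_beta' emb_def)
  from lborel_pair.integrable_fst[OF this] have Hi: "integrable lborel H"
    using partial_inversion(1)[OF f] by (simp add: H_def[abs_def])
  have "(LINT a|lborel. ee (- (p \<bullet> a)) * FT (\<lambda>p. \<phi> (p, q, r)) a) = \<phi> (p, q, r)"
  proof (rule FT_inversion[where B=C])
    show "integrable lborel (\<lambda>p. \<phi> (p, q, r))" using partial_inversion(2)[OF f, of 0 q r] by simp
    show "continuous_on UNIV (\<lambda>p. \<phi> (p, q, r))"
      by (rule continuous_on_compose2[OF S3c_continuous_on[OF f, of UNIV]]) (auto intro!: continuous_intros)
  qed (use C Hi H in auto)
  moreover have "times_h lam 0 \<phi> \<psi> z = (LINT a|lborel. ee (- (p \<bullet> a)) * H a * \<psi> (p, q, r))"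
  proof -
    have "times_h lam 0 \<phi> \<psi> z = (LINT a|lborel. LINT p'|lborel. (ee (- (p \<bullet> a)) * \<psi> (p, q, r)) * (ee (p' \<bullet> a) * \<phi> (p', q, r)))"
      unfolding times_h_def z prod.case ee_bar_inner_diff by (simp only: mult_ac mult_zero_left scaleR_zero_left add_0_right)
    then show ?thesis unfolding integral_mult_right_zero H_def by (simp only: mult_ac)
  qed
  ultimately show "times_h lam 0 \<phi> \<psi> z = \<phi> z * \<psi> z" unfolding H by (simp add: z)
qed

text \<open>The involution of the twisted convolution algebra: the kernel of the adjoint of twisted
  convolution by F. The phase corrects for the cocycle at the pair w, -w.\<close>

definition vstar :: "real \<Rightarrow> real \<Rightarrow> ('n::finite G \<Rightarrow> complex) \<Rightarrow> 'n G \<Rightarrow> complex" where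
  "vstar lam c F z = ee (c * eta lam (rpart z) * (fst z \<bullet> fst (snd z))) * cnj (hrefl F z)"

lemma vstar_S3c: "F \<in> S3c \<Longrightarrow> vstar lam c F \<in> S3c"
  unfolding vstar_def[abs_def] by (intro S3c_mods_mult[OF mods.phase] S3c_cnj hrefl_S3c)

text \<open>The inner integral is the conjugate of the transform at the reflected point, and the
  outer one is the inverse transform; the phase of the involution is that of
  \<open>vstar\<close>.\<close>

lemma star_h_vstar:
  fixes \<phi> :: "'n::finite G \<Rightarrow> complex"
  shows "star_h lam h \<phi> = hrefl (vee (vstar lam (- h) (vee \<phi>)))"
proof
  fix z :: "'n G"
  obtain p q r where z: "z = (p, q, r)" by (cases z) auto
  have c: "(LINT v|lborel. cnj (\<phi> (emb v r)) * ee (v \<bullet> w)) = cnj (vee \<phi> (emb (- w) r))" for w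
    unfolding vee_emb FT_def by (subst Bochner_Integration.integral_cnj[symmetric]) (simp add: mult.commute)
  have "star_h lam h \<phi> z = (LINT w|lborel. LINT v|lborel. (ee (- ((p, q) \<bullet> w)) * ee (- (h * eta lam r * (fst w \<bullet> snd w)))) * (cnj (\<phi> (emb v r)) * ee (v \<bullet> w)))"
  proof -
    have ph: "ee_bar ((p - fst v) \<bullet> fst w + (q - snd v) \<bullet> snd w) = ee (- ((p, q) \<bullet> w)) * ee (v \<bullet> w)" for v w
      by (simp add: ee_bar_eq inner_prod_def inner_diff_left algebra_simps flip: ee_add)
    show ?thesis unfolding star_h_def z prod.case unfolding case_prod_beta' ph
      by (simp only: ee_bar_eq emb_def mult_ac)
  qed
  also have "\<dots> = (LINT w|lborel. ee (- ((p, q) \<bullet> w)) * (ee (- (h * eta lam r * (fst w \<bullet> snd w))) * cnj (vee \<phi> (emb (- w) r))))"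
    by (simp only: integral_mult_right_zero c mult.assoc)
  also have "\<dots> = hrefl (vee (vstar lam (- h) (vee \<phi>))) z"
    unfolding hrefl_def[of "vee _"] vee_emb[of "vstar lam (- h) (vee \<phi>)"] FT_def vstar_def z hpart_triple rpart_triple
    by (simp add: hrefl_def emb_def inner_commute del: uminus_Pair)
  finally show "star_h lam h \<phi> z = hrefl (vee (vstar lam (- h) (vee \<phi>))) z" .
qed

lemma star_h_S3c: "\<phi> \<in> S3c \<Longrightarrow> star_h lam h \<phi> \<in> S3c"
  by (simp add: star_h_vstar hrefl_S3c vee_S3c vstar_S3c)

lemma vee_star_h: "\<phi> \<in> S3c \<Longrightarrow> vee (star_h lam h \<phi>) = vstar lam (- h) (vee \<phi>)"
  by (simp add: star_h_vstar vee_vee vee_S3c vstar_S3c)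

lemma star_h_0:
  assumes f: "\<phi> \<in> S3c" shows "star_h lam 0 \<phi> = (\<lambda>z. cnj (\<phi> z))"
proof (rule vee_inj)
  show "vee (star_h lam 0 \<phi>) = vee (\<lambda>z. cnj (\<phi> z))"
  proof
    fix z
    have "vee (\<lambda>z. cnj (\<phi> z)) z = cnj (hrefl (vee \<phi>) z)"
      unfolding hrefl_def vee_eq FT_def by (subst Bochner_Integration.integral_cnj[symmetric]) simp
    then show "vee (star_h lam 0 \<phi>) z = vee (\<lambda>z. cnj (\<phi> z)) z"
      using f by (simp add: vee_star_h vstar_def)
  qed
qed (use f star_h_S3c S3c_cnj in auto)

section \<open>The C*-norms\<close>

subsection \<open>Kernel operators on square integrable functions\<close>

lemma nn_integral_emb:
  fixes f :: "'n::finite G \<Rightarrow> ennreal"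
  assumes [measurable]: "f \<in> borel_measurable borel"
  shows "(\<integral>\<^sup>+z. f z \<partial>lborel) = (\<integral>\<^sup>+r. \<integral>\<^sup>+w. f (emb w r) \<partial>lborel \<partial>lborel)"
proof -
  have "(\<integral>\<^sup>+z. f z \<partial>lborel) = (\<integral>\<^sup>+p. \<integral>\<^sup>+s. f (p, s) \<partial>lborel \<partial>lborel)"
    by (rule nn_integral_lborel_pair) measurable
  also have "\<dots> = (\<integral>\<^sup>+p. \<integral>\<^sup>+r. \<integral>\<^sup>+q. f (p, q, r) \<partial>lborel \<partial>lborel \<partial>lborel)"
    by (intro nn_integral_cong nn_integral_lborel_pair(2)) measurable
  also have "\<dots> = (\<integral>\<^sup>+r. \<integral>\<^sup>+p. \<integral>\<^sup>+q. f (p, q, r) \<partial>lborel \<partial>lborel \<partial>lborel)"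
  proof -
    have m: "(\<lambda>s::(real^'n) \<times> real. \<integral>\<^sup>+q. f (fst s, q, snd s) \<partial>lborel) \<in> borel_measurable borel"
      by (rule measurable_lborel_nn_integral) measurable
    show ?thesis using nn_integral_lborel_pair(1)[OF m] nn_integral_lborel_pair(2)[OF m] by simp
  qed
  also have "\<dots> = (\<integral>\<^sup>+r. \<integral>\<^sup>+w. f (emb w r) \<partial>lborel \<partial>lborel)"
    by (intro nn_integral_cong, subst nn_integral_lborel_pair(1)) (auto simp: emb_def)
  finally show ?thesis .
qed

text \<open>Disintegration over r gives the preimage of a null set the measure 0 times infinity,
  which is 0 in \<open>ennreal\<close>. In this way statements about almost every fibre become
  statements about almost every point.\<close>

lemma AE_rpart:
  fixes P :: "real \<Rightarrow> bool"
  assumes "AE r in lborel. P r" shows "AE z in (lborel :: 'n::finite G measure). P (rpart z)"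
proof -
  from AE_E[OF assms] obtain N where N: "{r. \<not> P r} \<subseteq> N" "emeasure lborel N = 0" "N \<in> sets borel" by auto
  note [measurable] = N(3)
  have "emeasure lborel (rpart -` N :: 'n G set) = (\<integral>\<^sup>+z. indicator N (rpart z) \<partial>(lborel :: 'n G measure))"
    by (subst nn_integral_indicator[symmetric]) (auto simp: indicator_def intro!: nn_integral_cong measurable_sets_borel[OF rpart_measurable N(3)])
  also have "\<dots> = (\<integral>\<^sup>+r. \<integral>\<^sup>+w. indicator N (rpart (emb w r)) \<partial>(lborel :: 'n V measure) \<partial>lborel)"
    by (rule nn_integral_emb) measurable
  also have "\<dots> = (\<integral>\<^sup>+r. indicator N r * emeasure (lborel :: 'n V measure) UNIV \<partial>lborel)" by (simp add: nn_integral_cmult)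
  also have "\<dots> = 0" using N(2) by (simp add: nn_integral_multc)
  finally have "rpart -` N \<in> null_sets (lborel :: 'n G measure)"
    using measurable_sets_borel[OF rpart_measurable N(3)] by (auto simp: null_sets_def)
  then show ?thesis using N(1) by (intro AE_I'[of "rpart -` N"]) auto
qed

lemma eta_measurable [measurable]: "eta lam \<in> borel_measurable borel"
  unfolding eta_def[abs_def] by measurable

lemma twc_measurable [measurable]:
  assumes [measurable]: "F \<in> borel_measurable borel" "G \<in> borel_measurable borel"
  shows "twc lam c F G \<in> borel_measurable borel"
  unfolding twc_def[abs_def] by (rule measurable_lborel_integral) measurable

text \<open>The squared L^2 norm with values in \<open>ennreal\<close>, so that Tonelli and Fatou
  apply before finiteness is known.\<close>

definition sq_int :: "('a::euclidean_space \<Rightarrow> complex) \<Rightarrow> ennreal" where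
  "sq_int \<xi> = (\<integral>\<^sup>+z. ennreal ((cmod (\<xi> z))\<^sup>2) \<partial>lborel)"

lemma L2_fun_iff: "\<xi> \<in> L2_fun \<longleftrightarrow> \<xi> \<in> borel_measurable borel \<and> sq_int \<xi> < \<infinity>"
  unfolding L2_fun_def sq_int_def by (auto simp: integrable_iff_bounded)

lemma L2_fun_measurable: "\<xi> \<in> L2_fun \<Longrightarrow> \<xi> \<in> borel_measurable borel" by (simp add: L2_fun_iff)

lemma L2_norm_nonneg: "0 \<le> L2_norm \<xi>" by (simp add: L2_norm_def)

lemma sq_int_L2_norm: "\<xi> \<in> L2_fun \<Longrightarrow> sq_int \<xi> = ennreal ((L2_norm \<xi>)\<^sup>2)"
  unfolding L2_fun_def sq_int_def L2_norm_def by (simp add: nn_integral_eq_integral)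

lemma sq_int_emb:
  assumes [measurable]: "\<xi> \<in> borel_measurable borel"
  shows "sq_int \<xi> = (\<integral>\<^sup>+r. sq_int (\<lambda>w. \<xi> (emb w r)) \<partial>lborel)"
  unfolding sq_int_def by (rule nn_integral_emb) measurable

text \<open>Membership of C in the set whose infimum is \<open>L2_opnorm\<close>. Working with
  bounds avoids the infimum, which is meaningful only once a bound exists.\<close>

definition op_bound :: "real \<Rightarrow> (('a::euclidean_space \<Rightarrow> complex) \<Rightarrow> 'a \<Rightarrow> complex) \<Rightarrow> bool" where
  "op_bound C T \<longleftrightarrow> 0 \<le> C \<and> (\<forall>\<xi>\<in>L2_fun. T \<xi> \<in> L2_fun \<and> L2_norm (T \<xi>) \<le> C * L2_norm \<xi>)"

lemma op_bound_iff:
  "op_bound C T \<longleftrightarrow> 0 \<le> C \<and> (\<forall>\<xi>\<in>L2_fun. T \<xi> \<in> borel_measurable borel \<and> sq_int (T \<xi>) \<le> ennreal (C\<^sup>2) * sq_int \<xi>)"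
proof -
  have "T \<xi> \<in> L2_fun \<and> L2_norm (T \<xi>) \<le> C * L2_norm \<xi> \<longleftrightarrow> T \<xi> \<in> borel_measurable borel \<and> sq_int (T \<xi>) \<le> ennreal (C\<^sup>2) * sq_int \<xi>"
    if C: "0 \<le> C" and xi: "\<xi> \<in> L2_fun" for \<xi>
  proof -
    have fin: "ennreal (C\<^sup>2) * sq_int \<xi> < \<infinity>" using xi by (simp add: L2_fun_iff ennreal_mult_less_top)
    have "L2_norm (T \<xi>) \<le> C * L2_norm \<xi> \<longleftrightarrow> sq_int (T \<xi>) \<le> ennreal (C\<^sup>2) * sq_int \<xi>" if T: "T \<xi> \<in> L2_fun"
    proof -
      have "L2_norm (T \<xi>) \<le> C * L2_norm \<xi> \<longleftrightarrow> (L2_norm (T \<xi>))\<^sup>2 \<le> (C * L2_norm \<xi>)\<^sup>2"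
        using C by (intro power_mono_iff[symmetric]) (auto simp: L2_norm_nonneg)
      also have "\<dots> \<longleftrightarrow> ennreal ((L2_norm (T \<xi>))\<^sup>2) \<le> ennreal ((C * L2_norm \<xi>)\<^sup>2)" by (simp add: ennreal_le_iff)
      also have "ennreal ((C * L2_norm \<xi>)\<^sup>2) = ennreal (C\<^sup>2) * sq_int \<xi>" by (simp add: sq_int_L2_norm[OF xi] power_mult_distrib ennreal_mult)
      finally show ?thesis by (simp add: sq_int_L2_norm[OF T])
    qed
    then show ?thesis using fin by (auto simp: L2_fun_iff order.strict_trans1)
  qed
  then show ?thesis unfolding op_bound_def by blast
qed

text \<open>The infimum of the bounds is itself a bound: divide by the norm of a vector if it is
  nonzero; on a vector of norm 0 any one bound already forces its image to have norm 0.\<close>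

lemma op_bound_opnorm:
  assumes "op_bound C T" shows "op_bound (L2_opnorm T) T" "L2_opnorm T \<le> C" "0 \<le> L2_opnorm T"
proof -
  let ?S = "{C. 0 \<le> C \<and> (\<forall>\<xi>\<in>L2_fun. T \<xi> \<in> L2_fun \<and> L2_norm (T \<xi>) \<le> C * L2_norm \<xi>)}"
  have C: "C \<in> ?S" using assms by (simp add: op_bound_def)
  have bb: "bdd_below ?S" by (rule bdd_belowI[of _ 0]) simp
  show "L2_opnorm T \<le> C" unfolding L2_opnorm_def by (rule cInf_lower[OF C bb])
  show nn: "0 \<le> L2_opnorm T" unfolding L2_opnorm_def by (rule cInf_greatest) (use C in auto)
  have "L2_norm (T \<xi>) \<le> L2_opnorm T * L2_norm \<xi>" if xi: "\<xi> \<in> L2_fun" for \<xi>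
  proof (cases "L2_norm \<xi> = 0")
    case True then show ?thesis using C xi by auto
  next
    case False
    then have pos: "L2_norm \<xi> > 0" using L2_norm_nonneg[of \<xi>] by simp
    have "L2_norm (T \<xi>) / L2_norm \<xi> \<le> L2_opnorm T"
      unfolding L2_opnorm_def by (rule cInf_greatest) (use C xi pos in \<open>auto simp: divide_le_eq\<close>)
    then show ?thesis using pos by (simp add: divide_le_eq)
  qed
  then show "op_bound (L2_opnorm T) T" using C nn by (simp add: op_bound_def)
qed

lemma ennreal_cmod_square: "ennreal ((cmod x)\<^sup>2) = (ennreal (cmod x))\<^sup>2"
  by (simp add: ennreal_power)

text \<open>Young's inequality for L^1 and L^2, fibre by fibre. The phase has modulus one; writing
  |F| as a product of two square roots, Cauchy-Schwarz leaves one factor B and the convolution of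
  |F| with |\<xi>|^2, whose integral costs a second factor B.\<close>

lemma sq_int_twc_le:
  assumes [measurable]: "F \<in> borel_measurable borel" "\<xi> \<in> borel_measurable borel"
    and B: "\<And>r. (\<integral>\<^sup>+w. ennreal (cmod (F (emb w r))) \<partial>lborel) \<le> ennreal B"
  shows "sq_int (twc lam c F \<xi>) \<le> ennreal (B\<^sup>2) * sq_int \<xi>"
proof (cases "B \<ge> 0")
  case False
  \<comment> \<open>\<open>ennreal\<close> sends negative numbers to 0, so F vanishes almost
    everywhere on each fibre in this case.\<close>
  then have B0: "ennreal B = 0" by (simp add: ennreal_neg)
  have "twc lam c F \<xi> z = 0" for z
  proof -
    have "(\<integral>\<^sup>+w. ennreal (cmod (F (emb w (rpart z)))) \<partial>lborel) = 0" using B[of "rpart z"] B0 by simp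
    then have "AE w in lborel. F (emb w (rpart z)) = 0" by (subst (asm) nn_integral_0_iff_AE) auto
    then show ?thesis unfolding twc_def by (intro integral_eq_zero_AE) auto
  qed
  then show ?thesis by (simp add: sq_int_def)
next
  case True
  have sl: "sq_int (\<lambda>x. twc lam c F \<xi> (emb x r)) \<le> ennreal (B\<^sup>2) * sq_int (\<lambda>w. \<xi> (emb w r))" for r
  proof -
    let ?f = "\<lambda>w. ennreal (cmod (F (emb w r)))" and ?x = "\<lambda>w. ennreal (cmod (\<xi> (emb w r)))"
    have pt: "ennreal ((cmod (twc lam c F \<xi> (emb x r)))\<^sup>2) \<le> ennreal B * (\<integral>\<^sup>+w. ?f w * (?x (x - w))\<^sup>2 \<partial>lborel)" for x
    proof -
      have "ennreal (cmod (twc lam c F \<xi> (emb x r))) \<le> (\<integral>\<^sup>+w. ?f w * ?x (x - w) \<partial>lborel)"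
        unfolding twc_def hpart_emb rpart_emb
        by (rule order_trans[OF norm_integral_le_nn]) (simp add: norm_mult ennreal_mult)
      also have "\<dots> = (\<integral>\<^sup>+w. ennreal (sqrt (cmod (F (emb w r)))) * (ennreal (sqrt (cmod (F (emb w r)))) * ?x (x - w)) \<partial>lborel)"
        by (intro nn_integral_cong) (simp add: mult.assoc[symmetric] flip: ennreal_mult)
      finally have "(ennreal (cmod (twc lam c F \<xi> (emb x r))))\<^sup>2 \<le> (\<integral>\<^sup>+w. ennreal (sqrt (cmod (F (emb w r)))) * (ennreal (sqrt (cmod (F (emb w r)))) * ?x (x - w)) \<partial>lborel)\<^sup>2"
        by (rule power_mono) simp
      also have "\<dots> \<le> (\<integral>\<^sup>+w. (ennreal (sqrt (cmod (F (emb w r)))))\<^sup>2 \<partial>lborel) * (\<integral>\<^sup>+w. (ennreal (sqrt (cmod (F (emb w r)))) * ?x (x - w))\<^sup>2 \<partial>lborel)"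
        by (rule Cauchy_Schwarz_nn_integral) measurable
      also have "\<dots> = (\<integral>\<^sup>+w. ?f w \<partial>lborel) * (\<integral>\<^sup>+w. ?f w * (?x (x - w))\<^sup>2 \<partial>lborel)"
        by (simp add: power_mult_distrib ennreal_power)
      also have "\<dots> \<le> ennreal B * (\<integral>\<^sup>+w. ?f w * (?x (x - w))\<^sup>2 \<partial>lborel)" by (intro mult_right_mono B) simp
      finally show ?thesis by (simp add: ennreal_cmod_square)
    qed
    have "sq_int (\<lambda>x. twc lam c F \<xi> (emb x r)) \<le> (\<integral>\<^sup>+x. ennreal B * (\<integral>\<^sup>+w. ?f w * (?x (x - w))\<^sup>2 \<partial>lborel) \<partial>lborel)"
      unfolding sq_int_def by (intro nn_integral_mono pt)
    also have "\<dots> = ennreal B * (\<integral>\<^sup>+x. \<integral>\<^sup>+w. ?f w * (?x (x - w))\<^sup>2 \<partial>lborel \<partial>lborel)"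
    proof (rule nn_integral_cmult)
      have "(\<lambda>x. \<integral>\<^sup>+w. ?f w * (?x (x - w))\<^sup>2 \<partial>lborel) \<in> borel_measurable borel"
        by (rule measurable_lborel_nn_integral) measurable
      then show "(\<lambda>x. \<integral>\<^sup>+w. ?f w * (?x (x - w))\<^sup>2 \<partial>lborel) \<in> borel_measurable lborel" by simp
    qed
    also have "(\<integral>\<^sup>+x. \<integral>\<^sup>+w. ?f w * (?x (x - w))\<^sup>2 \<partial>lborel \<partial>lborel) = (\<integral>\<^sup>+w. \<integral>\<^sup>+x. ?f w * (?x (x - w))\<^sup>2 \<partial>lborel \<partial>lborel)"
      using nn_integral_lborel_pair[of "\<lambda>s. ?f (snd s) * (?x (fst s - snd s))\<^sup>2"] by simp
    also have "\<dots> = (\<integral>\<^sup>+w. ?f w * sq_int (\<lambda>w. \<xi> (emb w r)) \<partial>lborel)"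
    proof (rule nn_integral_cong)
      fix w
      have "(\<integral>\<^sup>+x. ?f w * (?x (x - w))\<^sup>2 \<partial>lborel) = ?f w * (\<integral>\<^sup>+x. (?x (x + - w))\<^sup>2 \<partial>lborel)"
        by (simp add: nn_integral_cmult)
      also have "(\<integral>\<^sup>+x. (?x (x + - w))\<^sup>2 \<partial>lborel) = sq_int (\<lambda>w. \<xi> (emb w r))"
        unfolding sq_int_def by (subst nn_integral_lborel_translate[where f="\<lambda>x. (?x x)\<^sup>2"]) (auto simp: ennreal_cmod_square)
      finally show "(\<integral>\<^sup>+x. ?f w * (?x (x - w))\<^sup>2 \<partial>lborel) = ?f w * sq_int (\<lambda>w. \<xi> (emb w r))" .
    qed
    also have "\<dots> = (\<integral>\<^sup>+w. ?f w \<partial>lborel) * sq_int (\<lambda>w. \<xi> (emb w r))" by (rule nn_integral_multc) measurable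
    also have "ennreal B * \<dots> \<le> ennreal B * (ennreal B * sq_int (\<lambda>w. \<xi> (emb w r)))"
      by (intro mult_left_mono mult_right_mono B) auto
    also have "\<dots> = ennreal (B\<^sup>2) * sq_int (\<lambda>w. \<xi> (emb w r))"
      using True by (simp add: power2_eq_square ennreal_mult mult.assoc)
    finally show ?thesis .
  qed
  have "sq_int (twc lam c F \<xi>) = (\<integral>\<^sup>+r. sq_int (\<lambda>x. twc lam c F \<xi> (emb x r)) \<partial>lborel)"
    by (rule sq_int_emb) measurable
  also have "\<dots> \<le> (\<integral>\<^sup>+r. ennreal (B\<^sup>2) * sq_int (\<lambda>w. \<xi> (emb w r)) \<partial>lborel)" by (intro nn_integral_mono sl)
  also have "\<dots> = ennreal (B\<^sup>2) * (\<integral>\<^sup>+r. sq_int (\<lambda>w. \<xi> (emb w r)) \<partial>lborel)"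
  proof (rule nn_integral_cmult)
    have "(\<lambda>r. sq_int (\<lambda>w. \<xi> (emb w r))) \<in> borel_measurable borel"
      unfolding sq_int_def by (rule measurable_lborel_nn_integral) measurable
    then show "(\<lambda>r. sq_int (\<lambda>w. \<xi> (emb w r))) \<in> borel_measurable lborel" by simp
  qed
  also have "\<dots> = ennreal (B\<^sup>2) * sq_int \<xi>" by (subst sq_int_emb[of \<xi>]) auto
  finally show ?thesis .
qed

text \<open>Membership in \<open>S3c\<close> would be too narrow: \<open>transference\<close>
  produces kernels F k with k bounded and measurable. Domination by \<open>wt\<close> makes the
  slices both integrable and square integrable, with bounds uniform in r.\<close>

definition dom_kernel :: "('n::finite G \<Rightarrow> complex) \<Rightarrow> bool" where
  "dom_kernel F \<longleftrightarrow> F \<in> borel_measurable borel \<and> (\<exists>C. \<forall>w r. cmod (F (emb w r)) \<le> C * wt w)"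

lemma dom_kernel_S3c: "F \<in> S3c \<Longrightarrow> dom_kernel F"
  unfolding dom_kernel_def using S3c_measurable S3c_wt0 by metis

lemma dom_kernel_bound:
  fixes F :: "'n::finite G \<Rightarrow> complex"
  assumes "dom_kernel F" obtains B where "B \<ge> 0" "\<And>r. (\<integral>\<^sup>+w. ennreal (cmod (F (emb w r))) \<partial>lborel) \<le> ennreal B"
proof -
  obtain C where C: "\<And>w r. cmod (F (emb w r)) \<le> C * wt w" using assms unfolding dom_kernel_def by blast
  have C0: "C * wt w \<ge> 0" for w :: "'n V" using order_trans[OF norm_ge_zero C] .
  have "(\<integral>\<^sup>+w. ennreal (cmod (F (emb w r))) \<partial>lborel) \<le> ennreal (LINT w|lborel. C * wt (w::'n V))" for r
    using C C0 by (subst nn_integral_eq_integral[symmetric]) (auto intro!: nn_integral_mono ennreal_leI integrable_wt)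
  moreover have "0 \<le> (LINT w|lborel. C * wt (w::'n V))" by (intro integral_nonneg_AE AE_I2 C0)
  ultimately show ?thesis using that by blast
qed

lemma op_bound_twc:
  assumes "dom_kernel F" "B \<ge> 0" "\<And>r. (\<integral>\<^sup>+w. ennreal (cmod (F (emb w r))) \<partial>lborel) \<le> ennreal B"
  shows "op_bound B (twc lam c F)"
proof -
  have m: "F \<in> borel_measurable borel" using assms(1) by (simp add: dom_kernel_def)
  have "twc lam c F \<xi> \<in> borel_measurable borel \<and> sq_int (twc lam c F \<xi>) \<le> ennreal (B\<^sup>2) * sq_int \<xi>" if "\<xi> \<in> L2_fun" for \<xi>
    by (rule conjI[OF twc_measurable[OF m L2_fun_measurable[OF that]] sq_int_twc_le[OF m L2_fun_measurable[OF that] assms(3)]])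
  then show ?thesis unfolding op_bound_iff using assms(2) by blast
qed

lemma norm_h_twc: "norm_h lam h \<phi> = L2_opnorm (twc lam (- h) (vee \<phi>))"
proof -
  have "L_h lam h \<phi> = twc lam (- h) (vee \<phi>)" by (intro ext L_h_twc)
  then show ?thesis by (simp add: norm_h_def)
qed

lemma norm_h_props:
  assumes "\<phi> \<in> S3c"
  shows "op_bound (norm_h lam h \<phi>) (twc lam (- h) (vee \<phi>))" "0 \<le> norm_h lam h \<phi>"
    "op_bound C (twc lam (- h) (vee \<phi>)) \<Longrightarrow> norm_h lam h \<phi> \<le> C"
proof -
  have dk: "dom_kernel (vee \<phi>)" using assms by (intro dom_kernel_S3c vee_S3c)
  then obtain B where "op_bound B (twc lam (- h) (vee \<phi>))" using dom_kernel_bound op_bound_twc by metis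
  then show "op_bound (norm_h lam h \<phi>) (twc lam (- h) (vee \<phi>))" "0 \<le> norm_h lam h \<phi>"
    "op_bound C (twc lam (- h) (vee \<phi>)) \<Longrightarrow> norm_h lam h \<phi> \<le> C"
    unfolding norm_h_twc using op_bound_opnorm by blast+
qed

lemma norm_h_le:
  assumes "\<phi> \<in> S3c" "B \<ge> 0" "\<And>r. (\<integral>\<^sup>+w. ennreal (cmod (vee \<phi> (emb w r))) \<partial>lborel) \<le> ennreal B"
  shows "norm_h lam h \<phi> \<le> B"
  using assms by (intro norm_h_props op_bound_twc dom_kernel_S3c vee_S3c)

subsection \<open>The operators form a C*-normed algebra\<close>

lemma cnj_measurable [measurable]: "cnj \<in> borel_measurable borel"
  by (intro borel_measurable_continuous_onI continuous_intros)

lemma wt_le_1: "wt w \<le> 1"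
  unfolding wt_def by (intro prod_le_1) (auto simp: inverse_le_1_iff add_nonneg_nonneg)

lemma continuous_AE_zero:
  fixes f :: "'a::euclidean_space \<Rightarrow> complex"
  assumes c: "continuous_on UNIV f" and ae: "AE x in lborel. f x = 0" shows "f x = 0"
proof (rule ccontr)
  assume "f x \<noteq> 0"
  have o: "open {x. f x \<noteq> 0}" using open_Collect_neq[OF c continuous_on_const[of _ 0]] by simp
  have "{x. f x \<noteq> 0} \<in> null_sets lborel"
    using ae o by (simp add: AE_iff_null_sets borel_open)
  then have "negligible {x. f x \<noteq> 0}" using null_sets_completionI negligible_iff_null_sets by blast
  then show False using open_not_negligible[OF o] \<open>f x \<noteq> 0\<close> by auto
qed

lemma sq_int_eq_0:
  assumes "continuous_on UNIV f" "sq_int f = 0" shows "f x = 0"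
proof (rule continuous_AE_zero[OF assms(1)])
  have [measurable]: "f \<in> borel_measurable borel" using assms(1) by (rule borel_measurable_continuous_onI)
  have "AE x in lborel. ennreal ((cmod (f x))\<^sup>2) = 0"
    using assms(2) unfolding sq_int_def by (subst (asm) nn_integral_0_iff_AE) auto
  then show "AE x in lborel. f x = 0" by eventually_elim (simp add: ennreal_eq_0_iff)
qed

lemma S3c_L2_fun:
  fixes f :: "'n::finite G \<Rightarrow> complex"
  assumes f: "f \<in> S3c" shows "f \<in> L2_fun"
proof -
  note [measurable] = S3c_measurable[OF f]
  obtain C where C: "C \<ge> 0" "\<And>z (v::'n G). norm v \<le> norm z \<Longrightarrow> cmod (f z) \<le> C * wt v" using S3c_wt_gen[OF f] by metis
  have "integrable lborel (\<lambda>z. (cmod (f z))\<^sup>2)"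
  proof (rule Bochner_Integration.integrable_bound[of _ "\<lambda>z. C\<^sup>2 * wt z"])
    show "integrable lborel (\<lambda>z::'n G. C\<^sup>2 * wt z)" by (intro integrable_mult_right integrable_wt)
    show "AE z in lborel. norm ((cmod (f z))\<^sup>2) \<le> norm (C\<^sup>2 * wt z)"
    proof (rule AE_I2)
      fix z :: "'n G"
      have "(cmod (f z))\<^sup>2 \<le> (C * wt z)\<^sup>2" using C(2)[of z z] by (intro power_mono) auto
      also have "\<dots> \<le> C\<^sup>2 * wt z"
        unfolding power_mult_distrib using wt_le_1[of z] wt_nonneg[of z]
        by (intro mult_left_mono) (auto simp: power2_eq_square mult_left_le)
      finally show "norm ((cmod (f z))\<^sup>2) \<le> norm (C\<^sup>2 * wt z)" by (simp add: wt_nonneg)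
    qed
  qed measurable
  then show ?thesis by (simp add: L2_fun_def)
qed

text \<open>An L^2 function is determined up to null sets, whereas \<open>twc\<close> is evaluated
  pointwise. On a good fibre its integral converges absolutely at every point, since kernel slices
  are square integrable too, and almost every fibre is good.\<close>

definition good :: "('n::finite G \<Rightarrow> complex) \<Rightarrow> real \<Rightarrow> bool" where
  "good \<xi> r \<longleftrightarrow> sq_int (\<lambda>w. \<xi> (emb w r)) < \<infinity>"

lemma AE_good:
  fixes \<xi> :: "'n::finite G \<Rightarrow> complex"
  assumes "\<xi> \<in> L2_fun" shows "AE r in lborel. good \<xi> r"
proof -
  note [measurable] = L2_fun_measurable[OF assms]
  have m: "(\<lambda>r. sq_int (\<lambda>w. \<xi> (emb w r))) \<in> borel_measurable lborel"
    unfolding sq_int_def using measurable_lborel_nn_integral[of "\<lambda>r w. ennreal ((cmod (\<xi> (emb w r)))\<^sup>2)"] by simp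
  have "(\<integral>\<^sup>+r. sq_int (\<lambda>w. \<xi> (emb w r)) \<partial>lborel) \<noteq> \<infinity>"
    using assms sq_int_emb[of \<xi>] by (simp add: L2_fun_iff)
  from nn_integral_PInf_AE[OF m this] show ?thesis by eventually_elim (simp add: good_def top.not_eq_extremum)
qed

lemma good_S3c: assumes "f \<in> S3c" shows "good f r"
proof -
  note [measurable] = S3c_slice_measurable[OF assms, of r]
  obtain C where C: "C \<ge> 0" "\<And>w r. cmod (f (emb w r)) \<le> C * wt w" using S3c_wt0[OF assms] by metis
  obtain D where D: "D \<ge> 0" "\<And>z. cmod (f z) \<le> D" using S3c_bounded[OF assms] by metis
  have "integrable lborel (\<lambda>w. f (emb w r) * f (emb w r))"
    by (rule integrable_wtI[where C="C * D"]) (measurable, use mult_mono[OF C(2) D(2)] C D in \<open>auto simp: norm_mult mult_ac wt_nonneg\<close>)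
  then show ?thesis unfolding good_def sq_int_def
    by (simp add: integrable_iff_bounded norm_mult power2_eq_square)
qed

text \<open>The Fubini hypothesis for associativity, adjoints and \<open>transference\<close>. The
  product of a and b is at most the sum of their squares; the shifts depend on the other variable
  only, so translation invariance leaves the L^1 norm of F as a factor.\<close>

lemma triple_integrable:
  fixes F :: "'b::euclidean_space \<Rightarrow> complex" and a b :: "'a::euclidean_space \<Rightarrow> complex"
  assumes F: "integrable lborel F" and [measurable]: "a \<in> borel_measurable borel" "b \<in> borel_measurable borel"
    "\<sigma> \<in> borel \<rightarrow>\<^sub>M borel" "\<tau> \<in> borel \<rightarrow>\<^sub>M borel"
    and a: "sq_int a < \<infinity>" and b: "sq_int b < \<infinity>"
  shows "integrable lborel (\<lambda>s. F (snd s) * (a (fst s + \<sigma> (snd s)) * b (fst s + \<tau> (snd s))))"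
proof (rule integrable_lborel_pairI)
  have [measurable]: "F \<in> borel_measurable borel" using borel_measurable_integrable[OF F] by simp
  show "(\<lambda>s. F (snd s) * (a (fst s + \<sigma> (snd s)) * b (fst s + \<tau> (snd s)))) \<in> borel_measurable borel" by measurable
  have in_le: "(\<integral>\<^sup>+x. ennreal (cmod (F w * (a (x + \<sigma> w) * b (x + \<tau> w)))) \<partial>lborel) \<le> ennreal (cmod (F w)) * (sq_int a + sq_int b)" for w
  proof -
    have "(\<integral>\<^sup>+x. ennreal (cmod (F w * (a (x + \<sigma> w) * b (x + \<tau> w)))) \<partial>lborel) = ennreal (cmod (F w)) * (\<integral>\<^sup>+x. ennreal (cmod (a (x + \<sigma> w)) * cmod (b (x + \<tau> w))) \<partial>lborel)"
      by (simp add: norm_mult ennreal_mult nn_integral_cmult)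
    also have "(\<integral>\<^sup>+x. ennreal (cmod (a (x + \<sigma> w)) * cmod (b (x + \<tau> w))) \<partial>lborel) \<le> (\<integral>\<^sup>+x. ennreal ((cmod (a (x + \<sigma> w)))\<^sup>2) + ennreal ((cmod (b (x + \<tau> w)))\<^sup>2) \<partial>lborel)"
    proof (rule nn_integral_mono)
      fix x
      have "cmod (a (x + \<sigma> w)) * cmod (b (x + \<tau> w)) \<le> (cmod (a (x + \<sigma> w)))\<^sup>2 + (cmod (b (x + \<tau> w)))\<^sup>2"
        using sum_squares_bound[of "cmod (a (x + \<sigma> w))" "cmod (b (x + \<tau> w))"] mult_nonneg_nonneg[OF norm_ge_zero norm_ge_zero, of "a (x + \<sigma> w)" "b (x + \<tau> w)"] by linarith
      then show "ennreal (cmod (a (x + \<sigma> w)) * cmod (b (x + \<tau> w))) \<le> ennreal ((cmod (a (x + \<sigma> w)))\<^sup>2) + ennreal ((cmod (b (x + \<tau> w)))\<^sup>2)"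
        by (simp add: ennreal_leI flip: ennreal_plus)
    qed
    also have "\<dots> = sq_int a + sq_int b"
      unfolding sq_int_def
      by (simp add: nn_integral_add nn_integral_lborel_translate[where f="\<lambda>x. ennreal ((cmod (a x))\<^sup>2)"] nn_integral_lborel_translate[where f="\<lambda>x. ennreal ((cmod (b x))\<^sup>2)"])
    finally show ?thesis by (auto simp: mult_left_mono)
  qed
  have "(\<integral>\<^sup>+x. \<integral>\<^sup>+w. ennreal (cmod (F w * (a (x + \<sigma> w) * b (x + \<tau> w)))) \<partial>lborel \<partial>lborel) = (\<integral>\<^sup>+w. \<integral>\<^sup>+x. ennreal (cmod (F w * (a (x + \<sigma> w) * b (x + \<tau> w)))) \<partial>lborel \<partial>lborel)"
    using nn_integral_lborel_pair[of "\<lambda>s. ennreal (cmod (F (snd s) * (a (fst s + \<sigma> (snd s)) * b (fst s + \<tau> (snd s)))))"] by simp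
  also have "\<dots> \<le> (\<integral>\<^sup>+w. ennreal (cmod (F w)) * (sq_int a + sq_int b) \<partial>lborel)" by (intro nn_integral_mono in_le)
  also have "\<dots> = (\<integral>\<^sup>+w. ennreal (cmod (F w)) \<partial>lborel) * (sq_int a + sq_int b)" by (rule nn_integral_multc) measurable
  also have "\<dots> < \<infinity>" using F a b by (simp add: integrable_iff_bounded ennreal_mult_less_top)
  finally show "(\<integral>\<^sup>+x. \<integral>\<^sup>+w. ennreal (cmod (F (snd (x, w)) * (a (fst (x, w) + \<sigma> (snd (x, w))) * b (fst (x, w) + \<tau> (snd (x, w)))))) \<partial>lborel \<partial>lborel) < \<infinity>" by simp
qed

lemma dom_kernel_slice:
  assumes "dom_kernel F"
  shows "F \<in> borel_measurable borel" "integrable lborel (\<lambda>w. F (emb w r))" "sq_int (\<lambda>w. F (emb w r)) < \<infinity>"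
proof -
  show m: "F \<in> borel_measurable borel" using assms by (simp add: dom_kernel_def)
  note [measurable] = m
  obtain C where C: "\<And>w r. cmod (F (emb w r)) \<le> C * wt w" using assms unfolding dom_kernel_def by blast
  show "integrable lborel (\<lambda>w. F (emb w r))" by (rule integrable_wtI[OF _ C]) measurable
  have "integrable lborel (\<lambda>w. F (emb w r) * F (emb w r))"
  proof (rule integrable_wtI[where C="C * \<bar>C\<bar>"])
    fix w :: "'a V"
    have c0: "0 \<le> C * wt w" using order_trans[OF norm_ge_zero C[of w r]] .
    have "cmod (F (emb w r) * F (emb w r)) \<le> (C * wt w) * (C * wt w)"
      unfolding norm_mult by (intro mult_mono C c0) auto
    also have "\<dots> \<le> (C * wt w) * \<bar>C\<bar>"
    proof (rule mult_left_mono[OF _ c0])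
      have "C * wt w \<le> \<bar>C\<bar> * wt w" by (intro mult_right_mono wt_nonneg) auto
      also have "\<dots> \<le> \<bar>C\<bar>" using wt_le_1[of w] by (simp add: mult_left_le)
      finally show "C * wt w \<le> \<bar>C\<bar>" .
    qed
    finally show "cmod (F (emb w r) * F (emb w r)) \<le> C * \<bar>C\<bar> * wt w" by (simp add: mult_ac)
  qed measurable
  then show "sq_int (\<lambda>w. F (emb w r)) < \<infinity>" unfolding sq_int_def
    by (simp add: integrable_iff_bounded norm_mult power2_eq_square)
qed

lemma sq_int_reflect:
  assumes [measurable]: "f \<in> borel_measurable borel" shows "sq_int (\<lambda>w. f (x - w)) = sq_int f"
  unfolding sq_int_def by (rule nn_integral_lborel_reflect[where f="\<lambda>x. ennreal ((cmod (f x))\<^sup>2)"]) measurable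

lemma mult_integrable_sq_int:
  fixes a b :: "'a::euclidean_space \<Rightarrow> complex"
  assumes [measurable]: "a \<in> borel_measurable borel" "b \<in> borel_measurable borel" and a: "sq_int a < \<infinity>" and b: "sq_int b < \<infinity>"
  shows "integrable lborel (\<lambda>x. a x * b x)"
proof (rule integrableI_bounded)
  have "(\<integral>\<^sup>+x. ennreal (cmod (a x * b x)) \<partial>lborel) \<le> (\<integral>\<^sup>+x. ennreal ((cmod (a x))\<^sup>2) + ennreal ((cmod (b x))\<^sup>2) \<partial>lborel)"
  proof (rule nn_integral_mono)
    fix x
    have "cmod (a x) * cmod (b x) \<le> (cmod (a x))\<^sup>2 + (cmod (b x))\<^sup>2"
      using sum_squares_bound[of "cmod (a x)" "cmod (b x)"] mult_nonneg_nonneg[OF norm_ge_zero norm_ge_zero, of "a x" "b x"] by linarith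
    then show "ennreal (cmod (a x * b x)) \<le> ennreal ((cmod (a x))\<^sup>2) + ennreal ((cmod (b x))\<^sup>2)"
      by (simp add: ennreal_leI norm_mult flip: ennreal_plus)
  qed
  also have "\<dots> = sq_int a + sq_int b" unfolding sq_int_def by (rule nn_integral_add) measurable
  also have "\<dots> < \<infinity>" using a b by simp
  finally show "(\<integral>\<^sup>+x. ennreal (cmod (a x * b x)) \<partial>lborel) < \<infinity>" .
qed measurable

lemma twc_good_integrable:
  assumes F: "dom_kernel F" and xi: "\<xi> \<in> borel_measurable borel" "good \<xi> r"
  shows "integrable lborel (\<lambda>w. F (emb w r) * \<xi> (emb (x - w) r) * ee (c * (fst w \<bullet> snd (x - w))))"
proof -
  note [measurable] = dom_kernel_slice(1)[OF F] xi(1)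
  have "integrable lborel (\<lambda>w. F (emb w r) * \<xi> (emb (x - w) r))"
  proof (rule mult_integrable_sq_int)
    show "sq_int (\<lambda>w. \<xi> (emb (x - w) r)) < \<infinity>"
      using xi(2) unfolding good_def by (subst sq_int_reflect[of "\<lambda>w. \<xi> (emb w r)"]) auto
  qed (use dom_kernel_slice(3)[OF F] in auto)
  then have "integrable lborel (\<lambda>w. ee (c * (fst w \<bullet> snd (x - w))) * (F (emb w r) * \<xi> (emb (x - w) r)))"
    by (rule integrable_ee_mult) measurable
  then show ?thesis by (simp add: mult_ac)
qed

lemma twc_add_good:
  assumes F: "dom_kernel F" and G: "dom_kernel G" and xi: "\<xi> \<in> borel_measurable borel" "good \<xi> (rpart z)"
  shows "twc lam c (\<lambda>z. F z + G z) \<xi> z = twc lam c F \<xi> z + twc lam c G \<xi> z"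
  unfolding twc_def using twc_good_integrable[OF F xi] twc_good_integrable[OF G xi]
  by (simp add: distrib_right flip: Bochner_Integration.integral_add)

lemma sq_int_cong_AE: "AE z in lborel. f z = g z \<Longrightarrow> sq_int f = sq_int g"
  unfolding sq_int_def by (rule nn_integral_cong_AE) (auto elim: eventually_mono)

lemma ennreal_power2_le: assumes "(x::ennreal)\<^sup>2 \<le> (ennreal y)\<^sup>2" "y \<ge> 0" shows "x \<le> ennreal y"
proof (cases x)
  case (real x')
  then have "x'\<^sup>2 \<le> y\<^sup>2" using assms by (simp add: ennreal_power)
  then show ?thesis using real assms(2) power2_le_imp_le by (simp add: ennreal_leI)
next
  case top
  then show ?thesis using assms by (simp add: ennreal_power power2_eq_square ennreal_top_mult top_unique ennreal_mult_eq_top_iff)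
qed

lemma Cauchy_Schwarz_sq_int:
  assumes [measurable]: "f \<in> borel_measurable borel" "g \<in> borel_measurable borel"
    and "sq_int f \<le> ennreal (a\<^sup>2)" "sq_int g \<le> ennreal (b\<^sup>2)" "a \<ge> 0" "b \<ge> 0"
  shows "(\<integral>\<^sup>+z. ennreal (cmod (f z)) * ennreal (cmod (g z)) \<partial>lborel) \<le> ennreal (a * b)"
proof (rule ennreal_power2_le)
  have "(\<integral>\<^sup>+z. ennreal (cmod (f z)) * ennreal (cmod (g z)) \<partial>lborel)\<^sup>2 \<le> sq_int f * sq_int g"
    unfolding sq_int_def ennreal_cmod_square by (rule Cauchy_Schwarz_nn_integral) measurable
  also have "\<dots> \<le> ennreal (a\<^sup>2) * ennreal (b\<^sup>2)" by (intro mult_mono assms) auto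
  also have "\<dots> = (ennreal (a * b))\<^sup>2" using assms by (simp add: ennreal_power power_mult_distrib ennreal_mult)
  finally show "(\<integral>\<^sup>+z. ennreal (cmod (f z)) * ennreal (cmod (g z)) \<partial>lborel)\<^sup>2 \<le> (ennreal (a * b))\<^sup>2" .
qed (use assms in auto)

lemma sq_int_add_le:
  assumes [measurable]: "f \<in> borel_measurable borel" "g \<in> borel_measurable borel"
    and *: "sq_int f \<le> ennreal (a\<^sup>2)" "sq_int g \<le> ennreal (b\<^sup>2)" "a \<ge> 0" "b \<ge> 0"
  shows "sq_int (\<lambda>z. f z + g z) \<le> ennreal ((a + b)\<^sup>2)"
proof -
  have "sq_int (\<lambda>z. f z + g z) \<le> (\<integral>\<^sup>+z. (ennreal ((cmod (f z))\<^sup>2) + ennreal ((cmod (g z))\<^sup>2)) + 2 * (ennreal (cmod (f z)) * ennreal (cmod (g z))) \<partial>lborel)"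
    unfolding sq_int_def
  proof (rule nn_integral_mono)
    fix z
    have "(cmod (f z + g z))\<^sup>2 \<le> (cmod (f z) + cmod (g z))\<^sup>2" by (intro power_mono norm_triangle_ineq) auto
    also have "\<dots> = ((cmod (f z))\<^sup>2 + (cmod (g z))\<^sup>2) + 2 * (cmod (f z) * cmod (g z))" by (simp add: power2_sum)
    finally have "ennreal ((cmod (f z + g z))\<^sup>2) \<le> ennreal (((cmod (f z))\<^sup>2 + (cmod (g z))\<^sup>2) + 2 * (cmod (f z) * cmod (g z)))" by (rule ennreal_leI)
    also have "\<dots> = (ennreal ((cmod (f z))\<^sup>2) + ennreal ((cmod (g z))\<^sup>2)) + 2 * (ennreal (cmod (f z)) * ennreal (cmod (g z)))"
      by (simp add: ennreal_mult)
    finally show "ennreal ((cmod (f z + g z))\<^sup>2) \<le> (ennreal ((cmod (f z))\<^sup>2) + ennreal ((cmod (g z))\<^sup>2)) + 2 * (ennreal (cmod (f z)) * ennreal (cmod (g z)))" .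
  qed
  also have "\<dots> = (sq_int f + sq_int g) + 2 * (\<integral>\<^sup>+z. ennreal (cmod (f z)) * ennreal (cmod (g z)) \<partial>lborel)"
    unfolding sq_int_def by (simp add: nn_integral_add nn_integral_cmult)
  also have "\<dots> \<le> (ennreal (a\<^sup>2) + ennreal (b\<^sup>2)) + 2 * ennreal (a * b)"
    by (intro add_mono mult_left_mono * Cauchy_Schwarz_sq_int) auto
  also have "\<dots> = ennreal ((a + b)\<^sup>2)"
    using assms by (simp add: power2_sum ennreal_mult mult.assoc)
  finally show ?thesis .
qed

text \<open>The convolution integral splits where both parts converge, that is on good fibres and
  hence almost everywhere; the triangle inequality of L^2 does the rest.\<close>

lemma op_bound_twc_add:
  assumes F: "dom_kernel F" and G: "dom_kernel G" and a: "op_bound a (twc lam c F)" and b: "op_bound b (twc lam c G)"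
  shows "op_bound (a + b) (twc lam c (\<lambda>z. F z + G z))"
  unfolding op_bound_iff
proof (intro conjI ballI)
  show "0 \<le> a + b" using a b by (simp add: op_bound_def)
  fix \<xi> :: "'a G \<Rightarrow> complex" assume xi: "\<xi> \<in> L2_fun"
  note m[measurable] = dom_kernel_slice(1)[OF F] dom_kernel_slice(1)[OF G] L2_fun_measurable[OF xi]
  show "twc lam c (\<lambda>z. F z + G z) \<xi> \<in> borel_measurable borel" by measurable
  have "sq_int (twc lam c (\<lambda>z. F z + G z) \<xi>) = sq_int (\<lambda>z. twc lam c F \<xi> z + twc lam c G \<xi> z)"
    using AE_rpart[OF AE_good[OF xi]] by (intro sq_int_cong_AE) (auto elim!: eventually_mono intro: twc_add_good[OF F G m(3)])
  also have "\<dots> \<le> ennreal ((a * L2_norm \<xi> + b * L2_norm \<xi>)\<^sup>2)"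
  proof (rule sq_int_add_le)
    show "sq_int (twc lam c F \<xi>) \<le> ennreal ((a * L2_norm \<xi>)\<^sup>2)" "sq_int (twc lam c G \<xi>) \<le> ennreal ((b * L2_norm \<xi>)\<^sup>2)"
      using a b xi unfolding op_bound_iff sq_int_L2_norm[OF xi] by (auto simp: power_mult_distrib ennreal_mult sq_int_L2_norm[OF xi])
  qed (use a b in \<open>auto simp: op_bound_def L2_norm_nonneg\<close>)
  also have "\<dots> = ennreal ((a + b)\<^sup>2) * sq_int \<xi>"
    by (simp add: sq_int_L2_norm[OF xi] power_mult_distrib ennreal_mult flip: distrib_right)
  finally show "sq_int (twc lam c (\<lambda>z. F z + G z) \<xi>) \<le> ennreal ((a + b)\<^sup>2) * sq_int \<xi>" .
qed

lemma op_bound_twc_cmult: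
  assumes "dom_kernel F" "op_bound a (twc lam c F)" shows "op_bound (cmod s * a) (twc lam c (\<lambda>z. s * F z))"
  unfolding op_bound_iff
proof (intro conjI ballI)
  show "0 \<le> cmod s * a" using assms by (simp add: op_bound_def)
  fix \<xi> :: "'a G \<Rightarrow> complex" assume xi: "\<xi> \<in> L2_fun"
  note [measurable] = dom_kernel_slice(1)[OF assms(1)] L2_fun_measurable[OF xi]
  show "twc lam c (\<lambda>z. s * F z) \<xi> \<in> borel_measurable borel" by measurable
  have "sq_int (twc lam c (\<lambda>z. s * F z) \<xi>) = ennreal ((cmod s)\<^sup>2) * sq_int (twc lam c F \<xi>)"
    unfolding sq_int_def twc_cmult by (simp add: norm_mult power_mult_distrib ennreal_mult nn_integral_cmult)
  also have "\<dots> \<le> ennreal ((cmod s)\<^sup>2) * (ennreal (a\<^sup>2) * sq_int \<xi>)"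
    using assms xi by (intro mult_left_mono) (auto simp: op_bound_iff)
  finally show "sq_int (twc lam c (\<lambda>z. s * F z) \<xi>) \<le> ennreal ((cmod s * a)\<^sup>2) * sq_int \<xi>"
    by (simp add: power_mult_distrib ennreal_mult mult.assoc)
qed

lemma norm_h_add:
  assumes "\<phi> \<in> S3c" "\<psi> \<in> S3c" shows "norm_h lam h (\<lambda>z. \<phi> z + \<psi> z) \<le> norm_h lam h \<phi> + norm_h lam h \<psi>"
proof (rule norm_h_props(3)[OF S3c_add[OF assms]])
  have "vee (\<lambda>z. \<phi> z + \<psi> z) = (\<lambda>z. vee \<phi> z + vee \<psi> z)" using assms by (intro ext vee_add)
  then show "op_bound (norm_h lam h \<phi> + norm_h lam h \<psi>) (twc lam (- h) (vee (\<lambda>z. \<phi> z + \<psi> z)))"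
    by (simp only:) (intro op_bound_twc_add norm_h_props(1) dom_kernel_S3c vee_S3c assms)
qed

lemma norm_h_cmult_le:
  assumes "\<phi> \<in> S3c" shows "norm_h lam h (\<lambda>z. s * \<phi> z) \<le> cmod s * norm_h lam h \<phi>"
proof (rule norm_h_props(3)[OF S3c_cmult[OF assms]])
  have "vee (\<lambda>z. s * \<phi> z) = (\<lambda>z. s * vee \<phi> z)" by (intro ext vee_cmult)
  then show "op_bound (cmod s * norm_h lam h \<phi>) (twc lam (- h) (vee (\<lambda>z. s * \<phi> z)))"
    by (simp only:) (intro op_bound_twc_cmult norm_h_props(1) dom_kernel_S3c vee_S3c assms)
qed

lemma norm_h_cmult:
  assumes "\<phi> \<in> S3c" shows "norm_h lam h (\<lambda>z. s * \<phi> z) = cmod s * norm_h lam h \<phi>"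
proof (cases "s = 0")
  case True
  then show ?thesis using norm_h_cmult_le[OF assms, of lam h s] norm_h_props(2)[OF S3c_cmult[OF assms], of lam h s] by simp
next
  case False
  have "cmod s * norm_h lam h \<phi> \<le> cmod s * (cmod (inverse s) * norm_h lam h (\<lambda>z. s * \<phi> z))"
    using norm_h_cmult_le[OF S3c_cmult[OF assms], of lam h "inverse s" s] False by (intro mult_left_mono) (simp_all add: mult.assoc[symmetric])
  also have "\<dots> = norm_h lam h (\<lambda>z. s * \<phi> z)" using False by (simp add: norm_inverse)
  finally show ?thesis using norm_h_cmult_le[OF assms, of lam h s] by simp
qed

text \<open>Bilinearity of the exponent makes the phase a 2-cocycle. For an L^2 vector \<xi> the
  identity says that the operators multiply like the kernels; for \<xi> in \<open>S3c\<close> it is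
  associativity of the deformed product.\<close>

lemma twc_assoc:
  fixes F G \<xi> :: "'n::finite G \<Rightarrow> complex"
  assumes F: "dom_kernel F" and G: "dom_kernel G" and xi: "\<xi> \<in> borel_measurable borel" "good \<xi> (rpart z)"
  shows "twc lam c F (twc lam c G \<xi>) z = twc lam c (twc lam c F G) \<xi> z"
proof -
  let ?r = "rpart z" and ?x = "hpart z"
  define t where "t = c * eta lam ?r"
  let ?F = "\<lambda>w. F (emb w ?r)" and ?G = "\<lambda>w. G (emb w ?r)" and ?X = "\<lambda>w. \<xi> (emb w ?r)"
  note [measurable] = dom_kernel_slice(1)[OF F] dom_kernel_slice(1)[OF G] xi(1)
  have "integrable lborel (\<lambda>s::'n V \<times> 'n V. ?F (snd s) * (?G (fst s + - snd s) * ?X (?x - (fst s + 0))))"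
    using dom_kernel_slice[OF F] dom_kernel_slice[OF G] xi(2) unfolding good_def
    by (intro triple_integrable[where b="\<lambda>w. ?X (?x - w)" and \<sigma>=uminus and \<tau>="\<lambda>_. 0"]) (auto simp: sq_int_reflect[where f="?X"])
  then have "integrable lborel (\<lambda>s::'n V \<times> 'n V. ee (t * (fst (snd s) \<bullet> snd (fst s - snd s)) + t * (fst (fst s) \<bullet> snd (?x - fst s))) * (?F (snd s) * (?G (fst s + - snd s) * ?X (?x - (fst s + 0)))))"
    by (rule integrable_ee_mult) measurable
  then have int: "integrable lborel (\<lambda>s::'n V \<times> 'n V. ?F (snd s) * ?G (fst s - snd s) * ee (t * (fst (snd s) \<bullet> snd (fst s - snd s))) * (?X (?x - fst s) * ee (t * (fst (fst s) \<bullet> snd (?x - fst s)))))"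
    by (simp add: ee_add mult_ac)
  have "twc lam c (twc lam c F G) \<xi> z = (LINT u|lborel. LINT w|lborel. ?F w * ?G (u - w) * ee (t * (fst w \<bullet> snd (u - w))) * (?X (?x - u) * ee (t * (fst u \<bullet> snd (?x - u)))))"
    unfolding twc_def[of _ _ _ \<xi>] t_def
    by (rule Bochner_Integration.integral_cong[OF refl]) (simp add: twc_def mult.assoc flip: integral_mult_left_zero)
  also have "\<dots> = (LINT w|lborel. LINT u|lborel. ?F w * ?G (u - w) * ee (t * (fst w \<bullet> snd (u - w))) * (?X (?x - u) * ee (t * (fst u \<bullet> snd (?x - u)))))"
    by (rule integral_lborel_swap[OF int])
  also have "\<dots> = (LINT w|lborel. ?F w * twc lam c G \<xi> (emb (?x - w) ?r) * ee (t * (fst w \<bullet> snd (?x - w))))"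
  proof (rule Bochner_Integration.integral_cong[OF refl])
    fix w :: "'n V"
    have "(LINT u|lborel. ?F w * ?G (u - w) * ee (t * (fst w \<bullet> snd (u - w))) * (?X (?x - u) * ee (t * (fst u \<bullet> snd (?x - u)))))
      = (LINT v|lborel. ?F w * ?G ((v + w) - w) * ee (t * (fst w \<bullet> snd ((v + w) - w))) * (?X (?x - (v + w)) * ee (t * (fst (v + w) \<bullet> snd (?x - (v + w))))))"
      by (rule integral_lborel_translate[symmetric]) measurable
    also have "\<dots> = (LINT v|lborel. (?F w * ee (t * (fst w \<bullet> snd (?x - w)))) * (?G v * ?X ((?x - w) - v) * ee (t * (fst v \<bullet> snd ((?x - w) - v)))))"
    proof (rule Bochner_Integration.integral_cong[OF refl])
      fix v :: "'n V"
      \<comment> \<open>The cocycle identity for the form \<open>fst w \<bullet> snd v\<close>,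
        after the translation u = v + w of the inner variable.\<close>
      have "t * (fst w \<bullet> snd v) + t * (fst (v + w) \<bullet> snd (?x - (v + w))) = t * (fst w \<bullet> snd (?x - w)) + t * (fst v \<bullet> snd ((?x - w) - v))"
        by (simp add: inner_add_left inner_diff_right inner_add_right algebra_simps)
      then have "ee (t * (fst w \<bullet> snd v)) * ee (t * (fst (v + w) \<bullet> snd (?x - (v + w)))) = ee (t * (fst w \<bullet> snd (?x - w))) * ee (t * (fst v \<bullet> snd ((?x - w) - v)))"
        by (simp only: ee_add[symmetric])
      moreover have "?x - (v + w) = (?x - w) - v" by simp
      ultimately show "?F w * ?G ((v + w) - w) * ee (t * (fst w \<bullet> snd ((v + w) - w))) * (?X (?x - (v + w)) * ee (t * (fst (v + w) \<bullet> snd (?x - (v + w))))) =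
        (?F w * ee (t * (fst w \<bullet> snd (?x - w)))) * (?G v * ?X ((?x - w) - v) * ee (t * (fst v \<bullet> snd ((?x - w) - v))))"
        by (simp only: add_diff_cancel_right' mult_ac)
    qed
    also have "\<dots> = ?F w * twc lam c G \<xi> (emb (?x - w) ?r) * ee (t * (fst w \<bullet> snd (?x - w)))"
      unfolding integral_mult_right_zero twc_def hpart_emb rpart_emb t_def[symmetric] by (simp only: mult_ac)
    finally show "(LINT u|lborel. ?F w * ?G (u - w) * ee (t * (fst w \<bullet> snd (u - w))) * (?X (?x - u) * ee (t * (fst u \<bullet> snd (?x - u))))) =
       ?F w * twc lam c G \<xi> (emb (?x - w) ?r) * ee (t * (fst w \<bullet> snd (?x - w)))" .
  qed
  also have "\<dots> = twc lam c F (twc lam c G \<xi>) z" unfolding twc_def[of _ _ F] t_def ..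
  finally show ?thesis ..
qed

lemma norm_h_times:
  assumes f: "\<phi> \<in> S3c" and g: "\<psi> \<in> S3c" shows "norm_h lam h (times_h lam h \<phi> \<psi>) \<le> norm_h lam h \<phi> * norm_h lam h \<psi>"
proof (rule norm_h_props(3)[OF times_h_S3c[OF f g]], unfold vee_times_h[OF f g] op_bound_iff, intro conjI ballI)
  let ?F = "vee \<phi>" and ?G = "vee \<psi>" and ?c = "- h" and ?a = "norm_h lam h \<phi>" and ?b = "norm_h lam h \<psi>"
  show "0 \<le> ?a * ?b" by (intro mult_nonneg_nonneg norm_h_props(2) f g)
  fix \<xi> :: "'a G \<Rightarrow> complex" assume xi: "\<xi> \<in> L2_fun"
  have dF: "dom_kernel ?F" and dG: "dom_kernel ?G" using f g by (auto intro: dom_kernel_S3c vee_S3c)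
  note m[measurable] = dom_kernel_slice(1)[OF dF] dom_kernel_slice(1)[OF dG] L2_fun_measurable[OF xi]
  show "twc lam ?c (twc lam ?c ?F ?G) \<xi> \<in> borel_measurable borel" by measurable
  have Gx: "twc lam ?c ?G \<xi> \<in> L2_fun" using norm_h_props(1)[OF g, of lam h] xi by (simp add: op_bound_def)
  have "sq_int (twc lam ?c (twc lam ?c ?F ?G) \<xi>) = sq_int (twc lam ?c ?F (twc lam ?c ?G \<xi>))"
    using AE_rpart[OF AE_good[OF xi]] by (intro sq_int_cong_AE) (auto elim!: eventually_mono intro: twc_assoc[OF dF dG m(3), symmetric])
  also have "\<dots> \<le> ennreal (?a\<^sup>2) * sq_int (twc lam ?c ?G \<xi>)"
    using norm_h_props(1)[OF f, of lam h] Gx by (simp add: op_bound_iff)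
  also have "\<dots> \<le> ennreal (?a\<^sup>2) * (ennreal (?b\<^sup>2) * sq_int \<xi>)"
    using norm_h_props(1)[OF g, of lam h] xi by (intro mult_left_mono) (auto simp: op_bound_iff)
  also have "\<dots> = ennreal ((?a * ?b)\<^sup>2) * sq_int \<xi>" by (simp add: power_mult_distrib ennreal_mult mult.assoc)
  finally show "sq_int (twc lam ?c (twc lam ?c ?F ?G) \<xi>) \<le> ennreal ((?a * ?b)\<^sup>2) * sq_int \<xi>" .
qed

lemma times_h_assoc:
  assumes "\<phi> \<in> S3c" "\<psi> \<in> S3c" "\<kappa> \<in> S3c"
  shows "times_h lam h (times_h lam h \<phi> \<psi>) \<kappa> = times_h lam h \<phi> (times_h lam h \<psi> \<kappa>)"
proof (rule vee_inj)
  have "twc lam (- h) (twc lam (- h) (vee \<phi>) (vee \<psi>)) (vee \<kappa>) z = twc lam (- h) (vee \<phi>) (twc lam (- h) (vee \<psi>) (vee \<kappa>)) z" for z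
    using assms by (intro twc_assoc[symmetric] dom_kernel_S3c vee_S3c S3c_measurable good_S3c)
  then show "vee (times_h lam h (times_h lam h \<phi> \<psi>) \<kappa>) = vee (times_h lam h \<phi> (times_h lam h \<psi> \<kappa>))"
    using assms by (simp add: vee_times_h times_h_S3c fun_eq_iff)
qed (use assms in \<open>auto intro!: times_h_S3c\<close>)

section \<open>The involution and the C*-identity\<close>

lemma vstar_emb: "vstar lam c F (emb w r) = ee (c * eta lam r * (fst w \<bullet> snd w)) * cnj (F (emb (- w) r))"
  by (simp add: vstar_def hrefl_def emb_def)

text \<open>The translation w = u - x exchanges the roles of the two kernels, and bilinearity
  matches the phase at -x with the phases of the two adjoint kernels and of their
  convolution.\<close>

lemma vstar_twc:
  fixes F G :: "'n::finite G \<Rightarrow> complex"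
  assumes F: "F \<in> S3c" and G: "G \<in> S3c"
  shows "vstar lam c (twc lam c F G) = twc lam c (vstar lam c G) (vstar lam c F)"
proof
  fix z :: "'n G"
  let ?r = "rpart z" and ?x = "hpart z"
  define t where "t = c * eta lam ?r"
  let ?F = "\<lambda>w. F (emb w ?r)" and ?G = "\<lambda>w. G (emb w ?r)"
  note [measurable] = S3c_measurable[OF F] S3c_measurable[OF G]
  have "vstar lam c (twc lam c F G) z = vstar lam c (twc lam c F G) (emb ?x ?r)" by simp
  also have "\<dots> = (LINT w|lborel. ee (t * (fst ?x \<bullet> snd ?x)) * cnj (?F w * ?G (- ?x - w) * ee (t * (fst w \<bullet> snd (- ?x - w)))))"
    unfolding vstar_emb twc_def hpart_emb rpart_emb integral_mult_right_zero t_def[symmetric] by (simp only: Bochner_Integration.integral_cnj)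
  also have "\<dots> = (LINT u|lborel. ee (t * (fst ?x \<bullet> snd ?x)) * cnj (?F (u + - ?x) * ?G (- ?x - (u + - ?x)) * ee (t * (fst (u + - ?x) \<bullet> snd (- ?x - (u + - ?x))))))"
    by (rule integral_lborel_translate[symmetric]) measurable
  also have "\<dots> = (LINT u|lborel. vstar lam c G (emb u ?r) * vstar lam c F (emb (?x - u) ?r) * ee (t * (fst u \<bullet> snd (?x - u))))"
  proof (rule Bochner_Integration.integral_cong[OF refl])
    fix u :: "'n V"
    have "t * (fst ?x \<bullet> snd ?x) + - (t * (fst (u + - ?x) \<bullet> snd (- u))) = t * (fst u \<bullet> snd u) + (t * (fst (?x - u) \<bullet> snd (?x - u)) + t * (fst u \<bullet> snd (?x - u)))"
      by (simp add: inner_add_left inner_diff_left inner_diff_right algebra_simps)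
    then have "ee (t * (fst ?x \<bullet> snd ?x)) * ee (- (t * (fst (u + - ?x) \<bullet> snd (- u)))) = ee (t * (fst u \<bullet> snd u)) * (ee (t * (fst (?x - u) \<bullet> snd (?x - u))) * ee (t * (fst u \<bullet> snd (?x - u))))"
      by (simp only: ee_add[symmetric])
    moreover have "- ?x - (u + - ?x) = - u" "u + - ?x = - (?x - u)" by simp_all
    ultimately show "ee (t * (fst ?x \<bullet> snd ?x)) * cnj (?F (u + - ?x) * ?G (- ?x - (u + - ?x)) * ee (t * (fst (u + - ?x) \<bullet> snd (- ?x - (u + - ?x))))) =
      vstar lam c G (emb u ?r) * vstar lam c F (emb (?x - u) ?r) * ee (t * (fst u \<bullet> snd (?x - u)))"
      unfolding vstar_emb t_def[symmetric] by (simp only: complex_cnj_mult cnj_ee mult_ac)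
  qed
  also have "\<dots> = twc lam c (vstar lam c G) (vstar lam c F) z" unfolding twc_def t_def ..
  finally show "vstar lam c (twc lam c F G) z = twc lam c (vstar lam c G) (vstar lam c F) z" .
qed

lemma vstar_vstar: "vstar lam c (vstar lam c F) = F"
proof
  fix z
  show "vstar lam c (vstar lam c F) z = F z"
    using vstar_emb[of lam c "vstar lam c F" "hpart z" "rpart z"] vstar_emb[of lam c F "- hpart z" "rpart z"]
    by (simp add: mult.assoc[symmetric])
qed

lemma star_h_star_h: "\<phi> \<in> S3c \<Longrightarrow> star_h lam h (star_h lam h \<phi>) = \<phi>"
  by (rule vee_inj) (simp_all add: star_h_S3c vee_star_h vstar_vstar)

lemma star_h_times:
  assumes "\<phi> \<in> S3c" "\<psi> \<in> S3c"
  shows "star_h lam h (times_h lam h \<phi> \<psi>) = times_h lam h (star_h lam h \<psi>) (star_h lam h \<phi>)"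
  by (rule vee_inj) (use assms in \<open>simp_all add: star_h_S3c times_h_S3c vee_star_h vee_times_h vstar_twc vee_S3c\<close>)

lemma star_h_add:
  assumes "\<phi> \<in> S3c" "\<psi> \<in> S3c"
  shows "star_h lam h (\<lambda>z. \<phi> z + \<psi> z) = (\<lambda>z. star_h lam h \<phi> z + star_h lam h \<psi> z)"
proof (rule vee_inj)
  show "vee (star_h lam h (\<lambda>z. \<phi> z + \<psi> z)) = vee (\<lambda>z. star_h lam h \<phi> z + star_h lam h \<psi> z)"
    using assms by (intro ext) (simp add: vee_add star_h_S3c S3c_add vee_star_h vstar_def hrefl_def distrib_left)
qed (use assms in \<open>auto intro!: star_h_S3c S3c_add\<close>)

lemma star_h_cmult:
  assumes "\<phi> \<in> S3c"
  shows "star_h lam h (\<lambda>z. s * \<phi> z) = (\<lambda>z. cnj s * star_h lam h \<phi> z)"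
proof (rule vee_inj)
  show "vee (star_h lam h (\<lambda>z. s * \<phi> z)) = vee (\<lambda>z. cnj s * star_h lam h \<phi> z)"
    using assms by (intro ext) (simp add: vee_cmult star_h_S3c S3c_cmult vee_star_h vstar_def hrefl_def)
qed (use assms in \<open>auto intro!: star_h_S3c S3c_cmult\<close>)

lemma twc_add_right:
  assumes F: "dom_kernel F" and xi: "\<xi> \<in> borel_measurable borel" "good \<xi> (rpart z)" and zt: "\<zeta> \<in> borel_measurable borel" "good \<zeta> (rpart z)"
  shows "twc lam c F (\<lambda>z. \<xi> z + \<zeta> z) z = twc lam c F \<xi> z + twc lam c F \<zeta> z"
  unfolding twc_def using twc_good_integrable[OF F xi] twc_good_integrable[OF F zt]
  by (simp add: distrib_right distrib_left flip: Bochner_Integration.integral_add)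

lemma twc_cmult_right: "twc lam c F (\<lambda>z. s * G z) z = s * twc lam c F G z"
  unfolding twc_def by (simp add: mult_ac flip: integral_mult_right_zero)

lemma
  assumes f: "\<phi> \<in> S3c" and g: "\<psi> \<in> S3c" and k: "\<kappa> \<in> S3c"
  shows times_h_add_left: "times_h lam h (\<lambda>z. \<phi> z + \<psi> z) \<kappa> = (\<lambda>z. times_h lam h \<phi> \<kappa> z + times_h lam h \<psi> \<kappa> z)" (is "?l1 = ?r1")
    and times_h_add_right: "times_h lam h \<phi> (\<lambda>z. \<psi> z + \<kappa> z) = (\<lambda>z. times_h lam h \<phi> \<psi> z + times_h lam h \<phi> \<kappa> z)" (is "?l2 = ?r2")
proof -
  note S = S3c_add times_h_S3c f g k
  note D = dom_kernel_S3c vee_S3c S3c_measurable good_S3c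
  have va: "vee (\<lambda>z. \<alpha> z + \<beta> z) = (\<lambda>z. vee \<alpha> z + vee \<beta> z)" if "\<alpha> \<in> S3c" "\<beta> \<in> S3c" for \<alpha> \<beta> :: "'a G \<Rightarrow> complex"
    using that by (intro ext vee_add)
  show "?l1 = ?r1"
  proof (rule vee_inj)
    show "vee ?l1 = vee ?r1"
      using f g k by (simp add: va vee_times_h S3c_add times_h_S3c) (intro ext twc_add_good D)
  qed (use f g k in \<open>auto intro!: S3c_add times_h_S3c\<close>)
  show "?l2 = ?r2"
  proof (rule vee_inj)
    show "vee ?l2 = vee ?r2"
      using f g k by (simp add: va vee_times_h S3c_add times_h_S3c) (intro ext twc_add_right D)
  qed (use f g k in \<open>auto intro!: S3c_add times_h_S3c\<close>)
qed

lemma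
  assumes f: "\<phi> \<in> S3c" and g: "\<psi> \<in> S3c"
  shows times_h_cmult_left: "times_h lam h (\<lambda>z. s * \<phi> z) \<psi> = (\<lambda>z. s * times_h lam h \<phi> \<psi> z)" (is "?l1 = ?r1")
    and times_h_cmult_right: "times_h lam h \<phi> (\<lambda>z. s * \<psi> z) = (\<lambda>z. s * times_h lam h \<phi> \<psi> z)" (is "?l2 = ?r2")
proof -
  have vc: "vee (\<lambda>z. s * \<alpha> z) = (\<lambda>z. s * vee \<alpha> z)" for \<alpha> :: "'a G \<Rightarrow> complex"
    by (intro ext vee_cmult)
  show "?l1 = ?r1"
    by (rule vee_inj) (use f g in \<open>simp_all add: vc vee_times_h S3c_cmult times_h_S3c twc_cmult fun_eq_iff\<close>)
  show "?l2 = ?r2"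
    by (rule vee_inj) (use f g in \<open>simp_all add: vc vee_times_h S3c_cmult times_h_S3c twc_cmult_right fun_eq_iff\<close>)
qed

text \<open>Exchange the integrals, move the shift from \<xi> to \<zeta> by x = y + w, and reflect
  w. The phase built into \<open>vstar\<close> is exactly what the reflection produces.\<close>

lemma twc_adjoint:
  fixes F \<xi> \<zeta> :: "'n::finite G \<Rightarrow> complex"
  assumes F: "dom_kernel F" and xi: "\<xi> \<in> borel_measurable borel" "good \<xi> r" and zt: "\<zeta> \<in> borel_measurable borel" "good \<zeta> r"
  shows "(LINT x|lborel. twc lam c F \<xi> (emb x r) * cnj (\<zeta> (emb x r))) = (LINT y|lborel. \<xi> (emb y r) * cnj (twc lam c (vstar lam c F) \<zeta> (emb y r)))"
proof -
  define t where "t = c * eta lam r"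
  let ?F = "\<lambda>w. F (emb w r)" and ?X = "\<lambda>w. \<xi> (emb w r)" and ?Z = "\<lambda>w. cnj (\<zeta> (emb w r))"
  note [measurable] = dom_kernel_slice(1)[OF F] xi(1) zt(1)
  have sZ: "sq_int ?Z < \<infinity>" using zt(2) by (simp add: good_def sq_int_def)
  have "integrable lborel (\<lambda>s::'n V \<times> 'n V. ?F (snd s) * (?X (fst s + - snd s) * ?Z (fst s + 0)))"
    using dom_kernel_slice[OF F] xi(2) sZ unfolding good_def
    by (intro triple_integrable[where \<sigma>=uminus and \<tau>="\<lambda>_. 0"]) auto
  then have "integrable lborel (\<lambda>s::'n V \<times> 'n V. ee (t * (fst (snd s) \<bullet> snd (fst s - snd s))) * (?F (snd s) * (?X (fst s + - snd s) * ?Z (fst s + 0))))"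
    by (rule integrable_ee_mult) measurable
  then have i1: "integrable lborel (\<lambda>s::'n V \<times> 'n V. ?F (snd s) * ?X (fst s - snd s) * ee (t * (fst (snd s) \<bullet> snd (fst s - snd s))) * ?Z (fst s))"
    by (simp add: mult_ac)
  have "integrable lborel (\<lambda>s::'n V \<times> 'n V. ?F (snd s) * (?X (fst s + 0) * ?Z (fst s + snd s)))"
    using dom_kernel_slice[OF F] xi(2) sZ unfolding good_def
    by (intro triple_integrable[where \<sigma>="\<lambda>_. 0" and \<tau>="\<lambda>x. x"]) auto
  then have "integrable lborel (\<lambda>s::'n V \<times> 'n V. ee (t * (fst (snd s) \<bullet> snd (fst s))) * (?F (snd s) * (?X (fst s + 0) * ?Z (fst s + snd s))))"
    by (rule integrable_ee_mult) measurable
  then have i2: "integrable lborel (\<lambda>s::'n V \<times> 'n V. ?F (snd s) * ?X (fst s) * ee (t * (fst (snd s) \<bullet> snd (fst s))) * ?Z (fst s + snd s))"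
    by (simp add: mult_ac)
  have "(LINT x|lborel. twc lam c F \<xi> (emb x r) * ?Z x) = (LINT x|lborel. LINT w|lborel. ?F w * ?X (x - w) * ee (t * (fst w \<bullet> snd (x - w))) * ?Z x)"
    unfolding twc_def hpart_emb rpart_emb t_def[symmetric] by (simp only: integral_mult_left_zero)
  also have "\<dots> = (LINT w|lborel. LINT x|lborel. ?F w * ?X (x - w) * ee (t * (fst w \<bullet> snd (x - w))) * ?Z x)"
    by (rule integral_lborel_swap[OF i1])
  also have "\<dots> = (LINT w|lborel. LINT y|lborel. ?F w * ?X y * ee (t * (fst w \<bullet> snd y)) * ?Z (y + w))"
  proof (rule Bochner_Integration.integral_cong[OF refl])
    fix w :: "'n V"
    have "(LINT x|lborel. ?F w * ?X (x - w) * ee (t * (fst w \<bullet> snd (x - w))) * ?Z x) = (LINT y|lborel. ?F w * ?X ((y + w) - w) * ee (t * (fst w \<bullet> snd ((y + w) - w))) * ?Z (y + w))"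
      by (rule integral_lborel_translate[symmetric]) measurable
    then show "(LINT x|lborel. ?F w * ?X (x - w) * ee (t * (fst w \<bullet> snd (x - w))) * ?Z x) = (LINT y|lborel. ?F w * ?X y * ee (t * (fst w \<bullet> snd y)) * ?Z (y + w))" by simp
  qed
  also have "\<dots> = (LINT y|lborel. LINT w|lborel. ?F w * ?X y * ee (t * (fst w \<bullet> snd y)) * ?Z (y + w))"
    by (rule integral_lborel_swap[OF i2, symmetric])
  also have "\<dots> = (LINT y|lborel. ?X y * cnj (twc lam c (vstar lam c F) \<zeta> (emb y r)))"
  proof (rule Bochner_Integration.integral_cong[OF refl])
    fix y :: "'n V"
    have "cnj (twc lam c (vstar lam c F) \<zeta> (emb y r)) = (LINT w|lborel. cnj (vstar lam c F (emb w r) * \<zeta> (emb (y - w) r) * ee (t * (fst w \<bullet> snd (y - w)))))"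
      unfolding twc_def hpart_emb rpart_emb t_def[symmetric] by (simp only: Bochner_Integration.integral_cnj)
    also have "\<dots> = (LINT w|lborel. cnj (vstar lam c F (emb (0 - w) r) * \<zeta> (emb (y - (0 - w)) r) * ee (t * (fst (0 - w) \<bullet> snd (y - (0 - w))))))"
      unfolding vstar_emb by (rule integral_lborel_reflect[symmetric]) measurable
    also have "\<dots> = (LINT w|lborel. ?F w * ee (t * (fst w \<bullet> snd y)) * ?Z (y + w))"
    proof (rule Bochner_Integration.integral_cong[OF refl])
      fix w :: "'n V"
      have "- (t * (fst w \<bullet> snd w)) + t * (fst w \<bullet> snd (y + w)) = t * (fst w \<bullet> snd y)" by (simp add: inner_add_right algebra_simps)
      then have "ee (- (t * (fst w \<bullet> snd w))) * ee (t * (fst w \<bullet> snd (y + w))) = ee (t * (fst w \<bullet> snd y))" by (simp only: ee_add[symmetric])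
      then show "cnj (vstar lam c F (emb (0 - w) r) * \<zeta> (emb (y - (0 - w)) r) * ee (t * (fst (0 - w) \<bullet> snd (y - (0 - w))))) = ?F w * ee (t * (fst w \<bullet> snd y)) * ?Z (y + w)"
        unfolding vstar_emb t_def[symmetric] by (simp add: mult_ac)
    qed
    finally show "(LINT w|lborel. ?F w * ?X y * ee (t * (fst w \<bullet> snd y)) * ?Z (y + w)) = ?X y * cnj (twc lam c (vstar lam c F) \<zeta> (emb y r))"
      by (simp add: mult_ac flip: integral_mult_right_zero)
  qed
  finally show ?thesis .
qed

text \<open>The squared norm of the image of \<xi> under an operator L is the pairing of \<xi> with
  L* L \<xi>, hence by Cauchy-Schwarz at most the norm of L* L times the squared norm of \<xi>. The
  adjoint relation is available on fibres where both \<xi> and its image are square integrable,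
  which holds for almost every r.\<close>

lemma norm_h_cstar_le:
  assumes f: "\<phi> \<in> S3c" shows "(norm_h lam h \<phi>)\<^sup>2 \<le> norm_h lam h (times_h lam h (star_h lam h \<phi>) \<phi>)"
proof -
  let ?c = "- h" and ?F = "vee \<phi>" and ?F' = "vstar lam (- h) (vee \<phi>)"
  define N where "N = norm_h lam h (times_h lam h (star_h lam h \<phi>) \<phi>)"
  have tS: "times_h lam h (star_h lam h \<phi>) \<phi> \<in> S3c" using f by (intro times_h_S3c star_h_S3c)
  have N0: "N \<ge> 0" unfolding N_def by (rule norm_h_props(2)[OF tS])
  have dF: "dom_kernel ?F" and dF': "dom_kernel ?F'" using f by (auto intro: dom_kernel_S3c vee_S3c vstar_S3c)
  have opN: "op_bound N (twc lam ?c (twc lam ?c ?F' ?F))"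
    using norm_h_props(1)[OF tS, of lam h] f by (simp add: N_def vee_times_h vee_star_h star_h_S3c)
  have "op_bound (sqrt N) (twc lam ?c ?F)"
    unfolding op_bound_iff
  proof (intro conjI ballI)
    show "0 \<le> sqrt N" using N0 by simp
    fix \<xi> :: "'a G \<Rightarrow> complex" assume xi: "\<xi> \<in> L2_fun"
    note m[measurable] = dom_kernel_slice(1)[OF dF] dom_kernel_slice(1)[OF dF'] L2_fun_measurable[OF xi]
    let ?e = "twc lam ?c ?F \<xi>" and ?z = "twc lam ?c (twc lam ?c ?F' ?F) \<xi>"
    show em: "?e \<in> borel_measurable borel" by measurable
    have eL: "?e \<in> L2_fun" using norm_h_props(1)[OF f, of lam h] xi by (simp add: op_bound_def)
    have sl: "sq_int (\<lambda>x. ?e (emb x r)) \<le> (\<integral>\<^sup>+x. ennreal (cmod (\<xi> (emb x r))) * ennreal (cmod (?z (emb x r))) \<partial>lborel)"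
      if gx: "good \<xi> r" and ge: "good ?e r" for r
    proof -
      have "integrable lborel (\<lambda>x. (cmod (?e (emb x r)))\<^sup>2)"
        using ge unfolding good_def sq_int_def by (auto simp: integrable_iff_bounded)
      then have "sq_int (\<lambda>x. ?e (emb x r)) = ennreal (LINT x|lborel. (cmod (?e (emb x r)))\<^sup>2)"
        unfolding sq_int_def by (intro nn_integral_eq_integral) auto
      also have "\<dots> \<le> ennreal (cmod (LINT x|lborel. ?e (emb x r) * cnj (?e (emb x r))))"
        by (intro ennreal_leI) (simp add: complex_norm_square[symmetric] del: of_real_power)
      also have "(LINT x|lborel. ?e (emb x r) * cnj (?e (emb x r))) = (LINT y|lborel. \<xi> (emb y r) * cnj (twc lam ?c ?F' ?e (emb y r)))"
        by (rule twc_adjoint[OF dF m(3) gx em ge])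
      also have "\<dots> = (LINT y|lborel. \<xi> (emb y r) * cnj (?z (emb y r)))"
        using gx by (subst twc_assoc[OF dF' dF m(3)]) auto
      also have "ennreal (cmod \<dots>) \<le> (\<integral>\<^sup>+y. ennreal (cmod (\<xi> (emb y r) * cnj (?z (emb y r)))) \<partial>lborel)"
        by (rule norm_integral_le_nn)
      finally show ?thesis by (simp add: norm_mult ennreal_mult)
    qed
    have "sq_int ?e = (\<integral>\<^sup>+r. sq_int (\<lambda>x. ?e (emb x r)) \<partial>lborel)" by (rule sq_int_emb) measurable
    also have "\<dots> \<le> (\<integral>\<^sup>+r. \<integral>\<^sup>+x. ennreal (cmod (\<xi> (emb x r))) * ennreal (cmod (?z (emb x r))) \<partial>lborel \<partial>lborel)"
    proof (rule nn_integral_mono_AE)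
      show "AE r in lborel. sq_int (\<lambda>x. ?e (emb x r)) \<le> (\<integral>\<^sup>+x. ennreal (cmod (\<xi> (emb x r))) * ennreal (cmod (?z (emb x r))) \<partial>lborel)"
        using AE_good[OF xi] AE_good[OF eL] by eventually_elim (rule sl)
    qed
    also have "\<dots> = (\<integral>\<^sup>+z. ennreal (cmod (\<xi> z)) * ennreal (cmod (?z z)) \<partial>lborel)"
      by (rule nn_integral_emb[symmetric]) measurable
    also have "\<dots> \<le> ennreal (L2_norm \<xi> * (N * L2_norm \<xi>))"
    proof (rule Cauchy_Schwarz_sq_int)
      show "sq_int ?z \<le> ennreal ((N * L2_norm \<xi>)\<^sup>2)"
        using opN xi unfolding op_bound_iff by (auto simp: sq_int_L2_norm[OF xi] power_mult_distrib ennreal_mult)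
    qed (use N0 in \<open>auto simp: sq_int_L2_norm[OF xi] L2_norm_nonneg\<close>)
    also have "\<dots> = ennreal ((sqrt N)\<^sup>2) * sq_int \<xi>"
      using N0 by (simp add: sq_int_L2_norm[OF xi] power2_eq_square ennreal_mult[symmetric] L2_norm_nonneg mult_ac)
    finally show "sq_int ?e \<le> ennreal ((sqrt N)\<^sup>2) * sq_int \<xi>" .
  qed
  then have "norm_h lam h \<phi> \<le> sqrt N" by (rule norm_h_props(3)[OF f])
  then have "(norm_h lam h \<phi>)\<^sup>2 \<le> (sqrt N)\<^sup>2" using norm_h_props(2)[OF f] by (intro power_mono)
  then show ?thesis using N0 by (simp add: N_def)
qed

lemma norm_h_le_star:
  assumes f: "\<phi> \<in> S3c" shows "norm_h lam h \<phi> \<le> norm_h lam h (star_h lam h \<phi>)"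
proof (cases "norm_h lam h \<phi> = 0")
  case True
  then show ?thesis using norm_h_props(2)[OF star_h_S3c[OF f]] by simp
next
  case False
  then have pos: "norm_h lam h \<phi> > 0" using norm_h_props(2)[OF f, of lam h] by simp
  have "norm_h lam h \<phi> * norm_h lam h \<phi> \<le> norm_h lam h (star_h lam h \<phi>) * norm_h lam h \<phi>"
    using order_trans[OF norm_h_cstar_le[OF f] norm_h_times[OF star_h_S3c[OF f] f]] by (simp add: power2_eq_square)
  then show ?thesis using pos by simp
qed

text \<open>The remaining inequality is submultiplicativity, once the involution is known not to
  increase the norm; this is \<open>norm_h_le_star\<close> for the image under the
  involution.\<close>

lemma norm_h_cstar:
  assumes f: "\<phi> \<in> S3c" shows "norm_h lam h (times_h lam h (star_h lam h \<phi>) \<phi>) = (norm_h lam h \<phi>)\<^sup>2"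
proof (rule antisym)
  have "norm_h lam h (star_h lam h \<phi>) \<le> norm_h lam h \<phi>"
    using norm_h_le_star[OF star_h_S3c[OF f]] star_h_star_h[OF f] by metis
  then have "norm_h lam h (star_h lam h \<phi>) * norm_h lam h \<phi> \<le> norm_h lam h \<phi> * norm_h lam h \<phi>"
    using norm_h_props(2)[OF f] by (rule mult_right_mono)
  then show "norm_h lam h (times_h lam h (star_h lam h \<phi>) \<phi>) \<le> (norm_h lam h \<phi>)\<^sup>2"
    using order_trans[OF norm_h_times[OF star_h_S3c[OF f] f]] by (simp add: power2_eq_square)
qed (rule norm_h_cstar_le[OF f])

text \<open>An operator of norm 0 kills the vector \<open>vstar F\<close>. The result is a
  continuous function whose value at the origin of the fibre over r is the integral of |F|^2 over
  that fibre. Hence the transform F vanishes, and \<open>vee\<close> is injective.\<close>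

lemma norm_h_zeroD:
  fixes \<phi> :: "'n::finite G \<Rightarrow> complex"
  assumes f: "\<phi> \<in> S3c" and 0: "norm_h lam h \<phi> = 0" shows "\<phi> = (\<lambda>z. 0)"
proof -
  let ?F = "vee \<phi>" and ?c = "- h"
  have FS: "?F \<in> S3c" using f by (rule vee_S3c)
  define T where "T = twc lam ?c ?F (vstar lam ?c ?F)"
  have TS: "T \<in> S3c" unfolding T_def by (intro twc_S3c vstar_S3c FS)
  have "sq_int T \<le> ennreal (0\<^sup>2) * sq_int (vstar lam ?c ?F)"
    using norm_h_props(1)[OF f, of lam h] S3c_L2_fun[OF vstar_S3c[OF FS]] unfolding 0 op_bound_iff T_def by blast
  then have T0: "T z = 0" for z by (intro sq_int_eq_0 S3c_continuous_on TS) simp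
  have F0: "?F (emb w r) = 0" for w r
  proof -
    have [measurable]: "?F \<in> borel_measurable borel" by (rule S3c_measurable[OF FS])
    have "T (emb 0 r) = (LINT w|lborel. ?F (emb w r) * cnj (?F (emb w r)))"
      unfolding T_def twc_def hpart_emb rpart_emb
    proof (rule Bochner_Integration.integral_cong[OF refl])
      fix w :: "'n V"
      \<comment> \<open>At the origin of the fibre the phase of the adjoint kernel and the phase of
        the convolution cancel.\<close>
      have 1: "ee (?c * eta lam r * (fst w \<bullet> snd w)) * ee (?c * eta lam r * (fst w \<bullet> snd (0 - w))) = 1"
        by (simp flip: ee_add)
      have 2: "vstar lam ?c ?F (emb (0 - w) r) = ee (?c * eta lam r * (fst w \<bullet> snd w)) * cnj (?F (emb w r))"
        by (simp add: vstar_emb)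
      show "?F (emb w r) * vstar lam ?c ?F (emb (0 - w) r) * ee (?c * eta lam r * (fst w \<bullet> snd (0 - w))) = ?F (emb w r) * cnj (?F (emb w r))"
        unfolding 2 using 1 by (simp only: mult_ac) (simp only: mult.assoc[symmetric] mult_1_left)
    qed
    also have "\<dots> = of_real (LINT w|lborel. (cmod (?F (emb w r)))\<^sup>2)"
      by (simp add: complex_norm_square[symmetric] del: of_real_power)
    finally have 1: "(LINT w|lborel. (cmod (?F (emb w r)))\<^sup>2) = 0" using T0[of "emb 0 r"] by simp
    have "integrable lborel (\<lambda>w. (cmod (?F (emb w r)))\<^sup>2)"
      using good_S3c[OF FS, of r] by (simp add: integrable_iff_bounded good_def sq_int_def)
    then have s0: "sq_int (\<lambda>w. ?F (emb w r)) = 0"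
      unfolding sq_int_def using 1 by (subst nn_integral_eq_integral) auto
    have c: "continuous_on UNIV (\<lambda>w. ?F (emb w r))"
      by (rule continuous_on_compose2[OF S3c_continuous_on[OF FS, of UNIV]]) (auto intro!: continuous_on_emb continuous_on_id continuous_on_const)
    show ?thesis by (rule sq_int_eq_0[OF c s0])
  qed
  have "vee \<phi> = vee (\<lambda>z. 0)"
  proof
    fix z show "vee \<phi> z = vee (\<lambda>z. 0) z" using F0[of "hpart z" "rpart z"] by (simp add: vee_zero)
  qed
  then show ?thesis using vee_inj[OF f S3c_zero] by blast
qed

lemma norm_h_zero: "norm_h lam h (\<lambda>z. 0) = 0"
  using norm_h_cmult[OF S3c_zero, of lam h 0] by simp

lemma pre_cstar_S3c: "pre_cstar_algebra (function_star_alg S3c (times_h lam h) (star_h lam h) (norm_h lam h))"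
proof (unfold_locales, unfold diff_def function_star_alg_def star_alg.simps, goal_cases)
  case 1 show ?case by (rule S3c_zero)
next case 2 then show ?case by (rule S3c_add)
next case 3 then show ?case by (rule S3c_cmult)
next case 4 then show ?case by (rule times_h_S3c)
next case 5 then show ?case by (rule star_h_S3c)
next case 6 show ?case by (simp add: add.assoc)
next case 7 show ?case by (simp add: add.commute)
next case 8 show ?case by simp
next case 9 show ?case by simp
next case 10 show ?case by (simp add: distrib_left)
next case 11 show ?case by (simp add: distrib_right)
next case 12 show ?case by (simp add: mult.assoc)
next case 13 show ?case by simp
next case 14 then show ?case by (rule times_h_assoc)
next case 15 then show ?case by (rule times_h_add_left)
next case 16 then show ?case by (rule times_h_add_right)
next case 17 then show ?case by (rule times_h_cmult_left)
next case 18 then show ?case by (rule times_h_cmult_right)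
next case 19 then show ?case by (rule star_h_star_h)
next case 20 then show ?case by (rule star_h_add)
next case 21 then show ?case by (rule star_h_cmult)
next case 22 then show ?case by (rule star_h_times)
next case 23 then show ?case by (rule norm_h_props(2))
next case 24 then show ?case using norm_h_zeroD norm_h_zero by blast
next case 25 then show ?case by (rule norm_h_add)
next case 26 then show ?case by (rule norm_h_cmult)
next case 27 then show ?case by (rule norm_h_times)
next case 28 then show ?case by (rule norm_h_cstar)
qed

subsection \<open>Continuity of the norm in the deformation parameter\<close>

text \<open>The tent max 0 (1 - |t|), scaled to L^2 norm 1. Support in the unit ball keeps
  modulation phases small, the Lipschitz constant controls translations, and boundedness keeps
  products with L^2 functions in L^2.\<close>

lemma window_exists:
  obtains g :: "'a::euclidean_space \<Rightarrow> real" and L M where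
    "g \<in> borel_measurable borel" "\<And>t. 0 \<le> g t" "\<And>t. g t \<le> M" "\<And>t. norm t > 1 \<Longrightarrow> g t = 0" "L \<ge> 0"
    "\<And>s t. \<bar>g s - g t\<bar> \<le> L * norm (s - t)" "integrable lborel g" "integrable lborel (\<lambda>t. (g t)\<^sup>2)" "(LINT t|lborel. (g t)\<^sup>2) = 1"
proof -
  define f :: "'a \<Rightarrow> real" where "f t = max 0 (1 - norm t)" for t
  have c: "continuous_on UNIV f" unfolding f_def by (intro continuous_intros)
  have [measurable]: "f \<in> borel_measurable borel" using c by (rule borel_measurable_continuous_onI)
  have ind: "integrable lborel (indicator (cball (0::'a) 1) :: 'a \<Rightarrow> real)"
    using emeasure_bounded_finite[OF bounded_cball[of "0::'a" 1]] by simp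
  have f1: "f t \<le> indicator (cball 0 1) t" "f t \<ge> 0" "(f t)\<^sup>2 \<le> indicator (cball 0 1) t" for t
    unfolding f_def by (auto simp: indicator_def power_le_one max_def)
  have fi: "integrable lborel f" by (rule Bochner_Integration.integrable_bound[OF ind]) (use f1 in \<open>auto intro!: AE_I2\<close>)
  have f2i: "integrable lborel (\<lambda>t. (f t)\<^sup>2)" by (rule Bochner_Integration.integrable_bound[OF ind]) (use f1 in \<open>auto intro!: AE_I2\<close>)
  define I where "I = (LINT t|lborel. (f t)\<^sup>2)"
  have "I \<noteq> 0"
  proof
    assume "I = 0"
    then have "AE t in lborel. (f t)\<^sup>2 = 0" unfolding I_def using f2i by (subst (asm) integral_nonneg_eq_0_iff_AE) auto
    then have "AE t in lborel. complex_of_real (f t) = 0" by eventually_elim simp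
    then have "complex_of_real (f 0) = 0" using c by (intro continuous_AE_zero[of "\<lambda>t. complex_of_real (f t)"]) (auto intro!: continuous_intros)
    then show False by (simp add: f_def)
  qed
  moreover have "I \<ge> 0" unfolding I_def by simp
  ultimately have I: "I > 0" by simp
  define a where "a = inverse (sqrt I)"
  have a: "a > 0" "a\<^sup>2 * I = 1" using I by (auto simp: a_def power_inverse)
  show ?thesis
  proof (rule that[of "\<lambda>t. a * f t" a a])
    show "\<bar>a * f s - a * f t\<bar> \<le> a * norm (s - t)" for s t
    proof -
      have "\<bar>f s - f t\<bar> \<le> norm (s - t)" unfolding f_def using norm_triangle_ineq3[of s t] by linarith
      then show ?thesis using a by (simp add: abs_mult flip: right_diff_distrib)
    qed
    show "a * f t \<le> a" for t using a by (simp add: f_def)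
    show "(LINT t|lborel. (a * f t)\<^sup>2) = 1" using a by (simp add: power_mult_distrib I_def)
    show "integrable lborel (\<lambda>t. a * f t)" "integrable lborel (\<lambda>t. (a * f t)\<^sup>2)"
      using fi f2i by (simp_all add: power_mult_distrib)
    show "a * f t = 0" if "1 < norm t" for t using that by (simp add: f_def)
    show "0 \<le> a * f t" "0 \<le> a" for t using a f1 by simp_all
  qed measurable
qed

text \<open>The vectors \<open>\<xi>\<^sub>t = \<xi> G(\<cdot>, t)\<close> intertwine the two parameters: averaging
  \<open>cnj G(z, t) (F *\<^sub>c \<xi>\<^sub>t)(z)\<close> over \<open>t\<close> gives the twisted convolution with parameter \<open>c + d\<close> and with the
  kernel \<open>F\<close> multiplied by the matrix coefficient \<open>k\<close>. Hence multiplication by \<open>k\<close> is a contraction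
  from the norm with parameter \<open>c\<close> to the norm with parameter \<open>c + d\<close>.\<close>

lemma transference:
  fixes F :: "'n::finite G \<Rightarrow> complex" and g :: "real^'n \<Rightarrow> real" and d :: real
  assumes g: "g \<in> borel_measurable borel" "\<And>t. 0 \<le> g t" "\<And>t. g t \<le> M" "integrable lborel (\<lambda>t. (g t)\<^sup>2)" "(LINT t|lborel. (g t)\<^sup>2) = 1"
    and F: "dom_kernel F" and op: "op_bound N (twc lam c F)"
  defines "\<beta> \<equiv> sqrt \<bar>d\<bar>"
  defines "s \<equiv> \<lambda>r. sgn d * sqrt \<bar>d\<bar> * eta lam r"
  defines "A \<equiv> \<lambda>w r. LINT t|lborel. ee (- (s r * (t \<bullet> fst w))) * of_real (g (t - \<beta> *\<^sub>R snd w) * g t)"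
  defines "k \<equiv> \<lambda>z. ee (d * eta lam (rpart z) * (fst (hpart z) \<bullet> snd (hpart z))) * A (hpart z) (rpart z)"
  shows "cmod (A w r) \<le> 1" "dom_kernel (\<lambda>z. F z * k z)" "op_bound N (twc lam (c + d) (\<lambda>z. F z * k z))"
proof -
  note [measurable] = g(1) dom_kernel_slice(1)[OF F]
  have sm[measurable]: "s \<in> borel_measurable borel" unfolding s_def by measurable
  \<comment> \<open>The phase with coefficient d is shared equally: s carries the sign, eta and one
    square root of |d|, \<beta> the other square root. Both s and \<beta> then tend to 0 with d,
    which a one-sided split would not achieve.\<close>
  have sb: "s r * \<beta> = d * eta lam r" for r
  proof -
    have "sgn d * sqrt \<bar>d\<bar> * sqrt \<bar>d\<bar> = d" by (simp add: mult.assoc sgn_mult_abs)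
    then show ?thesis unfolding s_def \<beta>_def by (simp add: mult_ac)
  qed
  have gsq: "sq_int (\<lambda>t. complex_of_real (g t)) = 1"
    unfolding sq_int_def using g(4,5) by (simp add: nn_integral_eq_integral)
  have g1: "(\<integral>\<^sup>+t. ennreal ((g (t + a))\<^sup>2) \<partial>lborel) = 1" for a
  proof -
    have "(\<integral>\<^sup>+t. ennreal ((g (t + a))\<^sup>2) \<partial>lborel) = (\<integral>\<^sup>+t. ennreal ((g t)\<^sup>2) \<partial>lborel)"
      by (rule nn_integral_lborel_translate[where f="\<lambda>t. ennreal ((g t)\<^sup>2)"]) measurable
    then show ?thesis using g(4,5) by (simp add: nn_integral_eq_integral)
  qed
  \<comment> \<open>A pairs the window with a translated and modulated copy of itself, and both have
    L^2 norm 1.\<close>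
  show A1: "cmod (A w r) \<le> 1" for w r
  proof -
    have "ennreal (cmod (A w r)) \<le> (\<integral>\<^sup>+t. ennreal (cmod (of_real (g (t + - \<beta> *\<^sub>R snd w)))) * ennreal (cmod (of_real (g t))) \<partial>lborel)"
      unfolding A_def by (rule order_trans[OF norm_integral_le_nn]) (simp add: norm_mult g(2) ennreal_mult)
    also have "\<dots> \<le> ennreal (1 * 1)"
    proof (rule Cauchy_Schwarz_sq_int)
      show "sq_int (\<lambda>t. complex_of_real (g (t + - \<beta> *\<^sub>R snd w))) \<le> ennreal (1\<^sup>2)"
        unfolding sq_int_def using g1[of "- \<beta> *\<^sub>R snd w"] by simp
    qed (auto simp: gsq)
    finally show ?thesis by simp
  qed
  have Am: "(\<lambda>z. A (hpart z) (rpart z)) \<in> borel_measurable borel"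
    unfolding A_def by (rule measurable_lborel_integral) measurable
  have km[measurable]: "k \<in> borel_measurable borel" unfolding k_def using Am by measurable
  have k1: "cmod (k z) \<le> 1" for z unfolding k_def by (simp add: norm_mult A1)
  show dFk: "dom_kernel (\<lambda>z. F z * k z)"
  proof -
    obtain C where C: "\<And>w r. cmod (F (emb w r)) \<le> C * wt w" using F unfolding dom_kernel_def by blast
    have "cmod (F (emb w r) * k (emb w r)) \<le> C * wt w" for w r
      using mult_mono[OF C[of w r] k1[of "emb w r"]] order_trans[OF norm_ge_zero C[of w r]] by (simp add: norm_mult)
    then show ?thesis unfolding dom_kernel_def by auto
  qed
  \<comment> \<open>A unit vector of L^2 in the variable t is attached to each point z: the window
    translated by \<beta> times the second horizontal component and modulated by s times the
    first.\<close>
  define Gt where "Gt z t = ee (s (rpart z) * (t \<bullet> fst (hpart z))) * of_real (g (t + \<beta> *\<^sub>R snd (hpart z)))" for z :: "'n G" and t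
  have Gm[measurable]: "(\<lambda>x. Gt (a x) (b x)) \<in> borel_measurable M'" if [measurable]: "a \<in> M' \<rightarrow>\<^sub>M borel" "b \<in> M' \<rightarrow>\<^sub>M borel" for a b and M' :: "'x measure"
    unfolding Gt_def by measurable
  have nG: "cmod (Gt z t) = g (t + \<beta> *\<^sub>R snd (hpart z))" for z t unfolding Gt_def by (simp add: norm_mult g(2))
  \<comment> \<open>The pairing of the unit vectors at x - w and x depends on x through a phase
    only, and this phase is the increment of the cocycle from c to c + d. What remains is a function
    of w and r alone, the coefficient k.\<close>
  have key: "(LINT t|lborel. Gt (emb (x - w) r) t * cnj (Gt (emb x r) t)) = ee (d * eta lam r * (fst w \<bullet> snd (x - w))) * k (emb w r)" for x w r
  proof -
    have "(LINT t|lborel. Gt (emb (x - w) r) t * cnj (Gt (emb x r) t)) =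
      (LINT t|lborel. ee (- (s r * (((t + \<beta> *\<^sub>R snd x) - \<beta> *\<^sub>R snd x) \<bullet> fst w))) * of_real (g ((t + \<beta> *\<^sub>R snd x) - \<beta> *\<^sub>R snd w) * g (t + \<beta> *\<^sub>R snd x)))"
    proof (rule Bochner_Integration.integral_cong[OF refl])
      fix t
      have e1: "ee (- (s r * (t \<bullet> fst w))) = ee (s r * (t \<bullet> fst (x - w))) * ee (- (s r * (t \<bullet> fst x)))"
        by (simp add: inner_diff_right algebra_simps flip: ee_add)
      have e2: "t + \<beta> *\<^sub>R snd (x - w) = (t + \<beta> *\<^sub>R snd x) - \<beta> *\<^sub>R snd w" by (simp add: scaleR_diff_right)
      show "Gt (emb (x - w) r) t * cnj (Gt (emb x r) t) = ee (- (s r * (((t + \<beta> *\<^sub>R snd x) - \<beta> *\<^sub>R snd x) \<bullet> fst w))) * of_real (g ((t + \<beta> *\<^sub>R snd x) - \<beta> *\<^sub>R snd w) * g (t + \<beta> *\<^sub>R snd x))"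
        unfolding Gt_def hpart_emb rpart_emb e2 add_diff_cancel_right' e1
        by (simp only: complex_cnj_mult cnj_ee complex_cnj_complex_of_real of_real_mult mult_ac)
    qed
    also have "\<dots> = (LINT t|lborel. ee (- (s r * ((t - \<beta> *\<^sub>R snd x) \<bullet> fst w))) * of_real (g (t - \<beta> *\<^sub>R snd w) * g t))"
      by (rule integral_lborel_translate[where g="\<lambda>t. ee (- (s r * ((t - \<beta> *\<^sub>R snd x) \<bullet> fst w))) * of_real (g (t - \<beta> *\<^sub>R snd w) * g t)"]) measurable
    also have "\<dots> = (LINT t|lborel. ee (d * eta lam r * (snd x \<bullet> fst w)) * (ee (- (s r * (t \<bullet> fst w))) * of_real (g (t - \<beta> *\<^sub>R snd w) * g t)))"
    proof (rule Bochner_Integration.integral_cong[OF refl])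
      fix t
      have "- (s r * ((t - \<beta> *\<^sub>R snd x) \<bullet> fst w)) = (s r * \<beta>) * (snd x \<bullet> fst w) + - (s r * (t \<bullet> fst w))"
        by (simp add: inner_diff_left algebra_simps)
      then have "ee (- (s r * ((t - \<beta> *\<^sub>R snd x) \<bullet> fst w))) = ee (d * eta lam r * (snd x \<bullet> fst w)) * ee (- (s r * (t \<bullet> fst w)))"
        by (simp only: sb ee_add)
      then show "ee (- (s r * ((t - \<beta> *\<^sub>R snd x) \<bullet> fst w))) * of_real (g (t - \<beta> *\<^sub>R snd w) * g t) = ee (d * eta lam r * (snd x \<bullet> fst w)) * (ee (- (s r * (t \<bullet> fst w))) * of_real (g (t - \<beta> *\<^sub>R snd w) * g t))"
        by (simp only: mult_ac)
    qed
    also have "\<dots> = ee (d * eta lam r * (snd x \<bullet> fst w)) * A w r" by (simp only: integral_mult_right_zero A_def)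
    also have "\<dots> = ee (d * eta lam r * (fst w \<bullet> snd (x - w))) * k (emb w r)"
    proof -
      have "d * eta lam r * (snd x \<bullet> fst w) = d * eta lam r * (fst w \<bullet> snd (x - w)) + d * eta lam r * (fst w \<bullet> snd w)"
        by (simp add: inner_diff_right inner_commute algebra_simps)
      then show ?thesis unfolding k_def hpart_emb rpart_emb by (simp only: ee_add mult_ac)
    qed
    finally show ?thesis .
  qed
  show "op_bound N (twc lam (c + d) (\<lambda>z. F z * k z))"
    unfolding op_bound_iff
  proof (intro conjI ballI)
    show "0 \<le> N" using op by (simp add: op_bound_def)
    fix \<xi> :: "'n G \<Rightarrow> complex" assume xi: "\<xi> \<in> L2_fun"
    note xm[measurable] = L2_fun_measurable[OF xi]
    show "twc lam (c + d) (\<lambda>z. F z * k z) \<xi> \<in> borel_measurable borel" by measurable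
    define X where "X t z = \<xi> z * Gt z t" for t z
    have Xm[measurable]: "X t \<in> borel_measurable borel" for t unfolding X_def by measurable
    have Xsq: "sq_int (X t) = (\<integral>\<^sup>+z. ennreal ((cmod (\<xi> z))\<^sup>2) * ennreal ((g (t + \<beta> *\<^sub>R snd (hpart z)))\<^sup>2) \<partial>lborel)" for t
      unfolding sq_int_def X_def by (simp add: norm_mult nG power_mult_distrib ennreal_mult)
    \<comment> \<open>The window is bounded by M, so for each single t the product stays in L^2 and
      the operator bound for parameter c applies to it.\<close>
    have XL: "X t \<in> L2_fun" for t
    proof -
      have "sq_int (X t) \<le> (\<integral>\<^sup>+z. ennreal ((cmod (\<xi> z))\<^sup>2) * ennreal (M\<^sup>2) \<partial>lborel)"
        unfolding Xsq by (intro nn_integral_mono mult_left_mono ennreal_leI power_mono g) auto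
      also have "\<dots> = sq_int \<xi> * ennreal (M\<^sup>2)" unfolding sq_int_def by (rule nn_integral_multc) measurable
      also have "\<dots> < \<infinity>" using xi by (simp add: L2_fun_iff ennreal_mult_less_top)
      finally show ?thesis by (simp add: L2_fun_iff)
    qed
    have Tm: "(\<lambda>s. twc lam c F (X (snd s)) (fst s)) \<in> borel_measurable borel"
      unfolding twc_def X_def by (rule measurable_lborel_integral) measurable
    have Tmz[measurable]: "(\<lambda>t. twc lam c F (X t) z) \<in> borel_measurable borel" for z
      unfolding twc_def X_def by (rule measurable_lborel_integral) measurable
    have pt: "ennreal ((cmod (twc lam (c + d) (\<lambda>z. F z * k z) \<xi> z))\<^sup>2) \<le> (\<integral>\<^sup>+t. ennreal ((cmod (twc lam c F (X t) z))\<^sup>2) \<partial>lborel)"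
      if gd: "good \<xi> (rpart z)" for z
    proof -
      let ?r = "rpart z" and ?x = "hpart z"
      let ?ph = "\<lambda>a w. ee (a * eta lam ?r * (fst w \<bullet> snd (?x - w)))"
      let ?I = "\<lambda>w. F (emb w ?r) * \<xi> (emb (?x - w) ?r) * ?ph c w"
      have Ii: "integrable lborel ?I" by (rule twc_good_integrable[OF F xm gd])
      have "integrable lborel (\<lambda>u::(real^'n) \<times> 'n V. ?I (snd u) * (complex_of_real (g (fst u + \<beta> *\<^sub>R snd (?x - snd u))) * complex_of_real (g (fst u + \<beta> *\<^sub>R snd ?x))))"
        using gsq by (intro triple_integrable[OF Ii, where a="\<lambda>t. complex_of_real (g t)" and b="\<lambda>t. complex_of_real (g t)"]) auto
      then have "integrable lborel (\<lambda>u::(real^'n) \<times> 'n V. ee (s ?r * (fst u \<bullet> fst (?x - snd u)) + - (s ?r * (fst u \<bullet> fst ?x))) * (?I (snd u) * (complex_of_real (g (fst u + \<beta> *\<^sub>R snd (?x - snd u))) * complex_of_real (g (fst u + \<beta> *\<^sub>R snd ?x)))))"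
        by (rule integrable_ee_mult) measurable
      then have int: "integrable lborel (\<lambda>u::(real^'n) \<times> 'n V. ?I (snd u) * (Gt (emb (?x - snd u) ?r) (fst u) * cnj (Gt (emb ?x ?r) (fst u))))"
        unfolding Gt_def hpart_emb rpart_emb ee_add by (simp add: mult_ac)
      have "twc lam (c + d) (\<lambda>z. F z * k z) \<xi> z = (LINT w|lborel. ?I w * (ee (d * eta lam ?r * (fst w \<bullet> snd (?x - w))) * k (emb w ?r)))"
        unfolding twc_def
      proof (rule Bochner_Integration.integral_cong[OF refl])
        fix w :: "'n V"
        have "?ph (c + d) w = ?ph c w * ?ph d w" by (simp only: ee_add[symmetric] distrib_right)
        then show "F (emb w ?r) * k (emb w ?r) * \<xi> (emb (?x - w) ?r) * ?ph (c + d) w = ?I w * (?ph d w * k (emb w ?r))"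
          by (simp only: mult_ac)
      qed
      also have "\<dots> = (LINT w|lborel. LINT t|lborel. ?I w * (Gt (emb (?x - w) ?r) t * cnj (Gt (emb ?x ?r) t)))"
        by (simp only: integral_mult_right_zero key)
      also have "\<dots> = (LINT t|lborel. LINT w|lborel. ?I w * (Gt (emb (?x - w) ?r) t * cnj (Gt (emb ?x ?r) t)))"
        by (rule integral_lborel_swap[OF int, symmetric])
      also have "\<dots> = (LINT t|lborel. cnj (Gt z t) * twc lam c F (X t) z)"
        unfolding twc_def X_def integral_mult_right_zero[symmetric] emb_parts by (simp only: mult_ac)
      finally have "ennreal (cmod (twc lam (c + d) (\<lambda>z. F z * k z) \<xi> z)) \<le> (\<integral>\<^sup>+t. ennreal (cmod (cnj (Gt z t) * twc lam c F (X t) z)) \<partial>lborel)"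
        using norm_integral_le_nn[of lborel "\<lambda>t. cnj (Gt z t) * twc lam c F (X t) z"] by simp
      also have "\<dots> = (\<integral>\<^sup>+t. ennreal (cmod (Gt z t)) * ennreal (cmod (twc lam c F (X t) z)) \<partial>lborel)"
        by (simp add: norm_mult ennreal_mult)
      finally have "(ennreal (cmod (twc lam (c + d) (\<lambda>z. F z * k z) \<xi> z)))\<^sup>2 \<le> \<dots>\<^sup>2" by (rule power_mono) simp
      \<comment> \<open>Cauchy-Schwarz in t; the factor belonging to \<open>Gt\<close> is 1 because
        each of these vectors has norm 1.\<close>
      also have "\<dots> \<le> (\<integral>\<^sup>+t. (ennreal (cmod (Gt z t)))\<^sup>2 \<partial>lborel) * (\<integral>\<^sup>+t. (ennreal (cmod (twc lam c F (X t) z)))\<^sup>2 \<partial>lborel)"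
        by (rule Cauchy_Schwarz_nn_integral) measurable
      also have "(\<integral>\<^sup>+t. (ennreal (cmod (Gt z t)))\<^sup>2 \<partial>lborel) = 1"
        using g1[of "\<beta> *\<^sub>R snd ?x"] by (simp add: nG g(2) ennreal_power)
      finally show ?thesis by (simp add: ennreal_cmod_square)
    qed
    have "sq_int (twc lam (c + d) (\<lambda>z. F z * k z) \<xi>) \<le> (\<integral>\<^sup>+z. \<integral>\<^sup>+t. ennreal ((cmod (twc lam c F (X t) z))\<^sup>2) \<partial>lborel \<partial>lborel)"
      unfolding sq_int_def
    proof (rule nn_integral_mono_AE)
      show "AE z in lborel. ennreal ((cmod (twc lam (c + d) (\<lambda>z. F z * k z) \<xi> z))\<^sup>2) \<le> (\<integral>\<^sup>+t. ennreal ((cmod (twc lam c F (X t) z))\<^sup>2) \<partial>lborel)"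
        using AE_rpart[OF AE_good[OF xi]] by eventually_elim (rule pt)
    qed
    also have "\<dots> = (\<integral>\<^sup>+t. sq_int (twc lam c F (X t)) \<partial>lborel)"
      unfolding sq_int_def using Tm nn_integral_lborel_pair[of "\<lambda>s. ennreal ((cmod (twc lam c F (X (snd s)) (fst s)))\<^sup>2)"] by simp
    \<comment> \<open>With t outermost, the bound N is used for each \<open>X t\<close> separately.
      The squared norms of the \<open>X t\<close> add up to that of \<xi>, again because the window
      has L^2 norm 1.\<close>
    also have "\<dots> \<le> (\<integral>\<^sup>+t. ennreal (N\<^sup>2) * sq_int (X t) \<partial>lborel)"
      using op XL by (intro nn_integral_mono) (auto simp: op_bound_iff)
    also have "\<dots> = ennreal (N\<^sup>2) * (\<integral>\<^sup>+t. \<integral>\<^sup>+z. ennreal ((cmod (\<xi> z))\<^sup>2) * ennreal ((g (t + \<beta> *\<^sub>R snd (hpart z)))\<^sup>2) \<partial>lborel \<partial>lborel)"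
      unfolding Xsq
    proof (rule nn_integral_cmult)
      have "(\<lambda>t. \<integral>\<^sup>+z. ennreal ((cmod (\<xi> z))\<^sup>2) * ennreal ((g (t + \<beta> *\<^sub>R snd (hpart z)))\<^sup>2) \<partial>lborel) \<in> borel_measurable borel"
        by (rule measurable_lborel_nn_integral) measurable
      then show "(\<lambda>t. \<integral>\<^sup>+z. ennreal ((cmod (\<xi> z))\<^sup>2) * ennreal ((g (t + \<beta> *\<^sub>R snd (hpart z)))\<^sup>2) \<partial>lborel) \<in> borel_measurable lborel" by simp
    qed
    also have "(\<integral>\<^sup>+t. \<integral>\<^sup>+z. ennreal ((cmod (\<xi> z))\<^sup>2) * ennreal ((g (t + \<beta> *\<^sub>R snd (hpart z)))\<^sup>2) \<partial>lborel \<partial>lborel) =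
       (\<integral>\<^sup>+z. \<integral>\<^sup>+t. ennreal ((cmod (\<xi> z))\<^sup>2) * ennreal ((g (t + \<beta> *\<^sub>R snd (hpart z)))\<^sup>2) \<partial>lborel \<partial>lborel)"
      using nn_integral_lborel_pair[of "\<lambda>s. ennreal ((cmod (\<xi> (snd s)))\<^sup>2) * ennreal ((g (fst s + \<beta> *\<^sub>R snd (hpart (snd s))))\<^sup>2)"] by simp
    also have "\<dots> = sq_int \<xi>"
      unfolding sq_int_def by (simp add: nn_integral_cmult g1)
    finally show "sq_int (twc lam (c + d) (\<lambda>z. F z * k z) \<xi>) \<le> ennreal (N\<^sup>2) * sq_int \<xi>" .
  qed
qed

text \<open>Split F = F k + F (1 - k) with k from \<open>transference\<close> for d = h - h'. The
  first part has norm at most that of \<phi> at h. The second is small in L^1 on every fibre: |1 -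
  k| is at most sqrt |d| times a polynomial in |w| and |eta|, which F absorbs.\<close>

lemma norm_h_perturb:
  fixes \<phi> :: "'n::finite G \<Rightarrow> complex"
  assumes f: "\<phi> \<in> S3c"
  obtains C where "C \<ge> 0" "\<And>h h'. \<bar>h - h'\<bar> \<le> 1 \<Longrightarrow> norm_h lam h' \<phi> \<le> norm_h lam h \<phi> + C * sqrt \<bar>h - h'\<bar>"
proof -
  let ?F = "vee \<phi>"
  have FS: "?F \<in> S3c" using f by (rule vee_S3c)
  have dF: "dom_kernel ?F" using FS by (rule dom_kernel_S3c)
  obtain g :: "real^'n \<Rightarrow> real" and L M where
    g: "g \<in> borel_measurable borel" "\<And>t. 0 \<le> g t" "\<And>t. g t \<le> M" "\<And>t. norm t > 1 \<Longrightarrow> g t = 0" "L \<ge> 0"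
    "\<And>s t. \<bar>g s - g t\<bar> \<le> L * norm (s - t)" "integrable lborel g" "integrable lborel (\<lambda>t. (g t)\<^sup>2)" "(LINT t|lborel. (g t)\<^sup>2) = 1"
    using window_exists by metis
  note [measurable] = g(1)
  define I1 where "I1 = (LINT t|lborel. g t)"
  have I1: "I1 \<ge> 0" unfolding I1_def by (intro integral_nonneg_AE AE_I2 g)
  \<comment> \<open>The phase in k and the modulation in A contribute 2 pi each; the displacement of
    the window contributes its Lipschitz constant L times its integral I1.\<close>
  define D where "D = 4 * pi + L * I1"
  have D0: "D \<ge> 0" unfolding D_def using g(5) I1 by simp
  obtain A1 where A1: "A1 \<ge> 0" "\<And>w r. (1 + norm (emb w r)) ^ 2 * cmod (?F (emb w r)) \<le> A1 * wt w" using S3c_wt[OF FS, of 2] by metis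
  \<comment> \<open>eta need not be bounded, but multiplication by it preserves \<open>S3c\<close>,
    so one constant serves all r.\<close>
  obtain A2 where A2: "A2 \<ge> 0" "\<And>w r. (1 + norm (emb w r)) ^ 2 * cmod (of_real (eta lam (rpart (emb w r))) * ?F (emb w r)) \<le> A2 * wt w" using S3c_wt[OF S3c_eta_mult[OF FS, of lam], of 2] by metis
  define W where "W = (LINT w|lborel. wt (w::'n V))"
  have W0: "W \<ge> 0" unfolding W_def by (intro integral_nonneg_AE AE_I2 wt_nonneg)
  have "norm_h lam h' \<phi> \<le> norm_h lam h \<phi> + (D * (A1 + A2) * W) * sqrt \<bar>h - h'\<bar>" if hh: "\<bar>h - h'\<bar> \<le> 1" for h h'
  proof -
    define d where "d = h - h'"
    define \<beta> where "\<beta> = sqrt \<bar>d\<bar>"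
    \<comment> \<open>From |d| <= 1 follows |d| <= \<beta>, so the phase in k, which is of order d,
      is controlled by \<beta> as well.\<close>
    have b: "0 \<le> \<beta>" "\<beta> \<le> 1" "\<beta> * \<beta> = \<bar>d\<bar>" using hh by (auto simp: \<beta>_def d_def)
    define s where "s r = sgn d * sqrt \<bar>d\<bar> * eta lam r" for r
    define A where "A w r = (LINT t|lborel. ee (- (s r * (t \<bullet> fst w))) * of_real (g (t - \<beta> *\<^sub>R snd w) * g t))" for w r
    define k where "k z = ee (d * eta lam (rpart z) * (fst (hpart z) \<bullet> snd (hpart z))) * A (hpart z) (rpart z)" for z
    note tr = transference[OF g(1,2,3,8,9) dF norm_h_props(1)[OF f, of lam h], of d, folded \<beta>_def s_def A_def k_def]
    have tr1: "cmod (A w r) \<le> 1" and tr2: "dom_kernel (\<lambda>z. ?F z * k z)" and tr3: "op_bound (norm_h lam h \<phi>) (twc lam (- h + d) (\<lambda>z. ?F z * k z))" for w r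
      using tr by (simp_all add: s_def[abs_def] A_def[abs_def] k_def[abs_def] \<beta>_def)
    have sabs: "\<bar>s r\<bar> \<le> \<beta> * \<bar>eta lam r\<bar>" for r
      unfolding s_def \<beta>_def abs_mult by (intro mult_right_mono) (auto simp: sgn_real_def)
    have kb: "cmod (1 - k (emb w r)) \<le> \<beta> * D * ((1 + \<bar>eta lam r\<bar>) * (1 + norm w)\<^sup>2)" for w r
    proof -
      let ?E = "\<bar>eta lam r\<bar>" and ?n = "norm w"
      have n1: "norm (fst w) \<le> ?n" "norm (snd w) \<le> ?n" by (rule norm_fst_le2 norm_snd_le2)+
      have p1: "cmod (1 - ee (d * eta lam r * (fst w \<bullet> snd w))) \<le> 2 * pi * (\<beta> * ?E * ?n\<^sup>2)"
      proof -
        have "cmod (1 - ee (d * eta lam r * (fst w \<bullet> snd w))) \<le> 2 * pi * \<bar>0 - d * eta lam r * (fst w \<bullet> snd w)\<bar>"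
          using ee_diff_le[of 0 "d * eta lam r * (fst w \<bullet> snd w)"] by simp
        also have "\<dots> \<le> 2 * pi * (\<beta> * ?E * ?n\<^sup>2)"
        proof (intro mult_left_mono)
          have "\<bar>0 - d * eta lam r * (fst w \<bullet> snd w)\<bar> = \<bar>d\<bar> * ?E * \<bar>fst w \<bullet> snd w\<bar>" by (simp add: abs_mult)
          also have "\<dots> \<le> \<beta> * ?E * (?n * ?n)"
            using b n1 by (intro mult_mono order_trans[OF Cauchy_Schwarz_ineq2]) (auto simp: mult_left_le_one_le b(3)[symmetric])
          finally show "\<bar>0 - d * eta lam r * (fst w \<bullet> snd w)\<bar> \<le> \<beta> * ?E * ?n\<^sup>2" by (simp add: power2_eq_square)
        qed auto
        finally show ?thesis .
      qed
      have p2: "cmod (1 - A w r) \<le> L * \<beta> * ?n * I1 + 2 * pi * (\<beta> * ?E * ?n)"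
      proof -
        let ?g' = "\<lambda>t. g (t - \<beta> *\<^sub>R snd w)"
        have gg: "integrable lborel (\<lambda>t. ?g' t * g t)"
        proof -
          have "sq_int (\<lambda>t. complex_of_real (g (t + - \<beta> *\<^sub>R snd w))) = sq_int (\<lambda>t. complex_of_real (g t))"
            unfolding sq_int_def using nn_integral_lborel_translate[where f="\<lambda>t. ennreal ((g t)\<^sup>2)" and t="- \<beta> *\<^sub>R snd w"] by simp
          moreover have "sq_int (\<lambda>t. complex_of_real (g t)) < \<infinity>"
            unfolding sq_int_def using g(8,9) by (simp add: nn_integral_eq_integral)
          ultimately have "integrable lborel (\<lambda>t. complex_of_real (g (t + - \<beta> *\<^sub>R snd w)) * complex_of_real (g t))"
            by (intro mult_integrable_sq_int) auto
          then have "integrable lborel (\<lambda>t. complex_of_real (?g' t * g t))" by simp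
          from integrable_Re[OF this] show ?thesis by simp
        qed
        have ggA: "(LINT t|lborel. ?g' t * g t) \<le> 1"
        proof -
          have "(LINT t|lborel. ?g' t * g t) \<le> (LINT t|lborel. ((g (t + - \<beta> *\<^sub>R snd w))\<^sup>2 + (g t)\<^sup>2) / 2)"
          proof (rule integral_mono[OF gg])
            have "integrable lborel (\<lambda>t. (g (t + - \<beta> *\<^sub>R snd w))\<^sup>2)" using g(8) by (subst integrable_lborel_translate[where g="\<lambda>t. (g t)\<^sup>2"]) auto
            then show "integrable lborel (\<lambda>t. ((g (t + - \<beta> *\<^sub>R snd w))\<^sup>2 + (g t)\<^sup>2) / 2)" using g(8) by simp
            show "?g' t * g t \<le> ((g (t + - \<beta> *\<^sub>R snd w))\<^sup>2 + (g t)\<^sup>2) / 2" for t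
              using sum_squares_bound[of "?g' t" "g t"] by simp
          qed
          also have "\<dots> = ((LINT t|lborel. (g (t + - \<beta> *\<^sub>R snd w))\<^sup>2) + 1) / 2"
          proof -
            have "integrable lborel (\<lambda>t. (g (t + - \<beta> *\<^sub>R snd w))\<^sup>2)" using g(8) by (subst integrable_lborel_translate[where g="\<lambda>t. (g t)\<^sup>2"]) auto
            then show ?thesis using g(8,9) by simp
          qed
          also have "(LINT t|lborel. (g (t + - \<beta> *\<^sub>R snd w))\<^sup>2) = 1"
            using g(9) by (subst integral_lborel_translate[where g="\<lambda>t. (g t)\<^sup>2"]) auto
          finally show ?thesis by simp
        qed
        have ig: "integrable lborel (\<lambda>t. ee (- (s r * (t \<bullet> fst w))) * complex_of_real (?g' t * g t))"
          by (intro integrable_ee_mult integrable_of_real gg) measurable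
        \<comment> \<open>The normalisation of the window replaces 1 by the integral of its square,
          so that 1 - A is a single integral of a small integrand.\<close>
        have eqA: "1 - A w r = (LINT t|lborel. complex_of_real ((g t)\<^sup>2) - ee (- (s r * (t \<bullet> fst w))) * complex_of_real (?g' t * g t))"
          unfolding A_def Bochner_Integration.integral_diff[OF integrable_of_real[OF g(8)] ig] by (simp only: integral_complex_of_real g(9) of_real_1)
        have "cmod (1 - A w r) \<le> (LINT t|lborel. (L * \<beta> * ?n) * g t + (2 * pi * (\<beta> * ?E * ?n)) * (?g' t * g t))"
          unfolding eqA
        proof (rule Bochner_Integration.integral_norm_bound_integral)
          show "integrable lborel (\<lambda>t. complex_of_real ((g t)\<^sup>2) - ee (- (s r * (t \<bullet> fst w))) * complex_of_real (?g' t * g t))"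
            by (intro Bochner_Integration.integrable_diff ig integrable_of_real g)
          show "integrable lborel (\<lambda>t. (L * \<beta> * ?n) * g t + (2 * pi * (\<beta> * ?E * ?n)) * (?g' t * g t))"
            by (intro Bochner_Integration.integrable_add integrable_mult_right g gg)
          fix t
          show "cmod (complex_of_real ((g t)\<^sup>2) - ee (- (s r * (t \<bullet> fst w))) * complex_of_real (?g' t * g t)) \<le> (L * \<beta> * ?n) * g t + (2 * pi * (\<beta> * ?E * ?n)) * (?g' t * g t)"
          \<comment> \<open>Only t in the unit ball contributes, and there the modulation phase is
            bounded by |s| times |w|.\<close>
          proof (cases "norm t > 1")
            case True then show ?thesis using g(4) by simp
          next
            case False
            let ?e = "ee (- (s r * (t \<bullet> fst w)))"
            have "complex_of_real ((g t)\<^sup>2) - ?e * complex_of_real (?g' t * g t) = (of_real (g t - ?g' t) + (1 - ?e) * of_real (?g' t)) * of_real (g t)"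
              by (simp add: power2_eq_square algebra_simps)
            then have "cmod (complex_of_real ((g t)\<^sup>2) - ?e * complex_of_real (?g' t * g t)) \<le> (\<bar>g t - ?g' t\<bar> + cmod (1 - ?e) * ?g' t) * g t"
              using norm_triangle_ineq[of "of_real (g t - ?g' t)" "(1 - ?e) * of_real (?g' t)"] g(2)
              by (simp add: norm_mult mult_right_mono del: of_real_diff)
            also have "\<dots> \<le> (L * \<beta> * ?n + (2 * pi * (\<beta> * ?E * ?n)) * ?g' t) * g t"
            proof (intro mult_right_mono add_mono)
              have "\<bar>g t - ?g' t\<bar> \<le> L * norm (\<beta> *\<^sub>R snd w)" using g(6)[of t "t - \<beta> *\<^sub>R snd w"] by simp
              also have "\<dots> \<le> L * (\<beta> * ?n)" using b n1 g(5) by (intro mult_left_mono) (auto simp: mult_left_mono)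
              finally show "\<bar>g t - ?g' t\<bar> \<le> L * \<beta> * ?n" by (simp add: mult.assoc)
              have "cmod (1 - ?e) \<le> 2 * pi * \<bar>0 - - (s r * (t \<bullet> fst w))\<bar>" using ee_diff_le[of 0 "- (s r * (t \<bullet> fst w))"] by simp
              also have "\<dots> \<le> 2 * pi * (\<beta> * ?E * ?n)"
              proof (intro mult_left_mono)
                have "\<bar>t \<bullet> fst w\<bar> \<le> 1 * ?n" using False n1 by (intro order_trans[OF Cauchy_Schwarz_ineq2] mult_mono) auto
                then have "\<bar>s r\<bar> * \<bar>t \<bullet> fst w\<bar> \<le> (\<beta> * ?E) * (1 * ?n)" using sabs[of r] b by (intro mult_mono) auto
                then show "\<bar>0 - - (s r * (t \<bullet> fst w))\<bar> \<le> \<beta> * ?E * ?n" by (simp add: abs_mult)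
              qed auto
              finally show "cmod (1 - ?e) \<le> 2 * pi * (\<beta> * ?E * ?n)" .
            qed (use g in auto)
            finally show ?thesis by (simp add: algebra_simps)
          qed
        qed
        also have "\<dots> = (L * \<beta> * ?n) * I1 + (2 * pi * (\<beta> * ?E * ?n)) * (LINT t|lborel. ?g' t * g t)"
          by (simp only: Bochner_Integration.integral_add[OF integrable_mult_right[OF g(7)] integrable_mult_right[OF gg]] integral_mult_right_zero I1_def)
        also have "\<dots> \<le> (L * \<beta> * ?n) * I1 + (2 * pi * (\<beta> * ?E * ?n)) * 1"
          using b by (intro add_left_mono mult_left_mono ggA) auto
        finally show ?thesis by simp
      qed
      have "1 - k (emb w r) = (1 - A w r) + (1 - ee (d * eta lam r * (fst w \<bullet> snd w))) * A w r"
        unfolding k_def hpart_emb rpart_emb by (simp add: algebra_simps)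
      then have "cmod (1 - k (emb w r)) \<le> cmod (1 - A w r) + cmod (1 - ee (d * eta lam r * (fst w \<bullet> snd w))) * cmod (A w r)"
        using norm_triangle_ineq[of "1 - A w r" "(1 - ee (d * eta lam r * (fst w \<bullet> snd w))) * A w r"] by (simp only: norm_mult)
      also have "\<dots> \<le> (L * \<beta> * ?n * I1 + 2 * pi * (\<beta> * ?E * ?n)) + (2 * pi * (\<beta> * ?E * ?n\<^sup>2)) * 1"
        by (intro add_mono mult_mono p1 p2 tr1) (use b in auto)
      also have "\<dots> \<le> \<beta> * D * ((1 + ?E) * (1 + ?n)\<^sup>2)"
      proof -
        have x: "0 \<le> ?E" "0 \<le> ?n" by auto
        have 1: "?n \<le> (1 + ?E) * (1 + ?n)\<^sup>2" and 2: "?E * ?n \<le> (1 + ?E) * (1 + ?n)\<^sup>2" and 3: "?E * ?n\<^sup>2 \<le> (1 + ?E) * (1 + ?n)\<^sup>2"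
          using x by (auto simp: power2_eq_square algebra_simps intro!: add_increasing add_increasing2)
        have "L * \<beta> * ?n * I1 + 2 * pi * (\<beta> * ?E * ?n) + (2 * pi * (\<beta> * ?E * ?n\<^sup>2)) * 1 = (\<beta> * (L * I1)) * ?n + (\<beta> * (2 * pi)) * (?E * ?n) + (\<beta> * (2 * pi)) * (?E * ?n\<^sup>2)"
          by (simp add: algebra_simps)
        also have "\<dots> \<le> (\<beta> * (L * I1)) * ((1 + ?E) * (1 + ?n)\<^sup>2) + (\<beta> * (2 * pi)) * ((1 + ?E) * (1 + ?n)\<^sup>2) + (\<beta> * (2 * pi)) * ((1 + ?E) * (1 + ?n)\<^sup>2)"
          by (intro add_mono mult_left_mono 1 2 3 mult_nonneg_nonneg b(1) g(5) I1) simp_all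
        also have "\<dots> = \<beta> * D * ((1 + ?E) * (1 + ?n)\<^sup>2)" unfolding D_def by (simp add: algebra_simps)
        finally show ?thesis .
      qed
      finally show ?thesis .
    qed
    have Fb: "cmod (?F (emb w r) * (1 - k (emb w r))) \<le> \<beta> * D * (A1 + A2) * wt w" for w r
    proof -
      let ?E = "\<bar>eta lam r\<bar>"
      have n: "(1 + norm w)\<^sup>2 \<le> (1 + norm (emb w r))\<^sup>2" by (intro power_mono add_left_mono norm_le_emb) auto
      have "cmod (?F (emb w r) * (1 - k (emb w r))) \<le> cmod (?F (emb w r)) * (\<beta> * D * ((1 + ?E) * (1 + norm w)\<^sup>2))"
        unfolding norm_mult by (intro mult_left_mono kb) auto
      also have "\<dots> = \<beta> * D * ((1 + norm w)\<^sup>2 * cmod (?F (emb w r)) + (1 + norm w)\<^sup>2 * cmod (of_real (eta lam (rpart (emb w r))) * ?F (emb w r)))"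
      proof -
        have "x * (y * ((1 + e) * m)) = y * (m * x + m * (e * x))" for x y e m :: real by (simp add: algebra_simps)
        then show ?thesis by (simp only: norm_mult norm_of_real rpart_emb)
      qed
      also have "\<dots> \<le> \<beta> * D * (A1 * wt w + A2 * wt w)"
        using b(1) D0 by (intro mult_left_mono add_mono order_trans[OF mult_right_mono[OF n] A1(2)] order_trans[OF mult_right_mono[OF n] A2(2)] mult_nonneg_nonneg norm_ge_zero)
      also have "\<dots> = \<beta> * D * (A1 + A2) * wt w" by (simp only: distrib_right mult.assoc)
      finally show ?thesis .
    qed
    have dR: "dom_kernel (\<lambda>z. ?F z * (1 - k z))"
    proof -
      have "(\<lambda>z. ?F z * k z) \<in> borel_measurable borel" using dom_kernel_slice(1)[OF tr2] .
      then have "(\<lambda>z. ?F z - ?F z * k z) \<in> borel_measurable borel" using dom_kernel_slice(1)[OF dF] by (intro borel_measurable_diff)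
      then have "(\<lambda>z. ?F z * (1 - k z)) \<in> borel_measurable borel" by (simp add: right_diff_distrib)
      then show ?thesis unfolding dom_kernel_def using Fb by blast
    qed
    have bR: "op_bound (\<beta> * D * (A1 + A2) * W) (twc lam (- h') (\<lambda>z. ?F z * (1 - k z)))"
    proof (rule op_bound_twc[OF dR])
      show "0 \<le> \<beta> * D * (A1 + A2) * W" using b D0 A1 A2 W0 by simp
      fix r
      have "(\<integral>\<^sup>+w. ennreal (cmod (?F (emb w r) * (1 - k (emb w r)))) \<partial>lborel) \<le> (\<integral>\<^sup>+w. ennreal (\<beta> * D * (A1 + A2) * wt (w::'n V)) \<partial>lborel)"
        by (intro nn_integral_mono ennreal_leI Fb)
      also have "\<dots> = ennreal (LINT w|lborel. \<beta> * D * (A1 + A2) * wt (w::'n V))"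
        using b D0 A1 A2 by (intro nn_integral_eq_integral integrable_mult_right integrable_wt AE_I2 mult_nonneg_nonneg wt_nonneg) auto
      finally show "(\<integral>\<^sup>+w. ennreal (cmod (?F (emb w r) * (1 - k (emb w r)))) \<partial>lborel) \<le> ennreal (\<beta> * D * (A1 + A2) * W)"
        by (simp add: W_def)
    qed
    have "- h + d = - h'" by (simp add: d_def)
    then have "op_bound (norm_h lam h \<phi> + \<beta> * D * (A1 + A2) * W) (twc lam (- h') (\<lambda>z. ?F z * k z + ?F z * (1 - k z)))"
      using op_bound_twc_add[OF tr2 dR _ bR] tr3 by simp
    moreover have "(\<lambda>z. ?F z * k z + ?F z * (1 - k z)) = ?F" by (simp add: fun_eq_iff algebra_simps)
    ultimately have "op_bound (norm_h lam h \<phi> + \<beta> * D * (A1 + A2) * W) (twc lam (- h') ?F)" by simp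
    from norm_h_props(3)[OF f this] show ?thesis by (simp add: \<beta>_def d_def mult_ac)
  qed
  moreover have "D * (A1 + A2) * W \<ge> 0" using D0 A1 A2 W0 by simp
  ultimately show ?thesis using that by blast
qed

text \<open>\<open>norm_h_perturb\<close> bounds either norm by the other with the same constant, so
  upper and lower semicontinuity come together.\<close>

lemma continuous_norm_h:
  assumes f: "\<phi> \<in> S3c" shows "continuous_on UNIV (\<lambda>h. norm_h lam h \<phi>)"
proof -
  obtain C where C: "C \<ge> 0" "\<And>h h'. \<bar>h - h'\<bar> \<le> 1 \<Longrightarrow> norm_h lam h' \<phi> \<le> norm_h lam h \<phi> + C * sqrt \<bar>h - h'\<bar>"
    using norm_h_perturb[OF f] by metis
  have "((\<lambda>h'. norm_h lam h' \<phi>) \<longlongrightarrow> norm_h lam h \<phi>) (at h)" for h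
  proof -
    have "((\<lambda>h'. norm_h lam h' \<phi> - norm_h lam h \<phi>) \<longlongrightarrow> 0) (at h)"
    proof (rule Lim_null_comparison)
      have "\<forall>\<^sub>F h' in at h. \<bar>h - h'\<bar> < 1"
        by (auto simp: eventually_at dist_real_def abs_minus_commute intro!: exI[of _ 1])
      then show "\<forall>\<^sub>F h' in at h. norm (norm_h lam h' \<phi> - norm_h lam h \<phi>) \<le> C * sqrt \<bar>h - h'\<bar>"
      proof eventually_elim
        case (elim h')
        have eq: "\<bar>h' - h\<bar> = \<bar>h - h'\<bar>" by (rule abs_minus_commute)
        have d: "\<bar>h - h'\<bar> \<le> 1" "\<bar>h' - h\<bar> \<le> 1" using elim unfolding eq by simp_all
        show ?case unfolding real_norm_def using C(2)[OF d(1)] C(2)[OF d(2)] unfolding eq by linarith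
      qed
      have "((\<lambda>h'. C * sqrt \<bar>h - h'\<bar>) \<longlongrightarrow> C * sqrt \<bar>h - h\<bar>) (at h)" by (intro tendsto_intros)
      then show "((\<lambda>h'. C * sqrt \<bar>h - h'\<bar>) \<longlongrightarrow> 0) (at h)" by simp
    qed
    then show ?thesis by (rule LIM_zero_cancel)
  qed
  then show ?thesis by (simp add: continuous_on_def)
qed

section \<open>The deformation\<close>

subsection \<open>Dependence of the operations on the deformation parameter\<close>

text \<open>A twisted convolution with its phase replaced by a defect m. The weight has degree two
  in |eta|, |w| and |v|, enough for the difference of two phases and for a second-order Taylor
  remainder. The inequality (1 + x)^2 <= 2 (1 + x^2) moves the eta factor into F, whose product with
  eta^2 is again in \<open>S3c\<close>; F also absorbs the weight in w, and G the weight in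
  v.\<close>

lemma phase_defect_bound:
  fixes F G :: "'n::finite G \<Rightarrow> complex"
  assumes F: "F \<in> S3c" and G: "G \<in> S3c"
  obtains C where "C \<ge> 0"
    "\<And>m \<epsilon> r. 0 \<le> \<epsilon> \<Longrightarrow> (\<And>w v. cmod (m w v) \<le> \<epsilon> * ((1 + \<bar>eta lam r\<bar>)\<^sup>2 * (1 + norm w)\<^sup>2 * (1 + norm v)\<^sup>2)) \<Longrightarrow>
      (\<integral>\<^sup>+x. ennreal (cmod (LINT w|lborel. F (emb w r) * G (emb (x - w) r) * m w (x - w))) \<partial>lborel) \<le> ennreal (\<epsilon> * C)"
proof -
  obtain A1 where A1: "A1 \<ge> 0" "\<And>w r. (1 + norm (emb w r)) ^ 2 * cmod (F (emb w r)) \<le> A1 * wt w"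
    using S3c_wt[OF F, of 2] by metis
  obtain A2 where A2: "A2 \<ge> 0" "\<And>w r. (1 + norm (emb w r)) ^ 2 * cmod (of_real (eta lam (rpart (emb w r))) * (of_real (eta lam (rpart (emb w r))) * F (emb w r))) \<le> A2 * wt w"
    using S3c_wt[OF S3c_eta_mult[OF S3c_eta_mult[OF F, of lam], of lam], of 2] by metis
  obtain A3 where A3: "A3 \<ge> 0" "\<And>w r. (1 + norm (emb w r)) ^ 2 * cmod (G (emb w r)) \<le> A3 * wt w"
    using S3c_wt[OF G, of 2] by metis
  define W where "W = (LINT w|lborel. wt (w::'n V))"
  have W0: "W \<ge> 0" unfolding W_def by (intro integral_nonneg_AE AE_I2 wt_nonneg)
  have W: "(\<integral>\<^sup>+w. ennreal (wt (w::'n V)) \<partial>lborel) = ennreal W"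
    unfolding W_def by (intro nn_integral_eq_integral integrable_wt AE_I2 wt_nonneg)
  have n: "(1 + norm w)\<^sup>2 \<le> (1 + norm (emb w r))\<^sup>2" for w :: "'n V" and r
    by (intro power_mono add_left_mono norm_le_emb) auto
  have FE: "(1 + \<bar>eta lam r\<bar>)\<^sup>2 * (1 + norm w)\<^sup>2 * cmod (F (emb w r)) \<le> 2 * (A1 + A2) * wt w" for w r
  proof -
    let ?e = "\<bar>eta lam r\<bar>"
    have "(1 + ?e)\<^sup>2 \<le> 2 * (1 + ?e\<^sup>2)" using sum_squares_bound[of 1 ?e] by (simp add: power2_sum)
    then have "(1 + ?e)\<^sup>2 * ((1 + norm w)\<^sup>2 * cmod (F (emb w r))) \<le> 2 * (1 + ?e\<^sup>2) * ((1 + norm w)\<^sup>2 * cmod (F (emb w r)))"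
      by (intro mult_right_mono) auto
    also have "\<dots> = 2 * ((1 + norm w)\<^sup>2 * cmod (F (emb w r)) + (1 + norm w)\<^sup>2 * cmod (of_real (eta lam (rpart (emb w r))) * (of_real (eta lam (rpart (emb w r))) * F (emb w r))))"
    proof -
      have "2 * (1 + e\<^sup>2) * (m * f) = 2 * (m * f + m * (e * (e * f)))" for e m f :: real by (simp add: algebra_simps power2_eq_square)
      then show ?thesis by (simp only: norm_mult norm_of_real rpart_emb)
    qed
    also have "\<dots> \<le> 2 * (A1 * wt w + A2 * wt w)"
      by (intro mult_left_mono add_mono order_trans[OF mult_right_mono[OF n] A1(2)] order_trans[OF mult_right_mono[OF n] A2(2)]) auto
    finally show ?thesis by (simp add: algebra_simps)
  qed
  have GE: "(1 + norm v)\<^sup>2 * cmod (G (emb v r)) \<le> A3 * wt v" for v r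
    by (rule order_trans[OF mult_right_mono[OF n] A3(2)]) simp
  have "(\<integral>\<^sup>+x. ennreal (cmod (LINT w|lborel. F (emb w r) * G (emb (x - w) r) * m w (x - w))) \<partial>lborel) \<le> ennreal (\<epsilon> * (2 * (A1 + A2) * A3 * W * W))"
    if e: "0 \<le> \<epsilon>" and m: "\<And>w v. cmod (m w v) \<le> \<epsilon> * ((1 + \<bar>eta lam r\<bar>)\<^sup>2 * (1 + norm w)\<^sup>2 * (1 + norm v)\<^sup>2)" for m \<epsilon> r
  proof -
    define K where "K = \<epsilon> * (2 * (A1 + A2) * A3)"
    have K: "K \<ge> 0" using e A1 A2 A3 by (simp add: K_def)
    have b: "cmod (F (emb w r) * G (emb v r) * m w v) \<le> K * (wt w * wt v)" for w v
    proof -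
      have "cmod (F (emb w r) * G (emb v r) * m w v) \<le> cmod (F (emb w r)) * cmod (G (emb v r)) * (\<epsilon> * ((1 + \<bar>eta lam r\<bar>)\<^sup>2 * (1 + norm w)\<^sup>2 * (1 + norm v)\<^sup>2))"
        unfolding norm_mult by (intro mult_left_mono m) auto
      also have "\<dots> = \<epsilon> * (((1 + \<bar>eta lam r\<bar>)\<^sup>2 * (1 + norm w)\<^sup>2 * cmod (F (emb w r))) * ((1 + norm v)\<^sup>2 * cmod (G (emb v r))))"
        by (simp only: mult_ac)
      also have "\<dots> \<le> \<epsilon> * ((2 * (A1 + A2) * wt w) * (A3 * wt v))"
        using e A1 A2 by (intro mult_left_mono mult_mono FE GE) (auto simp: wt_nonneg)
      also have "\<dots> = K * (wt w * wt v)" by (simp only: K_def mult_ac)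
      finally show ?thesis .
    qed
    have "(\<integral>\<^sup>+x. ennreal (cmod (LINT w|lborel. F (emb w r) * G (emb (x - w) r) * m w (x - w))) \<partial>lborel)
      \<le> (\<integral>\<^sup>+x. \<integral>\<^sup>+w. ennreal K * (ennreal (wt w) * ennreal (wt (x - w :: 'n V))) \<partial>lborel \<partial>lborel)"
    proof (intro nn_integral_mono)
      fix x :: "'n V"
      have "ennreal (cmod (LINT w|lborel. F (emb w r) * G (emb (x - w) r) * m w (x - w))) \<le> (\<integral>\<^sup>+w. ennreal (cmod (F (emb w r) * G (emb (x - w) r) * m w (x - w))) \<partial>lborel)"
        by (rule norm_integral_le_nn)
      also have "\<dots> \<le> (\<integral>\<^sup>+w. ennreal K * (ennreal (wt w) * ennreal (wt (x - w))) \<partial>lborel)"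
        using K b by (intro nn_integral_mono) (simp add: ennreal_mult[symmetric] wt_nonneg ennreal_leI)
      finally show "ennreal (cmod (LINT w|lborel. F (emb w r) * G (emb (x - w) r) * m w (x - w))) \<le> \<dots>" .
    qed
    also have "\<dots> = (\<integral>\<^sup>+w. \<integral>\<^sup>+x. ennreal K * (ennreal (wt (w::'n V)) * ennreal (wt (x - w))) \<partial>lborel \<partial>lborel)"
      using nn_integral_lborel_pair[of "\<lambda>z. ennreal K * (ennreal (wt (snd z :: 'n V)) * ennreal (wt (fst z - snd z)))"] by simp
    also have "\<dots> = (\<integral>\<^sup>+w. ennreal K * ennreal W * ennreal (wt (w::'n V)) \<partial>lborel)"
    proof (rule nn_integral_cong)
      fix w :: "'n V"
      have "(\<integral>\<^sup>+x. ennreal (wt (x - w)) \<partial>lborel) = ennreal W"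
        using nn_integral_lborel_translate[where f="\<lambda>x. ennreal (wt x)" and t="- w"] W by simp
      then show "(\<integral>\<^sup>+x. ennreal K * (ennreal (wt w) * ennreal (wt (x - w))) \<partial>lborel) = ennreal K * ennreal W * ennreal (wt w)"
        by (simp add: nn_integral_cmult mult_ac)
    qed
    also have "\<dots> = ennreal K * ennreal W * ennreal W"
    proof -
      have m: "(\<lambda>w::'n V. ennreal (wt w)) \<in> borel_measurable lborel" by measurable
      show ?thesis by (simp only: nn_integral_cmult[OF m] W)
    qed
    also have "\<dots> = ennreal (K * W * W)" using K W0 by (simp add: ennreal_mult)
    also have "K * W * W = \<epsilon> * (2 * (A1 + A2) * A3 * W * W)" by (simp only: K_def mult_ac)
    finally show ?thesis .
  qed
  moreover have "2 * (A1 + A2) * A3 * W * W \<ge> 0" using A1 A2 A3 W0 by simp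
  ultimately show ?thesis using that by blast
qed

text \<open>The exponent k is 1 for differences of phases and 2 for Taylor remainders; both fit
  under the same quadratic weight because its base is at least 1.\<close>

lemma phase_weight_bound:
  fixes w v :: "'n::finite V" and k :: nat
  assumes "k \<le> 2" "0 \<le> c" and e: "0 \<le> e"
  shows "c * (e * \<bar>fst w \<bullet> snd v\<bar>) ^ k \<le> c * ((1 + e)\<^sup>2 * (1 + norm w)\<^sup>2 * (1 + norm v)\<^sup>2)"
proof (intro mult_left_mono assms(2))
  have a: "\<bar>fst w \<bullet> snd v\<bar> \<le> norm w * norm v"
    by (rule order_trans[OF Cauchy_Schwarz_ineq2]) (intro mult_mono norm_fst_le2 norm_snd_le2; simp)
  have "e * \<bar>fst w \<bullet> snd v\<bar> \<le> (1 + e) * ((1 + norm w) * (1 + norm v))"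
    using e by (intro mult_mono order_trans[OF a]) auto
  then have "(e * \<bar>fst w \<bullet> snd v\<bar>) ^ k \<le> ((1 + e) * ((1 + norm w) * (1 + norm v))) ^ k"
    using e by (intro power_mono) auto
  also have "\<dots> \<le> ((1 + e) * ((1 + norm w) * (1 + norm v))) ^ 2"
  proof (rule power_increasing[OF assms(1)])
    show "1 \<le> (1 + e) * ((1 + norm w) * (1 + norm v))"
      using e mult_mono[of 1 "1 + e" 1 "(1 + norm w) * (1 + norm v)"] mult_mono[of 1 "1 + norm w" 1 "1 + norm v"] by simp
  qed
  finally show "(e * \<bar>fst w \<bullet> snd v\<bar>) ^ k \<le> (1 + e)\<^sup>2 * (1 + norm w)\<^sup>2 * (1 + norm v)\<^sup>2"
    by (simp only: power_mult_distrib mult.assoc)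
qed

text \<open>The norm itself moves with s, but the bound \<open>norm_h_le\<close> by L^1 norms of
  slices is the same for all parameters, and the phase is Lipschitz in the parameter.\<close>

lemma times_h_tendsto:
  fixes \<phi> \<psi> :: "'n::finite G \<Rightarrow> complex"
  assumes f: "\<phi> \<in> S3c" and g: "\<psi> \<in> S3c"
  shows "((\<lambda>s. norm_h lam s (\<lambda>z. times_h lam s \<phi> \<psi> z + -1 * times_h lam t \<phi> \<psi> z)) \<longlongrightarrow> 0) (at t)"
proof -
  let ?F = "vee \<phi>" and ?G = "vee \<psi>"
  note FS = vee_S3c[OF f] and GS = vee_S3c[OF g]
  obtain C where C: "C \<ge> 0" "\<And>m \<epsilon> r. 0 \<le> \<epsilon> \<Longrightarrow> (\<And>w v. cmod (m w v) \<le> \<epsilon> * ((1 + \<bar>eta lam r\<bar>)\<^sup>2 * (1 + norm w)\<^sup>2 * (1 + norm v)\<^sup>2)) \<Longrightarrow>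
      (\<integral>\<^sup>+x. ennreal (cmod (LINT w|lborel. ?F (emb w r) * ?G (emb (x - w) r) * m w (x - w))) \<partial>lborel) \<le> ennreal (\<epsilon> * C)"
    by (fact phase_defect_bound[OF FS GS, of lam])
  have b: "norm_h lam s (\<lambda>z. times_h lam s \<phi> \<psi> z + -1 * times_h lam t \<phi> \<psi> z) \<le> 2 * pi * \<bar>s - t\<bar> * C" for s
  proof (rule norm_h_le)
    let ?D = "\<lambda>z. times_h lam s \<phi> \<psi> z + -1 * times_h lam t \<phi> \<psi> z"
    show "?D \<in> S3c" by (intro S3c_add S3c_cmult times_h_S3c f g)
    show "0 \<le> 2 * pi * \<bar>s - t\<bar> * C" using C by simp
    fix r
    let ?m = "\<lambda>w v :: 'n V. ee ((- s * eta lam r) * (fst w \<bullet> snd v)) - ee ((- t * eta lam r) * (fst w \<bullet> snd v))"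
    have "vee ?D (emb x r) = (LINT w|lborel. ?F (emb w r) * ?G (emb (x - w) r) * ?m w (x - w))" for x
    proof -
      have "vee ?D (emb x r) = twc lam (- s) ?F ?G (emb x r) - twc lam (- t) ?F ?G (emb x r)"
        by (simp add: vee_diff times_h_S3c f g vee_times_h)
      also have "\<dots> = (LINT w|lborel. ?F (emb w r) * ?G (emb (x - w) r) * ?m w (x - w))"
        unfolding twc_def hpart_emb rpart_emb right_diff_distrib
        by (rule Bochner_Integration.integral_diff[OF twc_integrable[OF FS GS] twc_integrable[OF FS GS], symmetric])
      finally show ?thesis .
    qed
    moreover have "cmod (?m w v) \<le> 2 * pi * \<bar>s - t\<bar> * ((1 + \<bar>eta lam r\<bar>)\<^sup>2 * (1 + norm w)\<^sup>2 * (1 + norm v)\<^sup>2)" for w v :: "'n V"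
    proof -
      have "cmod (?m w v) \<le> 2 * pi * \<bar>(- s * eta lam r) * (fst w \<bullet> snd v) - (- t * eta lam r) * (fst w \<bullet> snd v)\<bar>" by (rule ee_diff_le)
      also have "(- s * eta lam r) * (fst w \<bullet> snd v) - (- t * eta lam r) * (fst w \<bullet> snd v) = - ((s - t) * (eta lam r * (fst w \<bullet> snd v)))"
        by (simp add: algebra_simps)
      also have "2 * pi * \<bar>\<dots>\<bar> = 2 * pi * \<bar>s - t\<bar> * (\<bar>eta lam r\<bar> * \<bar>fst w \<bullet> snd v\<bar>) ^ 1" by (simp add: abs_mult)
      also have "\<dots> \<le> 2 * pi * \<bar>s - t\<bar> * ((1 + \<bar>eta lam r\<bar>)\<^sup>2 * (1 + norm w)\<^sup>2 * (1 + norm v)\<^sup>2)" by (rule phase_weight_bound) auto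
      finally show ?thesis .
    qed
    ultimately show "(\<integral>\<^sup>+x. ennreal (cmod (vee ?D (emb x r))) \<partial>lborel) \<le> ennreal (2 * pi * \<bar>s - t\<bar> * C)"
      using C(2)[of "2 * pi * \<bar>s - t\<bar>" ?m r] by simp
  qed
  show ?thesis
  proof (rule Lim_null_comparison)
    show "\<forall>\<^sub>F s in at t. norm (norm_h lam s (\<lambda>z. times_h lam s \<phi> \<psi> z + -1 * times_h lam t \<phi> \<psi> z)) \<le> 2 * pi * \<bar>s - t\<bar> * C"
      unfolding real_norm_def abs_of_nonneg[OF norm_h_props(2)[OF S3c_add[OF times_h_S3c[OF f g] S3c_cmult[OF times_h_S3c[OF f g]]]]] by (intro always_eventually allI b)
    have "((\<lambda>s. 2 * pi * \<bar>s - t\<bar> * C) \<longlongrightarrow> 2 * pi * \<bar>t - t\<bar> * C) (at t)" by (intro tendsto_intros)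
    then show "((\<lambda>s. 2 * pi * \<bar>s - t\<bar> * C) \<longlongrightarrow> 0) (at t)" by simp
  qed
qed

text \<open>Only the phase of the adjoint kernel depends on the parameter. \<open>H\<close> is that
  kernel without its phase, and the factor eta from the Lipschitz bound is absorbed into it.\<close>

lemma star_h_tendsto:
  fixes \<phi> :: "'n::finite G \<Rightarrow> complex"
  assumes f: "\<phi> \<in> S3c"
  shows "((\<lambda>s. norm_h lam s (\<lambda>z. star_h lam s \<phi> z + -1 * star_h lam t \<phi> z)) \<longlongrightarrow> 0) (at t)"
proof -
  define H :: "'n G \<Rightarrow> complex" where "H = vstar lam 0 (vee \<phi>)"
  have HS: "H \<in> S3c" unfolding H_def by (intro vstar_S3c vee_S3c f)
  obtain A where A: "A \<ge> 0" "\<And>w r. (1 + norm (emb w r)) ^ 2 * cmod (of_real (eta lam (rpart (emb w r))) * H (emb w r)) \<le> A * wt w"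
    using S3c_wt[OF S3c_eta_mult[OF HS, of lam], of 2] by metis
  define W where "W = (LINT w|lborel. wt (w::'n V))"
  have W0: "W \<ge> 0" unfolding W_def by (intro integral_nonneg_AE AE_I2 wt_nonneg)
  have b: "norm_h lam s (\<lambda>z. star_h lam s \<phi> z + -1 * star_h lam t \<phi> z) \<le> 2 * pi * \<bar>s - t\<bar> * A * W" for s
  proof (rule norm_h_le)
    let ?D = "\<lambda>z. star_h lam s \<phi> z + -1 * star_h lam t \<phi> z"
    show "?D \<in> S3c" by (intro S3c_add S3c_cmult star_h_S3c f)
    show "0 \<le> 2 * pi * \<bar>s - t\<bar> * A * W" using A W0 by simp
    fix r
    have bd: "cmod (vee ?D (emb x r)) \<le> 2 * pi * \<bar>s - t\<bar> * A * wt x" for x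
    proof -
      have "vee ?D (emb x r) = vstar lam (- s) (vee \<phi>) (emb x r) - vstar lam (- t) (vee \<phi>) (emb x r)"
        by (simp add: vee_diff star_h_S3c f vee_star_h)
      also have "\<dots> = (ee (- s * eta lam r * (fst x \<bullet> snd x)) - ee (- t * eta lam r * (fst x \<bullet> snd x))) * H (emb x r)"
        by (simp add: vstar_emb H_def left_diff_distrib)
      finally have "cmod (vee ?D (emb x r)) \<le> (2 * pi * \<bar>- s * eta lam r * (fst x \<bullet> snd x) - - t * eta lam r * (fst x \<bullet> snd x)\<bar>) * cmod (H (emb x r))"
        by (simp only: norm_mult mult_right_mono[OF ee_diff_le norm_ge_zero])
      also have "- s * eta lam r * (fst x \<bullet> snd x) - - t * eta lam r * (fst x \<bullet> snd x) = - ((s - t) * (eta lam r * (fst x \<bullet> snd x)))"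
        by (simp add: algebra_simps)
      also have "(2 * pi * \<bar>\<dots>\<bar>) * cmod (H (emb x r)) = 2 * pi * \<bar>s - t\<bar> * (\<bar>fst x \<bullet> snd x\<bar> * cmod (of_real (eta lam (rpart (emb x r))) * H (emb x r)))"
        by (simp add: abs_mult norm_mult)
      also have "\<dots> \<le> 2 * pi * \<bar>s - t\<bar> * ((1 + norm (emb x r)) ^ 2 * cmod (of_real (eta lam (rpart (emb x r))) * H (emb x r)))"
      proof (intro mult_left_mono mult_right_mono)
        have "\<bar>fst x \<bullet> snd x\<bar> \<le> norm x * norm x"
          by (rule order_trans[OF Cauchy_Schwarz_ineq2]) (intro mult_mono norm_fst_le2 norm_snd_le2; simp)
        also have "\<dots> \<le> (1 + norm (emb x r)) * (1 + norm (emb x r))"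
          using norm_le_emb[of x r] by (intro mult_mono) (auto intro: order_trans)
        finally show "\<bar>fst x \<bullet> snd x\<bar> \<le> (1 + norm (emb x r)) ^ 2" by (simp add: power2_eq_square)
      qed auto
      also have "\<dots> \<le> 2 * pi * \<bar>s - t\<bar> * (A * wt x)" by (intro mult_left_mono A) auto
      finally show ?thesis by (simp only: mult.assoc)
    qed
    have "(\<integral>\<^sup>+x. ennreal (cmod (vee ?D (emb x r))) \<partial>lborel) \<le> (\<integral>\<^sup>+x. ennreal (2 * pi * \<bar>s - t\<bar> * A * wt (x::'n V)) \<partial>lborel)"
      by (intro nn_integral_mono ennreal_leI bd)
    also have "\<dots> = ennreal (LINT x|lborel. 2 * pi * \<bar>s - t\<bar> * A * wt (x::'n V))"
      using A by (intro nn_integral_eq_integral integrable_mult_right integrable_wt AE_I2 mult_nonneg_nonneg wt_nonneg) auto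
    finally show "(\<integral>\<^sup>+x. ennreal (cmod (vee ?D (emb x r))) \<partial>lborel) \<le> ennreal (2 * pi * \<bar>s - t\<bar> * A * W)"
      by (simp add: W_def)
  qed
  show ?thesis
  proof (rule Lim_null_comparison)
    show "\<forall>\<^sub>F s in at t. norm (norm_h lam s (\<lambda>z. star_h lam s \<phi> z + -1 * star_h lam t \<phi> z)) \<le> 2 * pi * \<bar>s - t\<bar> * A * W"
      unfolding real_norm_def abs_of_nonneg[OF norm_h_props(2)[OF S3c_add[OF star_h_S3c[OF f] S3c_cmult[OF star_h_S3c[OF f]]]]] by (intro always_eventually allI b)
    have "((\<lambda>s. 2 * pi * \<bar>s - t\<bar> * A * W) \<longlongrightarrow> 2 * pi * \<bar>t - t\<bar> * A * W) (at t)" by (intro tendsto_intros)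
    then show "((\<lambda>s. 2 * pi * \<bar>s - t\<bar> * A * W) \<longlongrightarrow> 0) (at t)" by simp
  qed
qed

subsection \<open>The semiclassical limit\<close>

abbreviation ddp :: "'n::finite \<Rightarrow> ('n G \<Rightarrow> complex) \<Rightarrow> 'n G \<Rightarrow> complex" where
  "ddp i \<equiv> dderiv (axis i 1, 0, 0)"

abbreviation ddq :: "'n::finite \<Rightarrow> ('n G \<Rightarrow> complex) \<Rightarrow> 'n G \<Rightarrow> complex" where
  "ddq i \<equiv> dderiv (0, axis i 1, 0)"

lemma axis_emb: "(axis i 1, 0, 0) = emb (axis i 1, 0) 0" "(0, axis i 1, 0) = emb (0, axis i 1) 0"
  by (simp_all add: emb_def)

lemma ddp_S3c: "f \<in> S3c \<Longrightarrow> ddp i f \<in> S3c" and ddq_S3c: "f \<in> S3c \<Longrightarrow> ddq i f \<in> S3c"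
  unfolding axis_emb by (rule dderiv_emb_0; assumption)+

lemma vee_ddp: "f \<in> S3c \<Longrightarrow> vee (ddp i f) z = - (2 * of_real pi * \<i> * of_real (fst (hpart z) $ i)) * vee f z"
  and vee_ddq: "f \<in> S3c \<Longrightarrow> vee (ddq i f) z = - (2 * of_real pi * \<i> * of_real (snd (hpart z) $ i)) * vee f z"
  unfolding axis_emb by (simp_all add: vee_hderiv inner_prod_def inner_axis)

text \<open>The first-order part \<open>\<phi> \<times>\<^sub>h \<psi> = \<phi>\<psi> + (i h / 2\<pi>) \<eta> \<Sum>\<^sub>i \<partial>\<^sub>p\<^sub>i \<phi> \<partial>\<^sub>q\<^sub>i \<psi> + O(h\<^sup>2)\<close> of the product: on the Fourier side it is
  the Taylor expansion of the phase in \<open>twc\<close>.\<close>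

definition first_order_defect where
  "first_order_defect lam h \<phi> \<psi> z = inverse (of_real h) * (times_h lam h \<phi> \<psi> z - \<phi> z * \<psi> z)
     - \<i> / (2 * of_real pi) * (of_real (eta lam (rpart z)) * (\<Sum>i\<in>UNIV. ddp i \<phi> z * ddq i \<psi> z))"

lemma first_order_defect_S3c: "\<phi> \<in> S3c \<Longrightarrow> \<psi> \<in> S3c \<Longrightarrow> first_order_defect lam h \<phi> \<psi> \<in> S3c"
  unfolding first_order_defect_def[abs_def]
  by (intro S3c_diff S3c_cmult S3c_mult times_h_S3c S3c_eta_mult S3c_sum ddp_S3c ddq_S3c) auto

text \<open>The convolution theorem, read off from the deformed product at parameter 0, where the
  phase is 1.\<close>

lemma vee_mult:
  assumes f: "\<phi> \<in> S3c" and g: "\<psi> \<in> S3c"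
  shows "vee (\<lambda>z. \<phi> z * \<psi> z) (emb x r) = (LINT w|lborel. vee \<phi> (emb w r) * vee \<psi> (emb (x - w) r))"
proof -
  have "vee (\<lambda>z. \<phi> z * \<psi> z) = twc 1 0 (vee \<phi>) (vee \<psi>)"
    using vee_times_h[OF f g, of 1 0] times_h_0[OF f, of 1 \<psi>] by simp
  then show ?thesis by (simp add: twc_def)
qed

text \<open>On the Fourier side the defect is the twisted convolution with its phase replaced by the
  second-order Taylor remainder divided by h. The remainder is quadratic in h, so |h| is left; the
  constant 2 pi^2 is (2 pi)^2 / 2.\<close>

lemma norm_first_order_defect:
  fixes \<phi> \<psi> :: "'n::finite G \<Rightarrow> complex"
  assumes f: "\<phi> \<in> S3c" and g: "\<psi> \<in> S3c"
  obtains C where "\<And>h. h \<noteq> 0 \<Longrightarrow> norm_h lam h (first_order_defect lam h \<phi> \<psi>) \<le> \<bar>h\<bar> * C"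
proof -
  let ?F = "vee \<phi>" and ?G = "vee \<psi>"
  note FS = vee_S3c[OF f] and GS = vee_S3c[OF g]
  obtain C where C: "C \<ge> 0" "\<And>m \<epsilon> r. 0 \<le> \<epsilon> \<Longrightarrow> (\<And>w v. cmod (m w v) \<le> \<epsilon> * ((1 + \<bar>eta lam r\<bar>)\<^sup>2 * (1 + norm w)\<^sup>2 * (1 + norm v)\<^sup>2)) \<Longrightarrow>
      (\<integral>\<^sup>+x. ennreal (cmod (LINT w|lborel. ?F (emb w r) * ?G (emb (x - w) r) * m w (x - w))) \<partial>lborel) \<le> ennreal (\<epsilon> * C)"
    by (fact phase_defect_bound[OF FS GS, of lam])
  have "norm_h lam h (first_order_defect lam h \<phi> \<psi>) \<le> \<bar>h\<bar> * (2 * pi\<^sup>2 * C)" if h: "h \<noteq> 0" for h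
  proof (rule norm_h_le)
    show "first_order_defect lam h \<phi> \<psi> \<in> S3c" by (rule first_order_defect_S3c[OF f g])
    show "0 \<le> \<bar>h\<bar> * (2 * pi\<^sup>2 * C)" using C by simp
    fix r
    let ?e = "complex_of_real (eta lam r)"
    let ?a = "\<lambda>w v :: 'n V. - h * eta lam r * (fst w \<bullet> snd v)"
    let ?m = "\<lambda>w v. (ee (?a w v) - 1 - 2 * of_real pi * \<i> * of_real (?a w v)) / of_real h"
    have vD: "vee (first_order_defect lam h \<phi> \<psi>) (emb x r) = (LINT w|lborel. ?F (emb w r) * ?G (emb (x - w) r) * ?m w (x - w))" for x
    proof -
      let ?P = "\<lambda>w. ?F (emb w r) * ?G (emb (x - w) r)"
      have int0: "integrable lborel ?P" using twc_integrable[OF FS GS, of r x 0] by simp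
      have int: "integrable lborel (\<lambda>w. ?P w * ee (?a w (x - w)))" by (rule twc_integrable[OF FS GS])
      let ?Q = "\<lambda>i w. vee (ddp i \<phi>) (emb w r) * vee (ddq i \<psi>) (emb (x - w) r)"
      have intQ: "integrable lborel (?Q i)" for i
        using twc_integrable[OF vee_S3c[OF ddp_S3c[OF f]] vee_S3c[OF ddq_S3c[OF g]], of i r i x 0] by simp
      have "vee (first_order_defect lam h \<phi> \<psi>) (emb x r) =
         inverse (of_real h) * (vee (times_h lam h \<phi> \<psi>) (emb x r) - vee (\<lambda>z. \<phi> z * \<psi> z) (emb x r))
         - \<i> / (2 * of_real pi) * (?e * (\<Sum>i\<in>UNIV. vee (\<lambda>z. ddp i \<phi> z * ddq i \<psi> z) (emb x r)))"
      proof -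
        have S: "(\<lambda>z. \<Sum>i\<in>UNIV. ddp i \<phi> z * ddq i \<psi> z) \<in> S3c" by (intro S3c_sum S3c_mult ddp_S3c ddq_S3c f g) auto
        have S1: "(\<lambda>z. \<i> / (2 * of_real pi) * (of_real (eta lam (rpart z)) * (\<Sum>i\<in>UNIV. ddp i \<phi> z * ddq i \<psi> z))) \<in> S3c"
          by (intro S3c_cmult S3c_eta_mult S)
        have S2: "(\<lambda>z. times_h lam h \<phi> \<psi> z - \<phi> z * \<psi> z) \<in> S3c" by (intro S3c_diff times_h_S3c S3c_mult f g)
        have vs: "vee (\<lambda>z. \<Sum>i\<in>UNIV. ddp i \<phi> z * ddq i \<psi> z) (emb x r) = (\<Sum>i\<in>UNIV. vee (\<lambda>z. ddp i \<phi> z * ddq i \<psi> z) (emb x r))"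
          by (rule vee_sum[OF finite]) (rule S3c_mult[OF ddp_S3c[OF f] ddq_S3c[OF g]])
        have eq: "first_order_defect lam h \<phi> \<psi> = (\<lambda>z. inverse (of_real h) * (times_h lam h \<phi> \<psi> z - \<phi> z * \<psi> z) -
            \<i> / (2 * of_real pi) * (of_real (eta lam (rpart z)) * (\<Sum>i\<in>UNIV. ddp i \<phi> z * ddq i \<psi> z)))"
          by (simp only: first_order_defect_def[abs_def])
        show ?thesis unfolding eq vee_diff[OF S3c_cmult[OF S2] S1] vee_cmult vee_rmult[where m="\<lambda>r. complex_of_real (eta lam r)"]
            vee_diff[OF times_h_S3c[OF f g] S3c_mult[OF f g]] rpart_emb
          by (simp only: vs)
      qed
      also have "\<dots> = inverse (of_real h) * ((LINT w|lborel. ?P w * ee (?a w (x - w))) - (LINT w|lborel. ?P w)) - \<i> / (2 * of_real pi) * (?e * (\<Sum>i\<in>UNIV. LINT w|lborel. ?Q i w))"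
        by (simp only: vee_times_h[OF f g] twc_def vee_mult[OF f g] vee_mult[OF ddp_S3c[OF f] ddq_S3c[OF g]] hpart_emb rpart_emb)
      also have "\<dots> = (LINT w|lborel. inverse (of_real h) * (?P w * ee (?a w (x - w)) - ?P w) - \<i> / (2 * of_real pi) * (?e * (\<Sum>i\<in>UNIV. ?Q i w)))"
        using int int0 intQ by (simp only: Bochner_Integration.integral_diff Bochner_Integration.integral_sum integral_mult_right_zero
           Bochner_Integration.integrable_diff integrable_mult_right Bochner_Integration.integrable_sum simp_thms)
      also have "\<dots> = (LINT w|lborel. ?P w * ?m w (x - w))"
      proof (rule Bochner_Integration.integral_cong[OF refl])
        fix w
        \<comment> \<open>Each pair of derivatives contributes (- 2 pi i)^2 = - 4 pi^2. Together
          with the coefficient i / (2 pi) this is - 2 pi i times eta times the bilinear form, the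
          derivative of the phase at h = 0.\<close>
        have "(\<Sum>i\<in>UNIV. ?Q i w) = (\<Sum>i\<in>UNIV. - (4 * of_real (pi\<^sup>2)) * ?P w * of_real (fst w $ i * snd (x - w) $ i))"
          by (intro sum.cong refl) (simp add: vee_ddp vee_ddq f g algebra_simps power2_eq_square)
        also have "\<dots> = - (4 * of_real (pi\<^sup>2)) * ?P w * of_real (fst w \<bullet> snd (x - w))"
          by (simp only: sum_distrib_left[symmetric] of_real_sum[symmetric] inner_vec_def inner_real_def)
        finally have Q: "(\<Sum>i\<in>UNIV. ?Q i w) = \<dots>" .
        show "inverse (of_real h) * (?P w * ee (?a w (x - w)) - ?P w) - \<i> / (2 * of_real pi) * (?e * (\<Sum>i\<in>UNIV. ?Q i w)) = ?P w * ?m w (x - w)"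
        proof -
          have "inverse c * (P * E - P) - \<i> / (2 * p) * (e * (- (4 * p\<^sup>2) * P * a)) = P * ((E - 1 - 2 * p * \<i> * (- c * e * a)) / c)"
            if "c \<noteq> 0" "p \<noteq> 0" for c P E p e a :: complex
            using that by (simp add: field_simps power2_eq_square)
          from this[of "of_real h" "of_real pi" "?P w" "ee (?a w (x - w))" ?e "of_real (fst w \<bullet> snd (x - w))"]
          show ?thesis unfolding Q using h by simp
        qed
      qed
      finally show ?thesis .
    qed
    have "cmod (?m w v) \<le> (2 * pi\<^sup>2 * \<bar>h\<bar>) * ((1 + \<bar>eta lam r\<bar>)\<^sup>2 * (1 + norm w)\<^sup>2 * (1 + norm v)\<^sup>2)" for w v :: "'n V"
    proof -
      have "cmod (?m w v) \<le> ((2 * pi * ?a w v)\<^sup>2 / 2) / \<bar>h\<bar>"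
        unfolding norm_divide norm_of_real by (intro divide_right_mono ee_taylor_le) auto
      also have "\<dots> = 2 * pi\<^sup>2 * \<bar>h\<bar> * (\<bar>eta lam r\<bar> * \<bar>fst w \<bullet> snd v\<bar>) ^ 2"
      proof -
        have "((2 * p * (- h * e * a))\<^sup>2 / 2) / \<bar>h\<bar> = 2 * p\<^sup>2 * \<bar>h\<bar> * (\<bar>e\<bar> * \<bar>a\<bar>)\<^sup>2" for p e a :: real
          using h by (cases "h > 0") (simp_all add: field_simps power2_eq_square abs_if)
        then show ?thesis by this
      qed
      also have "\<dots> \<le> (2 * pi\<^sup>2 * \<bar>h\<bar>) * ((1 + \<bar>eta lam r\<bar>)\<^sup>2 * (1 + norm w)\<^sup>2 * (1 + norm v)\<^sup>2)" by (rule phase_weight_bound) auto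
      finally show ?thesis .
    qed
    then show "(\<integral>\<^sup>+x. ennreal (cmod (vee (first_order_defect lam h \<phi> \<psi>) (emb x r))) \<partial>lborel) \<le> ennreal (\<bar>h\<bar> * (2 * pi\<^sup>2 * C))"
      unfolding vD using C(2)[of "2 * pi\<^sup>2 * \<bar>h\<bar>" ?m r] by (simp add: mult_ac)
  qed
  then show ?thesis using that by blast
qed

lemma omega_bracket_eq:
  "omega_bracket lam \<phi> \<psi> z = of_real (eta lam (rpart z)) * (\<Sum>i\<in>UNIV. ddp i \<phi> z * ddq i \<psi> z - ddp i \<psi> z * ddq i \<phi> z)"
  by (cases z) (simp add: omega_bracket_def)

text \<open>The commutator expression is the difference of two first-order defects: the pointwise
  products cancel by commutativity, and the antisymmetrised first-order terms are the bracket with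
  factor i / (2 pi).\<close>

lemma semiclassical_limit:
  fixes \<phi> \<psi> :: "'n::finite G \<Rightarrow> complex"
  assumes f: "\<phi> \<in> S3c" and g: "\<psi> \<in> S3c"
  shows "((\<lambda>h. norm_h lam h (\<lambda>z. (times_h lam h \<phi> \<psi> z - times_h lam h \<psi> \<phi> z) / of_real h
            - \<i> / (2 * of_real pi) * omega_bracket lam \<phi> \<psi> z)) \<longlongrightarrow> 0) (at 0)"
proof -
  let ?D = "\<lambda>h z. (times_h lam h \<phi> \<psi> z - times_h lam h \<psi> \<phi> z) / of_real h - \<i> / (2 * of_real pi) * omega_bracket lam \<phi> \<psi> z"
  obtain C1 where C1: "\<And>h. h \<noteq> 0 \<Longrightarrow> norm_h lam h (first_order_defect lam h \<phi> \<psi>) \<le> \<bar>h\<bar> * C1" using norm_first_order_defect[OF f g] by metis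
  obtain C2 where C2: "\<And>h. h \<noteq> 0 \<Longrightarrow> norm_h lam h (first_order_defect lam h \<psi> \<phi>) \<le> \<bar>h\<bar> * C2" using norm_first_order_defect[OF g f] by metis
  have eq: "?D h = (\<lambda>z. first_order_defect lam h \<phi> \<psi> z + -1 * first_order_defect lam h \<psi> \<phi> z)" for h
  proof
    fix z
    have *: "(A - B) / c - k * (e * (S - T)) = (inverse c * (A - P) - k * (e * S)) + -1 * (inverse c * (B - P) - k * (e * T))"
      for A B c k e S T P :: complex by (simp add: divide_inverse algebra_simps)
    show "?D h z = first_order_defect lam h \<phi> \<psi> z + -1 * first_order_defect lam h \<psi> \<phi> z"
      unfolding first_order_defect_def omega_bracket_eq sum_subtractf mult.commute[of "\<psi> z" "\<phi> z"] by (rule *)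
  qed
  note dS = first_order_defect_S3c[OF f g] first_order_defect_S3c[OF g f]
  show ?thesis
  proof (rule Lim_null_comparison)
    have b: "norm (norm_h lam h (?D h)) \<le> \<bar>h\<bar> * C1 + \<bar>h\<bar> * C2" if h: "h \<noteq> 0" for h
    proof -
      have "norm_h lam h (?D h) \<le> norm_h lam h (first_order_defect lam h \<phi> \<psi>) + norm_h lam h (\<lambda>z. -1 * first_order_defect lam h \<psi> \<phi> z)"
        unfolding eq by (intro norm_h_add S3c_cmult dS)
      also have "\<dots> \<le> \<bar>h\<bar> * C1 + \<bar>h\<bar> * C2"
        unfolding norm_h_cmult[OF dS(2)] using C1[OF h] C2[OF h] by simp
      finally show ?thesis unfolding eq real_norm_def abs_of_nonneg[OF norm_h_props(2)[OF S3c_add[OF dS(1) S3c_cmult[OF dS(2)]]]] .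
    qed
    show "\<forall>\<^sub>F h in at 0. norm (norm_h lam h (?D h)) \<le> \<bar>h\<bar> * C1 + \<bar>h\<bar> * C2"
      using b by (auto simp: eventually_at intro!: exI[of _ 1])
    have "((\<lambda>h. \<bar>h\<bar> * C1 + \<bar>h\<bar> * C2) \<longlongrightarrow> \<bar>0\<bar> * C1 + \<bar>0\<bar> * C2) (at 0)" by (intro tendsto_intros)
    then show "((\<lambda>h. \<bar>h\<bar> * C1 + \<bar>h\<bar> * C2) \<longlongrightarrow> 0) (at 0)" by simp
  qed
qed

subsection \<open>Bump functions and density\<close>

text \<open>The standard flat function exp (-1/t) multiplied by powers of 1/t. The whole family is
  needed because differentiation leads from k to k + 1 and k + 2.\<close>

definition exp_cutoff :: "nat \<Rightarrow> real \<Rightarrow> real" where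
  "exp_cutoff k t = (if t > 0 then inverse t ^ k * exp (- inverse t) else 0)"

lemma exp_cutoff_nonneg: "0 \<le> exp_cutoff k t"
  by (simp add: exp_cutoff_def)

text \<open>A single term of the exponential series at 1/t gives inverse t ^ (k + 2) <= (k + 2)! exp
  (1/t). The two extra powers make the bound quadratic in t, so the derivative at 0 exists and
  vanishes.\<close>

lemma exp_cutoff_le: "exp_cutoff k t \<le> fact (k + 2) * t\<^sup>2"
proof (cases "t > 0")
  case True
  have "inverse t ^ (k + 2) / fact (k + 2) \<le> exp (inverse t)"
  proof -
    have "(\<Sum>n\<in>{k+2}. inverse (fact n) * inverse t ^ n) \<le> (\<Sum>n. inverse (fact n) * inverse t ^ n)"
      using True by (intro sum_le_suminf summable_exp) auto
    then show ?thesis by (simp add: exp_def divide_inverse mult.commute)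
  qed
  then have "inverse t ^ (k + 2) \<le> fact (k + 2) * exp (inverse t)" by (simp add: pos_divide_le_eq mult.commute)
  then have "inverse t ^ (k + 2) * exp (- inverse t) \<le> fact (k + 2)" by (simp add: exp_minus pos_divide_le_eq flip: divide_inverse)
  then have "(inverse t ^ (k + 2) * exp (- inverse t)) * t\<^sup>2 \<le> fact (k + 2) * t\<^sup>2" by (intro mult_right_mono) auto
  moreover have "(inverse t ^ (k + 2) * exp (- inverse t)) * t\<^sup>2 = exp_cutoff k t"
    using True by (simp add: exp_cutoff_def power_add field_simps power2_eq_square)
  ultimately show ?thesis by simp
qed (simp add: exp_cutoff_def)

lemma exp_cutoff_deriv: "(exp_cutoff k has_real_derivative (exp_cutoff (k + 2) t - real k * exp_cutoff (k + 1) t)) (at t)"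
proof -
  consider "t > 0" | "t < 0" | "t = 0" by linarith
  then show ?thesis
  proof cases
    case 1
    have "((\<lambda>t. inverse t ^ k * exp (- inverse t)) has_real_derivative (exp_cutoff (k + 2) t - real k * exp_cutoff (k + 1) t)) (at t)"
    proof -
      have i: "(inverse has_real_derivative - (inverse t ^ Suc (Suc 0))) (at t)" using 1 by (intro DERIV_inverse) simp
      have "((\<lambda>t. inverse t ^ k) has_real_derivative - (real k * inverse t ^ (k + 1))) (at t)"
        using DERIV_power[OF i, of k] by (cases k) (simp_all add: algebra_simps)
      moreover have "((\<lambda>t. exp (- inverse t)) has_real_derivative exp (- inverse t) * (inverse t ^ 2)) (at t)"
        using DERIV_chain2[OF DERIV_exp DERIV_minus[OF i]] by (simp add: power2_eq_square)
      ultimately show ?thesis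
        by (rule DERIV_mult'[THEN DERIV_cong]) (use 1 in \<open>simp add: exp_cutoff_def power_add power2_eq_square algebra_simps\<close>)
    qed
    moreover have "\<forall>\<^sub>F s in nhds t. exp_cutoff k s = inverse s ^ k * exp (- inverse s)"
      using eventually_nhds_in_open[of "{0<..}" t] 1 by (auto elim!: eventually_mono simp: exp_cutoff_def)
    ultimately show ?thesis by (subst DERIV_cong_ev[OF refl _ refl]) auto
  next
    case 2
    have "((\<lambda>t. 0) has_real_derivative (exp_cutoff (k + 2) t - real k * exp_cutoff (k + 1) t)) (at t)"
      using 2 by (simp add: exp_cutoff_def)
    moreover have "\<forall>\<^sub>F s in nhds t. exp_cutoff k s = 0"
      using eventually_nhds_in_open[of "{..<0}" t] 2 by (auto elim!: eventually_mono simp: exp_cutoff_def)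
    ultimately show ?thesis by (subst DERIV_cong_ev[OF refl _ refl]) auto
  next
    case 3
    have "((\<lambda>s. (exp_cutoff k s - exp_cutoff k 0) / (s - 0)) \<longlongrightarrow> 0) (at 0)"
    proof (rule Lim_null_comparison)
      have "norm ((exp_cutoff k s - exp_cutoff k 0) / (s - 0)) \<le> fact (k + 2) * \<bar>s\<bar>" if "s \<noteq> 0" for s
      proof -
        have "\<bar>exp_cutoff k s\<bar> / \<bar>s\<bar> \<le> (fact (k + 2) * s\<^sup>2) / \<bar>s\<bar>"
          using exp_cutoff_le[of k s] exp_cutoff_nonneg[of k s] by (intro divide_right_mono) auto
        also have "(fact (k + 2) * s\<^sup>2) / \<bar>s\<bar> = fact (k + 2) * \<bar>s\<bar>"
          using that by (simp add: power2_eq_square abs_if)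
        finally show ?thesis by (simp add: exp_cutoff_def)
      qed
      then show "\<forall>\<^sub>F s in at 0. norm ((exp_cutoff k s - exp_cutoff k 0) / (s - 0)) \<le> fact (k + 2) * \<bar>s\<bar>"
        by (auto simp: eventually_at intro!: exI[of _ 1])
      have "((\<lambda>s::real. fact (k + 2) * \<bar>s\<bar>) \<longlongrightarrow> fact (k + 2) * \<bar>0\<bar>) (at 0)" by (intro tendsto_intros)
      then show "((\<lambda>s::real. fact (k + 2) * \<bar>s\<bar>) \<longlongrightarrow> 0) (at 0)" by simp
    qed
    then show ?thesis using 3 by (simp add: has_field_derivative_iff exp_cutoff_def)
  qed
qed

text \<open>For R > 0 it is positive exactly inside the ball; the squared norm makes it a
  polynomial, so its derivatives are multipliers in \<open>mods\<close>.\<close>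

definition ball_fun :: "'a::real_inner \<Rightarrow> real \<Rightarrow> 'a \<Rightarrow> real" where
  "ball_fun z0 R z = R\<^sup>2 - (norm (z - z0))\<^sup>2"

definition bump :: "'a::real_inner \<Rightarrow> real \<Rightarrow> 'a \<Rightarrow> real" where
  "bump z0 R z = exp_cutoff 0 (ball_fun z0 R z)"

lemma ball_fun_pos: "R > 0 \<Longrightarrow> ball_fun z0 R z > 0 \<longleftrightarrow> norm (z - z0) < R"
  unfolding ball_fun_def using power_strict_mono[of "norm (z - z0)" R 2] power2_less_imp_less[of "norm (z - z0)" R] by auto

lemma bump_pos: "R > 0 \<Longrightarrow> norm (z - z0) < R \<Longrightarrow> bump z0 R z > 0"
  and bump_zero: "R > 0 \<Longrightarrow> norm (z - z0) \<ge> R \<Longrightarrow> bump z0 R z = 0"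
  and bump_nonneg: "bump z0 R z \<ge> 0" and bump_le_1: "bump z0 R z \<le> 1"
  using ball_fun_pos[of R z0 z] by (auto simp: bump_def exp_cutoff_def)

text \<open>Derivatives of a bump are sums of terms in which a multiplier meets some
  \<open>exp_cutoff k\<close> of \<open>ball_fun\<close>. Each such term is continuous and vanishes
  outside the ball, hence is rapid.\<close>

lemma bump_S3c:
  fixes z0 :: "'n::finite G"
  assumes R: "R > 0"
  shows "(\<lambda>z. of_real (bump z0 R z)) \<in> S3c"
proof -
  let ?S = "{\<lambda>z. m z * of_real (exp_cutoff k (ball_fun z0 R z)) | m k. m \<in> mods 1}"
  have du: "(ball_fun z0 R has_derivative (\<lambda>v. - 2 * ((z - z0) \<bullet> v))) (at z)" for z
    unfolding ball_fun_def power2_norm_eq_inner by (auto intro!: derivative_eq_intros simp: inner_commute)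
  have dc: "((\<lambda>z. complex_of_real (exp_cutoff k (ball_fun z0 R z))) has_derivative
     (\<lambda>v. of_real ((exp_cutoff (k + 2) (ball_fun z0 R z) - real k * exp_cutoff (k + 1) (ball_fun z0 R z)) * (- 2 * ((z - z0) \<bullet> v))))) (at z)" for k z
    by (intro has_derivative_of_real has_derivative_compose[OF du exp_cutoff_deriv[unfolded has_field_derivative_def]])
  have diffc: "(\<lambda>z. complex_of_real (exp_cutoff k (ball_fun z0 R z))) differentiable (at z)" for k z
    using dc differentiable_def by blast
  have mu: "(\<lambda>z. of_real (- 2 * ((z - z0) \<bullet> v))) \<in> mods 1" for v
  proof -
    have "(\<lambda>z. - 2 * of_real (z \<bullet> v) + of_real (2 * (z0 \<bullet> v))) \<in> mods 1" by (intro mods.intros)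
    then show ?thesis by (simp add: inner_diff_left right_diff_distrib)
  qed
  have inS: "(\<lambda>z. m z * of_real (exp_cutoff k (ball_fun z0 R z))) \<in> ?S" if "m \<in> mods 1" for m k using that by blast
  have "schwartz (\<lambda>z. complex_of_real (bump z0 R z))"
  proof (rule schwartz_fin_sums_coinduct)
    have "(\<lambda>z. 1 * complex_of_real (exp_cutoff 0 (ball_fun z0 R z))) \<in> ?S" by (rule inS[OF mods.const])
    then show "(\<lambda>z. complex_of_real (bump z0 R z)) \<in> fin_sums ?S" by (auto simp: bump_def intro: fin_sums.base)
    show Sd: "h differentiable (at x)" if "h \<in> ?S" for h x
      using that by clarify (rule differentiable_mult[OF mods_differentiable diffc])
    show "rapid h" if h: "h \<in> ?S" for h
      unfolding rapid_def
    proof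
      fix n
      have "continuous_on (cball z0 R) (\<lambda>z. (1 + norm z) ^ n * cmod (h z))"
        using Sd[OF h] by (intro continuous_intros continuous_at_imp_continuous_on ballI differentiable_imp_continuous_within)
      then have "bounded ((\<lambda>z. (1 + norm z) ^ n * cmod (h z)) ` cball z0 R)"
        by (intro compact_imp_bounded compact_continuous_image) auto
      then obtain C where "\<forall>y \<in> (\<lambda>z. (1 + norm z) ^ n * cmod (h z)) ` cball z0 R. norm y \<le> C"
        unfolding bounded_iff by blast
      then have C: "\<bar>(1 + norm z) ^ n * cmod (h z)\<bar> \<le> C" if "z \<in> cball z0 R" for z
        using that by simp
      have "(1 + norm z) ^ n * cmod (h z) \<le> max C 0" for z
      proof (cases "z \<in> cball z0 R")
        case True then show ?thesis using C[of z] by linarith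
      next
        case False
        then have "\<not> ball_fun z0 R z > 0" using ball_fun_pos[OF R, of z0 z] by (simp add: dist_norm norm_minus_commute)
        then have "h z = 0" using h by (auto simp: exp_cutoff_def)
        then show ?thesis by simp
      qed
      then show "\<exists>C. \<forall>z. (1 + norm z) ^ n * cmod (h z) \<le> C" by blast
    qed
    fix h b assume "h \<in> ?S"
    then obtain m k where h: "h = (\<lambda>z. m z * of_real (exp_cutoff k (ball_fun z0 R z)))" "m \<in> mods 1" by auto
    have "dderiv b h = (\<lambda>z. (dderiv b m z * of_real (exp_cutoff k (ball_fun z0 R z)) +
        (m z * of_real (- 2 * ((z - z0) \<bullet> b))) * of_real (exp_cutoff (k + 2) (ball_fun z0 R z))) +
        (- of_nat k * (m z * of_real (- 2 * ((z - z0) \<bullet> b)))) * of_real (exp_cutoff (k + 1) (ball_fun z0 R z)))"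
      unfolding h(1) by (intro ext) (simp add: dderiv_mult[OF mods_differentiable[OF h(2)] diffc] dderiv_eq[OF dc] algebra_simps)
    moreover have "(\<lambda>z. dderiv b m z * of_real (exp_cutoff k (ball_fun z0 R z))) \<in> ?S"
      by (rule inS[OF mods_dderiv[OF h(2)]])
    moreover have "(\<lambda>z. (m z * of_real (- 2 * ((z - z0) \<bullet> b))) * of_real (exp_cutoff (k + 2) (ball_fun z0 R z))) \<in> ?S"
      by (rule inS[OF mods.mult[OF h(2) mu]])
    moreover have "(\<lambda>z. (- of_nat k * (m z * of_real (- 2 * ((z - z0) \<bullet> b)))) * of_real (exp_cutoff (k + 1) (ball_fun z0 R z))) \<in> ?S"
      by (rule inS[OF mods.mult[OF mods.const mods.mult[OF h(2) mu]]])
    ultimately show "dderiv b h \<in> fin_sums ?S" by (simp only:) (intro fin_sums.add fin_sums.base)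
  qed
  then show ?thesis
  proof (rule S3cI)
    fix z :: "'n G" assume "norm z0 + R < \<bar>rpart z\<bar>"
    then have "R \<le> norm (z - z0)" using norm_rpart_le[of z] norm_triangle_ineq2[of z z0] by linarith
    then show "complex_of_real (bump z0 R z) = 0" using R by (simp add: bump_zero)
  qed
qed

section \<open>Polynomial approximation and density in \<open>C_infinity\<close>\<close>

lemma polynomial_mods:
  fixes p :: "'n::finite G \<Rightarrow> real"
  assumes "real_polynomial_function p" shows "(\<lambda>z. of_real (p z)) \<in> mods lam"
  using assms
proof induction
  case (linear f)
  define a where "a = (\<Sum>b\<in>Basis. f b *\<^sub>R b)"
  have "f z = z \<bullet> a" for z
  proof -
    have l: "linear f" using linear by (rule bounded_linear.linear)
    have "f z = f (\<Sum>b\<in>Basis. (z \<bullet> b) *\<^sub>R b)" by (simp only: euclidean_representation)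
    also have "\<dots> = (\<Sum>b\<in>Basis. (z \<bullet> b) * f b)" by (simp only: linear_sum[OF l] linear_scale[OF l] o_def real_scaleR_def)
    finally show ?thesis by (simp add: a_def inner_sum_right mult.commute)
  qed
  then show ?case using mods.coord by (simp only:)
qed (auto intro: mods.intros)

lemma S3c_C_infinity:
  fixes f :: "'n::finite G \<Rightarrow> complex"
  assumes "f \<in> S3c" shows "f \<in> C_infinity"
  unfolding C_infinity_def
proof (intro CollectI conjI allI impI S3c_continuous_on assms)
  fix e :: real assume e: "e > 0"
  obtain C where C: "C \<ge> 0" "\<And>z. (1 + norm z) ^ 1 * cmod (f z) \<le> C" using rapidE[OF S3c_rapid[OF assms], of 1] by metis
  have "cmod (f z) < e" if "z \<notin> cball 0 (C / e)" for z
  proof -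
    have "C < norm z * e" using that e by (simp add: not_le pos_divide_less_eq)
    then have "C < (1 + norm z) * e" using e by (simp add: distrib_right)
    then have "(1 + norm z) * cmod (f z) < (1 + norm z) * e" using C(2)[of z] by simp
    then show ?thesis using norm_ge_zero[of z] by (auto simp: mult_less_cancel_left)
  qed
  then show "\<exists>K. compact K \<and> (\<forall>x. x \<notin> K \<longrightarrow> cmod (f x) < e)" by (intro exI[of _ "cball 0 (C / e)"]) auto
qed

text \<open>Cutting f off to f', supported in the ball of radius R + 1, costs less than e/2. The
  quotient of f' by a bump of radius R + 2 is approximated by a polynomial on that larger ball, and
  multiplication by the bump brings the polynomial into \<open>S3c\<close>. The bump is at most 1,
  so the error does not grow.\<close>

lemma S3c_dense:
  fixes f :: "'n::finite G \<Rightarrow> complex"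
  assumes f: "f \<in> C_infinity" and e: "e > 0"
  shows "\<exists>g\<in>S3c. \<forall>x. cmod (f x - g x) < e"
proof -
  have cf: "continuous_on UNIV f" using f by (simp add: C_infinity_def)
  obtain K where K: "compact K" "\<And>x. x \<notin> K \<Longrightarrow> cmod (f x) < e / 2"
    using f e unfolding C_infinity_def by (auto dest: spec[of _ "e/2"])
  obtain R where R: "R > 0" "\<And>x. x \<in> K \<Longrightarrow> norm x \<le> R" using compact_imp_bounded[OF K(1)] by (auto simp: bounded_pos)
  define c :: "'n G \<Rightarrow> real" where "c z = max 0 (min 1 (R + 1 - norm z))" for z
  define f' where "f' z = of_real (c z) * f z" for z
  have c01: "0 \<le> c z" "c z \<le> 1" for z by (auto simp: c_def)
  have ff: "cmod (f z - f' z) < e / 2" for z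
  proof (cases "z \<in> K")
    case True then show ?thesis using R(2)[of z] e by (simp add: f'_def c_def)
  next
    case False
    have "cmod (f z - f' z) = (1 - c z) * cmod (f z)"
    proof -
      have "f z - f' z = of_real (1 - c z) * f z" by (simp add: f'_def left_diff_distrib)
      then show ?thesis using c01[of z] by (simp only: norm_mult norm_of_real)
    qed
    also have "\<dots> \<le> 1 * cmod (f z)" using c01 by (intro mult_right_mono) auto
    also have "\<dots> < e / 2" using K(2)[OF False] by simp
    finally show ?thesis .
  qed
  let ?b = "bump (0::'n G) (R + 2)"
  have b: "?b z > 0" if "norm z < R + 2" for z using that R(1) by (intro bump_pos) auto
  have bS: "(\<lambda>z. complex_of_real (?b z)) \<in> S3c" using R(1) by (intro bump_S3c) simp
  have cb: "continuous_on UNIV ?b"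
    using continuous_on_Re[OF S3c_continuous_on[OF bS, of UNIV]] by simp
  obtain x0 where x0: "x0 \<in> cball 0 (R + 1)" "\<And>y. y \<in> cball 0 (R + 1) \<Longrightarrow> ?b x0 \<le> ?b y"
    using continuous_attains_inf[of "cball (0::'n G) (R + 1)" ?b] R(1) continuous_on_subset[OF cb] by auto
  define \<mu> where "\<mu> = ?b x0"
  have mu: "\<mu> > 0" unfolding \<mu>_def using x0(1) by (intro b) auto
  \<comment> \<open>The maximum with \<mu>, the least value of the bump on the ball of radius R + 1,
    keeps g continuous everywhere and changes nothing where f' is nonzero.\<close>
  define g where "g z = f' z / of_real (max (?b z) \<mu>)" for z
  have cg: "continuous_on UNIV g"
    unfolding g_def f'_def c_def using mu by (intro continuous_intros cf cb) (auto simp: max_def)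
  have gb: "g z * of_real (?b z) = f' z" for z
  proof (cases "norm z \<le> R + 1")
    case True
    then have "\<mu> \<le> ?b z" using x0(2)[of z] by (simp add: \<mu>_def)
    then show ?thesis using mu by (simp add: g_def max_def)
  next
    case False then show ?thesis by (simp add: g_def f'_def c_def)
  qed
  obtain p where p: "polynomial_function p" "\<And>x. x \<in> cball 0 (R + 2) \<Longrightarrow> cmod (g x - p x) < e / 2"
    using Stone_Weierstrass_polynomial_function[of "cball (0::'n G) (R + 2)" g "e / 2"] continuous_on_subset[OF cg] e by auto
  have "(\<lambda>z. of_real (Re (p z)) + \<i> * of_real (Im (p z))) \<in> mods 1"
    using p(1) bounded_linear_Re bounded_linear_Im unfolding polynomial_function_def
    by (intro mods.add mods.mult mods.const polynomial_mods) (auto simp: o_def)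
  then have "p \<in> mods 1" by (simp add: complex_eq[symmetric])
  then have S: "(\<lambda>z. p z * of_real (?b z)) \<in> S3c" by (rule S3c_mods_mult[OF _ bS])
  have "cmod (f z - p z * of_real (?b z)) < e" for z
  proof -
    have "cmod (f' z - p z * of_real (?b z)) \<le> e / 2"
    proof (cases "norm z \<le> R + 2")
      case True
      have "f' z - p z * of_real (?b z) = (g z - p z) * of_real (?b z)" by (simp add: gb[symmetric] left_diff_distrib)
      then have "cmod (f' z - p z * of_real (?b z)) = cmod (g z - p z) * ?b z" by (simp add: norm_mult bump_nonneg)
      also have "\<dots> \<le> (e / 2) * 1" using p(2)[of z] True e by (intro mult_mono bump_le_1 bump_nonneg) auto
      finally show ?thesis by simp
    next
      case False
      then have "?b z = 0" using R(1) by (intro bump_zero) auto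
      moreover have "f' z = 0" using False by (simp add: f'_def c_def)
      ultimately show ?thesis using e by simp
    qed
    then show ?thesis using ff[of z] norm_triangle_ineq[of "f z - f' z" "f' z - p z * of_real (?b z)"] by simp
  qed
  then show ?thesis by (intro bexI[OF _ S] allI)
qed

lemma dense_star_subalgebra_S3c: "dense_star_subalgebra S3c"
  unfolding dense_star_subalgebra_def
  by (intro conjI ballI allI impI subsetI S3c_zero S3c_add S3c_cmult S3c_mult S3c_cnj) (erule S3c_C_infinity | erule (1) S3c_dense | assumption)+

subsection \<open>The norm at parameter zero\<close>

text \<open>Convolution by \<open>FT f\<close> is multiplication by f between two Fourier
  transforms. The Bessel inequality is used once for each transform and has constant 1, so only the
  bound M of f remains.\<close>

lemma convolution_multiplier_L1:
  fixes f \<eta> :: "'a::euclidean_space \<Rightarrow> complex"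
  assumes f: "integrable lborel f" and M: "\<And>p. cmod (f p) \<le> M" and \<eta>: "integrable lborel \<eta>"
  shows "sq_int (\<lambda>x. LINT w|lborel. FT f w * \<eta> (x - w)) \<le> ennreal (M\<^sup>2) * sq_int \<eta>"
proof -
  have [measurable]: "f \<in> borel_measurable borel" "\<eta> \<in> borel_measurable borel" using f \<eta> by auto
  have eq: "(LINT w|lborel. FT f w * \<eta> (x - w)) = FT (\<lambda>p. f p * FT \<eta> (- p)) x" for x
  proof -
    have "integrable lborel (\<lambda>w. \<eta> (x - w))" using \<eta> by (subst integrable_lborel_reflect) auto
    from integrable_lborel_prod[OF this f]
    have "integrable lborel (\<lambda>z. ee (snd z \<bullet> fst z) * (\<eta> (x - fst z) * f (snd z)))"
      by (rule integrable_ee_mult) measurable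
    then have int: "integrable lborel (\<lambda>z. ee (snd z \<bullet> fst z) * f (snd z) * \<eta> (x - fst z))" by (simp only: mult_ac)
    have "(LINT w|lborel. FT f w * \<eta> (x - w)) = (LINT w|lborel. LINT p|lborel. ee (p \<bullet> w) * f p * \<eta> (x - w))"
      unfolding FT_def by (simp only: integral_mult_left_zero)
    also have "\<dots> = (LINT p|lborel. LINT w|lborel. ee (p \<bullet> w) * f p * \<eta> (x - w))"
      by (rule integral_lborel_swap[OF int])
    also have "\<dots> = (LINT p|lborel. ee (p \<bullet> x) * (f p * FT \<eta> (- p)))"
    proof (rule Bochner_Integration.integral_cong[OF refl])
      fix p
      have "(LINT w|lborel. ee (p \<bullet> w) * f p * \<eta> (x - w)) = (LINT w|lborel. ee (p \<bullet> (x - (x - w))) * f p * \<eta> (x - w))" by simp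
      also have "\<dots> = (LINT v|lborel. ee (p \<bullet> (x - v)) * f p * \<eta> v)"
        by (rule integral_lborel_reflect[where g="\<lambda>v. ee (p \<bullet> (x - v)) * f p * \<eta> v"]) measurable
      also have "\<dots> = (LINT v|lborel. (ee (p \<bullet> x) * f p) * (ee (v \<bullet> - p) * \<eta> v))"
      proof (rule Bochner_Integration.integral_cong[OF refl])
        fix v
        have "p \<bullet> (x - v) = p \<bullet> x + v \<bullet> - p" by (simp add: inner_diff_right inner_commute)
        then show "ee (p \<bullet> (x - v)) * f p * \<eta> v = (ee (p \<bullet> x) * f p) * (ee (v \<bullet> - p) * \<eta> v)" by (simp only: ee_add mult_ac)
      qed
      also have "\<dots> = ee (p \<bullet> x) * (f p * FT \<eta> (- p))" unfolding FT_def integral_mult_right_zero by (simp only: mult_ac)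
      finally show "(LINT w|lborel. ee (p \<bullet> w) * f p * \<eta> (x - w)) = \<dots>" .
    qed
    finally show ?thesis unfolding FT_def[of "\<lambda>p. f p * FT \<eta> (- p)"] .
  qed
  have int: "integrable lborel (\<lambda>p. f p * FT \<eta> (- p))"
  proof (rule Bochner_Integration.integrable_bound)
    show "integrable lborel (\<lambda>p. f p * of_real (LINT v|lborel. cmod (\<eta> v)))" using f by simp
    show "AE p in lborel. cmod (f p * FT \<eta> (- p)) \<le> cmod (f p * of_real (LINT v|lborel. cmod (\<eta> v)))"
      by (intro AE_I2) (auto simp: norm_mult intro!: mult_left_mono norm_FT_le[OF \<eta>])
  qed measurable
  have "sq_int (\<lambda>x. LINT w|lborel. FT f w * \<eta> (x - w)) \<le> (\<integral>\<^sup>+p. ennreal ((cmod (f p * FT \<eta> (- p)))\<^sup>2) \<partial>lborel)"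
    unfolding sq_int_def eq by (rule FT_Bessel[OF int])
  also have "\<dots> \<le> (\<integral>\<^sup>+p. ennreal (M\<^sup>2) * ennreal ((cmod (FT \<eta> (0 - p)))\<^sup>2) \<partial>lborel)"
    by (intro nn_integral_mono) (auto simp: norm_mult power_mult_distrib ennreal_mult[symmetric] intro!: ennreal_leI mult_right_mono power_mono M)
  also have "\<dots> = ennreal (M\<^sup>2) * (\<integral>\<^sup>+p. ennreal ((cmod (FT \<eta> (0 - p)))\<^sup>2) \<partial>lborel)"
    by (rule nn_integral_cmult) measurable
  also have "(\<integral>\<^sup>+p. ennreal ((cmod (FT \<eta> (0 - p)))\<^sup>2) \<partial>lborel) = (\<integral>\<^sup>+p. ennreal ((cmod (FT \<eta> p))\<^sup>2) \<partial>lborel)"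
    by (rule nn_integral_lborel_reflect[where f="\<lambda>p. ennreal ((cmod (FT \<eta> p))\<^sup>2)"]) measurable
  also have "ennreal (M\<^sup>2) * \<dots> \<le> ennreal (M\<^sup>2) * sq_int \<eta>"
    unfolding sq_int_def by (intro mult_left_mono FT_Bessel \<eta>) auto
  finally show ?thesis .
qed

text \<open>Truncations of \<eta> to balls are integrable. As \<open>FT f\<close> and \<eta> are
  square integrable, the convolutions of the truncations converge pointwise by dominated
  convergence, and Fatou carries the bound over.\<close>

lemma convolution_multiplier_L2:
  fixes f \<eta> :: "'a::euclidean_space \<Rightarrow> complex"
  assumes f: "integrable lborel f" and M: "\<And>p. cmod (f p) \<le> M" and F: "sq_int (FT f) < \<infinity>"
    and \<eta>: "\<eta> \<in> borel_measurable borel" "sq_int \<eta> < \<infinity>"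
  shows "sq_int (\<lambda>x. LINT w|lborel. FT f w * \<eta> (x - w)) \<le> ennreal (M\<^sup>2) * sq_int \<eta>"
proof -
  note [measurable] = \<eta>(1)
  have [measurable]: "f \<in> borel_measurable borel" using f by auto
  have [measurable]: "cball (0::'a) r \<in> sets borel" for r by simp
  define e where "e n w = \<eta> w * indicator (cball 0 (real n)) w" for n w
  have [measurable]: "e n \<in> borel_measurable borel" for n unfolding e_def by measurable
  let ?c = "\<lambda>\<eta> x. LINT w|lborel. FT f w * \<eta> (x - w)"
  have cm: "?c \<zeta> \<in> borel_measurable borel" if [measurable]: "\<zeta> \<in> borel_measurable borel" for \<zeta>
    by (rule measurable_lborel_integral) measurable
  have le: "cmod (e n w) \<le> cmod (\<eta> w)" for n w by (simp add: e_def indicator_def)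
  have ei: "integrable lborel (e n)" for n
    unfolding e_def
  proof (rule mult_integrable_sq_int)
    have "sq_int (indicator (cball 0 (real n)) :: 'a \<Rightarrow> complex) = (\<integral>\<^sup>+z. indicator (cball (0::'a) (real n)) z \<partial>lborel)"
      unfolding sq_int_def by (intro nn_integral_cong) (simp add: indicator_def)
    also have "\<dots> = emeasure lborel (cball (0::'a) (real n))" by simp
    also have "\<dots> < \<infinity>" by (rule emeasure_bounded_finite) simp
    finally show "sq_int (indicator (cball 0 (real n)) :: 'a \<Rightarrow> complex) < \<infinity>" .
  qed (use \<eta> in measurable)
  have b: "sq_int (?c (e n)) \<le> ennreal (M\<^sup>2) * sq_int \<eta>" for n
  proof -
    have "sq_int (e n) \<le> sq_int \<eta>" unfolding sq_int_def by (intro nn_integral_mono ennreal_leI power_mono le) auto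
    then show ?thesis using order_trans[OF convolution_multiplier_L1[OF f M ei[of n]] mult_left_mono] by auto
  qed
  have lim: "(\<lambda>n. ?c (e n) x) \<longlonglongrightarrow> ?c \<eta> x" for x
  proof (rule integral_dominated_convergence)
    have "integrable lborel (\<lambda>w. FT f w * \<eta> (x - w))"
      using F \<eta> by (intro mult_integrable_sq_int) (auto simp: sq_int_reflect)
    then show "integrable lborel (\<lambda>w. cmod (FT f w * \<eta> (x - w)))" by (rule integrable_norm)
    show "AE w in lborel. cmod (FT f w * e n (x - w)) \<le> cmod (FT f w * \<eta> (x - w))" for n
      by (simp add: norm_mult mult_left_mono le)
    show "AE w in lborel. (\<lambda>n. FT f w * e n (x - w)) \<longlonglongrightarrow> FT f w * \<eta> (x - w)"
    proof (rule AE_I2)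
      fix w
      have "\<forall>\<^sub>F n in sequentially. FT f w * e n (x - w) = FT f w * \<eta> (x - w)"
        using eventually_ge_at_top[of "nat \<lceil>norm (x - w)\<rceil>"]
        by eventually_elim (auto simp: e_def nat_le_iff ceiling_le_iff)
      then show "(\<lambda>n. FT f w * e n (x - w)) \<longlonglongrightarrow> FT f w * \<eta> (x - w)" by (rule tendsto_eventually)
    qed
  qed measurable
  have "sq_int (?c \<eta>) = (\<integral>\<^sup>+x. liminf (\<lambda>n. ennreal ((cmod (?c (e n) x))\<^sup>2)) \<partial>lborel)"
    unfolding sq_int_def
  proof (intro nn_integral_cong lim_imp_Liminf[symmetric])
    show "(\<lambda>n. ennreal ((cmod (?c (e n) x))\<^sup>2)) \<longlonglongrightarrow> ennreal ((cmod (?c \<eta> x))\<^sup>2)" for x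
      by (intro tendsto_ennrealI tendsto_power tendsto_norm lim)
  qed simp
  also have "\<dots> \<le> liminf (\<lambda>n. sq_int (?c (e n)))"
    unfolding sq_int_def using cm[of "e _"] by (intro nn_integral_liminf) simp
  also have "\<dots> \<le> liminf (\<lambda>n::nat. ennreal (M\<^sup>2) * sq_int \<eta>)" by (intro Liminf_mono always_eventually allI b)
  also have "\<dots> = ennreal (M\<^sup>2) * sq_int \<eta>" by (simp add: Liminf_const)
  finally show ?thesis .
qed

lemma norm_0_le:
  fixes \<phi> :: "'n::finite G \<Rightarrow> complex"
  assumes f: "\<phi> \<in> S3c" and M: "\<And>z. cmod (\<phi> z) \<le> M"
  shows "norm_h lam 0 \<phi> \<le> M"
proof (rule norm_h_props(3)[OF f], unfold op_bound_iff, intro conjI ballI)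
  show "0 \<le> M" using M[of 0] norm_ge_zero order_trans by blast
  fix \<xi> :: "'n G \<Rightarrow> complex" assume xi: "\<xi> \<in> L2_fun"
  note [measurable] = L2_fun_measurable[OF xi] S3c_measurable[OF vee_S3c[OF f]]
  show m: "twc lam (- 0) (vee \<phi>) \<xi> \<in> borel_measurable borel" by measurable
  have *: "sq_int (\<lambda>w. twc lam (- 0) (vee \<phi>) \<xi> (emb w r)) \<le> ennreal (M\<^sup>2) * sq_int (\<lambda>w. \<xi> (emb w r))" if "good \<xi> r" for r
  proof -
    have eq: "twc lam (- 0) (vee \<phi>) \<xi> (emb x r) = (LINT w|lborel. FT (\<lambda>w. \<phi> (emb w r)) w * \<xi> (emb (x - w) r))" for x
      by (simp add: twc_def vee_emb)
    have "sq_int (FT (\<lambda>w. \<phi> (emb w r))) < \<infinity>"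
      using dom_kernel_slice(3)[OF dom_kernel_S3c[OF vee_S3c[OF f]], of r] by (simp add: vee_emb)
    then show ?thesis unfolding eq using that M
      by (intro convolution_multiplier_L2[where \<eta>="\<lambda>w. \<xi> (emb w r)"] S3c_slice_integrable f) (auto simp: good_def)
  qed
  have "sq_int (twc lam (- 0) (vee \<phi>) \<xi>) = (\<integral>\<^sup>+r. sq_int (\<lambda>w. twc lam (- 0) (vee \<phi>) \<xi> (emb w r)) \<partial>lborel)"
    using m by (rule sq_int_emb)
  also have "\<dots> \<le> (\<integral>\<^sup>+r. ennreal (M\<^sup>2) * sq_int (\<lambda>w. \<xi> (emb w r)) \<partial>lborel)"
    by (rule nn_integral_mono_AE, rule eventually_mono[OF AE_good[OF xi]], rule *)
  also have "\<dots> = ennreal (M\<^sup>2) * (\<integral>\<^sup>+r. sq_int (\<lambda>w. \<xi> (emb w r)) \<partial>lborel)"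
  proof (rule nn_integral_cmult)
    have "(\<lambda>r. sq_int (\<lambda>w. \<xi> (emb w r))) \<in> borel_measurable borel"
      unfolding sq_int_def by (rule measurable_lborel_nn_integral) measurable
    then show "(\<lambda>r. sq_int (\<lambda>w. \<xi> (emb w r))) \<in> borel_measurable lborel" by simp
  qed
  also have "(\<integral>\<^sup>+r. sq_int (\<lambda>w. \<xi> (emb w r)) \<partial>lborel) = sq_int \<xi>"
    by (rule sq_int_emb[symmetric]) measurable
  finally show "sq_int (twc lam (- 0) (vee \<phi>) \<xi>) \<le> ennreal (M\<^sup>2) * sq_int \<xi>" .
qed

text \<open>The Bessel inequality for f and for \<open>vee f\<close>, together with inversion: two
  transforms return f up to reflection, so no step can lose norm.\<close>

lemma Plancherel_S3c:
  fixes f :: "'n::finite G \<Rightarrow> complex"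
  assumes f: "f \<in> S3c"
  shows "sq_int (vee f) = sq_int f"
proof -
  have le: "sq_int (vee g) \<le> sq_int g" if g: "g \<in> S3c" for g :: "'n G \<Rightarrow> complex"
    unfolding sq_int_emb[OF S3c_measurable[OF vee_S3c[OF g]]] sq_int_emb[OF S3c_measurable[OF g]]
    unfolding vee_emb sq_int_def by (intro nn_integral_mono FT_Bessel S3c_slice_integrable g)
  have h: "sq_int (hrefl g) = sq_int g" if g: "g \<in> S3c" for g :: "'n G \<Rightarrow> complex"
  proof -
    have "sq_int (\<lambda>w. hrefl g (emb w r)) = sq_int (\<lambda>w. g (emb w r))" for r
      using sq_int_reflect[OF S3c_slice_measurable[OF g, of r], of 0] by simp
    then show ?thesis
      unfolding sq_int_emb[OF S3c_measurable[OF hrefl_S3c[OF g]]] sq_int_emb[OF S3c_measurable[OF g]] by simp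
  qed
  have "sq_int f = sq_int (vee (vee f))" using h[OF vee_S3c[OF vee_S3c[OF f]]] by (simp only: vee_inversion[OF f])
  then show ?thesis using le[OF f] le[OF vee_S3c[OF f]] by (intro antisym) simp_all
qed

text \<open>If |\<phi>| exceeds the norm N at z0, it does so on a ball. Testing the operator on the
  transform of a bump \<zeta> supported there, Plancherel turns it into multiplication by \<phi>,
  which would stretch \<zeta> by more than N.\<close>

lemma norm_0_ge:
  fixes \<phi> :: "'n::finite G \<Rightarrow> complex"
  assumes f: "\<phi> \<in> S3c"
  shows "cmod (\<phi> z0) \<le> norm_h lam 0 \<phi>"
proof (rule ccontr)
  define N where "N = norm_h lam 0 \<phi>"
  assume "\<not> ?thesis"
  then have N: "N < cmod (\<phi> z0)" by (simp add: N_def)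
  have N0: "0 \<le> N" unfolding N_def by (rule norm_h_props(2)[OF f])
  have cf: "continuous_on UNIV \<phi>" by (rule S3c_continuous_on[OF f])
  have "z0 \<in> (\<lambda>z. cmod (\<phi> z)) -` {N<..}" using N by simp
  moreover have "open ((\<lambda>z. cmod (\<phi> z)) -` {N<..})" using cf by (intro open_vimage continuous_intros) auto
  ultimately obtain \<delta> where d: "\<delta> > 0" "ball z0 \<delta> \<subseteq> (\<lambda>z. cmod (\<phi> z)) -` {N<..}" by (metis openE)
  then have dN: "N < cmod (\<phi> z)" if "norm (z - z0) < \<delta>" for z
    using that subsetD[OF d(2), of z] by (simp add: dist_norm norm_minus_commute)
  define \<zeta> where "\<zeta> z = complex_of_real (bump z0 \<delta> z)" for z
  have chS: "\<zeta> \<in> S3c" unfolding \<zeta>_def by (rule bump_S3c[OF d(1)])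
  note chL = S3c_L2_fun[OF chS]
  \<comment> \<open>The excess of |\<phi> \<zeta>|^2 over N^2 |\<zeta>|^2: nonnegative because
    \<zeta> vanishes off the ball, and positive at z0. The norm bound forces its integral to be
    0.\<close>
  define D where "D z = ((cmod (\<phi> z))\<^sup>2 - N\<^sup>2) * (cmod (\<zeta> z))\<^sup>2" for z
  have D0: "0 \<le> D z" for z
  proof (cases "norm (z - z0) < \<delta>")
    case True then show ?thesis using dN[OF True] N0 by (simp add: D_def power_mono)
  next
    case False then show ?thesis using d(1) by (simp add: D_def \<zeta>_def bump_zero)
  qed
  have cD: "continuous_on UNIV D" unfolding D_def by (intro continuous_intros cf S3c_continuous_on[OF chS])
  note [measurable] = borel_measurable_continuous_onI[OF cD] S3c_measurable[OF chS] S3c_measurable[OF f]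
  have "sq_int (\<lambda>z. \<phi> z * \<zeta> z) = sq_int (twc lam (- 0) (vee \<phi>) (vee \<zeta>))"
    using Plancherel_S3c[OF S3c_mult[OF f chS]] vee_times_h[OF f chS, of lam 0] times_h_0[OF f, of lam \<zeta>] by simp
  also have "\<dots> \<le> ennreal (N\<^sup>2) * sq_int (vee \<zeta>)"
    using norm_h_props(1)[OF f, of lam 0] S3c_L2_fun[OF vee_S3c[OF chS]] by (simp add: op_bound_iff N_def)
  finally have le: "sq_int (\<lambda>z. \<phi> z * \<zeta> z) \<le> ennreal (N\<^sup>2) * sq_int \<zeta>" by (simp only: Plancherel_S3c[OF chS])
  have "sq_int (\<lambda>z. \<phi> z * \<zeta> z) = (\<integral>\<^sup>+z. ennreal (N\<^sup>2) * ennreal ((cmod (\<zeta> z))\<^sup>2) + ennreal (D z) \<partial>lborel)"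
    unfolding sq_int_def
  proof (rule nn_integral_cong)
    fix z
    have "(cmod (\<phi> z * \<zeta> z))\<^sup>2 = N\<^sup>2 * (cmod (\<zeta> z))\<^sup>2 + D z" by (simp add: D_def norm_mult power_mult_distrib algebra_simps)
    then show "ennreal ((cmod (\<phi> z * \<zeta> z))\<^sup>2) = ennreal (N\<^sup>2) * ennreal ((cmod (\<zeta> z))\<^sup>2) + ennreal (D z)"
      using D0[of z] by (simp add: ennreal_mult)
  qed
  also have "\<dots> = ennreal (N\<^sup>2) * sq_int \<zeta> + (\<integral>\<^sup>+z. ennreal (D z) \<partial>lborel)"
    unfolding sq_int_def by (subst nn_integral_add) (auto simp: nn_integral_cmult)
  finally have "ennreal (N\<^sup>2) * sq_int \<zeta> + (\<integral>\<^sup>+z. ennreal (D z) \<partial>lborel) \<le> ennreal (N\<^sup>2) * sq_int \<zeta> + 0" using le by simp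
  moreover have "ennreal (N\<^sup>2) * sq_int \<zeta> \<noteq> \<infinity>" using chL by (auto simp: L2_fun_iff ennreal_mult_eq_top_iff)
  ultimately have "(\<integral>\<^sup>+z. ennreal (D z) \<partial>lborel) = 0" by (simp add: ennreal_add_left_cancel_le)
  then have "sq_int (\<lambda>z. complex_of_real (sqrt (D z))) = 0" unfolding sq_int_def using D0 by simp
  then have "complex_of_real (sqrt (D z0)) = 0"
    using cD by (intro sq_int_eq_0[of "\<lambda>z. complex_of_real (sqrt (D z))"]) (auto intro!: continuous_intros)
  then have "D z0 = 0" by simp
  then show False using N N0 bump_pos[OF d(1), of z0 z0] d(1) power_strict_mono[OF N N0, of 2] by (simp add: D_def \<zeta>_def)
qed

lemma norm_0_eq:
  fixes \<phi> :: "'n::finite G \<Rightarrow> complex"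
  assumes f: "\<phi> \<in> S3c"
  shows "norm_h lam 0 \<phi> = (SUP z. cmod (\<phi> z))"
proof (rule antisym)
  obtain C where C: "\<And>z. cmod (\<phi> z) \<le> C" using S3c_bounded[OF f] by metis
  have "bdd_above (range (\<lambda>z. cmod (\<phi> z)))" using C by (intro bdd_aboveI2)
  then show "norm_h lam 0 \<phi> \<le> (SUP z. cmod (\<phi> z))" by (intro norm_0_le[OF f] cSUP_upper) auto
  show "(SUP z. cmod (\<phi> z)) \<le> norm_h lam 0 \<phi>" by (intro cSUP_least norm_0_ge[OF f]) auto
qed

subsection \<open>The Poisson bracket\<close>

text \<open>Under the injective map \<open>vee\<close> horizontal derivatives become
  multiplications, and multiplications commute.\<close>

lemma dderiv_emb_commute:
  assumes f: "f \<in> S3c"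
  shows "dderiv (emb v 0) (dderiv (emb w 0) f) = dderiv (emb w 0) (dderiv (emb v 0) f)"
proof (rule vee_inj)
  show "vee (dderiv (emb v 0) (dderiv (emb w 0) f)) = vee (dderiv (emb w 0) (dderiv (emb v 0) f))"
    by (simp add: fun_eq_iff vee_hderiv dderiv_emb_0 f)
qed (intro dderiv_emb_0 f)+

text \<open>A function of r passes through \<open>vee\<close> as a factor and commutes with the
  multiplication that represents the horizontal derivative.\<close>

lemma dderiv_emb_rmult:
  assumes f: "f \<in> S3c"
  shows "dderiv (emb v 0) (\<lambda>z::'a::finite G. of_real (eta lam (rpart z)) * f z) = (\<lambda>z. of_real (eta lam (rpart z)) * dderiv (emb v 0) f z)"
proof (rule vee_inj)
  show "vee (dderiv (emb v 0) (\<lambda>z. of_real (eta lam (rpart z)) * f z)) = vee (\<lambda>z. of_real (eta lam (rpart z)) * dderiv (emb v 0) f z)"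
  proof
    fix z :: "'a G"
    have vr: "vee (\<lambda>z. of_real (eta lam (rpart z)) * F z) z = of_real (eta lam (rpart z)) * vee F z" for F
      by (rule vee_rmult[where m="\<lambda>r. complex_of_real (eta lam r)"])
    show "vee (dderiv (emb v 0) (\<lambda>z. of_real (eta lam (rpart z)) * f z)) z = vee (\<lambda>z. of_real (eta lam (rpart z)) * dderiv (emb v 0) f z) z"
      unfolding vee_hderiv[OF S3c_eta_mult[OF f]] vr vee_hderiv[OF f] by (simp only: mult_ac)
  qed
qed (intro dderiv_emb_0 S3c_eta_mult f)+

lemma dderiv_emb_sum:
  assumes "finite A" "\<And>a. a \<in> A \<Longrightarrow> f a \<in> S3c"
  shows "dderiv (emb v 0) (\<lambda>z. \<Sum>a\<in>A. f a z) = (\<lambda>z. \<Sum>a\<in>A. dderiv (emb v 0) (f a) z)"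
  using assms
proof (induction A rule: finite_induct)
  case empty
  show ?case by (auto intro!: dderiv_eq)
next
  case (insert a A)
  have "dderiv (emb v 0) (\<lambda>z. f a z + (\<Sum>a\<in>A. f a z)) = (\<lambda>z. dderiv (emb v 0) (f a) z + dderiv (emb v 0) (\<lambda>z. \<Sum>a\<in>A. f a z) z)"
    using insert by (intro ext dderiv_add S3c_differentiable S3c_sum) auto
  then show ?case using insert by simp
qed

text \<open>The part of the canonical bracket belonging to the i-th conjugate pair. The factor eta
  is left out because it depends on r only and horizontal derivatives pass over it.\<close>

definition pairing where
  "pairing i f g z = ddp i f z * ddq i g z - ddp i g z * ddq i f z"

lemma pairing_S3c: "f \<in> S3c \<Longrightarrow> g \<in> S3c \<Longrightarrow> pairing i f g \<in> S3c"
  unfolding pairing_def[abs_def] by (intro S3c_diff S3c_mult ddp_S3c ddq_S3c)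

lemma omega_bracket_pairing: "omega_bracket lam f g = (\<lambda>z. of_real (eta lam (rpart z)) * (\<Sum>i\<in>UNIV. pairing i f g z))"
  by (simp add: fun_eq_iff omega_bracket_eq pairing_def)

lemma omega_bracket_S3c: "f \<in> S3c \<Longrightarrow> g \<in> S3c \<Longrightarrow> omega_bracket lam f g \<in> S3c"
  unfolding omega_bracket_pairing by (intro S3c_eta_mult S3c_sum pairing_S3c) auto

lemma dderiv_pairing:
  assumes f: "f \<in> S3c" and g: "g \<in> S3c"
  shows "dderiv (emb v 0) (pairing i f g) z =
     dderiv (emb v 0) (ddp i f) z * ddq i g z + ddp i f z * dderiv (emb v 0) (ddq i g) z
     - (dderiv (emb v 0) (ddp i g) z * ddq i f z + ddp i g z * dderiv (emb v 0) (ddq i f) z)"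
proof -
  have d: "ddp i h differentiable (at z)" "ddq i h differentiable (at z)" if "h \<in> S3c" for h
    using that by (auto intro: S3c_differentiable ddp_S3c ddq_S3c)
  note dm = differentiable_mult[OF d]
  have "dderiv (emb v 0) (\<lambda>z. ddp i f z * ddq i g z + -1 * (ddp i g z * ddq i f z)) z =
      dderiv (emb v 0) (\<lambda>z. ddp i f z * ddq i g z) z + -1 * dderiv (emb v 0) (\<lambda>z. ddp i g z * ddq i f z) z"
    unfolding dderiv_add[OF dm[OF f g] differentiable_mult[OF differentiable_const dm[OF g f]]] dderiv_cmult[OF dm[OF g f]] ..
  moreover have "pairing i f g = (\<lambda>z. ddp i f z * ddq i g z + -1 * (ddp i g z * ddq i f z))" by (simp add: fun_eq_iff pairing_def)
  ultimately show ?thesis by (simp only: dderiv_mult[OF d(1)[OF f] d(2)[OF g]] dderiv_mult[OF d(1)[OF g] d(2)[OF f]] minus_mult_left[symmetric] mult_1 diff_conv_add_uminus)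
qed

lemma dderiv_omega_bracket:
  assumes f: "f \<in> S3c" and g: "g \<in> S3c"
  shows "dderiv (emb v 0) (omega_bracket lam f g) z = of_real (eta lam (rpart z)) * (\<Sum>j\<in>UNIV. dderiv (emb v 0) (pairing j f g) z)"
proof -
  have S: "(\<lambda>z. \<Sum>i\<in>UNIV. pairing i f g z) \<in> S3c" by (intro S3c_sum pairing_S3c f g) auto
  show ?thesis
    unfolding omega_bracket_pairing dderiv_emb_rmult[OF S]
    by (subst dderiv_emb_sum) (auto intro: pairing_S3c f g)
qed

text \<open>Small p, q are first derivatives with index i, capital P, Q those with index j. The
  letters a and b are second derivatives in p_i, p_j and in q_i, q_j; u and v are the mixed ones in
  p_j, q_i and in p_i, q_j. The suffix names the function. The first three lines are the cyclic sum
  for (i, j), the last three that for (j, i).\<close>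

lemma jacobi_identity_pairing:
  fixes pf :: complex
  shows "(pf * (ug * Qh + Pg * bh - (uh * Qg + Ph * bg)) - (ag * Qh + Pg * vh - (ah * Qg + Ph * vg)) * qf)
     + (pg * (uh * Qf + Ph * bf - (uf * Qh + Pf * bh)) - (ah * Qf + Ph * vf - (af * Qh + Pf * vh)) * qg)
     + (ph * (uf * Qg + Pf * bg - (ug * Qf + Pg * bf)) - (af * Qg + Pf * vg - (ag * Qf + Pg * vf)) * qh)
     + ((Pf * (vg * qh + pg * bh - (vh * qg + ph * bg)) - (ag * qh + pg * uh - (ah * qg + ph * ug)) * Qf)
     + (Pg * (vh * qf + ph * bf - (vf * qh + pf * bh)) - (ah * qf + ph * uf - (af * qh + pf * uh)) * Qg)
     + (Ph * (vf * qg + pf * bg - (vg * qf + pg * bf)) - (af * qg + pf * ug - (ag * qf + pg * uf)) * Qh)) = 0"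
  by (simp add: algebra_simps)

text \<open>Only horizontal derivatives occur in the bracket, so eta comes out of the nested
  brackets as a square. What remains is a double sum over pairs of indices whose terms are
  antisymmetric.\<close>

lemma jacobi_omega_bracket:
  fixes f g h :: "'n::finite G \<Rightarrow> complex"
  assumes f: "f \<in> S3c" and g: "g \<in> S3c" and h: "h \<in> S3c"
  shows "omega_bracket lam f (omega_bracket lam g h) z + omega_bracket lam g (omega_bracket lam h f) z + omega_bracket lam h (omega_bracket lam f g) z = 0"
proof -
  define J where "J f g h i j = ddp i f z * ddq i (pairing j g h) z - ddp i (pairing j g h) z * ddq i f z" for f g h :: "'n G \<Rightarrow> complex" and i j
  define T where "T i j = J f g h i j + J g h f i j + J h f g i j" for i j
  let ?e = "complex_of_real (eta lam (rpart z))"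
  have br: "omega_bracket lam f (omega_bracket lam g h) z = ?e\<^sup>2 * (\<Sum>i\<in>UNIV. \<Sum>j\<in>UNIV. J f g h i j)"
    if f: "f \<in> S3c" and g: "g \<in> S3c" and h: "h \<in> S3c" for f g h
  proof -
    have "omega_bracket lam f (omega_bracket lam g h) z = ?e * (\<Sum>i\<in>UNIV. ddp i f z * (?e * (\<Sum>j\<in>UNIV. ddq i (pairing j g h) z)) - (?e * (\<Sum>j\<in>UNIV. ddp i (pairing j g h) z)) * ddq i f z)"
      unfolding omega_bracket_eq[of lam f] axis_emb dderiv_omega_bracket[OF g h] ..
    also have "\<dots> = ?e * (\<Sum>i\<in>UNIV. ?e * (\<Sum>j\<in>UNIV. J f g h i j))"
    proof (intro arg_cong[where f="\<lambda>x. ?e * x"] sum.cong refl)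
      fix i :: 'n
      show "ddp i f z * (?e * (\<Sum>j\<in>UNIV. ddq i (pairing j g h) z)) - (?e * (\<Sum>j\<in>UNIV. ddp i (pairing j g h) z)) * ddq i f z = ?e * (\<Sum>j\<in>UNIV. J f g h i j)"
        unfolding J_def sum_subtractf sum_distrib_left[symmetric] sum_distrib_right[symmetric]
        by (simp only: right_diff_distrib mult_ac)
    qed
    also have "\<dots> = ?e\<^sup>2 * (\<Sum>i\<in>UNIV. \<Sum>j\<in>UNIV. J f g h i j)" by (simp add: sum_distrib_left[symmetric] power2_eq_square)
    finally show ?thesis .
  qed
  \<comment> \<open>The cyclic sum for a single pair of indices need not vanish; second derivatives
    cancel only against those of the exchanged pair.\<close>
  have anti: "T i j + T j i = 0" for i j
  proof -
    have c: "ddp j (ddp i k) = ddp i (ddp j k)" "ddq j (ddq i k) = ddq i (ddq j k)" "ddq i (ddp j k) = ddp j (ddq i k)" "ddq j (ddp i k) = ddp i (ddq j k)"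
      if "k \<in> S3c" for k :: "'n G \<Rightarrow> complex"
      unfolding axis_emb by (rule dderiv_emb_commute[OF that])+
    have dp: "ddp i (pairing j f g) z = ddp i (ddp j f) z * ddq j g z + ddp j f z * ddp i (ddq j g) z - (ddp i (ddp j g) z * ddq j f z + ddp j g z * ddp i (ddq j f) z)"
      "ddq i (pairing j f g) z = ddq i (ddp j f) z * ddq j g z + ddp j f z * ddq i (ddq j g) z - (ddq i (ddp j g) z * ddq j f z + ddp j g z * ddq i (ddq j f) z)"
      if "f \<in> S3c" "g \<in> S3c" for f g :: "'n G \<Rightarrow> complex" and i j
      unfolding axis_emb by (rule dderiv_pairing[unfolded axis_emb, OF that])+
    show ?thesis
      unfolding T_def J_def dp[OF f g] dp[OF g h] dp[OF h f] c[OF f] c[OF g] c[OF h]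
      by (rule jacobi_identity_pairing)
  qed
  have "(\<Sum>i\<in>UNIV. \<Sum>j\<in>UNIV. T i j) = (\<Sum>i\<in>UNIV. \<Sum>j\<in>UNIV. T j i)" by (rule sum.swap)
  also have "\<dots> = - (\<Sum>i\<in>UNIV. \<Sum>j\<in>UNIV. T i j)"
  proof -
    have "T j i = - T i j" for i j using anti[of i j] by (metis add.commute add_eq_0_iff)
    then have "(\<Sum>i\<in>UNIV. \<Sum>j\<in>UNIV. T j i) = (\<Sum>i\<in>UNIV. \<Sum>j\<in>UNIV. - T i j)" by (intro sum.cong refl)
    then show ?thesis by (simp only: sum_negf)
  qed
  finally have "(\<Sum>i\<in>UNIV. \<Sum>j\<in>UNIV. T i j) = 0" by simp
  moreover have "omega_bracket lam f (omega_bracket lam g h) z + omega_bracket lam g (omega_bracket lam h f) z + omega_bracket lam h (omega_bracket lam f g) z = ?e\<^sup>2 * (\<Sum>i\<in>UNIV. \<Sum>j\<in>UNIV. T i j)"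
    unfolding br[OF f g h] br[OF g h f] br[OF h f g] T_def sum.distrib by (simp only: distrib_left)
  ultimately show ?thesis by simp
qed

section \<open>Bilinearity, Leibniz rule and reality of the bracket\<close>

lemma omega_bracket_minus: "omega_bracket lam g f = (\<lambda>z. - omega_bracket lam f g z)"
proof -
  have "pairing i g f z = - pairing i f g z" for i z by (simp add: pairing_def)
  then show ?thesis by (simp only: omega_bracket_pairing sum_negf mult_minus_right)
qed

lemma omega_bracket_add:
  assumes f: "f \<in> S3c" and g: "g \<in> S3c"
  shows "omega_bracket lam (\<lambda>x. f x + g x) h = (\<lambda>x. omega_bracket lam f h x + omega_bracket lam g h x)"
proof -
  have "pairing i (\<lambda>x. f x + g x) h z = pairing i f h z + pairing i g h z" for i z
    unfolding pairing_def dderiv_add[OF S3c_differentiable[OF f] S3c_differentiable[OF g]] by (simp add: algebra_simps)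
  then show ?thesis by (simp only: omega_bracket_pairing sum.distrib distrib_left)
qed

lemma omega_bracket_cmult:
  assumes f: "f \<in> S3c"
  shows "omega_bracket lam (\<lambda>x. c * f x) g = (\<lambda>x. c * omega_bracket lam f g x)"
proof -
  have "pairing i (\<lambda>x. c * f x) g z = c * pairing i f g z" for i z
    unfolding pairing_def dderiv_cmult[OF S3c_differentiable[OF f]] by (simp add: algebra_simps)
  then show ?thesis by (simp only: omega_bracket_pairing sum_distrib_left[symmetric] mult.left_commute)
qed

lemma omega_bracket_cmult_right:
  assumes "g \<in> S3c"
  shows "omega_bracket lam f (\<lambda>x. c * g x) = (\<lambda>x. c * omega_bracket lam f g x)"
  unfolding omega_bracket_minus[of lam f] omega_bracket_cmult[OF assms] by (simp only: mult_minus_right)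

lemma omega_bracket_leibniz:
  assumes f: "f \<in> S3c" and g: "g \<in> S3c" and h: "h \<in> S3c"
  shows "omega_bracket lam f (\<lambda>x. g x * h x) = (\<lambda>x. omega_bracket lam f g x * h x + g x * omega_bracket lam f h x)"
proof
  fix z
  have "pairing i f (\<lambda>x. g x * h x) z = pairing i f g z * h z + g z * pairing i f h z" for i
    unfolding pairing_def dderiv_mult[OF S3c_differentiable[OF g] S3c_differentiable[OF h]] by (simp add: algebra_simps)
  then show "omega_bracket lam f (\<lambda>x. g x * h x) z = omega_bracket lam f g z * h z + g z * omega_bracket lam f h z"
    by (simp only: omega_bracket_pairing sum.distrib sum_distrib_left[symmetric] sum_distrib_right[symmetric] distrib_left mult_ac)
qed

lemma omega_bracket_cnj:
  assumes f: "f \<in> S3c" and g: "g \<in> S3c"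
  shows "omega_bracket lam (\<lambda>x. cnj (f x)) (\<lambda>x. cnj (g x)) = (\<lambda>x. cnj (omega_bracket lam f g x))"
proof -
  have "pairing i (\<lambda>x. cnj (f x)) (\<lambda>x. cnj (g x)) z = cnj (pairing i f g z)" for i z
    unfolding pairing_def dderiv_cnj[OF S3c_differentiable[OF f]] dderiv_cnj[OF S3c_differentiable[OF g]] by simp
  then show ?thesis by (simp only: omega_bracket_pairing cnj_sum complex_cnj_mult complex_cnj_complex_of_real)
qed

text \<open>A real constant multiple of a Poisson bracket is again one: in the Jacobi identity the
  constant appears as a common square, and being real it commutes with conjugation.\<close>

lemma poisson_bracket_S3c:
  "poisson_bracket_on S3c (\<lambda>\<phi> \<psi> z. 1 / (2 * of_real pi) * omega_bracket lam \<phi> \<psi> z)"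
proof -
  define k :: complex where "k = 1 / (2 * of_real pi)"
  have ck: "cnj k = k" by (simp add: k_def)
  have jac: "k * omega_bracket lam f (\<lambda>z. k * omega_bracket lam g h z) x + k * omega_bracket lam g (\<lambda>z. k * omega_bracket lam h f z) x + k * omega_bracket lam h (\<lambda>z. k * omega_bracket lam f g z) x = 0"
    if "f \<in> S3c" "g \<in> S3c" "h \<in> S3c" for f g h :: "'a G \<Rightarrow> complex" and x
  proof -
    have "k * omega_bracket lam f (\<lambda>z. k * omega_bracket lam g h z) x + k * omega_bracket lam g (\<lambda>z. k * omega_bracket lam h f z) x + k * omega_bracket lam h (\<lambda>z. k * omega_bracket lam f g z) x
      = k * k * (omega_bracket lam f (omega_bracket lam g h) x + omega_bracket lam g (omega_bracket lam h f) x + omega_bracket lam h (omega_bracket lam f g) x)"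
      using that by (simp add: omega_bracket_cmult_right omega_bracket_S3c distrib_left mult.assoc)
    then show ?thesis using jacobi_omega_bracket[OF that, of lam x] by simp
  qed
  show ?thesis
    unfolding poisson_bracket_on_def k_def[symmetric]
  proof (intro conjI ballI allI)
    fix f g h :: "'a G \<Rightarrow> complex" and c x assume S: "f \<in> S3c" "g \<in> S3c" "h \<in> S3c"
    show "(\<lambda>z. k * omega_bracket lam f g z) \<in> S3c" by (intro S3c_cmult omega_bracket_S3c S)
    show "(\<lambda>z. k * omega_bracket lam (\<lambda>x. f x + g x) h z) = (\<lambda>x. k * omega_bracket lam f h x + k * omega_bracket lam g h x)"
      unfolding omega_bracket_add[OF S(1,2)] distrib_left ..
    show "(\<lambda>z. k * omega_bracket lam (\<lambda>x. c * f x) g z) = (\<lambda>x. c * (k * omega_bracket lam f g x))"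
      unfolding omega_bracket_cmult[OF S(1)] by (simp only: mult.left_commute)
    show "(\<lambda>z. k * omega_bracket lam g f z) = (\<lambda>x. - (k * omega_bracket lam f g x))"
      unfolding omega_bracket_minus[of lam g] by simp
    show "k * omega_bracket lam f (\<lambda>z. k * omega_bracket lam g h z) x + k * omega_bracket lam g (\<lambda>z. k * omega_bracket lam h f z) x + k * omega_bracket lam h (\<lambda>z. k * omega_bracket lam f g z) x = 0"
      by (rule jac[OF S])
    show "(\<lambda>z. k * omega_bracket lam f (\<lambda>x. g x * h x) z) = (\<lambda>x. k * omega_bracket lam f g x * h x + g x * (k * omega_bracket lam f h x))"
      unfolding omega_bracket_leibniz[OF S] by (simp only: distrib_left mult.assoc mult.left_commute)
    show "(\<lambda>z. k * omega_bracket lam (\<lambda>x. cnj (f x)) (\<lambda>x. cnj (g x)) z) = (\<lambda>x. cnj (k * omega_bracket lam f g x))"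
      unfolding omega_bracket_cnj[OF S(1,2)] by (simp add: ck)
  qed
qed

theorem theorem2p10:
  fixes lam :: real
  assumes "lam \<noteq> 0"
  shows "strict_deformation_quantization (S3c :: ('n::finite G \<Rightarrow> complex) set)
           (\<lambda>\<phi> \<psi> z. 1 / (2 * of_real pi) * omega_bracket lam \<phi> \<psi> z)
           UNIV (times_h lam) (star_h lam) (norm_h lam) \<and>
         (\<forall>\<phi>\<in>(S3c :: ('n G \<Rightarrow> complex) set). \<forall>\<psi>\<in>S3c.
           ((\<lambda>h. norm_h lam h (\<lambda>z. (times_h lam h \<phi> \<psi> z - times_h lam h \<psi> \<phi> z) / of_real h
                                  - \<i> / (2 * of_real pi) * omega_bracket lam \<phi> \<psi> z)) \<longlongrightarrow> 0) (at 0))"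
proof -
  let ?S = "\<lambda>h. function_star_alg (S3c :: ('n G \<Rightarrow> complex) set) (times_h lam h) (star_h lam h) (norm_h lam h)"
  \<comment> \<open>Only product, involution and norm depend on the parameter; the linear operations
    are the pointwise ones in every fibre, as \<open>continuous_field_generated\<close>
    asks.\<close>
  have field: "continuous_field UNIV (\<lambda>h. completion (?S h)) (generated_fields UNIV (\<lambda>h. completion (?S h)) (constant_fields UNIV ?S S3c))"
  proof (rule continuous_field_generated)
    show "pre_cstar_algebra (?S t)" for t by (rule pre_cstar_S3c)
    show "continuous_on UNIV (\<lambda>t. nrm (?S t) a)" if "a \<in> S3c" for a
      using continuous_norm_h[OF that, of lam] by (simp add: function_star_alg_def)
    show "((\<lambda>s. nrm (?S s) (diff (?S s) (mul (?S s) a b) (mul (?S t) a b))) \<longlongrightarrow> 0) (at t within UNIV)" if "a \<in> S3c" "b \<in> S3c" for a b t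
      using times_h_tendsto[OF that, of lam t] by (simp add: function_star_alg_def diff_def)
    show "((\<lambda>s. nrm (?S s) (diff (?S s) (star (?S s) a) (star (?S t) a))) \<longlongrightarrow> 0) (at t within UNIV)" if "a \<in> S3c" for a t
      using star_h_tendsto[OF that, of lam t] by (simp add: function_star_alg_def diff_def)
  qed (simp_all add: function_star_alg_def)
  have i: "\<i> * (1 / (2 * complex_of_real pi) * x) = \<i> / (2 * of_real pi) * x" for x by simp
  show ?thesis
    unfolding strict_deformation_quantization_def Let_def i
    by (intro conjI ballI dense_star_subalgebra_S3c poisson_bracket_S3c open_UNIV is_interval_univ UNIV_I pre_cstar_S3c
        times_h_0 star_h_0 norm_0_eq field semiclassical_limit)
qed

end
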